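(* Let $I$ be a squarefree strongly stable ideal of $S$ that is finitely generated in each degree. Then $\Delta_{\mathrm{lex}}(I)>_{\mathrm{lex}}I$ unless $I$ is a USLI, in which case $\Delta_{\mathrm{lex}}(I)=I$. Moreover, if $I$ is finitely generated and is not a USLI, then all ideals in the sequence $\{\Delta^i_{\mathrm{lex}}(I)\}_{i\ge0}$ are distinct.
   Context: $\mathbf k$ is a field of characteristic zero; $S=\mathbf k[x_i:i\in\mathbb N]=\bigcup_nS_{[n]}$, $S_{[n]}=\mathbf k[x_1,\ldots,x_n]$. Monomials are ordered by graded lex: lower degree is larger, equal degrees compared lexicographically with $x_1>x_2>\cdots$. For monomial ideals $I_1\ne I_2$, $I_1>_{\mathrm{lex}}I_2$ means the lex-largest monomial in the symmetric difference of $I_1$ and $I_2$ lies in $I_1$. A squarefree monomial ideal $I$ is squarefree strongly stable if for every minimal generator $m$ and $i<j$ with $x_j\mid m$, $x_i\nmid m$, $mx_i/x_j\in I$. A squarefree monomial ideal $I\subset S$ is a squarefree lexsegment ideal of $S$ if for each monomial $m\in I$ and each squarefree $m'$ with $\deg m'=\deg m$ and $m'>_{\mathrm{lex}}m$, $m'\in I$; a USLI is an ideal finitely generated in each degree which is a squarefree lexsegment ideal of $S$. $\mathrm{Gin}_{\mathrm{lex}}(J)$ for homogeneous $J\subset S_{[n]}$ is $\mathrm{in}_{\mathrm{lex}}(gJ)$ for generic (upper triangular) $g$; for $I\subset S$ finitely generated in each degree, $\mathrm{Gin}_{\mathrm{lex}}(I)=\lim_n(\mathrm{Gin}_{\mathrm{lex}}(I\cap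 S_{[n]}))S$ (degreewise eventually constant). $\Phi(x_{i_1}\cdots x_{i_k})=x_{i_1}x_{i_2+1}\cdots x_{i_k+k-1}$ ($i_1\le\cdots\le i_k$), $\Phi(J)=\langle\Phi(m):m\in G(J)\rangle$; $\Delta_{\mathrm{lex}}(I)=\Phi(\mathrm{Gin}_{\mathrm{lex}}(I))$ and $\Delta^i_{\mathrm{lex}}$ is its $i$-fold iterate. *)

theory Defs
  imports Complex_Main "HOL-Library.Poly_Mapping" "Jordan_Normal_Form.Matrix"
begin

section \<open>Polynomials in countably many variables\<close>

text \<open>
  Variables are indexed from 0: the variable written \<open>x\<^sub>i\<close> in the usual 1-based notation is
  \<open>var (i - 1)\<close>. Accordingly the polynomial ring in the first \<open>n\<close> variables uses the
  indices in \<open>{..<n}\<close>.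
\<close>

type_synonym mono = "nat \<Rightarrow>\<^sub>0 nat"
type_synonym ('v, 'k) mpoly = "('v \<Rightarrow>\<^sub>0 nat) \<Rightarrow>\<^sub>0 'k"
type_synonym 'k S = "(nat, 'k) mpoly"

abbreviation monomial :: "mono \<Rightarrow> 'k::field_char_0 S" where
  "monomial m \<equiv> Poly_Mapping.single m 1"

abbreviation var :: "nat \<Rightarrow> 'k::field_char_0 S" where
  "var i \<equiv> monomial (Poly_Mapping.single i 1)"

abbreviation const :: "'k::field_char_0 \<Rightarrow> 'k S" where
  "const c \<equiv> Poly_Mapping.single 0 c"

definition polys_in :: "'v set \<Rightarrow> ('v, 'k::field_char_0) mpoly set" where
  "polys_in V = {p. \<forall>m\<in>Poly_Mapping.keys p. Poly_Mapping.keys m \<subseteq> V}"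

abbreviation S_fin :: "nat \<Rightarrow> 'k::field_char_0 S set" where
  "S_fin n \<equiv> polys_in {..<n}"

text \<open>Substitution of \<open>a v\<close> for each variable \<open>v\<close>, with \<open>h\<close> applied to the coefficients.\<close>

definition subst :: "('k::field_char_0 \<Rightarrow> 'r::comm_ring_1) \<Rightarrow> ('v \<Rightarrow> 'r) \<Rightarrow> ('v, 'k) mpoly \<Rightarrow> 'r" where
  "subst h a p = (\<Sum>m\<in>Poly_Mapping.keys p.
     h (Poly_Mapping.lookup p m) *
     (\<Prod>v\<in>Poly_Mapping.keys m. a v ^ Poly_Mapping.lookup m v))"

definition mdeg :: "mono \<Rightarrow> nat" where
  "mdeg m = (\<Sum>i\<in>Poly_Mapping.keys m. Poly_Mapping.lookup m i)"

definition homogeneous :: "nat \<Rightarrow> 'k::field_char_0 S \<Rightarrow> bool" where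
  "homogeneous d p \<longleftrightarrow> (\<forall>m\<in>Poly_Mapping.keys p. mdeg m = d)"

section \<open>Ideals\<close>

text \<open>
  The ideal of the subring \<open>R\<close> generated by \<open>A \<subseteq> R\<close>. For \<open>R = UNIV\<close> this is the library's span
  over the ring itself; the carrier is explicit because ideals of the subrings \<open>S_fin n\<close> are
  needed as well.
\<close>

definition ideal_gen :: "'k::field_char_0 S set \<Rightarrow> 'k S set \<Rightarrow> 'k S set" where
  "ideal_gen R A = {\<Sum>a\<in>B. r a * a | B r. finite B \<and> B \<subseteq> A \<and> (\<forall>a\<in>B. r a \<in> R)}"

lemma ideal_gen_UNIV_eq_span: "ideal_gen UNIV A = Modules.module.span (*) A"
proof -
  interpret Modules.module "(*) :: 'a S \<Rightarrow> 'a S \<Rightarrow> 'a S"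
    by unfold_locales (simp_all add: algebra_simps)
  show ?thesis
    unfolding ideal_gen_def span_explicit by auto
qed

definition finitely_generated :: "'k::field_char_0 S set \<Rightarrow> bool" where
  "finitely_generated I \<longleftrightarrow> (\<exists>A. finite A \<and> I = ideal_gen UNIV A)"

definition fin_gen_each_degree :: "'k::field_char_0 S set \<Rightarrow> bool" where
  "fin_gen_each_degree I \<longleftrightarrow>
     (\<exists>A. I = ideal_gen UNIV A \<and> (\<forall>p\<in>A. \<exists>d. homogeneous d p) \<and>
          (\<forall>d. finite {p \<in> A. homogeneous d p}))"

definition monomial_ideal :: "'k::field_char_0 S set \<Rightarrow> bool" where
  "monomial_ideal I \<longleftrightarrow> (\<exists>A. I = ideal_gen UNIV (monomial ` A))"

definition mdvd :: "mono \<Rightarrow> mono \<Rightarrow> bool" where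
  "mdvd m m' \<longleftrightarrow> (\<exists>u. m' = m + u)"

text \<open>The exponents of the minimal monomial generators of a monomial ideal.\<close>

definition min_gens :: "'k::field_char_0 S set \<Rightarrow> mono set" where
  "min_gens I = {m. monomial m \<in> I \<and> (\<forall>m'. monomial m' \<in> I \<and> mdvd m' m \<longrightarrow> m' = m)}"

section \<open>The graded lexicographic order\<close>

text \<open>
  On \<open>mono\<close> the library's \<open><\<close> compares the exponents at the least index where they differ, i.e. it
  is the lexicographic order with \<open>x\<^sub>1 > x\<^sub>2 > \<dots>\<close>. In the graded version used here monomials of
  lower degree are larger.
\<close>

definition mono_gt :: "mono \<Rightarrow> mono \<Rightarrow> bool" where
  "mono_gt m m' \<longleftrightarrow> mdeg m < mdeg m' \<or> mdeg m = mdeg m' \<and> m' < m"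

lemma mono_gt_iff:
  "mono_gt m m' \<longleftrightarrow> mdeg m < mdeg m' \<or> mdeg m = mdeg m' \<and>
     (\<exists>i. Poly_Mapping.lookup m i > Poly_Mapping.lookup m' i \<and>
          (\<forall>j<i. Poly_Mapping.lookup m j = Poly_Mapping.lookup m' j))"
  unfolding mono_gt_def less_poly_mapping.rep_eq less_fun_def by auto

definition ideal_gt :: "'k::field_char_0 S set \<Rightarrow> 'k S set \<Rightarrow> bool" where
  "ideal_gt I J \<longleftrightarrow>
     (\<exists>m. monomial m \<in> I \<and> monomial m \<notin> J \<and>
       (\<forall>m'. (monomial m' \<in> I) \<noteq> (monomial m' \<in> J) \<and> m' \<noteq> m \<longrightarrow> mono_gt m m'))"

definition lead_mono :: "'k::field_char_0 S \<Rightarrow> mono" where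
  "lead_mono f = (THE m. m \<in> Poly_Mapping.keys f \<and>
                         (\<forall>m'\<in>Poly_Mapping.keys f. m' \<noteq> m \<longrightarrow> mono_gt m m'))"

definition initial_ideal :: "nat \<Rightarrow> 'k::field_char_0 S set \<Rightarrow> 'k S set" where
  "initial_ideal n J = ideal_gen (S_fin n) {monomial (lead_mono f) | f. f \<in> J \<and> f \<noteq> 0}"

section \<open>Squarefree strongly stable and squarefree lexsegment ideals\<close>

definition mono_squarefree :: "mono \<Rightarrow> bool" where
  "mono_squarefree m \<longleftrightarrow> (\<forall>i. Poly_Mapping.lookup m i \<le> 1)"

definition squarefree_monomial_ideal :: "'k::field_char_0 S set \<Rightarrow> bool" where
  "squarefree_monomial_ideal I \<longleftrightarrow>
     (\<exists>A. (\<forall>m\<in>A. mono_squarefree m) \<and> I = ideal_gen UNIV (monomial ` A))"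

definition squarefree_strongly_stable :: "'k::field_char_0 S set \<Rightarrow> bool" where
  "squarefree_strongly_stable I \<longleftrightarrow> squarefree_monomial_ideal I \<and>
     (\<forall>m\<in>min_gens I. \<forall>i j. i < j \<and> j \<in> Poly_Mapping.keys m \<and> i \<notin> Poly_Mapping.keys m \<longrightarrow>
        monomial (m - Poly_Mapping.single j 1 + Poly_Mapping.single i 1) \<in> I)"

definition squarefree_lexsegment :: "'k::field_char_0 S set \<Rightarrow> bool" where
  "squarefree_lexsegment I \<longleftrightarrow> squarefree_monomial_ideal I \<and>
     (\<forall>m m'. monomial m \<in> I \<and> mono_squarefree m' \<and> mdeg m' = mdeg m \<and> mono_gt m' m \<longrightarrow>
        monomial m' \<in> I)"

definition USLI :: "'k::field_char_0 S set \<Rightarrow> bool" where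
  "USLI I \<longleftrightarrow> fin_gen_each_degree I \<and> squarefree_lexsegment I"

section \<open>Generic initial ideals\<close>

definition upper_tri_group :: "nat \<Rightarrow> 'k::field_char_0 mat set" where
  "upper_tri_group n = {g \<in> carrier_mat n n. upper_triangular g \<and> invertible_mat g}"

definition zariski_open :: "nat \<Rightarrow> 'k::field_char_0 mat set \<Rightarrow> bool" where
  "zariski_open n U \<longleftrightarrow>
     (\<exists>P \<subseteq> polys_in ({..<n} \<times> {..<n}).
        U = {g \<in> upper_tri_group n. \<exists>p\<in>P. subst (\<lambda>c. c) (\<lambda>(i, j). g $$ (i, j)) p \<noteq> 0})"

text \<open>
  A matrix acts by \<open>g x\<^sub>j = (\<Sum>i. g\<^sub>i\<^sub>j x\<^sub>i)\<close>; for upper triangular \<open>g\<close>, a variable is sent to a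
  combination of itself and lexicographically larger variables. (The opposite convention would
  leave every initial ideal unchanged.) Only elements of \<open>S_fin n\<close> are ever acted upon by an
  \<open>n \<times> n\<close> matrix.
\<close>

definition act :: "'k::field_char_0 mat \<Rightarrow> 'k S \<Rightarrow> 'k S" where
  "act g = subst const (\<lambda>j. \<Sum>i<dim_row g. const (g $$ (i, j)) * var i)"

text \<open>The value of the initial ideal on a nonempty Zariski open set of upper triangular matrices.\<close>

definition Gin_fin :: "nat \<Rightarrow> 'k::field_char_0 S set \<Rightarrow> 'k S set" where
  "Gin_fin n J = (THE M. \<exists>U. zariski_open n U \<and> U \<noteq> {} \<and>
                             (\<forall>g\<in>U. initial_ideal n (act g ` J) = M))"

text \<open>The degreewise eventual value of the extensions to the whole ring.\<close>

definition Gin :: "'k::field_char_0 S set \<Rightarrow> 'k S set" where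
  "Gin I = (THE L. monomial_ideal L \<and>
     (\<forall>d. \<forall>\<^sub>F n in sequentially.
        {p \<in> ideal_gen UNIV (Gin_fin n (I \<inter> S_fin n)). homogeneous d p} =
        {p \<in> L. homogeneous d p}))"

section \<open>The shifting operator\<close>

text \<open>The weakly increasing list of indices of the variables of a monomial, with multiplicity.\<close>

definition var_list :: "mono \<Rightarrow> nat list" where
  "var_list m = concat (map (\<lambda>i. replicate (Poly_Mapping.lookup m i) i)
                            (sorted_list_of_set (Poly_Mapping.keys m)))"

definition Phi_mono :: "mono \<Rightarrow> mono" where
  "Phi_mono m = (\<Sum>j<length (var_list m). Poly_Mapping.single (var_list m ! j + j) 1)"

definition Phi :: "'k::field_char_0 S set \<Rightarrow> 'k S set" where
  "Phi J = ideal_gen UNIV (monomial ` Phi_mono ` min_gens J)"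

definition Delta_lex :: "'k::field_char_0 S set \<Rightarrow> 'k S set" where
  "Delta_lex I = Phi (Gin I)"

end

theory Submission
  imports Defs "HOL-Library.Multiset_Order" "HOL-Computational_Algebra.Polynomial" "Jordan_Normal_Form.Determinant"
begin

text \<open>
  A squarefree strongly stable ideal is the same thing as a family \<open>F\<close> of finite sets, closed under
  supersets and under moving elements to the left. In degree \<open>d\<close> let \<open>IM F\<close> be the monomials with
  support in \<open>F\<close> and \<open>JM F\<close> those whose \<open>\<Phi>\<close>-image lies in \<open>F\<close>; they are equinumerous. For
  a suitable triangular change of coordinates the matrix of coefficients of the transformed \<open>IM F\<close>
  at \<open>JM F\<close> is nonsingular, by induction on the number of variables and the degree: split by
  divisibility by the first variable, and use a change of variables composed with
  \<open>x\<^sub>i \<mapsto> x\<^sub>i + x\<^bsub>i+1\<^esub>\<close>, which does not change leading monomials. Hence the generic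
  initial ideal, whose leading monomials are the largest possible ones, dominates \<open>JM F\<close>, which is
  \<open>\<Delta>(I) \<ge> I\<close>. If equality holds, then no coordinate change produces larger leading monomials than
  \<open>JM F\<close>, and this forces \<open>F\<close> to be a lexsegment by induction on the first differing position.
  Conversely \<open>\<Phi>\<close> preserves the number of squarefree monomials in each degree, and a lexsegment is
  maximal for given numbers; for finitely generated ideals these numbers also determine a lexsegment
  among all strongly stable families, so an ideal that is not a lexsegment never becomes one.
\<close>

text \<open>The obstacle is the first variable. Dividing \<open>JM F\<close> by \<open>x_a\<close>
  lowers the remaining indices of the shifted set by one, which is the family \<open>F1\<close>;
  dividing \<open>IM F\<close> by \<open>x_a\<close> yields \<open>I1\<close>, where no index moves.
  Sending \<open>x_j\<close> to \<open>x_(j-1)\<close> relates the two, but followed by a triangular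
  change it would have zero diagonal. Replacing \<open>x_i\<close> by \<open>x_i + x_(i+1)\<close>
  afterwards restores the diagonal, and is harmless because it only produces dominated monomials.
  Lower bounds on leading monomials come from one source: among the coordinate sets of the right
  size that separate a space, the leading monomials form the largest. So one nonsingular point
  suffices, and inclusions become equalities by counting. Characteristic zero makes the field
  infinite, which lets open sets meet, and keeps exponents nonzero as coefficients, which gives
  strong stability. Infinitely many variables are handled by \<open>bnd\<close>: up to a given
  degree the generators involve finitely many variables, and all later ones enter freely.\<close>

declare One_nat_def [simp del]

section \<open>Substitution\<close>

abbreviation lookup :: "('a \<Rightarrow>\<^sub>0 'b::zero) \<Rightarrow> 'a \<Rightarrow> 'b" where "lookup \<equiv> Poly_Mapping.lookup"
abbreviation keys :: "('a \<Rightarrow>\<^sub>0 'b::zero) \<Rightarrow> 'a set" where "keys \<equiv> Poly_Mapping.keys"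
abbreviation single :: "'a \<Rightarrow> 'b \<Rightarrow> ('a \<Rightarrow>\<^sub>0 'b::zero)" where "single \<equiv> Poly_Mapping.single"

text \<open>A bare predicate, since the same substitution lemmas serve for the embedding of
  constants, for evaluation, for composition with another substitution and for evaluation of
  univariate polynomials along a line.\<close>

definition rhom :: "('a::comm_ring_1 \<Rightarrow> 'b::comm_ring_1) \<Rightarrow> bool" where
  "rhom h \<longleftrightarrow> h 0 = 0 \<and> h 1 = 1 \<and> (\<forall>a b. h (a + b) = h a + h b) \<and> (\<forall>a b. h (a * b) = h a * h b)"

lemma rhomD: "rhom h \<Longrightarrow> h 0 = 0" "rhom h \<Longrightarrow> h 1 = 1" "rhom h \<Longrightarrow> h (a + b) = h a + h b"
  "rhom h \<Longrightarrow> h (a * b) = h a * h b"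
  unfolding rhom_def by auto

lemma rhom_sum: "rhom h \<Longrightarrow> h (sum f A) = (\<Sum>x\<in>A. h (f x))"
  by (induction A rule: infinite_finite_induct) (auto simp: rhomD)

lemma rhom_prod: "rhom h \<Longrightarrow> h (prod f A) = (\<Prod>x\<in>A. h (f x))"
  by (induction A rule: infinite_finite_induct) (auto simp: rhomD)

lemma rhom_power: "rhom h \<Longrightarrow> h (x ^ n) = h x ^ n"
  by (induction n) (auto simp: rhomD)

lemma rhom_const: "rhom const"
  unfolding rhom_def by (auto simp: single_add mult_single)

lemma rhom_id: "rhom (\<lambda>c. c)"
  unfolding rhom_def by auto

definition mev :: "('v \<Rightarrow> 'r::comm_ring_1) \<Rightarrow> ('v \<Rightarrow>\<^sub>0 nat) \<Rightarrow> 'r" where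
  "mev a m = (\<Prod>v\<in>keys m. a v ^ lookup m v)"

lemma mev_superset: "finite K \<Longrightarrow> keys m \<subseteq> K \<Longrightarrow> mev a m = (\<Prod>v\<in>K. a v ^ lookup m v)"
  unfolding mev_def by (rule prod.mono_neutral_left) (auto simp: in_keys_iff)

lemma mev_0 [simp]: "mev a 0 = 1"
  by (simp add: mev_def)

lemma mev_add: "mev a (m + m') = mev a m * mev a m'"
proof -
  let ?K = "keys m \<union> keys m'"
  have "mev a (m + m') = (\<Prod>v\<in>?K. a v ^ lookup (m + m') v)"
    by (rule mev_superset) (use keys_add[of m m'] in auto)
  moreover have "mev a m = (\<Prod>v\<in>?K. a v ^ lookup m v)" "mev a m' = (\<Prod>v\<in>?K. a v ^ lookup m' v)"
    by (auto intro!: mev_superset)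
  ultimately show ?thesis by (simp add: lookup_add power_add prod.distrib)
qed

lemma mev_single [simp]: "mev a (single v k) = a v ^ k"
  by (simp add: mev_def)

lemma subst_superset:
  assumes "rhom h" "finite K" "keys p \<subseteq> K"
  shows "subst h a p = (\<Sum>m\<in>K. h (lookup p m) * mev a m)"
  unfolding subst_def mev_def[symmetric]
  by (rule sum.mono_neutral_left) (use assms in \<open>auto simp: in_keys_iff rhomD\<close>)

lemma subst_alt: "subst h a p = (\<Sum>m\<in>keys p. h (lookup p m) * mev a m)"
  unfolding subst_def mev_def ..

lemma subst_add:
  assumes "rhom h" shows "subst h a (p + q) = subst h a p + subst h a q"
proof -
  let ?K = "keys p \<union> keys q"
  have "subst h a (p + q) = (\<Sum>m\<in>?K. h (lookup (p + q) m) * mev a m)"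
    using assms keys_add[of p q] by (intro subst_superset) auto
  moreover have "subst h a p = (\<Sum>m\<in>?K. h (lookup p m) * mev a m)"
    "subst h a q = (\<Sum>m\<in>?K. h (lookup q m) * mev a m)"
    using assms by (auto intro!: subst_superset)
  ultimately show ?thesis using assms by (simp add: lookup_add rhomD algebra_simps sum.distrib)
qed

lemma subst_0 [simp]: "subst h a 0 = 0"
  by (simp add: subst_def)

lemma subst_sum: "rhom h \<Longrightarrow> subst h a (sum f A) = (\<Sum>x\<in>A. subst h a (f x))"
  by (induction A rule: infinite_finite_induct) (auto simp: subst_add)

lemma subst_single: "rhom h \<Longrightarrow> subst h a (single m c) = h c * mev a m"
  by (simp add: subst_alt rhomD)

lemma poly_expand: "p = (\<Sum>m\<in>keys p. single m (lookup p m))"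
  by (rule poly_mapping_eqI) (auto simp: lookup_sum lookup_single when_def in_keys_iff)

lemma subst_mult:
  assumes "rhom h" shows "subst h a (p * q) = subst h a p * subst h a q"
proof -
  have "p * q = (\<Sum>m\<in>keys p. single m (lookup p m)) * (\<Sum>m\<in>keys q. single m (lookup q m))"
    using poly_expand[of p] poly_expand[of q] by simp
  also have "\<dots> = (\<Sum>m\<in>keys p. \<Sum>m'\<in>keys q. single (m + m') (lookup p m * lookup q m'))"
    by (simp add: sum_product mult_single)
  finally have "subst h a (p * q) =
    (\<Sum>m\<in>keys p. \<Sum>m'\<in>keys q. subst h a (single (m + m') (lookup p m * lookup q m')))"
    using assms by (simp add: subst_sum)
  also have "\<dots> = (\<Sum>m\<in>keys p. \<Sum>m'\<in>keys q. h (lookup p m) * mev a m * (h (lookup q m') * mev a m'))"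
    using assms by (simp add: subst_single mev_add rhomD mult_ac)
  also have "\<dots> = subst h a p * subst h a q"
    by (simp add: subst_alt sum_product)
  finally show ?thesis .
qed

lemma rhom_subst: "rhom h \<Longrightarrow> rhom (subst h a)"
  unfolding rhom_def[of "subst h a"]
  using subst_single[of h a 0 1] by (auto simp: subst_add subst_mult rhomD)

lemma rhom_mev: "rhom \<phi> \<Longrightarrow> \<phi> (mev a m) = mev (\<lambda>v. \<phi> (a v)) m"
  by (simp add: mev_def rhom_prod rhom_power)

lemma rhom_of_subst: "rhom \<phi> \<Longrightarrow> \<phi> (subst h a p) = subst (\<lambda>c. \<phi> (h c)) (\<lambda>v. \<phi> (a v)) p"
  by (simp add: subst_alt rhom_sum rhomD rhom_mev)

abbreviation sb :: "('v \<Rightarrow> 'k S) \<Rightarrow> ('v, 'k::field_char_0) mpoly \<Rightarrow> 'k S" where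
  "sb \<equiv> subst const"
abbreviation ev :: "('v \<Rightarrow> 'k) \<Rightarrow> ('v, 'k::field_char_0) mpoly \<Rightarrow> 'k" where
  "ev \<equiv> subst (\<lambda>c. c)"

lemmas rhom_sb = rhom_subst[OF rhom_const]
lemmas rhom_ev = rhom_subst[OF rhom_id]
lemmas sb_add = subst_add[OF rhom_const]
lemmas sb_mult = subst_mult[OF rhom_const]
lemmas sb_sum = subst_sum[OF rhom_const]
lemmas sb_single = subst_single[OF rhom_const]
lemmas ev_add = subst_add[OF rhom_id]
lemmas ev_mult = subst_mult[OF rhom_id]
lemmas ev_sum = subst_sum[OF rhom_id]
lemmas ev_single = subst_single[OF rhom_id]

lemma sb_1 [simp]: "sb s 1 = 1"
  using rhom_sb rhomD(2) by blast

lemma sb_const [simp]: "sb s (const c) = const c"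
  by (simp add: sb_single)

lemma sb_var [simp]: "sb s (var j) = s j"
  by (simp add: sb_single)

lemma ev_const [simp]: "ev s (const c) = c"
  by (simp add: ev_single)

lemma ev_var [simp]: "ev s (single (single j 1) 1) = s j"
  by (simp add: ev_single)

lemma sb_sb: "sb s (sb t p) = sb (\<lambda>j. sb s (t j)) p"
  using rhom_of_subst[OF rhom_sb, of s const t p] by simp

lemma ev_sb: "ev y (sb t p) = ev (\<lambda>j. ev y (t j)) p"
  using rhom_of_subst[OF rhom_ev, of y const t p] by simp

lemma mev_cong: "(\<And>v. v \<in> keys m \<Longrightarrow> s v = t v) \<Longrightarrow> mev s m = mev t m"
  unfolding mev_def by (rule prod.cong) auto

lemma subst_cong:
  assumes "p \<in> polys_in V" "\<And>v. v \<in> V \<Longrightarrow> s v = t v"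
  shows "subst h s p = subst h t p"
proof -
  have "mev s m = mev t m" if "m \<in> keys p" for m
    using assms that by (intro mev_cong) (auto simp: polys_in_def)
  then show ?thesis by (simp add: subst_alt)
qed

lemma mev_var: "mev var m = monomial m"
proof -
  have "(\<Prod>v\<in>A. (var v :: 'a S) ^ lookup m v) = monomial (\<Sum>v\<in>A. single v (lookup m v))" if "finite A" for A
    using that
  proof (induction A rule: finite_induct)
    case (insert x A)
    have "(var x :: 'a S) ^ k = monomial (single x k)" for k
      by (induction k) (auto simp: mult_single single_add[symmetric] plus_1_eq_Suc)
    then show ?case using insert by (simp add: mult_single)
  qed simp
  from this[of "keys m"] show ?thesis by (simp add: mev_def poly_expand[symmetric])
qed

lemma sb_var_id: "sb var p = p"
  using poly_expand[of p] by (simp add: subst_alt mev_var mult_single)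

lemma lookup_single_mult [simp]: "lookup (single w c * p) (w + m) = c * lookup p m"
  for p :: "'k::field_char_0 S"
proof -
  have "single w c * p = (\<Sum>k\<in>keys p. single (w + k) (c * lookup p k))"
    by (subst poly_expand[of p]) (simp add: sum_distrib_left mult_single)
  then show ?thesis
    by (auto simp: lookup_sum lookup_single when_def in_keys_iff)
qed

lemma lookup_const_mult [simp]: "lookup (const c * p) m = c * lookup p m"
  using lookup_single_mult[of 0 c p m] by simp

lemma lookup_single_mult_eq_0: "lookup (single w c * p) m \<noteq> 0 \<Longrightarrow> \<exists>u\<in>keys p. m = w + u"
  for p :: "'k::field_char_0 S"
proof -
  assume "lookup (single w c * p) m \<noteq> 0"
  then have "m \<in> keys (single w c * p)" by (simp add: in_keys_iff)
  then show ?thesis using keys_mult[of "single w c" p] by (auto split: if_splits)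
qed

lemma polys_in_mono: "V \<subseteq> W \<Longrightarrow> polys_in V \<subseteq> polys_in W"
  by (auto simp: polys_in_def)

lemma polys_in_0: "0 \<in> polys_in V"
  by (simp add: polys_in_def)

lemma polys_in_add: "p \<in> polys_in V \<Longrightarrow> q \<in> polys_in V \<Longrightarrow> p + q \<in> polys_in V"
  unfolding polys_in_def using keys_add[of p q] by blast

lemma polys_in_mult: "p \<in> polys_in V \<Longrightarrow> q \<in> polys_in V \<Longrightarrow> p * q \<in> polys_in V"
proof -
  assume p: "p \<in> polys_in V" and q: "q \<in> polys_in V"
  have "keys (a + b) \<subseteq> V" if "a \<in> keys p" "b \<in> keys q" for a b
    using keys_add[of a b] p q that unfolding polys_in_def by blast
  then show ?thesis using keys_mult[of p q] unfolding polys_in_def by blast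
qed

lemma polys_in_sum: "(\<And>x. x \<in> A \<Longrightarrow> f x \<in> polys_in V) \<Longrightarrow> sum f A \<in> polys_in V"
  by (induction A rule: infinite_finite_induct) (auto simp: polys_in_add polys_in_0)

section \<open>Linear algebra with leading monomials\<close>

text \<open>Within one degree the order \<^const>\<open>mono_gt\<close> is the linear order of the type \<^typ>\<open>mono\<close>, so leading
  monomials of homogeneous polynomials are maxima; finite sets of monomials of the same degree are
  compared as multisets.\<close>

definition lead :: "'k::field_char_0 S \<Rightarrow> mono" where
  "lead p = Max (keys p)"

definition leads :: "'k::field_char_0 S set \<Rightarrow> mono set" where
  "leads V = lead ` (V - {0})"

definition sp :: "mono set \<Rightarrow> 'k::field_char_0 S set" where
  "sp A = {p. keys p \<subseteq> A}"

definition lin :: "'k::field_char_0 S set \<Rightarrow> bool" where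
  "lin V \<longleftrightarrow> 0 \<in> V \<and> (\<forall>p\<in>V. \<forall>q\<in>V. p + q \<in> V) \<and> (\<forall>c. \<forall>p\<in>V. const c * p \<in> V)"

lemma lead_in_keys: "p \<noteq> 0 \<Longrightarrow> lead p \<in> keys p"
  unfolding lead_def by (intro Max_in) auto

lemma lead_ge: "m \<in> keys p \<Longrightarrow> m \<le> lead p"
  unfolding lead_def by (intro Max_ge) auto

lemma lookup_lead: "p \<noteq> 0 \<Longrightarrow> lookup p (lead p) \<noteq> 0"
  using lead_in_keys by (simp add: in_keys_iff)

lemma lead_eqI: "m \<in> keys p \<Longrightarrow> (\<And>u. u \<in> keys p \<Longrightarrow> u \<le> m) \<Longrightarrow> lead p = m"
  unfolding lead_def by (intro Max_eqI) auto

lemma linD: "lin V \<Longrightarrow> 0 \<in> V" "lin V \<Longrightarrow> p \<in> V \<Longrightarrow> q \<in> V \<Longrightarrow> p + q \<in> V"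
  "lin V \<Longrightarrow> p \<in> V \<Longrightarrow> const c * p \<in> V"
  unfolding lin_def by auto

lemma lin_sum: "lin V \<Longrightarrow> (\<And>x. x \<in> A \<Longrightarrow> f x \<in> V) \<Longrightarrow> sum f A \<in> V"
  by (induction A rule: infinite_finite_induct) (auto simp: linD)

lemma lin_comb: "lin V \<Longrightarrow> (\<And>x. x \<in> A \<Longrightarrow> f x \<in> V) \<Longrightarrow> (\<Sum>x\<in>A. const (c x) * f x) \<in> V"
  by (intro lin_sum) (auto intro: linD)

lemma lin_sp: "lin (sp A)"
  unfolding lin_def sp_def subset_iff mem_Collect_eq in_keys_iff lookup_add lookup_const_mult
  by (auto, metis add.right_neutral)

lemma sp_mono: "A \<subseteq> B \<Longrightarrow> sp A \<subseteq> sp B"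
  by (auto simp: sp_def)

lemma monomial_in_sp [simp]: "c \<noteq> 0 \<Longrightarrow> single m c \<in> sp A \<longleftrightarrow> m \<in> A"
  by (auto simp: sp_def)

lemma lin_image: "lin V \<Longrightarrow> rhom T \<Longrightarrow> (\<And>c. T (const c) = const c) \<Longrightarrow> lin (T ` V)"
  unfolding lin_def image_iff
proof (intro conjI ballI allI)
  assume *: "0 \<in> V \<and> (\<forall>p\<in>V. \<forall>q\<in>V. p + q \<in> V) \<and> (\<forall>c. \<forall>p\<in>V. const c * p \<in> V)"
    "rhom T" "\<And>c. T (const c) = const c"
  show "\<exists>x\<in>V. 0 = T x" using * rhomD(1) by (intro bexI[of _ 0]) auto
  show "\<exists>x\<in>V. p + q = T x" if pq: "p \<in> T ` V" "q \<in> T ` V" for p q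
  proof -
    obtain x y where "x \<in> V" "y \<in> V" "p = T x" "q = T y" using pq by auto
    then show ?thesis using * by (intro bexI[of _ "x + y"]) (auto simp: rhomD)
  qed
  show "\<exists>x\<in>V. const c * p = T x" if p: "p \<in> T ` V" for c p
  proof -
    obtain x where "x \<in> V" "p = T x" using p by auto
    then show ?thesis using * by (intro bexI[of _ "const c * x"]) (auto simp: rhomD)
  qed
qed

section \<open>Leading monomials as a replacement for bases and dimension\<close>

lemma single_eq_0_iff [simp]: "single m c = 0 \<longleftrightarrow> c = 0"
  by (metis lookup_single_eq lookup_zero single_zero)

lemma keys_single_lead: "c \<noteq> 0 \<Longrightarrow> lead (single m c) = m"
  by (simp add: lead_def)

lemma leads_sp: "leads (sp A :: 'k::field_char_0 S set) = A"
proof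
  show "leads (sp A :: 'k S set) \<subseteq> A" using lead_in_keys by (auto simp: leads_def sp_def)
  have "m = lead (monomial m :: 'k S)" "(monomial m :: 'k S) \<in> sp A - {0}" if "m \<in> A" for m
    using that by (auto simp: keys_single_lead sp_def)
  then show "A \<subseteq> leads (sp A :: 'k S set)" unfolding leads_def by blast
qed

text \<open>Gaussian elimination for a system with more unknowns than equations: an unknown with
  nonzero coefficient in the equation \<open>x\<close> is the pivot, and the induction hypothesis is
  applied to the remaining unknowns with the pivot eliminated.\<close>

lemma elim:
  fixes f :: "'b \<Rightarrow> 'x \<Rightarrow> 'k::field"
  assumes "finite C" "finite B" "card C < card B"
  shows "\<exists>c. (\<exists>b\<in>B. c b \<noteq> 0) \<and> (\<forall>x\<in>C. (\<Sum>b\<in>B. c b * f b x) = 0)"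
  using assms
proof (induction C arbitrary: B f rule: finite_induct)
  case empty
  then obtain b where "b \<in> B" by fastforce
  then show ?case by (intro exI[of _ "\<lambda>_. 1"]) auto
next
  case (insert x C)
  show ?case
  proof (cases "\<forall>b\<in>B. f b x = 0")
    case True
    have "card C < card B" using insert by simp
    with insert.IH[OF insert.prems(1), of f] obtain c where
      "\<exists>b\<in>B. c b \<noteq> 0" "\<forall>x\<in>C. (\<Sum>b\<in>B. c b * f b x) = 0" by auto
    with True show ?thesis by (intro exI[of _ c]) auto
  next
    case False
    then obtain b0 where b0: "b0 \<in> B" "f b0 x \<noteq> 0" by auto
    define B' where "B' = B - {b0}"
    have B': "finite B'" "card C < card B'" "B = insert b0 B'" "b0 \<notin> B'"
      using insert b0 by (auto simp: B'_def)
    obtain c where c: "\<exists>b\<in>B'. c b \<noteq> 0"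
      "\<forall>y\<in>C. (\<Sum>b\<in>B'. c b * (f b y - f b x / f b0 x * f b0 y)) = 0"
      using insert.IH[OF B'(1,2), of "\<lambda>b y. f b y - f b x / f b0 x * f b0 y"] by auto
    \<comment> \<open>The value of the pivot unknown is forced by the equation \<open>x\<close>; the
      other equations then follow from the reduced ones.\<close>
    define r where "r = - (\<Sum>b\<in>B'. c b * f b x) / f b0 x"
    define c' where "c' = c(b0 := r)"
    have eq: "(\<Sum>b\<in>B. c' b * f b y) = r * f b0 y + (\<Sum>b\<in>B'. c b * f b y)" for y
    proof -
      have "(\<Sum>b\<in>B'. c' b * f b y) = (\<Sum>b\<in>B'. c b * f b y)"
        using B' by (intro sum.cong) (auto simp: c'_def)
      then show ?thesis using B' by (simp add: c'_def)
    qed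
    have "(\<Sum>b\<in>B. c' b * f b y) = 0" if "y \<in> insert x C" for y
    proof (cases "y = x")
      case True
      then show ?thesis using b0 unfolding eq by (simp add: r_def)
    next
      case False
      then have "(\<Sum>b\<in>B'. c b * (f b y - f b x / f b0 x * f b0 y)) = 0" using that c by auto
      then show ?thesis unfolding eq r_def
        by (simp add: algebra_simps sum_subtractf sum_distrib_left sum_divide_distrib)
    qed
    moreover have "\<exists>b\<in>B. c' b \<noteq> 0" using c(1) B' by (auto simp: c'_def)
    ultimately show ?thesis by blast
  qed
qed

lemma lookup_comb: "lookup (\<Sum>b\<in>B. const (c b) * v b) m = (\<Sum>b\<in>B. c b * lookup (v b) m)"
  by (simp add: lookup_sum)

text \<open>Distinct leading monomials cannot cancel: at the largest index with nonzero coefficient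
  only one summand contributes.\<close>

lemma lead_comb:
  assumes "finite B" "\<And>b. b \<in> B \<Longrightarrow> v b \<noteq> 0 \<and> lead (v b) = b" "\<exists>b\<in>B. c b \<noteq> 0"
  shows "(\<Sum>b\<in>B. const (c b) * v b) \<noteq> 0 \<and> lead (\<Sum>b\<in>B. const (c b) * v b) = Max {b\<in>B. c b \<noteq> 0}"
proof -
  let ?p = "\<Sum>b\<in>B. const (c b) * v b"
  let ?m = "Max {b\<in>B. c b \<noteq> 0}"
  have m: "?m \<in> {b\<in>B. c b \<noteq> 0}" using assms by (intro Max_in) auto
  have le: "b \<le> ?m" if "b \<in> B" "c b \<noteq> 0" for b using that assms(1) by (intro Max_ge) auto
  have z: "c b * lookup (v b) u = 0" if "b \<in> B" "u > ?m \<or> (u = ?m \<and> b \<noteq> ?m)" for b u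
  proof (rule ccontr)
    assume "c b * lookup (v b) u \<noteq> 0"
    then have "c b \<noteq> 0" "u \<in> keys (v b)" by (auto simp: in_keys_iff)
    then have "u \<le> b" "b \<le> ?m" using that le assms(2) lead_ge by (metis, blast)
    then show False using that by auto
  qed
  have "lookup ?p ?m = (\<Sum>b\<in>B. if b = ?m then c b * lookup (v b) ?m else 0)"
    unfolding lookup_comb using z by (intro sum.cong) auto
  also have "\<dots> = c ?m * lookup (v ?m) ?m" using assms(1) m by (subst sum.delta) auto
  finally have 1: "?m \<in> keys ?p" using m assms(2)[of ?m] lookup_lead[of "v ?m"] by (auto simp: in_keys_iff)
  moreover have "u \<le> ?m" if "u \<in> keys ?p" for u
  proof (rule ccontr)
    assume "\<not> u \<le> ?m"
    then have "?m < u" by simp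
    then have "lookup ?p u = 0" unfolding lookup_comb by (intro sum.neutral ballI z) auto
    then show False using that by (simp add: in_keys_iff)
  qed
  ultimately show ?thesis using lead_eqI by (metis (no_types, lifting) empty_iff keys_zero)
qed

lemma leads_basis:
  obtains v where "\<And>b. b \<in> leads V \<Longrightarrow> v b \<in> V \<and> v b \<noteq> 0 \<and> lead (v b) = b"
proof -
  have "\<forall>b\<in>leads V. \<exists>p. p \<in> V \<and> p \<noteq> 0 \<and> lead p = b" by (auto simp: leads_def)
  then show thesis using that by metis
qed

text \<open>A nonzero element has a nonzero coefficient at its own leading monomial. So the
  coordinates in \<open>leads V\<close> separate \<open>V\<close>, and their number plays the role
  of the dimension.\<close>

lemma vanish_leads: "p \<in> V \<Longrightarrow> (\<And>m. m \<in> leads V \<Longrightarrow> lookup p m = 0) \<Longrightarrow> p = 0"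
  using lookup_lead unfolding leads_def by blast

text \<open>With fewer target coordinates than basis vectors, \<open>elim\<close> gives a nonzero
  combination whose image vanishes on \<open>leads W\<close>, hence is zero, against the injectivity
  of \<open>T\<close> on \<open>V\<close>.\<close>

lemma card_leads_le:
  assumes "lin V" "lin W" "T ` V \<subseteq> W" "\<And>p. p \<in> V \<Longrightarrow> T p = 0 \<Longrightarrow> p = 0" "finite (leads W)" "finite (leads V)"
    and T: "\<And>p q. T (p + q) = T p + T q" "\<And>c p. T (const c * p) = const c * T p"
  shows "card (leads V) \<le> card (leads W)"
proof (rule ccontr)
  assume "\<not> ?thesis"
  then have lt: "card (leads W) < card (leads V)" by simp
  obtain v where v: "\<And>b. b \<in> leads V \<Longrightarrow> v b \<in> V \<and> v b \<noteq> 0 \<and> lead (v b) = b" using leads_basis by blast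
  obtain c where c: "\<exists>b\<in>leads V. c b \<noteq> 0" "\<forall>x\<in>leads W. (\<Sum>b\<in>leads V. c b * lookup (T (v b)) x) = 0"
    using elim[OF assms(5,6) lt, of "\<lambda>b. lookup (T (v b))"] by auto
  let ?p = "\<Sum>b\<in>leads V. const (c b) * v b"
  have T0: "T 0 = 0" using T(2)[of 0 0] by simp
  have Tsum: "T (\<Sum>b\<in>A. const (c b) * v b) = (\<Sum>b\<in>A. const (c b) * T (v b))" for A
    by (induction A rule: infinite_finite_induct) (auto simp: T T0)
  have "?p \<in> V" using assms(1) v by (intro lin_comb) auto
  moreover have "T ?p = 0"
  proof (rule vanish_leads)
    show "T ?p \<in> W" using \<open>?p \<in> V\<close> assms(3) by auto
    show "lookup (T ?p) m = 0" if "m \<in> leads W" for m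
      unfolding Tsum lookup_comb using c that by auto
  qed
  ultimately have "?p = 0" using assms(4) by blast
  moreover have "?p \<noteq> 0" using lead_comb[OF assms(6) _ c(1), of v] v by blast
  ultimately show False by simp
qed

section \<open>Finite sets of monomials in the multiset order\<close>

lemma set_less_iff:
  fixes A B :: "'a::linorder set"
  assumes "finite A" "finite B"
  shows "mset_set A < mset_set B \<longleftrightarrow> A \<noteq> B \<and> (\<forall>y\<in>A - B. \<exists>x\<in>B - A. y < x)"
proof -
  have "mset_set A \<noteq> mset_set B \<longleftrightarrow> A \<noteq> B" using assms by (metis finite_set_mset_mset_set)
  moreover have "count (mset_set B) y < count (mset_set A) y \<longleftrightarrow> y \<in> A - B" for y
    using assms by (cases "y \<in> A"; cases "y \<in> B") auto
  moreover have "count (mset_set A) y < count (mset_set B) y \<longleftrightarrow> y \<in> B - A" for y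
    using assms by (cases "y \<in> A"; cases "y \<in> B") auto
  ultimately show ?thesis unfolding less_multiset\<^sub>H\<^sub>O by auto
qed

lemma set_le_iff:
  fixes A B :: "'a::linorder set"
  assumes "finite A" "finite B"
  shows "mset_set A \<le> mset_set B \<longleftrightarrow> (\<forall>y\<in>A - B. \<exists>x\<in>B - A. y < x)"
  using set_less_iff[OF assms] assms
  by (cases "A = B") (auto simp: order_le_less)

text \<open>If the comparison failed at \<open>m\<close>, there would be more leading monomials than
  members of \<open>A\<close> below \<open>m\<close>. Then some nonzero combination of the
  corresponding vectors vanishes on \<open>A\<close> below \<open>m\<close>, and it vanishes on the
  rest of \<open>A\<close> because its leading monomial is below \<open>m\<close>.\<close>

lemma leads_ge:
  fixes V :: "'k::field_char_0 S set"
  assumes "lin V" "finite (leads V)" "finite A" "card A = card (leads V)"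
    and inj: "\<And>p. p \<in> V \<Longrightarrow> (\<And>m. m \<in> A \<Longrightarrow> lookup p m = 0) \<Longrightarrow> p = 0"
  shows "mset_set A \<le> mset_set (leads V)"
  unfolding set_le_iff[OF assms(3,2)]
proof (rule ccontr)
  let ?B = "leads V"
  assume "\<not> (\<forall>y\<in>A - ?B. \<exists>x\<in>?B - A. y < x)"
  then obtain m where m: "m \<in> A" "m \<notin> ?B" "\<And>x. x \<in> ?B \<Longrightarrow> m < x \<Longrightarrow> x \<in> A" by fastforce
  \<comment> \<open>All leading monomials above \<open>m\<close> lie in \<open>A\<close>, and so
    does \<open>m\<close> itself, so \<open>A\<close> has at least one element more from
    \<open>m\<close> upward and therefore fewer below.\<close>
  have "insert m {x\<in>?B. m < x} \<subseteq> {x\<in>A. m \<le> x}" using m by auto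
  then have "card (insert m {x\<in>?B. m < x}) \<le> card {x\<in>A. m \<le> x}" using assms by (intro card_mono) auto
  then have "Suc (card {x\<in>?B. m < x}) \<le> card {x\<in>A. m \<le> x}" using assms by simp
  moreover have "card A = card {x\<in>A. m \<le> x} + card {x\<in>A. x < m}"
  proof -
    have "A = {x\<in>A. m \<le> x} \<union> {x\<in>A. x < m}" by auto
    then have "card A = card ({x\<in>A. m \<le> x} \<union> {x\<in>A. x < m})" by (rule arg_cong)
    also have "\<dots> = card {x\<in>A. m \<le> x} + card {x\<in>A. x < m}"
      using assms(3) by (intro card_Un_disjoint) auto
    finally show ?thesis .
  qed
  moreover have "card ?B = card {x\<in>?B. m < x} + card {x\<in>?B. x < m}"
  proof -
    have "x < m \<or> m < x" if "x \<in> ?B" for x using m(2) that by (cases x m rule: linorder_cases) auto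
    then have "?B = {x\<in>?B. m < x} \<union> {x\<in>?B. x < m}" by blast
    then have "card ?B = card ({x\<in>?B. m < x} \<union> {x\<in>?B. x < m})" by (rule arg_cong)
    also have "\<dots> = card {x\<in>?B. m < x} + card {x\<in>?B. x < m}"
      using assms(2) by (intro card_Un_disjoint) auto
    finally show ?thesis .
  qed
  ultimately have lt: "card {x\<in>A. x < m} < card {x\<in>?B. x < m}" using assms(4) by linarith
  obtain v where v: "\<And>b. b \<in> leads V \<Longrightarrow> v b \<in> V \<and> v b \<noteq> 0 \<and> lead (v b) = b" using leads_basis by blast
  let ?L = "{x\<in>?B. x < m}"
  obtain c where c: "\<exists>b\<in>?L. c b \<noteq> 0" "\<forall>x\<in>{x\<in>A. x < m}. (\<Sum>b\<in>?L. c b * lookup (v b) x) = 0"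
    using elim[OF _ _ lt, of "\<lambda>b. lookup (v b)"] assms by auto
  let ?p = "\<Sum>b\<in>?L. const (c b) * v b"
  have p: "?p \<noteq> 0" "lead ?p = Max {b\<in>?L. c b \<noteq> 0}"
    using lead_comb[of ?L v c] v c(1) assms(2) by auto
  have "lead ?p \<in> {b\<in>?L. c b \<noteq> 0}" unfolding p(2) using c(1) assms(2) by (intro Max_in) auto
  then have small: "lead ?p < m" by auto
  have "?p \<in> V" using assms(1) v by (intro lin_comb) auto
  moreover have "lookup ?p x = 0" if "x \<in> A" for x
  proof (cases "x < m")
    case True then show ?thesis unfolding lookup_comb using c that by auto
  next
    case False
    then show ?thesis using small lead_ge[of x ?p] by (cases "x \<in> keys ?p") (auto simp: in_keys_iff)
  qed
  ultimately show False using inj p by blast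
qed

text \<open>Nonsingularity at one point of a matrix of functions from a ring \<open>R\<close> is detected by a single
  element of \<open>R\<close>, obtained by fraction-free elimination.\<close>

lemma nonsing:
  fixes M :: "'x \<Rightarrow> 'a \<Rightarrow> 'b \<Rightarrow> 'k::field" and x0 :: 'x
  assumes "finite A" and one: "(\<lambda>_. 1) \<in> R" and diff: "\<And>f g. f \<in> R \<Longrightarrow> g \<in> R \<Longrightarrow> (\<lambda>x. f x - g x) \<in> R"
    and mult: "\<And>f g. f \<in> R \<Longrightarrow> g \<in> R \<Longrightarrow> (\<lambda>x. f x * g x) \<in> R"
    and M: "\<And>a b. a \<in> A \<Longrightarrow> b \<in> B \<Longrightarrow> (\<lambda>x. M x a b) \<in> R"
    and reg: "\<And>z. (\<And>b. b \<in> B \<Longrightarrow> (\<Sum>a\<in>A. z a * M x0 a b) = 0) \<Longrightarrow> \<forall>a\<in>A. z a = 0"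
  shows "\<exists>D\<in>R. D x0 \<noteq> 0 \<and> (\<forall>x. D x \<noteq> 0 \<longrightarrow>
    (\<forall>z. (\<forall>b\<in>B. (\<Sum>a\<in>A. z a * M x a b) = 0) \<longrightarrow> (\<forall>a\<in>A. z a = 0)))"
  using assms(1) M reg
proof (induction A arbitrary: M B rule: finite_induct)
  case empty
  show ?case by (rule bexI[OF _ one]) auto
next
  case (insert a0 A)
  have "\<exists>b0\<in>B. M x0 a0 b0 \<noteq> 0"
  proof (rule ccontr)
    assume c: "\<not> ?thesis"
    have "(\<Sum>a\<in>insert a0 A. (if a = a0 then 1 else 0) * M x0 a b) = 0" if "b \<in> B" for b
      by (rule sum.neutral) (use c that in auto)
    then have "\<forall>a\<in>insert a0 A. (if a = a0 then 1 else 0 :: 'k) = 0"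
      by (rule insert.prems(2)[where z = "\<lambda>a. if a = a0 then 1 else 0"])
    then show False by auto
  qed
  then obtain b0 where b0: "b0 \<in> B" "M x0 a0 b0 \<noteq> 0" by blast
  \<comment> \<open>Cross-multiplication by the pivot \<open>M x a0 b0\<close> avoids division, so
    the new entries stay in \<open>R\<close>.\<close>
  define M' where "M' x a b = M x a0 b0 * M x a b - M x a b0 * M x a0 b" for x a b
  have "\<exists>D\<in>R. D x0 \<noteq> 0 \<and> (\<forall>x. D x \<noteq> 0 \<longrightarrow>
    (\<forall>z. (\<forall>b\<in>B. (\<Sum>a\<in>A. z a * M' x a b) = 0) \<longrightarrow> (\<forall>a\<in>A. z a = 0)))"
  proof (rule insert.IH)
    show "(\<lambda>x. M' x a b) \<in> R" if "a \<in> A" "b \<in> B" for a b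
      unfolding M'_def using that insert.prems b0 by (intro diff mult) auto
    show "\<forall>a\<in>A. z a = 0" if z: "\<And>b. b \<in> B \<Longrightarrow> (\<Sum>a\<in>A. z a * M' x0 a b) = 0" for z
    proof -
      \<comment> \<open>Scaling by the pivot, with the coordinate at \<open>a0\<close> chosen to
        cancel column \<open>b0\<close>, turns a kernel vector of the reduced matrix into one of the
        original matrix.\<close>
      define w where "w a = (if a = a0 then - (\<Sum>a\<in>A. z a * M x0 a b0) else z a * M x0 a0 b0)" for a
      have "\<forall>a\<in>insert a0 A. w a = 0"
      proof (rule insert.prems(2))
        fix b assume b: "b \<in> B"
        have "(\<Sum>a\<in>A. w a * M x0 a b) = (\<Sum>a\<in>A. z a * M x0 a0 b0 * M x0 a b)"
          using insert by (intro sum.cong) (auto simp: w_def)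
        then have "(\<Sum>a\<in>insert a0 A. w a * M x0 a b) = (\<Sum>a\<in>A. z a * M' x0 a b)"
          using insert by (simp add: w_def M'_def algebra_simps sum_subtractf sum_distrib_left)
        then show "(\<Sum>a\<in>insert a0 A. w a * M x0 a b) = 0" using z b by simp
      qed
      then show ?thesis using b0 insert by (auto simp: w_def split: if_splits)
    qed
  qed
  then obtain D where D: "D \<in> R" "D x0 \<noteq> 0" "\<And>x z a. D x \<noteq> 0 \<Longrightarrow>
    (\<forall>b\<in>B. (\<Sum>a\<in>A. z a * M' x a b) = 0) \<Longrightarrow> a \<in> A \<Longrightarrow> z a = 0" by blast
  have "\<forall>a\<in>insert a0 A. z a = 0"
    if x: "M x a0 b0 * D x \<noteq> 0" and z: "\<forall>b\<in>B. (\<Sum>a\<in>insert a0 A. z a * M x a b) = 0" for x z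
  proof -
    have s: "(\<Sum>a\<in>A. z a * M x a b) = - z a0 * M x a0 b" if "b \<in> B" for b
      using bspec[OF z that] insert by (simp add: algebra_simps eq_neg_iff_add_eq_0)
    have "(\<Sum>a\<in>A. z a * M' x a b) = 0" if "b \<in> B" for b
    proof -
      have "(\<Sum>a\<in>A. z a * M' x a b) =
        M x a0 b0 * (\<Sum>a\<in>A. z a * M x a b) - M x a0 b * (\<Sum>a\<in>A. z a * M x a b0)"
        by (simp add: M'_def algebra_simps sum_subtractf sum_distrib_left)
      then show ?thesis using s[OF that] s[OF b0(1)] by simp
    qed
    then have zA: "\<forall>a\<in>A. z a = 0" using D(3)[of x z] x by auto
    then have "z a0 * M x a0 b0 = 0" using s[OF b0(1)] by simp
    then show ?thesis using x zA by auto
  qed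
  moreover have "(\<lambda>x. M x a0 b0 * D x) \<in> R" using insert.prems(1) b0 D by (intro mult) auto
  ultimately show ?case using b0 D by (intro bexI[of _ "\<lambda>x. M x a0 b0 * D x"]) auto
qed

section \<open>Monomials and the shifting operator\<close>

definition Mon :: "nat \<Rightarrow> nat \<Rightarrow> nat \<Rightarrow> mono set" where
  "Mon a n d = {m. keys m \<subseteq> {a..<n} \<and> mdeg m = d}"

text \<open>Comparing these counts for all \<open>k\<close> is the dominance order: in equal degree
  it says that one monomial arises from the other by lowering indices of variables. Strong stability
  and triangular substitutions are both expressed through it.\<close>

definition pref :: "mono \<Rightarrow> nat \<Rightarrow> nat" where
  "pref m k = (\<Sum>i<k. lookup m i)"

lemma mono_keys_add: "keys (m + m') = keys m \<union> keys m'" for m m' :: mono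
  by (auto simp: in_keys_iff lookup_add)

lemma mdeg_superset: "finite K \<Longrightarrow> keys m \<subseteq> K \<Longrightarrow> mdeg m = (\<Sum>i\<in>K. lookup m i)"
  unfolding mdeg_def by (rule sum.mono_neutral_left) (auto simp: in_keys_iff)

lemma mdeg_add [simp]: "mdeg (m + m') = mdeg m + mdeg m'"
proof -
  let ?K = "keys m \<union> keys m'"
  have "mdeg (m + m') = (\<Sum>i\<in>?K. lookup (m + m') i)" by (rule mdeg_superset) (auto simp: mono_keys_add)
  moreover have "mdeg m = (\<Sum>i\<in>?K. lookup m i)" "mdeg m' = (\<Sum>i\<in>?K. lookup m' i)"
    by (auto intro!: mdeg_superset)
  ultimately show ?thesis by (simp add: lookup_add sum.distrib)
qed

lemma mdeg_0 [simp]: "mdeg 0 = 0"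
  by (simp add: mdeg_def)

lemma mdeg_single [simp]: "mdeg (single i k) = k"
  by (simp add: mdeg_def)

lemma lookup_le_mdeg: "lookup m i \<le> mdeg m"
  by (cases "i \<in> keys m") (auto simp: mdeg_def in_keys_iff intro: member_le_sum)

lemma mdeg_eq_0_iff [simp]: "mdeg m = 0 \<longleftrightarrow> m = 0"
proof
  assume "mdeg m = 0"
  then have "lookup m i = lookup 0 i" for i using lookup_le_mdeg[of m i] by simp
  then show "m = 0" by (rule poly_mapping_eqI)
qed simp

lemma finite_Mon [simp]: "finite (Mon a n d)"
proof -
  let ?A = "{f. \<forall>x. (x \<in> {a..<n} \<longrightarrow> f x \<in> {..d}) \<and> (x \<notin> {a..<n} \<longrightarrow> f x = (0::nat))}"
  have "finite ?A" by (rule finite_set_of_finite_funs) auto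
  moreover have "lookup m \<in> ?A" if "m \<in> Mon a n d" for m
    using that lookup_le_mdeg[of m] by (auto simp: Mon_def in_keys_iff subset_iff)
  ultimately have "finite (lookup ` Mon a n d)" by (meson finite_subset image_subsetI)
  then show ?thesis by (rule finite_imageD) (auto intro!: inj_onI poly_mapping_eqI)
qed

lemma mono_split: "i \<in> keys m \<Longrightarrow> m = single i 1 + (m - single i 1)" for m :: mono
  by (rule poly_mapping_eqI) (auto simp: lookup_add lookup_minus lookup_single when_def in_keys_iff)

text \<open>Removing the least variable lowers the position of all others by one, while removing the
  greatest, as in \<open>mono_back\<close>, leaves the other positions alone. Both views of the
  shift are needed.\<close>

lemma mono_front [case_names zero add]:
  assumes "P 0" "\<And>a m. keys m \<subseteq> {a..} \<Longrightarrow> P m \<Longrightarrow> P (single a 1 + m)"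
  shows "P (m :: mono)"
proof (induction "mdeg m" arbitrary: m)
  case 0 then show ?case using assms by simp
next
  case (Suc d)
  then have "keys m \<noteq> {}" by auto
  define a where "a = Min (keys m)"
  have a: "a \<in> keys m" "\<And>i. i \<in> keys m \<Longrightarrow> a \<le> i" using \<open>keys m \<noteq> {}\<close> by (auto simp: a_def)
  obtain m' where m: "m = single a 1 + m'" using mono_split[OF a(1)] by blast
  then have "keys m' \<subseteq> {a..}" "mdeg m' = d" using a(2) Suc by (auto simp: mono_keys_add)
  then show ?case using assms(2) Suc m by blast
qed

lemma mono_back [case_names zero add]:
  assumes "P 0" "\<And>a m. keys m \<subseteq> {..a} \<Longrightarrow> P m \<Longrightarrow> P (m + single a 1)"
  shows "P (m :: mono)"
proof (induction "mdeg m" arbitrary: m)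
  case 0 then show ?case using assms by simp
next
  case (Suc d)
  then have "keys m \<noteq> {}" by auto
  define a where "a = Max (keys m)"
  have a: "a \<in> keys m" "\<And>i. i \<in> keys m \<Longrightarrow> i \<le> a" using \<open>keys m \<noteq> {}\<close> by (auto simp: a_def)
  obtain m' where m: "m = m' + single a 1" using mono_split[OF a(1)] by (metis add.commute)
  then have "keys m' \<subseteq> {..a}" "mdeg m' = d" using a(2) Suc by (auto simp: mono_keys_add)
  then show ?case using assms(2) Suc m by blast
qed

section \<open>The shift as a map from monomials to finite sets\<close>

lemma count_concat_replicate:
  "distinct xs \<Longrightarrow> count (mset (concat (map (\<lambda>i. replicate (f i) i) xs))) j = (if j \<in> set xs then f j else 0)"
  by (induction xs) auto

lemma sorted_concat_replicate:
  "sorted xs \<Longrightarrow> sorted (concat (map (\<lambda>i. replicate (f i) (i::nat)) xs))"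
  by (induction xs) (auto simp: sorted_append)

lemma count_var_list: "count (mset (var_list m)) i = lookup m i"
  unfolding var_list_def by (subst count_concat_replicate) (auto simp: in_keys_iff)

lemma sorted_var_list: "sorted (var_list m)"
  unfolding var_list_def by (rule sorted_concat_replicate) simp

lemma set_var_list: "set (var_list m) = keys m"
  by (auto simp: var_list_def in_keys_iff)

lemma var_list_eqI: "sorted l \<Longrightarrow> (\<And>i. count (mset l) i = lookup m i) \<Longrightarrow> var_list m = l"
  using sorted_var_list[of m] count_var_list[of m]
  by (metis multiset_eqI properties_for_sort sort_key_id_if_sorted)

lemma var_list_0 [simp]: "var_list 0 = []"
  by (rule var_list_eqI) auto

lemma var_list_Cons: "keys m \<subseteq> {a..} \<Longrightarrow> var_list (single a 1 + m) = a # var_list m"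
  by (rule var_list_eqI)
    (auto simp: sorted_var_list set_var_list count_var_list lookup_add lookup_single)

lemma var_list_snoc: "keys m \<subseteq> {..a} \<Longrightarrow> var_list (m + single a 1) = var_list m @ [a]"
  by (rule var_list_eqI)
    (auto simp: sorted_append sorted_var_list set_var_list count_var_list lookup_add lookup_single)

lemma length_var_list: "length (var_list m) = mdeg m"
  by (induction m rule: mono_back) (auto simp: var_list_snoc)

definition PhiS :: "mono \<Rightarrow> nat set" where
  "PhiS m = (\<lambda>j. var_list m ! j + j) ` {..<mdeg m}"

definition xm :: "nat set \<Rightarrow> mono" where
  "xm T = (\<Sum>i\<in>T. single i 1)"

lemma lookup_xm: "finite T \<Longrightarrow> lookup (xm T) i = (if i \<in> T then 1 else 0)"
  by (auto simp: xm_def lookup_sum lookup_single when_def)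

lemma keys_xm [simp]: "finite T \<Longrightarrow> keys (xm T) = T"
  by (auto simp: in_keys_iff lookup_xm split: if_splits)

lemma mdeg_xm [simp]: "finite T \<Longrightarrow> mdeg (xm T) = card T"
  by (simp add: mdeg_def lookup_xm)

lemma squarefree_xm: "finite T \<Longrightarrow> mono_squarefree (xm T)"
  by (auto simp: mono_squarefree_def lookup_xm)

lemma squarefree_eq_xm: "mono_squarefree m \<Longrightarrow> xm (keys m) = m"
proof (rule poly_mapping_eqI)
  fix k
  assume "mono_squarefree m"
  then have "lookup m k \<le> 1" by (simp add: mono_squarefree_def)
  then show "lookup (xm (keys m)) k = lookup m k" by (cases "lookup m k = 0") (auto simp: lookup_xm in_keys_iff)
qed

lemma PhiS_0 [simp]: "PhiS 0 = {}"
  by (simp add: PhiS_def)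

lemma PhiS_Cons:
  assumes "keys m \<subseteq> {a..}" shows "PhiS (single a 1 + m) = insert a (Suc ` PhiS m)"
proof -
  have "{..<mdeg (single a 1 + m)} = insert 0 (Suc ` {..<mdeg m})"
    by (simp add: lessThan_Suc_eq_insert_0 plus_1_eq_Suc)
  then show ?thesis using assms by (auto simp: PhiS_def var_list_Cons image_image)
qed

lemma PhiS_snoc:
  assumes "keys m \<subseteq> {..a}" shows "PhiS (m + single a 1) = insert (a + mdeg m) (PhiS m)"
proof -
  have "{..<mdeg (m + single a 1)} = insert (mdeg m) {..<mdeg m}" by auto
  moreover have "(\<lambda>j. (var_list m @ [a]) ! j + j) ` {..<mdeg m} = PhiS m"
    unfolding PhiS_def by (rule image_cong) (auto simp: nth_append length_var_list)
  ultimately show ?thesis using assms by (auto simp: PhiS_def var_list_snoc nth_append length_var_list)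
qed

lemma PhiS_less: "keys m \<subseteq> {..<n} \<Longrightarrow> PhiS m \<subseteq> {..<n + mdeg m}"
proof (induction m rule: mono_back)
  case (add a m)
  have k: "a < n" "keys m \<subseteq> {..<n}" using add(3) by (simp_all add: mono_keys_add)
  have "PhiS m \<subseteq> {..<n + mdeg m}" by (rule add(2)[OF k(2)])
  then show ?case using k(1) unfolding PhiS_snoc[OF add(1)] by (fastforce simp: subset_iff)
qed simp

text \<open>Positions count from 0, so a last variable \<open>x_a\<close> moves only to
  \<open>a + mdeg m - 1\<close>. A further factor \<open>x_a\<close> therefore lands on a new index,
  which is what makes \<open>card_PhiS\<close> work.\<close>

lemma PhiS_less_Max: "keys m \<subseteq> {..a} \<Longrightarrow> PhiS m \<subseteq> {..<a + mdeg m}"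
proof (induction m arbitrary: a rule: mono_back)
  case (add b m)
  have k: "b \<le> a" using add(3) by (simp add: mono_keys_add)
  have "PhiS m \<subseteq> {..<b + mdeg m}" by (rule add(2)[OF add(1)])
  then show ?case using k unfolding PhiS_snoc[OF add(1)] by (fastforce simp: subset_iff)
qed simp

lemma PhiS_ge: "keys m \<subseteq> {a..} \<Longrightarrow> PhiS m \<subseteq> {a..}"
proof (induction m rule: mono_front)
  case (add b m)
  have k: "a \<le> b" "keys m \<subseteq> {a..}" using add(3) by (simp_all add: mono_keys_add)
  have "PhiS m \<subseteq> {a..}" by (rule add(2)[OF k(2)])
  then show ?case using k(1) unfolding PhiS_Cons[OF add(1)] by (fastforce simp: subset_iff)
qed simp

lemma finite_PhiS [simp]: "finite (PhiS m)"
  by (simp add: PhiS_def)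

lemma card_PhiS [simp]: "card (PhiS m) = mdeg m"
proof (induction m rule: mono_back)
  case (add a m)
  have "a + mdeg m \<notin> PhiS m" using PhiS_less_Max[OF add(1)] by auto
  then show ?case using add by (simp add: PhiS_snoc)
qed simp

lemma Phi_mono_eq: "Phi_mono m = xm (PhiS m)"
proof -
  have "inj_on (\<lambda>j. var_list m ! j + j) {..<mdeg m}"
    by (rule eq_card_imp_inj_on) (auto simp: PhiS_def[symmetric])
  then show ?thesis
    unfolding Phi_mono_def xm_def PhiS_def by (simp add: sum.reindex length_var_list)
qed

text \<open>Appending variables of larger index does not change the positions of the earlier ones.
  Together with \<open>stable_prefix\<close> this carries divisibility by a generator over to the
  shifted sets.\<close>

lemma PhiS_split: "PhiS (m1 + m2) \<supseteq> PhiS m1" if "keys m1 \<subseteq> {..a}" "keys m2 \<subseteq> {a..}"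
  using that
proof (induction m2 rule: mono_back)
  case (add b m)
  have "keys (m1 + m) \<subseteq> {..b}" using add by (auto simp: mono_keys_add)
  then show ?case using add PhiS_snoc[of "m1 + m" b] by (auto simp: mono_keys_add add.assoc)
qed simp

section \<open>Dominance under the shift\<close>

lemma pref_add [simp]: "pref (m + m') k = pref m k + pref m' k"
  by (simp add: pref_def lookup_add sum.distrib)

lemma pref_0 [simp]: "pref 0 k = 0"
  by (simp add: pref_def)

lemma pref_single [simp]: "pref (single i c) k = (if i < k then c else 0)"
  by (simp add: pref_def lookup_single when_def)

lemma pref_le_mdeg: "pref m k \<le> mdeg m"
proof -
  have "mdeg m = (\<Sum>i\<in>keys m \<union> {..<k}. lookup m i)" by (rule mdeg_superset) auto
  also have "\<dots> \<ge> pref m k" unfolding pref_def by (rule sum_mono2) auto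
  finally show ?thesis .
qed

lemma pref_eq_mdeg: "keys m \<subseteq> {..<k} \<Longrightarrow> pref m k = mdeg m"
  by (simp add: mdeg_superset[of "{..<k}"] pref_def)

lemma pref_Suc: "pref m (Suc k) = pref m k + lookup m k"
  by (simp add: pref_def)

lemma pref_mono: "k \<le> l \<Longrightarrow> pref m k \<le> pref m l"
  unfolding pref_def by (rule sum_mono2) auto

text \<open>Translates dominance of monomials into dominance of the shifted sets: the number of indices
  \<open>r\<close>-th in order and below \<open>k\<close> becomes a count below \<open>k + r\<close>.\<close>

lemma less_pref_iff: "r < pref m k \<longleftrightarrow> r < card (PhiS m \<inter> {..<k + r})"
proof (induction m arbitrary: k r rule: mono_back)
  case zero
  then show ?case by simp
next
  case (add a m)
  let ?d = "mdeg m"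
  have new: "a + ?d \<notin> PhiS m" using PhiS_less_Max[OF add(1)] by auto
  have P: "PhiS (m + single a 1) = insert (a + ?d) (PhiS m)" using PhiS_snoc[OF add(1)] .
  have le: "card (PhiS m \<inter> X) \<le> ?d" for X
    using card_mono[of "PhiS m" "PhiS m \<inter> X"] by simp
  show ?case
  proof (cases "a + ?d < k + r")
    case True
    then have c: "card (PhiS (m + single a 1) \<inter> {..<k + r}) = Suc (card (PhiS m \<inter> {..<k + r}))"
      using new unfolding P by (subst Int_insert_left) simp
    show ?thesis
    proof (cases "a < k")
      case True
      then have "pref m k = ?d" using add(1) by (intro pref_eq_mdeg) auto
      then have "pref (m + single a 1) k = Suc ?d" using True by (simp add: One_nat_def)
      moreover have "r < Suc ?d \<longleftrightarrow> r < Suc (card (PhiS m \<inter> {..<k + r}))"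
      proof -
        consider "r < ?d" | "r = ?d" | "?d < r" by linarith
        then show ?thesis
        proof cases
          case 1
          then show ?thesis using add(2)[of r k] \<open>pref m k = ?d\<close> by simp
        next
          case 2
          then have "PhiS m \<inter> {..<k + r} = PhiS m" using PhiS_less_Max[OF add(1)] True by auto
          then show ?thesis using 2 by simp
        next
          case 3
          then show ?thesis using le[of "{..<k + r}"] by simp
        qed
      qed
      ultimately show ?thesis unfolding c by simp
    next
      case False
      then have "?d < r" using \<open>a + ?d < k + r\<close> by simp
      have "\<not> r < pref (m + single a 1) k" using False \<open>?d < r\<close> pref_le_mdeg[of m k] by simp
      moreover have "\<not> r < Suc (card (PhiS m \<inter> {..<k + r}))" using \<open>?d < r\<close> le[of "{..<k + r}"] by simp
      ultimately show ?thesis unfolding c by blast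
    qed
  next
    case False
    then have c: "card (PhiS (m + single a 1) \<inter> {..<k + r}) = card (PhiS m \<inter> {..<k + r})"
      unfolding P by (subst Int_insert_left) simp
    show ?thesis
    proof (cases "a < k")
      case True
      then have "pref m k = ?d" using add(1) by (intro pref_eq_mdeg) auto
      then have "r < pref (m + single a 1) k \<longleftrightarrow> r < pref m k" using True \<open>\<not> a + ?d < k + r\<close> by simp
      then show ?thesis unfolding c add(2) .
    next
      case False
      then have "r < pref (m + single a 1) k \<longleftrightarrow> r < pref m k" by simp
      then show ?thesis unfolding c add(2) .
    qed
  qed
qed

lemma dom_PhiS:
  assumes "\<And>k. pref m k \<le> pref u k"
  shows "card (PhiS m \<inter> {..<K}) \<le> card (PhiS u \<inter> {..<K})"
proof (rule ccontr)
  assume c: "\<not> ?thesis"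
  \<comment> \<open>The element number \<open>r\<close> of \<open>PhiS m\<close>, counted from 0, is
    below \<open>K\<close> exactly if it comes from a variable of index below \<open>K - r\<close>;
    at this threshold the prefix counts are compared.\<close>
  define r where "r = card (PhiS m \<inter> {..<K}) - 1"
  have r: "r < card (PhiS m \<inter> {..<K})" "\<not> r < card (PhiS u \<inter> {..<K})" using c by (auto simp: r_def)
  have "card (PhiS m \<inter> {..<K}) \<le> card {..<K}" by (rule card_mono) auto
  then have "r \<le> K" using r by simp
  then have K: "K = (K - r) + r" by simp
  from r(1) have "r < pref m (K - r)" using less_pref_iff[of r m "K - r"] K by simp
  then have "r < pref u (K - r)" using assms order.strict_trans2 by blast
  then show False using less_pref_iff[of r u "K - r"] K r by simp
qed

lemma PhiS_dom:
  assumes "\<And>K. card (PhiS m \<inter> {..<K}) \<le> card (PhiS u \<inter> {..<K})"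
  shows "pref m k \<le> pref u k"
proof (rule ccontr)
  assume "\<not> ?thesis"
  then have "pref u k < pref m k" by simp
  then have "pref u k < card (PhiS u \<inter> {..<k + pref u k})"
    using less_pref_iff[of "pref u k" m k] assms order.strict_trans2 by blast
  then show False using less_pref_iff[of "pref u k" u k] by simp
qed

text \<open>The largest element \<open>t\<close> of a set with \<open>d\<close> further elements
  must come from the variable of index \<open>t - d\<close> in the last position. The second
  conjunct records which variables are used, so that ranges of variables can be controlled.\<close>

lemma PhiS_surj: "finite T \<Longrightarrow> \<exists>m. PhiS m = T \<and> (\<forall>y. T \<subseteq> {..<y} \<longrightarrow> keys m \<subseteq> {..y - card T})"
proof (induction "card T" arbitrary: T)
  case 0
  then show ?case by (intro exI[of _ 0]) auto
next
  case (Suc d)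
  define t where "t = Max T"
  define T' where "T' = T - {t}"
  have "T \<noteq> {}" using Suc by auto
  then have t: "t \<in> T" "\<And>i. i \<in> T \<Longrightarrow> i \<le> t" using Suc by (auto simp: t_def)
  have T': "finite T'" "card T' = d" "T = insert t T'" "T' \<subseteq> {..<t}"
    using Suc t by (auto simp: T'_def order.strict_iff_order)
  obtain m where m: "PhiS m = T'" "keys m \<subseteq> {..t - d}" using Suc(1)[of T'] T' by auto
  have "card T' \<le> card {..<t}" using T' by (intro card_mono) auto
  then have "d \<le> t" using T' by simp
  moreover have "mdeg m = d" using card_PhiS[of m] m T' by simp
  ultimately have "PhiS (m + single (t - d) 1) = T" using PhiS_snoc[OF m(2)] m T' by simp
  moreover have "keys (m + single (t - d) 1) \<subseteq> {..y - card T}" if "T \<subseteq> {..<y}" for y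
  proof -
    have "t - d \<le> y - card T" using that t(1) Suc(2) by auto
    then show ?thesis using m(2) by (auto simp: mono_keys_add)
  qed
  ultimately show ?case by blast
qed

text \<open>Peel off the least variables. If they differ, the smaller index is the first element of
  its shifted set and is missing from the other; if they agree, the first difference of the
  remainders moves up by one.\<close>

lemma mono_less_PhiS:
  assumes "m' < m" "mdeg m' = mdeg m"
  shows "\<exists>i. i \<in> PhiS m \<and> i \<notin> PhiS m' \<and> (\<forall>j<i. j \<in> PhiS m \<longleftrightarrow> j \<in> PhiS m')"
  using assms
proof (induction m arbitrary: m' rule: mono_front)
  case zero
  then show ?case by simp
next
  case (add a m)
  have "keys m' \<noteq> {}" using add by auto
  define b where "b = Min (keys m')"
  have b: "b \<in> keys m'" "\<And>i. i \<in> keys m' \<Longrightarrow> b \<le> i" using \<open>keys m' \<noteq> {}\<close> by (auto simp: b_def)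
  obtain v where v: "m' = single b 1 + v" using mono_split[OF b(1)] by blast
  have kv: "keys v \<subseteq> {b..}" using b v by (auto simp: mono_keys_add)
  note P = PhiS_Cons[OF kv] PhiS_Cons[OF add(1)]
  consider "a < b" | "b < a" | "a = b" by linarith
  then show ?case
  proof cases
    case 1
    have "j \<notin> PhiS (single a 1 + m)" "j \<notin> PhiS m'" if "j < a" for j
      using 1 that PhiS_ge[OF add(1)] PhiS_ge[OF kv] unfolding v P by (auto dest!: subsetD)
    moreover have "a \<notin> PhiS m'" using 1 PhiS_ge[OF kv] unfolding v P by (auto dest!: subsetD)
    ultimately show ?thesis unfolding P by blast
  next
    case 2
    have "lookup (single a 1 + m) j = 0" if "j \<le> b" for j
      using 2 that add(1) by (auto simp: lookup_add lookup_single in_keys_iff subset_iff)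
    moreover have "lookup m' b > 0" using b(1) by (simp add: in_keys_iff)
    moreover have "lookup m' j = 0" if "j < b" for j
      using b(2)[of j] that by (cases "j \<in> keys m'") (auto simp: in_keys_iff)
    ultimately have "single a 1 + m < m'"
      unfolding less_poly_mapping.rep_eq less_fun_def by (intro exI[of _ b]) auto
    then show ?thesis using add by simp
  next
    case 3
    have "v < m" using add(3) unfolding v 3 by simp
    moreover have "mdeg v = mdeg m" using add(4) unfolding v 3 by simp
    ultimately obtain i where "i \<in> PhiS m" "i \<notin> PhiS v" "\<forall>j<i. j \<in> PhiS m \<longleftrightarrow> j \<in> PhiS v"
      using add(2) by blast
    moreover have "b \<noteq> Suc i" using \<open>i \<in> PhiS m\<close> PhiS_ge[OF add(1)] 3 by (auto dest!: subsetD)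
    ultimately show ?thesis unfolding v 3 P[unfolded 3]
      by (intro exI[of _ "Suc i"]) (auto simp: less_Suc_eq_0_disj image_iff)
  qed
qed

lemma inj_PhiS: "PhiS m = PhiS m' \<Longrightarrow> m = m'"
  using mono_less_PhiS[of m m'] mono_less_PhiS[of m' m] card_PhiS[of m] card_PhiS[of m']
  by (metis linorder_less_linear)

section \<open>Squarefree strongly stable families\<close>

text \<open>A squarefree monomial ideal is encoded by the family of the supports of its squarefree
  monomials; \<open>a\<close> is the first variable.\<close>

definition fam :: "nat \<Rightarrow> nat set set \<Rightarrow> bool" where
  "fam a F \<longleftrightarrow> (\<forall>T\<in>F. finite T \<and> T \<subseteq> {a..}) \<and>
     (\<forall>T\<in>F. \<forall>T'. T \<subseteq> T' \<and> finite T' \<and> T' \<subseteq> {a..} \<longrightarrow> T' \<in> F) \<and>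
     (\<forall>T\<in>F. \<forall>j\<in>T. \<forall>i. a \<le> i \<and> i < j \<and> i \<notin> T \<longrightarrow> insert i (T - {j}) \<in> F)"

text \<open>Bounds the variables in the minimal generators of degree at most \<open>d\<close>.\<close>

definition bnd :: "nat set set \<Rightarrow> nat \<Rightarrow> nat \<Rightarrow> bool" where
  "bnd F d n \<longleftrightarrow> (\<forall>T\<in>F. card T \<le> d \<longrightarrow> T \<inter> {..<n} \<in> F)"

definition F0 :: "nat \<Rightarrow> nat set set \<Rightarrow> nat set set" where
  "F0 a F = {T\<in>F. a \<notin> T}"

text \<open>The index shift mirrors \<open>PhiS_Cons\<close>, so that dividing \<open>JM F\<close>
  by \<open>x_a\<close> gives \<open>JM (F1 a F)\<close>. The first variable stays \<open>a\<close>,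
  because after the division \<open>x_a\<close> may occur again.\<close>

definition F1 :: "nat \<Rightarrow> nat set set \<Rightarrow> nat set set" where
  "F1 a F = {T. finite T \<and> T \<subseteq> {a..} \<and> insert a (Suc ` T) \<in> F}"

definition IM :: "nat set set \<Rightarrow> nat \<Rightarrow> nat \<Rightarrow> nat \<Rightarrow> mono set" where
  "IM F a n d = {m\<in>Mon a n d. keys m \<in> F}"

definition JM :: "nat set set \<Rightarrow> nat \<Rightarrow> nat \<Rightarrow> nat \<Rightarrow> mono set" where
  "JM F a n d = {m\<in>Mon a n d. PhiS m \<in> F}"

lemma finite_IM [simp]: "finite (IM F a n d)" and finite_JM [simp]: "finite (JM F a n d)"
  by (simp_all add: IM_def JM_def)

section \<open>Families and their decomposition along the first variable\<close>

lemma famD: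
  assumes "fam a F" "T \<in> F"
  shows "finite T" "T \<subseteq> {a..}" "T \<subseteq> T' \<Longrightarrow> finite T' \<Longrightarrow> T' \<subseteq> {a..} \<Longrightarrow> T' \<in> F"
    "j \<in> T \<Longrightarrow> a \<le> i \<Longrightarrow> i < j \<Longrightarrow> i \<notin> T \<Longrightarrow> insert i (T - {j}) \<in> F"
proof -
  note F = assms(1)[unfolded fam_def]
  note F2 = F[THEN conjunct2, THEN conjunct1, rule_format, OF assms(2)]
  note F3 = F[THEN conjunct2, THEN conjunct2, rule_format, OF assms(2)]
  show "finite T" by (rule F[THEN conjunct1, rule_format, OF assms(2), THEN conjunct1])
  show "T \<subseteq> {a..}" by (rule F[THEN conjunct1, rule_format, OF assms(2), THEN conjunct2])
  show "T' \<in> F" if "T \<subseteq> T'" "finite T'" "T' \<subseteq> {a..}"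
    by (rule F2) (intro conjI that)
  show "insert i (T - {j}) \<in> F" if "j \<in> T" "a \<le> i" "i < j" "i \<notin> T"
    by (rule F3) (intro conjI that)+
qed

lemma famI:
  assumes "\<And>T. T \<in> F \<Longrightarrow> finite T" "\<And>T. T \<in> F \<Longrightarrow> T \<subseteq> {a..}"
    "\<And>T T'. T \<in> F \<Longrightarrow> T \<subseteq> T' \<Longrightarrow> finite T' \<Longrightarrow> T' \<subseteq> {a..} \<Longrightarrow> T' \<in> F"
    "\<And>T i j. T \<in> F \<Longrightarrow> j \<in> T \<Longrightarrow> a \<le> i \<Longrightarrow> i < j \<Longrightarrow> i \<notin> T \<Longrightarrow> insert i (T - {j}) \<in> F"
  shows "fam a F"
  unfolding fam_def
proof (intro conjI ballI allI impI)
  fix T assume T: "T \<in> F"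
  show "finite T" by (rule assms(1)[OF T])
  show "T \<subseteq> {a..}" by (rule assms(2)[OF T])
  show "T' \<in> F" if "T \<subseteq> T' \<and> finite T' \<and> T' \<subseteq> {a..}" for T' using that by (intro assms(3)[OF T]) simp_all
  show "insert i (T - {j}) \<in> F" if "j \<in> T" "a \<le> i \<and> i < j \<and> i \<notin> T" for i j
    using that by (intro assms(4)[OF T]) simp_all
qed

lemma bnd_mono:
  assumes "fam a F" "bnd F d n" "d' \<le> d" "n \<le> n'" shows "bnd F d' n'"
  unfolding bnd_def
proof (intro ballI impI)
  fix T assume T: "T \<in> F" "card T \<le> d'"
  then have "T \<inter> {..<n} \<in> F" using assms by (auto simp: bnd_def)
  moreover have "T \<inter> {..<n} \<subseteq> T \<inter> {..<n'}" using assms(4) by auto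
  moreover have "finite (T \<inter> {..<n'})" "T \<inter> {..<n'} \<subseteq> {a..}" using famD(1,2)[OF assms(1) T(1)] by auto
  ultimately show "T \<inter> {..<n'} \<in> F" by (rule famD(3)[OF assms(1)])
qed

lemma fam_F0: assumes F: "fam a F" shows "fam (Suc a) (F0 a F)"
proof (rule famI)
  fix T assume T: "T \<in> F0 a F"
  then have T': "T \<in> F" "a \<notin> T" by (simp_all add: F0_def)
  show "finite T" using famD(1)[OF F T'(1)] .
  have "a \<le> x \<and> a \<noteq> x" if "x \<in> T" for x using famD(2)[OF F T'(1)] T'(2) that by auto
  then show "T \<subseteq> {Suc a..}" by (auto simp: Suc_le_eq order.strict_iff_order)
  show "T'' \<in> F0 a F" if "T \<subseteq> T''" "finite T''" "T'' \<subseteq> {Suc a..}" for T''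
  proof -
    have s: "T'' \<subseteq> {a..}" "a \<notin> T''" using that(3) by auto
    have "T'' \<in> F" by (rule famD(3)[OF F T'(1) that(1,2) s(1)])
    then show ?thesis using s by (simp add: F0_def)
  qed
  show "insert i (T - {j}) \<in> F0 a F" if "j \<in> T" "Suc a \<le> i" "i < j" "i \<notin> T" for i j
  proof -
    have "insert i (T - {j}) \<in> F" using that by (intro famD(4)[OF F T'(1)]) simp_all
    then show ?thesis using that T' by (simp add: F0_def)
  qed
qed

lemma fam_F1: assumes F: "fam a F" shows "fam a (F1 a F)"
proof (rule famI)
  fix T assume T: "T \<in> F1 a F"
  then have T': "finite T" "T \<subseteq> {a..}" "insert a (Suc ` T) \<in> F" by (simp_all add: F1_def)
  show "finite T" "T \<subseteq> {a..}" by fact+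
  show "T'' \<in> F1 a F" if "T \<subseteq> T''" "finite T''" "T'' \<subseteq> {a..}" for T''
  proof -
    have "insert a (Suc ` T'') \<in> F" using that
      by (intro famD(3)[OF F T'(3)]) (auto simp: subset_iff intro: le_SucI)
    then show ?thesis using that by (simp add: F1_def)
  qed
  show "insert i (T - {j}) \<in> F1 a F" if "j \<in> T" "a \<le> i" "i < j" "i \<notin> T" for i j
  proof -
    have "insert (Suc i) (insert a (Suc ` T) - {Suc j}) \<in> F"
      using that by (intro famD(4)[OF F T'(3)]) auto
    moreover have "insert (Suc i) (insert a (Suc ` T) - {Suc j}) = insert a (Suc ` insert i (T - {j}))"
      using that by auto
    ultimately show ?thesis using T' that by (auto simp: F1_def)
  qed
qed

lemma bnd_F0: "bnd F d n \<Longrightarrow> bnd (F0 a F) d n"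
  by (auto simp: bnd_def F0_def)

lemma bnd_F1:
  assumes "fam a F" "bnd F (Suc d) (Suc n)" "a \<le> n" shows "bnd (F1 a F) d n"
  unfolding bnd_def
proof (intro ballI impI)
  fix T assume T: "T \<in> F1 a F" "card T \<le> d"
  then have T': "finite T" "T \<subseteq> {a..}" "insert a (Suc ` T) \<in> F" by (auto simp: F1_def)
  have "a \<notin> Suc ` T" using T' by (auto dest!: subsetD)
  then have "card (insert a (Suc ` T)) \<le> Suc d" using T T' by (simp add: card_image)
  then have "insert a (Suc ` T) \<inter> {..<Suc n} \<in> F" using assms(2) T' by (auto simp: bnd_def)
  moreover have "insert a (Suc ` T) \<inter> {..<Suc n} = insert a (Suc ` (T \<inter> {..<n}))" using assms(3) by auto
  ultimately show "T \<inter> {..<n} \<in> F1 a F" using T' by (auto simp: F1_def)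
qed

text \<open>Single exchanges reach any dominating set: replace the least element \<open>j\<close> of
  \<open>T - T'\<close> by the least element \<open>i\<close> of \<open>T' - T\<close>. Dominance at
  \<open>Suc j\<close> forces \<open>i < j\<close>, and the new set is still dominated by
  \<open>T'\<close> while \<open>T'\<close> has one element less outside it.\<close>

lemma fam_dom:
  assumes F: "fam a F" and T: "T \<in> F" and T': "finite T'" "T' \<subseteq> {a..}" "card T' = card T"
    and dom: "\<And>k. card (T \<inter> {..<k}) \<le> card (T' \<inter> {..<k})"
  shows "T' \<in> F"
  using T T' dom
proof (induction "card (T' - T)" arbitrary: T)
  case 0
  then have "T' \<subseteq> T" "finite T" using famD(1)[OF F] by auto
  then show ?case using 0 by (metis card_subset_eq)
next
  case (Suc c)
  have fT: "finite T" using famD(1)[OF F] Suc by auto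
  have "card (T - T') = card (T' - T)"
    using card_le_sym_Diff[of T T'] card_le_sym_Diff[of T' T] Suc fT by simp
  then have "T - T' \<noteq> {}" "T' - T \<noteq> {}" using Suc by (metis card.empty nat.distinct(1))+
  define i where "i = Min (T' - T)"
  define j where "j = Min (T - T')"
  have i: "i \<in> T'" "i \<notin> T" "\<And>x. x \<in> T' - T \<Longrightarrow> i \<le> x"
    using Min_in[of "T' - T"] Min_le[of "T' - T"] \<open>T' - T \<noteq> {}\<close> Suc by (auto simp: i_def)
  have j: "j \<in> T" "j \<notin> T'" "\<And>x. x \<in> T - T' \<Longrightarrow> j \<le> x"
    using Min_in[of "T - T'"] Min_le[of "T - T'"] \<open>T - T' \<noteq> {}\<close> fT by (auto simp: j_def)
  have "i < j"
  proof (rule ccontr)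
    assume "\<not> i < j"
    then have "j < i" using i j by (metis linorder_neqE_nat)
    then have "T' \<inter> {..<Suc j} \<subset> T \<inter> {..<Suc j}" using i j
      by (intro psubsetI subsetI) (force simp: less_Suc_eq)+
    then have "card (T' \<inter> {..<Suc j}) < card (T \<inter> {..<Suc j})" using fT by (intro psubset_card_mono) auto
    then show False using Suc(7) by (metis leD)
  qed
  define U where "U = insert i (T - {j})"
  have r1: "U \<in> F" unfolding U_def using famD(4)[OF F Suc(3) j(1)] i \<open>i < j\<close> Suc by auto
  have r2: "card T' = card U"
    using Suc.prems(4) card.remove[OF fT j(1)] fT i(2) unfolding U_def by simp
  have r3: "c = card (T' - U)"
  proof -
    have "T' - U = (T' - T) - {i}" using j by (auto simp: U_def)
    then show ?thesis using Suc(2) i Suc.prems by simp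
  qed
  have r4: "card (U \<inter> {..<k}) \<le> card (T' \<inter> {..<k})" for k
  proof -
    consider "k \<le> i" | "i < k" "k \<le> j" | "j < k" by linarith
    then show ?thesis
    proof cases
      case 1
      then have "U \<inter> {..<k} = T \<inter> {..<k}" using \<open>i < j\<close> by (auto simp: U_def)
      then show ?thesis using Suc by simp
    next
      case 2
      then have "U \<inter> {..<k} \<subseteq> T' \<inter> {..<k}" using i j by (force simp: U_def)
      then show ?thesis using Suc by (intro card_mono) auto
    next
      case 3
      then have "U \<inter> {..<k} = insert i ((T \<inter> {..<k}) - {j})" using \<open>i < j\<close> by (auto simp: U_def)
      moreover have "card (insert i ((T \<inter> {..<k}) - {j})) = card (T \<inter> {..<k})"
      proof -
        have "j \<in> T \<inter> {..<k}" "i \<notin> T \<inter> {..<k} - {j}" using 3 i j by auto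
        then show ?thesis using card.remove[of "T \<inter> {..<k}" j] fT by simp
      qed
      ultimately show ?thesis using Suc(7)[of k] by simp
    qed
  qed
  show ?case by (rule Suc.hyps(1)[OF r3 r1 Suc.prems(2,3) r2 r4])
qed

lemma JM_dom:
  assumes "fam a F" "m \<in> JM F a n d" "u \<in> Mon a n d" "\<And>k. pref m k \<le> pref u k"
  shows "u \<in> JM F a n d"
proof -
  have m: "PhiS m \<in> F" "mdeg m = d" using assms(2) by (simp_all add: JM_def Mon_def)
  have "keys u \<subseteq> {a..}" "mdeg u = d" using assms(3) by (auto simp: Mon_def)
  then have "PhiS u \<subseteq> {a..}" "card (PhiS u) = card (PhiS m)" using PhiS_ge m by simp_all
  then have "PhiS u \<in> F" by (intro fam_dom[OF assms(1) m(1) finite_PhiS _ _ dom_PhiS[OF assms(4)]])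
  then show ?thesis using assms(3) by (simp add: JM_def)
qed

section \<open>Counting the monomials of an ideal and of its shifted counterpart\<close>

lemma Mon_add_single: "single a 1 + m \<in> Mon a n (Suc d) \<longleftrightarrow> a < n \<and> m \<in> Mon a n d"
  by (auto simp: Mon_def mono_keys_add One_nat_def)

lemma Mon_Suc_iff: "m \<in> Mon (Suc a) n d \<longleftrightarrow> m \<in> Mon a n d \<and> a \<notin> keys m"
  by (auto simp: Mon_def subset_iff Suc_le_eq order.strict_iff_order)

lemma IM_F0: "IM (F0 a F) (Suc a) n d = {m\<in>IM F a n d. a \<notin> keys m}"
  by (auto simp: IM_def F0_def Mon_Suc_iff)

lemma JM_F0: "JM (F0 a F) (Suc a) n d = {m\<in>JM F a n d. a \<notin> keys m}"
proof -
  have "a \<notin> PhiS m" if "m \<in> Mon (Suc a) n d" for m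
    using that PhiS_ge[of m "Suc a"] by (auto simp: Mon_def subset_iff)
  then show ?thesis by (auto simp: JM_def F0_def Mon_Suc_iff)
qed

lemma JM_F1: "single a 1 + m \<in> JM F a n (Suc d) \<longleftrightarrow> a < n \<and> m \<in> JM (F1 a F) a n d"
proof (cases "a < n \<and> m \<in> Mon a n d")
  case True
  then have "keys m \<subseteq> {a..}" by (auto simp: Mon_def)
  then show ?thesis using True PhiS_Cons[of m a] PhiS_ge[of m a]
    by (auto simp: JM_def Mon_add_single F1_def)
next
  case False
  then show ?thesis by (auto simp: JM_def Mon_add_single)
qed

text \<open>The quotient of \<open>IM F\<close> by \<open>x_a\<close>. Its support condition lacks
  the index shift of \<open>F1\<close>; the gap to \<open>IM (F1 a F)\<close> is bridged by
  \<open>card_I1\<close> for counting and by \<open>transfer\<close> for coefficients.\<close>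

definition I1 :: "nat set set \<Rightarrow> nat \<Rightarrow> nat \<Rightarrow> nat \<Rightarrow> mono set" where
  "I1 F a n d = {m\<in>Mon a n d. insert a (keys m) \<in> F}"

lemma I1_iff: "single a 1 + m \<in> IM F a n (Suc d) \<longleftrightarrow> a < n \<and> m \<in> I1 F a n d"
  by (auto simp: IM_def I1_def Mon_add_single mono_keys_add)

lemma finite_I1 [simp]: "finite (I1 F a n d)"
  by (simp add: I1_def)

lemma card_with_var:
  assumes "A \<subseteq> Mon a n (Suc d)"
  shows "card {m\<in>A. a \<in> keys m} = card {m. single a 1 + m \<in> A}"
proof -
  have "{m\<in>A. a \<in> keys m} = (+) (single a 1) ` {m. single a 1 + m \<in> A}"
    using mono_split[of a] by (force simp: mono_keys_add)
  then show ?thesis by (simp add: card_image inj_on_def)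
qed

lemma card_split_var: "finite A \<Longrightarrow> card A = card {m\<in>A. (a::nat) \<notin> keys m} + card {m\<in>A. a \<in> keys m}" for A :: "mono set"
proof -
  assume f: "finite A"
  have "A = {m\<in>A. a \<notin> keys m} \<union> {m\<in>A. a \<in> keys m}" by auto
  then have "card A = card ({m\<in>A. a \<notin> keys m} \<union> {m\<in>A. a \<in> keys m})" by (rule arg_cong)
  also have "\<dots> = card {m\<in>A. a \<notin> keys m} + card {m\<in>A. a \<in> keys m}"
    using f by (intro card_Un_disjoint) auto
  finally show ?thesis .
qed

text \<open>A cyclic shift of the interval from \<open>a\<close> to \<open>n - 1\<close>, extended
  by the identity because \<open>map_key\<close> relabels all of \<open>nat\<close>. It moves every
  later variable one index down and parks the exponent of \<open>x_a\<close> at index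
  \<open>n - 1\<close>.\<close>

definition rot :: "nat \<Rightarrow> nat \<Rightarrow> nat \<Rightarrow> nat" where
  "rot a n j = (if a \<le> j \<and> Suc j < n then Suc j else if Suc j = n \<and> a < n then a else j)"

lemma bij_rot: "bij (rot a n)"
proof (rule bijI)
  show "inj (rot a n)"
  proof (rule injI)
    fix x y assume "rot a n x = rot a n y"
    then show "x = y" unfolding rot_def by presburger
  qed
  have "\<exists>j. i = rot a n j" for i
  proof -
    consider "a < n" "i = a" | "a < i" "i < n" | "\<not> (a \<le> i \<and> i < n)" by linarith
    then show ?thesis
    proof cases
      case 1 then show ?thesis by (intro exI[of _ "n - 1"]) (auto simp: rot_def)
    next
      case 2 then show ?thesis by (intro exI[of _ "i - 1"]) (auto simp: rot_def)
    next
      case 3 then show ?thesis by (intro exI[of _ i]) (auto simp: rot_def)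
    qed
  qed
  then show "surj (rot a n)" by (auto simp: surj_def)
qed

lemma mdeg_map_key: "bij f \<Longrightarrow> mdeg (Poly_Mapping.map_key f m) = mdeg m"
proof -
  assume b: "bij f"
  then have i: "inj f" by (rule bij_is_inj)
  have "bij_betw f (keys (Poly_Mapping.map_key f m)) (keys m)"
    using b i by (auto simp: bij_betw_def keys_map_key inj_on_def inj_def image_vimage_eq bij_is_surj surj_image_vimage_eq)
  from sum.reindex_bij_betw[OF this, of "lookup m"] show ?thesis
    unfolding mdeg_def by (simp add: map_key.rep_eq i)
qed

lemma card_keys_le: "card (keys m) \<le> mdeg m"
proof -
  have "(\<Sum>i\<in>keys m. 1) \<le> (\<Sum>i\<in>keys m. lookup m i)"
    by (rule sum_mono) (simp add: in_keys_iff One_nat_def Suc_le_eq)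
  then show ?thesis by (simp add: mdeg_def)
qed

text \<open>After relabelling by \<open>rot\<close>, the raised support with \<open>a\<close>
  adjoined equals the old support with \<open>a\<close> adjoined, plus the index \<open>n\<close> in
  case \<open>x_a\<close> divides \<open>m\<close>. The bound \<open>bnd\<close> allows this extra
  index to be removed without leaving \<open>F\<close>.\<close>

lemma card_I1:
  assumes F: "fam a F" and b: "bnd F (Suc d) n" and n: "a < n"
  shows "card (I1 F a n d) = card (IM (F1 a F) a n d)"
proof -
  let ?r = "rot a n" and ?g = "Poly_Mapping.map_key (rot a n) :: mono \<Rightarrow> mono"
  have i: "inj ?r" using bij_rot by (rule bij_is_inj)
  have kg: "keys (?g m) = {j. ?r j \<in> keys m}" for m using i by (auto simp: keys_map_key)
  have Mg: "?g m \<in> Mon a n d \<longleftrightarrow> m \<in> Mon a n d" for m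
  proof -
    have "j \<in> {a..<n} \<longleftrightarrow> ?r j \<in> {a..<n}" for j
      unfolding rot_def atLeastLessThan_iff by presburger
    then have "(\<forall>j. ?r j \<in> keys m \<longrightarrow> j \<in> {a..<n}) \<longleftrightarrow> (\<forall>j. ?r j \<in> keys m \<longrightarrow> ?r j \<in> {a..<n})"
      by blast
    also have "\<dots> \<longleftrightarrow> (\<forall>j. j \<in> keys m \<longrightarrow> j \<in> {a..<n})"
      using bij_is_surj[OF bij_rot, of a n] by (metis surjD)
    finally show ?thesis using mdeg_map_key[OF bij_rot] by (auto simp: Mon_def kg)
  qed
  have eq: "insert a (keys m) \<in> F \<longleftrightarrow> insert a (Suc ` keys (?g m)) \<in> F" if m: "m \<in> Mon a n d" for m
  proof -
    have *: "insert a (Suc ` keys (?g m)) = insert a (keys m) \<union> (if a \<in> keys m then {n} else {})"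
    proof (rule Set.set_eqI)
      fix x
      have k: "j \<in> keys m \<Longrightarrow> a \<le> j \<and> j < n" for j using m by (auto simp: Mon_def)
      have "x \<in> Suc ` keys (?g m) \<longleftrightarrow> x > 0 \<and> ?r (x - 1) \<in> keys m" by (cases x) (auto simp: kg image_iff)
      also have "\<dots> \<longleftrightarrow> (x \<in> keys m \<and> x \<noteq> a) \<or> (x = n \<and> a \<in> keys m)"
      proof (cases x)
        case 0
        then show ?thesis using k[of 0] n by auto
      next
        case (Suc y)
        consider "a \<le> y" "Suc y < n" | "Suc y = n" | "y < a" | "n < Suc y" by linarith
        then show ?thesis
        proof cases
          case 3
          then have "rot a n y = y" using n by (simp add: rot_def)
          then show ?thesis using 3 Suc n k[of y] k[of "Suc y"] by auto
        next
          case 4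
          then have "rot a n y = y" using n by (simp add: rot_def)
          then show ?thesis using 4 Suc n k[of y] k[of "Suc y"] by auto
        qed (use Suc n k[of n] in \<open>auto simp: rot_def\<close>)
      qed
      finally show "x \<in> insert a (Suc ` keys (?g m)) \<longleftrightarrow>
        x \<in> insert a (keys m) \<union> (if a \<in> keys m then {n} else {})" by auto
    qed
    show ?thesis
    proof (cases "a \<in> keys m")
      case False then show ?thesis unfolding * by simp
    next
      case True
      have k: "keys m \<subseteq> {a..<n}" "mdeg m = d" using m by (auto simp: Mon_def)
      have "card (keys m) \<le> d" using card_keys_le[of m] k by simp
      note k = k(1) this
      have "keys m \<in> F \<longleftrightarrow> insert n (keys m) \<in> F"
      proof
        assume "keys m \<in> F"
        moreover have "keys m \<subseteq> insert n (keys m)" "insert n (keys m) \<subseteq> {a..}" using k n by auto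
        ultimately show "insert n (keys m) \<in> F" using famD(3)[OF F, of "keys m" "insert n (keys m)"] by simp
      next
        assume *: "insert n (keys m) \<in> F"
        \<comment> \<open>The support has at most \<open>d\<close> elements, so with
          \<open>n\<close> inserted it is still within the reach of the bound for
          \<open>Suc d\<close>.\<close>
        have "card (insert n (keys m)) \<le> Suc d" using k by (simp add: card_insert_if)
        then have "insert n (keys m) \<inter> {..<n} \<in> F" using * b by (auto simp: bnd_def)
        moreover have "insert n (keys m) \<inter> {..<n} = keys m" using k by auto
        ultimately show "keys m \<in> F" by simp
      qed
      then show ?thesis unfolding * using True by (simp add: insert_absorb)
    qed
  qed
  have "?g m \<in> IM (F1 a F) a n d \<longleftrightarrow> m \<in> I1 F a n d" for m
    using Mg[of m] eq[of m] by (auto simp: IM_def I1_def F1_def Mon_def)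
  moreover have "inj ?g" 
  proof (rule injI, rule poly_mapping_eqI)
    fix u v :: mono and k assume "?g u = ?g v"
    then have "lookup u (?r j) = lookup v (?r j)" for j by (metis i map_key.rep_eq comp_apply)
    then show "lookup u k = lookup v k" using bij_is_surj[OF bij_rot, of a n] by (metis surjD)
  qed
  moreover have "surj ?g"
  proof -
    have "inj (inv_into UNIV ?r)" using bij_rot[of a n] bij_imp_bij_inv bij_is_inj by blast
    then have "?g (Poly_Mapping.map_key (inv_into UNIV ?r) m) = m" for m
      using i by (intro poly_mapping_eqI) (simp add: map_key.rep_eq)
    then show ?thesis by (rule surjI)
  qed
  ultimately have "bij_betw ?g (I1 F a n d) (IM (F1 a F) a n d)"
    by (force simp: bij_betw_def inj_on_def inj_def surj_def image_iff)
  then show ?thesis by (rule bij_betw_same_card)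
qed

lemma Mon_0: "Mon a n 0 = {0}"
  by (auto simp: Mon_def)

lemma Mon_empty: "n \<le> a \<Longrightarrow> Mon a n (Suc d) = {}"
  by (auto simp: Mon_def)

text \<open>Both sides split by divisibility by \<open>x_a\<close>. The part free of
  \<open>x_a\<close> belongs to \<open>F0\<close>; the quotient of the rest is
  \<open>JM (F1 a F)\<close> on one side and has the size of \<open>IM (F1 a F)\<close> on the
  other. Hence a nested induction on the degree and on \<open>n - a\<close>.\<close>

lemma card_IM_JM:
  assumes "fam a F" "bnd F d n"
  shows "card (IM F a n d) = card (JM F a n d)"
  using assms
proof (induction d arbitrary: a F n)
  case 0
  then show ?case by (auto simp: IM_def JM_def Mon_0 intro!: arg_cong[where f = card])
next
  case (Suc d)
  note outer = Suc.IH
  show ?case using Suc.prems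
  proof (induction "n - a" arbitrary: a F)
    case 0
    then show ?case by (simp add: IM_def JM_def Mon_empty)
  next
    case (Suc k)
    then have an: "a < n" by simp
    have "card (IM F a n (Suc d)) = card (IM (F0 a F) (Suc a) n (Suc d)) + card (I1 F a n d)"
    proof -
      have "card {m \<in> IM F a n (Suc d). a \<in> keys m} = card {m. single a 1 + m \<in> IM F a n (Suc d)}"
        by (rule card_with_var) (auto simp: IM_def)
      then show ?thesis using an card_split_var[of "IM F a n (Suc d)" a] by (simp add: IM_F0 I1_iff)
    qed
    also have "card (IM (F0 a F) (Suc a) n (Suc d)) = card (JM (F0 a F) (Suc a) n (Suc d))"
      using Suc.hyps(2) by (intro Suc.hyps(1) fam_F0[OF Suc.prems(1)] bnd_F0[OF Suc.prems(2)]) simp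
    also have "card (I1 F a n d) = card (JM (F1 a F) a n d)"
    proof -
      \<comment> \<open>\<open>bnd_F1\<close> lowers both parameters by one, so the bound is first
        relaxed to \<open>Suc n\<close>.\<close>
      have b: "bnd F (Suc d) (Suc n)" by (rule bnd_mono[OF Suc.prems]) simp_all
      have "card (IM (F1 a F) a n d) = card (JM (F1 a F) a n d)"
        by (rule outer[OF fam_F1[OF Suc.prems(1)] bnd_F1[OF Suc.prems(1) b]]) (use an in simp)
      then show ?thesis using card_I1[OF Suc.prems an] by simp
    qed
    also have "card (JM (F0 a F) (Suc a) n (Suc d)) + card (JM (F1 a F) a n d) = card (JM F a n (Suc d))"
    proof -
      have "card {m \<in> JM F a n (Suc d). a \<in> keys m} = card {m. single a 1 + m \<in> JM F a n (Suc d)}"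
        by (rule card_with_var) (auto simp: JM_def)
      then show ?thesis using an card_split_var[of "JM F a n (Suc d)" a] by (simp add: JM_F0 JM_F1)
    qed
    finally show ?case .
  qed
qed

section \<open>Upper triangular substitutions\<close>

text \<open>Matrices are functions on all pairs of indices, so that one \<open>G\<close> acts for
  every number of variables. The lower limit \<open>a\<close> restricts to the variables from
  \<open>a\<close> on, as the inductions along the first variable require.\<close>

definition U :: "nat \<Rightarrow> (nat \<times> nat \<Rightarrow> 'k::field_char_0) \<Rightarrow> nat \<Rightarrow> 'k S" where
  "U a G j = (\<Sum>i\<in>{a..j}. const (G (i, j)) * var i)"

definition Up :: "(nat \<times> nat \<Rightarrow> 'k::field_char_0) set" where
  "Up = {G. (\<forall>i. G (i, i) \<noteq> 0) \<and> (\<forall>i j. j < i \<longrightarrow> G (i, j) = 0)}"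

lemma UpD: "G \<in> Up \<Longrightarrow> G (i, i) \<noteq> 0"
  by (simp add: Up_def)

lemma sp_sum: "(\<And>x. x \<in> X \<Longrightarrow> f x \<in> sp A) \<Longrightarrow> sum f X \<in> sp A"
  by (rule lin_sum[OF lin_sp])

lemma sp_const: "p \<in> sp A \<Longrightarrow> const c * p \<in> sp A"
  by (rule linD(3)[OF lin_sp])

lemma sp_add: "p \<in> sp A \<Longrightarrow> q \<in> sp A \<Longrightarrow> p + q \<in> sp A"
  by (rule linD(2)[OF lin_sp])

lemma sp_uminus: "p \<in> sp A \<Longrightarrow> - p \<in> sp A"
  by (simp add: sp_def)

lemma sp_diff: "p \<in> sp A \<Longrightarrow> q \<in> sp A \<Longrightarrow> p - q \<in> sp A"
  using sp_add[of p A "- q"] sp_uminus[of q A] by simp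

lemma sp_mult:
  assumes "p \<in> sp A" "q \<in> sp B" "\<And>u v. u \<in> A \<Longrightarrow> v \<in> B \<Longrightarrow> u + v \<in> C"
  shows "p * q \<in> sp C"
proof -
  have "keys (p * q) \<subseteq> C"
  proof
    fix x assume "x \<in> keys (p * q)"
    then obtain u v where "x = u + v" "u \<in> keys p" "v \<in> keys q" using keys_mult[of p q] by blast
    then show "x \<in> C" using assms(3)[of u v] assms(1,2) by (auto simp: sp_def)
  qed
  then show ?thesis by (simp add: sp_def)
qed

lemma Mon_add: "u \<in> Mon a n d \<Longrightarrow> v \<in> Mon a n e \<Longrightarrow> u + v \<in> Mon a n (d + e)"
  by (simp add: Mon_def mono_keys_add)

lemma Mon_mono: "a' \<le> a \<Longrightarrow> n \<le> n' \<Longrightarrow> Mon a n d \<subseteq> Mon a' n' d"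
  unfolding Mon_def by fastforce

lemma single_Mon: "single i 1 \<in> Mon a n 1 \<longleftrightarrow> a \<le> i \<and> i < n"
  by (simp add: Mon_def)

lemma sp_Mon_mult: "p \<in> sp (Mon a n d) \<Longrightarrow> q \<in> sp (Mon a n e) \<Longrightarrow> p * q \<in> sp (Mon a n (d + e))"
  by (rule sp_mult) (auto intro: Mon_add)

lemma polys_in_sp: "p \<in> sp (Mon a n d) \<Longrightarrow> p \<in> polys_in {a..<n}"
  by (auto simp: sp_def polys_in_def Mon_def)

lemma U_in: assumes "j < n" shows "U a G j \<in> sp (Mon a n 1)"
proof -
  have "const (G (i, j)) * var i \<in> sp (Mon a n 1)" if "i \<in> {a..j}" for i
    by (rule sp_const) (use that assms in \<open>simp add: single_Mon\<close>)
  then show ?thesis unfolding U_def by (rule sp_sum)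
qed

lemma mev_in:
  assumes "\<And>j. j \<in> keys m \<Longrightarrow> s j \<in> sp (Mon b n 1)"
  shows "mev s m \<in> sp (Mon b n (mdeg m))"
  using assms
proof (induction m rule: mono_back)
  case zero
  show ?case by (simp add: sp_def Mon_0)
next
  case (add a m)
  have "mev s m \<in> sp (Mon b n (mdeg m))" by (rule add(2)) (rule add(3), simp add: mono_keys_add)
  moreover have "s a \<in> sp (Mon b n 1)" by (rule add(3)) (simp add: mono_keys_add)
  ultimately show ?case using sp_Mon_mult[of "mev s m" b n "mdeg m" "s a" 1] by (simp add: mev_add)
qed

lemma sb_alt: "sb s p = (\<Sum>m\<in>keys p. const (lookup p m) * mev s m)"
  by (simp add: subst_alt)

lemma sb_alt_super: "finite A \<Longrightarrow> p \<in> sp A \<Longrightarrow> sb s p = (\<Sum>m\<in>A. const (lookup p m) * mev s m)"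
  by (rule subst_superset[OF rhom_const]) (auto simp: sp_def)

lemma sb_in_sp:
  assumes "p \<in> sp A" "\<And>m. m \<in> A \<Longrightarrow> mev s m \<in> sp B"
  shows "sb s p \<in> sp B"
  unfolding sb_alt by (intro lin_comb[OF lin_sp] assms(2)) (use assms(1) in \<open>auto simp: sp_def\<close>)

lemma sb_in:
  assumes "p \<in> sp (Mon a n d)" "\<And>j. a \<le> j \<Longrightarrow> j < n \<Longrightarrow> s j \<in> sp (Mon b n' 1)"
  shows "sb s p \<in> sp (Mon b n' d)"
proof (rule sb_in_sp[OF assms(1)])
  fix m assume m: "m \<in> Mon a n d"
  have "mev s m \<in> sp (Mon b n' (mdeg m))"
    by (rule mev_in, rule assms(2)) (use m in \<open>auto simp: Mon_def\<close>)
  then show "mev s m \<in> sp (Mon b n' d)" using m by (simp add: Mon_def)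
qed

lemma sb_U_in: "p \<in> sp (Mon a n d) \<Longrightarrow> sb (U a G) p \<in> sp (Mon a n d)"
  by (rule sb_in) (auto intro: U_in)

text \<open>Preimages of single variables are found in increasing order: subtract from
  \<open>x_j\<close> the preimages of the earlier variables in its image and divide by the diagonal
  entry.\<close>

lemma U_inverse:
  assumes "G \<in> Up"
  obtains l where "\<And>j n. a \<le> j \<Longrightarrow> j < n \<Longrightarrow> l j \<in> sp (Mon a n 1)"
    "\<And>j. a \<le> j \<Longrightarrow> sb (U a G) (l j) = var j"
proof -
  have "\<exists>l. l \<in> sp (Mon a (Suc j) 1) \<and> sb (U a G) l = var j" if "a \<le> j" for j
    using that
  proof (induction j rule: less_induct)
    case (less j)
    then have "\<forall>i\<in>{a..<j}. \<exists>l. l \<in> sp (Mon a (Suc i) 1) \<and> sb (U a G) l = var i" by simp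
    then obtain l where l: "\<And>i. i \<in> {a..<j} \<Longrightarrow> l i \<in> sp (Mon a (Suc i) 1) \<and> sb (U a G) (l i) = var i"
      by metis
    define q where "q = const (1 / G (j, j)) * (var j - (\<Sum>i\<in>{a..<j}. const (G (i, j)) * l i))"
    have "l i \<in> sp (Mon a (Suc j) 1)" if "i \<in> {a..<j}" for i
      using l[OF that] that sp_mono[OF Mon_mono[of a a "Suc i" "Suc j" 1]] by auto
    then have "(\<Sum>i\<in>{a..<j}. const (G (i, j)) * l i) \<in> sp (Mon a (Suc j) 1)"
      by (intro sp_sum sp_const)
    moreover have "var j \<in> sp (Mon a (Suc j) 1)" using less.prems by (simp add: single_Mon)
    ultimately have "q \<in> sp (Mon a (Suc j) 1)" unfolding q_def by (intro sp_const sp_diff)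
    moreover have "sb (U a G) q = var j"
    proof -
      have rm: "sb (U a G) (p - r) = sb (U a G) p - sb (U a G) r" for p r
        using sb_add[of "U a G" "p - r" r] by simp
      have "sb (U a G) q = const (1 / G (j, j)) * (U a G j - (\<Sum>i\<in>{a..<j}. const (G (i, j)) * sb (U a G) (l i)))"
        unfolding q_def by (simp add: sb_mult rm sb_sum)
      also have "(\<Sum>i\<in>{a..<j}. const (G (i, j)) * sb (U a G) (l i)) = (\<Sum>i\<in>{a..<j}. const (G (i, j)) * var i)"
        by (rule sum.cong) (use l in auto)
      also have "U a G j = (\<Sum>i\<in>{a..<j}. const (G (i, j)) * var i) + const (G (j, j)) * var j"
      proof -
        have "{a..j} = insert j {a..<j}" using less.prems by auto
        then show ?thesis unfolding U_def by (simp add: add.commute)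
      qed
      finally show ?thesis using UpD[OF assms, of j] by (simp add: mult_single mult.assoc[symmetric])
    qed
    ultimately show ?case by blast
  qed
  then obtain l where l: "\<And>j. a \<le> j \<Longrightarrow> l j \<in> sp (Mon a (Suc j) 1) \<and> sb (U a G) (l j) = var j" by metis
  show thesis
  proof (rule that)
    show "l j \<in> sp (Mon a n 1)" if "a \<le> j" "j < n" for j n
      using l[OF that(1)] sp_mono[OF Mon_mono[of a a "Suc j" n 1]] that by auto
    show "sb (U a G) (l j) = var j" if "a \<le> j" for j using l[OF that] by simp
  qed
qed

lemma U_surj:
  assumes "G \<in> Up" "p \<in> sp (Mon a n d)"
  obtains q where "q \<in> sp (Mon a n d)" "sb (U a G) q = p"
proof -
  obtain l where l: "\<And>j n. a \<le> j \<Longrightarrow> j < n \<Longrightarrow> l j \<in> sp (Mon a n 1)"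
    "\<And>j. a \<le> j \<Longrightarrow> sb (U a G) (l j) = var j" using U_inverse[OF assms(1)] by blast
  have "sb (U a G) (sb l p) = sb (\<lambda>j. sb (U a G) (l j)) p" by (rule sb_sb)
  also have "\<dots> = sb var p" by (rule subst_cong[OF polys_in_sp[OF assms(2)]]) (simp add: l)
  finally have "sb (U a G) (sb l p) = p" by (simp add: sb_var_id)
  moreover have "sb l p \<in> sp (Mon a n d)" by (rule sb_in[OF assms(2) l(1)])
  ultimately show thesis using that by blast
qed

section \<open>Substitutions that are triangular with respect to dominance\<close>

lemma mult_expand:
  fixes p q :: "'k::field_char_0 S"
  shows "p * q = (\<Sum>u\<in>keys p. \<Sum>v\<in>keys q. single (u + v) (lookup p u * lookup q v))"
proof -
  have "p * q = (\<Sum>u\<in>keys p. single u (lookup p u)) * (\<Sum>v\<in>keys q. single v (lookup q v))"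
    using poly_expand[of p] poly_expand[of q] by simp
  then show ?thesis by (simp add: sum_product mult_single)
qed

lemma lookup_mult_unique:
  fixes p q :: "'k::field_char_0 S"
  assumes "\<And>u v. u \<in> keys p \<Longrightarrow> v \<in> keys q \<Longrightarrow> u + v = m + w \<Longrightarrow> u = m \<and> v = w"
  shows "lookup (p * q) (m + w) = lookup p m * lookup q w"
proof -
  have "lookup (p * q) (m + w) = (\<Sum>u\<in>keys p. \<Sum>v\<in>keys q. (if u + v = m + w then lookup p u * lookup q v else 0))"
    by (simp add: mult_expand lookup_sum lookup_single when_def)
  also have "\<dots> = (\<Sum>u\<in>keys p. \<Sum>v\<in>keys q. (if u = m then (if v = w then lookup p u * lookup q v else 0) else 0))"
  proof (intro sum.cong refl)
    fix u v assume "u \<in> keys p" "v \<in> keys q"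
    then show "(if u + v = m + w then lookup p u * lookup q v else 0) =
      (if u = m then (if v = w then lookup p u * lookup q v else 0) else 0)" using assms[of u v] by auto
  qed
  also have "\<dots> = (\<Sum>u\<in>keys p. if u = m then (\<Sum>v\<in>keys q. if v = w then lookup p u * lookup q v else 0) else 0)"
    by (rule sum.cong) auto
  also have "\<dots> = lookup p m * lookup q w"
    by (auto simp: sum.delta' in_keys_iff)
  finally show ?thesis .
qed

lemma pref_inject: "(\<And>k. pref m k = pref u k) \<Longrightarrow> m = u"
proof (rule poly_mapping_eqI)
  fix i assume "\<And>k. pref m k = pref u k"
  from this[of i] this[of "Suc i"] show "lookup m i = lookup u i" by (simp add: pref_Suc)
qed

text \<open>Before the first index where the exponents differ the prefix counts agree, so dominance
  one step further decides the lexicographic comparison.\<close>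

lemma dom_le:
  assumes "\<And>k. pref m k \<le> pref u k" shows "m \<le> u"
proof (cases "m = u")
  case False
  have ex: "\<exists>i. lookup m i \<noteq> lookup u i"
  proof (rule ccontr)
    assume "\<not> ?thesis"
    then have "m = u" by (intro poly_mapping_eqI) simp
    with False show False by simp
  qed
  define i where "i = (LEAST i. lookup m i \<noteq> lookup u i)"
  have i: "lookup m i \<noteq> lookup u i" unfolding i_def using ex by (rule LeastI_ex)
  have j: "lookup m j = lookup u j" if "j < i" for j using not_less_Least[of j] that unfolding i_def by blast
  then have "pref m i = pref u i" unfolding pref_def by (intro sum.cong) auto
  with assms[of "Suc i"] have "lookup m i \<le> lookup u i" by (simp add: pref_Suc)
  then have "lookup m i < lookup u i" using i by simp
  then have "m < u" unfolding less_poly_mapping.rep_eq less_fun_def by (intro exI[of _ i] conjI allI impI j)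
  then show ?thesis by simp
qed simp

text \<open>Prefix counts add under products, and so does dominance. A product of dominating factors
  can only equal the original monomial if every factor is an equality, which isolates the product of
  the diagonal coefficients.\<close>

lemma mev_dom_up:
  fixes s :: "nat \<Rightarrow> 'k::field_char_0 S"
  assumes "\<And>j v k. j \<in> keys m \<Longrightarrow> v \<in> keys (s j) \<Longrightarrow> pref (single j 1) k \<le> pref v k"
  shows "(\<forall>u\<in>keys (mev s m). \<forall>k. pref m k \<le> pref u k) \<and>
    lookup (mev s m) m = (\<Prod>j\<in>keys m. lookup (s j) (single j 1) ^ lookup m j)"
proof -
  have "(\<forall>u\<in>keys (mev s m). \<forall>k. pref m k \<le> pref u k) \<and> lookup (mev s m) m = mev (\<lambda>j. lookup (s j) (single j 1)) m"
    using assms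
  proof (induction m rule: mono_back)
    case zero
    show ?case by simp
  next
    case (add a m)
    have IH: "\<forall>u\<in>keys (mev s m). \<forall>k. pref m k \<le> pref u k" "lookup (mev s m) m = mev (\<lambda>j. lookup (s j) (single j 1)) m"
      using add(2)[OF add(3)] by (simp_all add: mono_keys_add)
    have a: "pref (single a 1) k \<le> pref v k" if "v \<in> keys (s a)" for v k
      using add(3)[OF _ that] by (simp add: mono_keys_add)
    have "\<forall>k. pref (m + single a 1) k \<le> pref u k" if u: "u \<in> keys (mev s (m + single a 1))" for u
    proof -
      obtain x v where x: "u = x + v" "x \<in> keys (mev s m)" "v \<in> keys (s a)"
        using u keys_mult[of "mev s m" "s a"] by (auto simp: mev_add)
      show ?thesis using IH(1) x(2) a[OF x(3)] unfolding x(1) pref_add by (blast intro: add_mono)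
    qed
    moreover have "lookup (mev s m * s a) (m + single a 1) = lookup (mev s m) m * lookup (s a) (single a 1)"
    proof (rule lookup_mult_unique)
      fix u v assume u: "u \<in> keys (mev s m)" and v: "v \<in> keys (s a)" and eq: "u + v = m + single a 1"
      have "pref m k = pref u k" for k
      proof -
        have "pref u k + pref v k = pref m k + pref (single a 1) k" using eq by (metis pref_add)
        moreover have "pref m k \<le> pref u k" using IH(1) u by blast
        moreover have "pref (single a 1) k \<le> pref v k" by (rule a[OF v])
        ultimately show ?thesis by linarith
      qed
      then have "u = m" using pref_inject by metis
      then show "u = m \<and> v = single a 1" using eq by simp
    qed
    ultimately show ?case using IH(2) by (simp add: mev_add)
  qed
  then show ?thesis by (simp add: mev_def)
qed

text \<open>The mirror image, for substitutions such as \<open>cc\<close> that add later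
  variables.\<close>

lemma mev_dom_down:
  fixes s :: "nat \<Rightarrow> 'k::field_char_0 S"
  assumes "\<And>j v k. j \<in> keys m \<Longrightarrow> v \<in> keys (s j) \<Longrightarrow> pref v k \<le> pref (single j 1) k"
  shows "(\<forall>u\<in>keys (mev s m). \<forall>k. pref u k \<le> pref m k) \<and>
    lookup (mev s m) m = (\<Prod>j\<in>keys m. lookup (s j) (single j 1) ^ lookup m j)"
proof -
  have "(\<forall>u\<in>keys (mev s m). \<forall>k. pref u k \<le> pref m k) \<and> lookup (mev s m) m = mev (\<lambda>j. lookup (s j) (single j 1)) m"
    using assms
  proof (induction m rule: mono_back)
    case zero
    show ?case by simp
  next
    case (add a m)
    have IH: "\<forall>u\<in>keys (mev s m). \<forall>k. pref u k \<le> pref m k" "lookup (mev s m) m = mev (\<lambda>j. lookup (s j) (single j 1)) m"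
      using add(2)[OF add(3)] by (simp_all add: mono_keys_add)
    have a: "pref v k \<le> pref (single a 1) k" if "v \<in> keys (s a)" for v k
      using add(3)[OF _ that] by (simp add: mono_keys_add)
    have "\<forall>k. pref u k \<le> pref (m + single a 1) k" if u: "u \<in> keys (mev s (m + single a 1))" for u
    proof -
      obtain x v where x: "u = x + v" "x \<in> keys (mev s m)" "v \<in> keys (s a)"
        using u keys_mult[of "mev s m" "s a"] by (auto simp: mev_add)
      show ?thesis using IH(1) x(2) a[OF x(3)] unfolding x(1) pref_add by (blast intro: add_mono)
    qed
    moreover have "lookup (mev s m * s a) (m + single a 1) = lookup (mev s m) m * lookup (s a) (single a 1)"
    proof (rule lookup_mult_unique)
      fix u v assume u: "u \<in> keys (mev s m)" and v: "v \<in> keys (s a)" and eq: "u + v = m + single a 1"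
      have "pref m k = pref u k" for k
      proof -
        have "pref u k + pref v k = pref m k + pref (single a 1) k" using eq by (metis pref_add)
        moreover have "pref u k \<le> pref m k" using IH(1) u by blast
        moreover have "pref v k \<le> pref (single a 1) k" by (rule a[OF v])
        ultimately show ?thesis by linarith
      qed
      then have "u = m" using pref_inject by metis
      then show "u = m \<and> v = single a 1" using eq by simp
    qed
    ultimately show ?case using IH(2) by (simp add: mev_add)
  qed
  then show ?thesis by (simp add: mev_def)
qed

lemma lookup_sb: "finite A \<Longrightarrow> p \<in> sp A \<Longrightarrow> lookup (sb s p) b = (\<Sum>m\<in>A. lookup p m * lookup (mev s m) b)"
  by (simp add: sb_alt_super lookup_sum)

lemma sp_keys: "p \<in> sp (keys p)"
  by (simp add: sp_def)

lemma lookup_sb_keys: "lookup (sb s p) b = (\<Sum>m\<in>keys p. lookup p m * lookup (mev s m) b)"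
  for p :: "'k::field_char_0 S"
  by (rule lookup_sb[OF _ sp_keys]) simp

lemma keys_U: assumes "v \<in> keys (U a G j)" shows "\<exists>i. a \<le> i \<and> i \<le> j \<and> v = single i 1"
proof -
  have "U a G j \<in> sp ((\<lambda>i. single i 1) ` {a..j})"
    unfolding U_def by (rule sp_sum, rule sp_const) auto
  then have "v \<in> (\<lambda>i. single i 1) ` {a..j}" using assms by (auto simp: sp_def)
  then show ?thesis by auto
qed

lemma single_one_eq_iff [simp]: "single i (1::nat) = single j 1 \<longleftrightarrow> i = j"
  by (metis lookup_single_eq lookup_single_not_eq zero_neq_one)

lemma lookup_U: "lookup (U a G j) (single i 1) = (if a \<le> i \<and> i \<le> j then G (i, j) else 0)"
proof -
  have "lookup (U a G j) (single i 1) = (\<Sum>k\<in>{a..j}. if k = i then G (i, j) else 0)"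
    unfolding U_def lookup_sum by (rule sum.cong) (auto simp: lookup_single when_def)
  then show ?thesis by (auto simp: sum.delta)
qed

lemma U_dom:
  assumes "v \<in> keys (U a G j)" shows "pref (single j 1) k \<le> pref v k"
  using keys_U[OF assms] by auto

text \<open>Images of monomials contain no smaller monomials, so the least monomial of
  \<open>p\<close> keeps its coefficient up to a product of diagonal entries.\<close>

lemma U_inj:
  assumes G: "G \<in> Up" and p: "p \<in> polys_in {a..}" and z: "sb (U a G) p = 0"
  shows "p = 0"
proof (rule ccontr)
  assume "p \<noteq> 0"
  define m0 where "m0 = Min (keys p)"
  have m0: "m0 \<in> keys p" "\<And>m. m \<in> keys p \<Longrightarrow> m0 \<le> m" using \<open>p \<noteq> 0\<close> by (auto simp: m0_def)
  have up: "(\<forall>u\<in>keys (mev (U a G) m). \<forall>k. pref m k \<le> pref u k) \<and>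
    lookup (mev (U a G) m) m = (\<Prod>j\<in>keys m. lookup (U a G j) (single j 1) ^ lookup m j)" for m
    by (rule mev_dom_up) (erule U_dom)
  have "lookup (sb (U a G) p) m0 = (\<Sum>m\<in>keys p. if m = m0 then lookup p m * lookup (mev (U a G) m) m else 0)"
    unfolding lookup_sb_keys
  proof (intro sum.cong refl)
    fix m assume m: "m \<in> keys p"
    have "m \<le> m0" if k: "m0 \<in> keys (mev (U a G) m)"
      using up[of m, THEN conjunct1, rule_format, OF k] by (rule dom_le)
    then have "m = m0" if "m0 \<in> keys (mev (U a G) m)" using m0(2)[OF m] that by simp
    then show "lookup p m * lookup (mev (U a G) m) m0 = (if m = m0 then lookup p m * lookup (mev (U a G) m) m else 0)"
      by (auto simp: in_keys_iff)
  qed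
  also have "\<dots> = lookup p m0 * lookup (mev (U a G) m0) m0" using m0 by (simp add: sum.delta)
  also have "\<dots> \<noteq> 0"
  proof -
    have "keys m0 \<subseteq> {a..}" using p m0 by (auto simp: polys_in_def)
    then have "(\<Prod>j\<in>keys m0. lookup (U a G j) (single j 1) ^ lookup m0 j) \<noteq> 0"
      using UpD[OF G] by (auto simp: lookup_U)
    then show ?thesis using m0(1) up[of m0] by (simp add: in_keys_iff)
  qed
  finally show False using z by simp
qed

section \<open>Genericity\<close>

text \<open>Polynomial functions of the entries in the leading block of size \<open>n\<close>. They
  are taken as functions rather than polynomials because \<open>nonsing\<close> works with a ring of
  functions.\<close>

definition R :: "nat \<Rightarrow> ((nat \<times> nat \<Rightarrow> 'k::field_char_0) \<Rightarrow> 'k) set" where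
  "R n = {f. \<exists>p\<in>polys_in ({..<n} \<times> {..<n}). f = (\<lambda>G. ev G p)}"

lemma R_const: "(\<lambda>_. c) \<in> R n"
proof -
  have "single 0 c \<in> polys_in ({..<n} \<times> {..<n})" by (simp add: polys_in_def)
  moreover have "(\<lambda>_. c) = (\<lambda>G. ev G (single (0 :: nat \<times> nat \<Rightarrow>\<^sub>0 nat) c))"
    by (rule ext) (simp add: ev_single)
  ultimately show ?thesis unfolding R_def by blast
qed

lemma R_coord: "i < n \<Longrightarrow> j < n \<Longrightarrow> (\<lambda>G. G (i, j) :: 'a::field_char_0) \<in> R n"
proof -
  assume "i < n" "j < n"
  then have "single (single (i, j) 1) 1 \<in> (polys_in ({..<n} \<times> {..<n}) :: (nat \<times> nat, 'a) mpoly set)"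
    by (simp add: polys_in_def)
  moreover have "(\<lambda>G. G (i, j)) = (\<lambda>G. ev G (single (single (i, j) 1) (1 :: 'a)))" by simp
  ultimately show ?thesis unfolding R_def by blast
qed

lemma R_add: "f \<in> R n \<Longrightarrow> g \<in> R n \<Longrightarrow> (\<lambda>G. f G + g G) \<in> R n"
proof -
  assume "f \<in> R n" "g \<in> R n"
  then obtain p q where "p \<in> polys_in ({..<n} \<times> {..<n})" "q \<in> polys_in ({..<n} \<times> {..<n})"
    "f = (\<lambda>G. ev G p)" "g = (\<lambda>G. ev G q)" by (auto simp: R_def)
  then show ?thesis unfolding R_def by (auto intro!: bexI[of _ "p + q"] simp: ev_add polys_in_add)
qed

lemma R_mult: "f \<in> R n \<Longrightarrow> g \<in> R n \<Longrightarrow> (\<lambda>G. f G * g G) \<in> R n"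
proof -
  assume "f \<in> R n" "g \<in> R n"
  then obtain p q where "p \<in> polys_in ({..<n} \<times> {..<n})" "q \<in> polys_in ({..<n} \<times> {..<n})"
    "f = (\<lambda>G. ev G p)" "g = (\<lambda>G. ev G q)" by (auto simp: R_def)
  then show ?thesis unfolding R_def by (auto intro!: bexI[of _ "p * q"] simp: ev_mult polys_in_mult)
qed

lemma R_diff: "f \<in> R n \<Longrightarrow> g \<in> R n \<Longrightarrow> (\<lambda>G. f G - g G) \<in> R n"
  using R_add[of f n "\<lambda>G. - 1 * g G"] R_mult[OF R_const[of "- 1"], of g n] by simp

lemma R_sum: "(\<And>x. x \<in> A \<Longrightarrow> f x \<in> R n) \<Longrightarrow> (\<lambda>G. \<Sum>x\<in>A. f x G) \<in> R n"
  by (induction A rule: infinite_finite_induct) (simp_all add: R_const R_add)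

lemma R_cong:
  assumes "f \<in> R n" "\<And>i j. i < n \<Longrightarrow> j < n \<Longrightarrow> G (i, j) = G' (i, j)" shows "f G = f G'"
proof -
  obtain p where p: "p \<in> polys_in ({..<n} \<times> {..<n})" "f = (\<lambda>G. ev G p)" using assms(1) by (auto simp: R_def)
  show ?thesis unfolding p(2) by (rule subst_cong[OF p(1)]) (use assms(2) in auto)
qed

lemma R_mono: "n \<le> n' \<Longrightarrow> R n \<subseteq> R n'"
proof -
  assume "n \<le> n'"
  then have "{..<n} \<times> {..<n} \<subseteq> {..<n'} \<times> {..<n'}" by auto
  from polys_in_mono[OF this] show ?thesis unfolding R_def by blast
qed

lemma rhom_poly: "rhom (\<lambda>q :: 'k::field_char_0 poly. poly q t)"
  by (simp add: rhom_def)

text \<open>Two nonempty open sets of triangular matrices meet, because a line through a point of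
  each is not contained in any of the finitely many hypersurfaces involved.\<close>

lemma line_poly:
  fixes p :: "('v, 'k::field_char_0) mpoly"
  shows "\<exists>q. \<forall>t. poly q t = ev (\<lambda>v. G1 v + t * (G2 v - G1 v)) p"
proof (intro exI allI)
  fix t
  show "poly (subst (\<lambda>c. [:c:]) (\<lambda>v. [:G1 v, G2 v - G1 v:]) p) t = ev (\<lambda>v. G1 v + t * (G2 v - G1 v)) p"
    by (simp add: rhom_of_subst[OF rhom_poly[of t]])
qed

lemma generic_meet:
  assumes f: "f \<in> R n" "f G1 \<noteq> 0" "G1 \<in> Up" and g: "g \<in> R n" "g G2 \<noteq> 0" "G2 \<in> Up"
  shows "\<exists>G\<in>Up. f G \<noteq> (0 :: 'k::field_char_0) \<and> g G \<noteq> 0"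
proof -
  obtain p q where pq: "f = (\<lambda>G. ev G p)" "g = (\<lambda>G. ev G q)" using f(1) g(1) by (auto simp: R_def)
  define L where "L t v = G1 v + t * (G2 v - G1 v)" for t v
  obtain p1 where p1: "\<And>t. poly p1 t = f (L t)" using line_poly[of G1 G2 p] unfolding pq L_def by blast
  obtain q1 where q1: "\<And>t. poly q1 t = g (L t)" using line_poly[of G1 G2 q] unfolding pq L_def by blast
  \<comment> \<open>The line leaves \<open>Up\<close> where a diagonal entry vanishes;
    \<open>D\<close> detects this for the first \<open>n\<close> entries.\<close>
  define D where "D = (\<Prod>i<n. [:G1 (i, i), G2 (i, i) - G1 (i, i):])"
  have D: "poly D t = (\<Prod>i<n. L t (i, i))" for t unfolding D_def poly_prod L_def by simp
  have "L 0 = G1" "L 1 = G2" unfolding L_def by auto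
  then have "p1 \<noteq> 0" "q1 \<noteq> 0" using p1[of 0] q1[of 1] f(2) g(2) by auto
  moreover have "D \<noteq> 0" using UpD[OF f(3)] by (auto simp: D_def)
  ultimately have "p1 * q1 * D \<noteq> 0" by simp
  then have "finite {t. poly (p1 * q1 * D) t = 0}" by (rule poly_roots_finite)
  then obtain t where t: "poly (p1 * q1 * D) t \<noteq> 0" using infinite_UNIV_char_0[where 'a = 'k]
    by (metis (mono_tags, lifting) UNIV_eq_I mem_Collect_eq)
  \<comment> \<open>Outside the leading block the line is not controlled, so the identity is used
    there; by \<open>R_cong\<close> the values of \<open>f\<close> and \<open>g\<close> do not
    change.\<close>
  define G where "G v = (if fst v < n \<and> snd v < n then L t v else if fst v = snd v then 1 else 0)" for v
  have "f G = f (L t)" "g G = g (L t)" by (rule R_cong[OF f(1)], simp add: G_def, rule R_cong[OF g(1)], simp add: G_def)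
  then have "f G \<noteq> 0" "g G \<noteq> 0" using t p1 q1 by auto
  moreover have "G \<in> Up" unfolding Up_def
  proof (intro CollectI conjI allI impI)
    fix i show "G (i, i) \<noteq> 0" using t by (auto simp: G_def D)
    show "G (i, j) = 0" if "j < i" for j using that f(3) g(3) by (simp add: G_def L_def Up_def)
  qed
  ultimately show ?thesis by blast
qed

text \<open>Validity on a principal open set that meets \<open>Up\<close>. Having a point is part of
  the notion, so that \<open>generic_ex\<close> yields a witness and \<open>generic_meet\<close>
  gives closure under finite conjunctions.\<close>

definition generic :: "nat \<Rightarrow> ((nat \<times> nat \<Rightarrow> 'k::field_char_0) \<Rightarrow> bool) \<Rightarrow> bool" where
  "generic n C \<longleftrightarrow> (\<exists>f\<in>R n. (\<exists>G\<in>Up. f G \<noteq> 0) \<and> (\<forall>G\<in>Up. f G \<noteq> 0 \<longrightarrow> C G))"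

lemma genericI:
  "f \<in> R n \<Longrightarrow> G \<in> Up \<Longrightarrow> f G \<noteq> 0 \<Longrightarrow> (\<And>G. G \<in> Up \<Longrightarrow> f G \<noteq> 0 \<Longrightarrow> C G) \<Longrightarrow> generic n C"
  unfolding generic_def by (rule bexI[of _ f]) auto

lemma generic_conj:
  assumes "generic n C" "generic n C'" shows "generic n (\<lambda>G. C G \<and> C' G)"
proof -
  obtain f G1 where f: "f \<in> R n" "G1 \<in> Up" "f G1 \<noteq> 0" "\<And>G. G \<in> Up \<Longrightarrow> f G \<noteq> 0 \<Longrightarrow> C G"
    using assms(1) unfolding generic_def by blast
  obtain g G2 where g: "g \<in> R n" "G2 \<in> Up" "g G2 \<noteq> 0" "\<And>G. G \<in> Up \<Longrightarrow> g G \<noteq> 0 \<Longrightarrow> C' G"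
    using assms(2) unfolding generic_def by blast
  obtain G where G: "G \<in> Up" "f G \<noteq> 0" "g G \<noteq> 0" using generic_meet[OF f(1,3,2) g(1,3,2)] by blast
  show ?thesis
  proof (rule genericI[OF R_mult[OF f(1) g(1)] G(1)])
    show "f G * g G \<noteq> 0" using G by simp
    show "C H \<and> C' H" if "H \<in> Up" "f H * g H \<noteq> 0" for H
      using f(4)[OF that(1)] g(4)[OF that(1)] that(2) by simp
  qed
qed

lemma generic_ex: "generic n C \<Longrightarrow> \<exists>G\<in>Up. C G"
  unfolding generic_def by blast

lemma generic_imp:
  assumes "generic n C" "\<And>G. G \<in> Up \<Longrightarrow> C G \<Longrightarrow> C' G" shows "generic n C'"
proof -
  obtain f G where f: "f \<in> R n" "G \<in> Up" "f G \<noteq> 0" "\<And>G. G \<in> Up \<Longrightarrow> f G \<noteq> 0 \<Longrightarrow> C G"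
    using assms(1) unfolding generic_def by blast
  show ?thesis by (rule genericI[OF f(1-3)]) (rule assms(2)[OF _ f(4)])
qed

lemma generic_mono: assumes "generic n C" "n \<le> n'" shows "generic n' C"
proof -
  obtain f G where f: "f \<in> R n" "G \<in> Up" "f G \<noteq> 0" "\<And>G. G \<in> Up \<Longrightarrow> f G \<noteq> 0 \<Longrightarrow> C G"
    using assms(1) unfolding generic_def by blast
  show ?thesis by (rule genericI[OF subsetD[OF R_mono[OF assms(2)] f(1)] f(2-4)])
qed

lemma id_in_Up: "(\<lambda>(i, j). if i = j then 1 else 0) \<in> Up"
  by (simp add: Up_def)

lemma generic_True: "generic n (\<lambda>_. True)"
  by (rule genericI[OF R_const[of 1] id_in_Up]) simp_all

lemma generic_all: "finite X \<Longrightarrow> (\<And>x. x \<in> X \<Longrightarrow> generic n (C x)) \<Longrightarrow> generic n (\<lambda>G. \<forall>x\<in>X. C x G)"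
proof (induction X rule: finite_induct)
  case empty
  show ?case using generic_True by simp
next
  case (insert x X)
  have "generic n (\<lambda>G. C x G \<and> (\<forall>x\<in>X. C x G))"
    by (rule generic_conj[OF insert.prems insert.IH[OF insert.prems]]) simp_all
  then show ?case by simp
qed

text \<open>The supports of the factors vary with the matrix entries. Summing over all divisors of
  \<open>m\<close> gives a fixed index set, and only then is the polynomial dependence on the
  entries visible term by term.\<close>

lemma lookup_mult_sum:
  fixes p q :: "'k::field_char_0 S"
  shows "lookup (p * q) m = (\<Sum>u\<in>{u. \<exists>v. m = u + v}. lookup p u * lookup q (m - u))"
proof -
  let ?D = "{u. \<exists>v. m = u + v}"
  have fin: "finite ?D"
  proof -
    obtain n where "keys m \<subseteq> {..<n}" using finite_nat_iff_bounded[of "keys m"] by auto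
    then have "?D \<subseteq> (\<Union>e\<in>{..mdeg m}. Mon 0 n e)" by (auto simp: Mon_def mono_keys_add subset_iff)
    then show ?thesis by (rule finite_subset) auto
  qed
  have "lookup (p * q) m = (\<Sum>u\<in>keys p. \<Sum>v\<in>keys q. (if u + v = m then lookup p u * lookup q v else 0))"
    by (simp add: mult_expand lookup_sum lookup_single when_def)
  also have "\<dots> = (\<Sum>u\<in>keys p. if u \<in> ?D then lookup p u * lookup q (m - u) else 0)"
  proof (rule sum.cong[OF refl])
    fix u assume "u \<in> keys p"
    show "(\<Sum>v\<in>keys q. if u + v = m then lookup p u * lookup q v else 0) =
      (if u \<in> ?D then lookup p u * lookup q (m - u) else 0)"
    proof (cases "u \<in> ?D")
      case True
      then obtain w where w: "m = u + w" by blast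
      have "(\<Sum>v\<in>keys q. if u + v = m then lookup p u * lookup q v else 0) =
        (\<Sum>v\<in>keys q. if v = w then lookup p u * lookup q v else 0)" by (rule sum.cong) (auto simp: w)
      also have "\<dots> = lookup p u * lookup q w" by (auto simp: sum.delta' in_keys_iff)
      finally show ?thesis using True by (simp add: w)
    qed (auto intro!: sum.neutral)
  qed
  also have "\<dots> = (\<Sum>u\<in>keys p \<inter> ?D. lookup p u * lookup q (m - u))"
    by (rule sum.inter_restrict[symmetric]) simp
  also have "\<dots> = (\<Sum>u\<in>?D. lookup p u * lookup q (m - u))"
    by (rule sum.mono_neutral_left) (auto simp: fin in_keys_iff)
  finally show ?thesis .
qed

lemma R_mev:
  fixes s :: "(nat \<times> nat \<Rightarrow> 'k::field_char_0) \<Rightarrow> nat \<Rightarrow> 'k S"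
  assumes "\<And>j m. j \<in> keys w \<Longrightarrow> (\<lambda>G. lookup (s G j) m) \<in> R n"
  shows "(\<lambda>G. lookup (mev (s G) w) m) \<in> R n"
  using assms
proof (induction w arbitrary: m rule: mono_back)
  case zero
  show ?case using R_const by simp
next
  case (add a w)
  have 1: "(\<lambda>G. lookup (mev (s G) w) u) \<in> R n" for u
    by (rule add(2)) (rule add(3), simp add: mono_keys_add)
  have 2: "(\<lambda>G. lookup (s G a) u) \<in> R n" for u
    by (rule add(3)) (simp add: mono_keys_add)
  show ?case unfolding mev_add mev_single power_one_right lookup_mult_sum
    by (intro R_sum R_mult 1 2)
qed

lemma R_U: assumes "j < n" shows "(\<lambda>G. lookup (U a G j) m) \<in> R n"
proof -
  have "(\<lambda>G. \<Sum>i\<in>{a..j}. G (i, j) * lookup (var i) m) \<in> R n"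
    by (intro R_sum R_mult R_const R_coord) (use assms in auto)
  then show ?thesis unfolding U_def lookup_sum lookup_const_mult .
qed

text \<open>Nonsingularity of the block of coefficients with rows \<open>A\<close> and columns
  \<open>B\<close>, stated as injectivity so that it makes sense independently of the sizes of
  \<open>A\<close> and \<open>B\<close>.\<close>

definition nd :: "nat \<Rightarrow> mono set \<Rightarrow> mono set \<Rightarrow> (nat \<times> nat \<Rightarrow> 'k::field_char_0) \<Rightarrow> bool" where
  "nd a A B G \<longleftrightarrow> (\<forall>p\<in>sp A. (\<forall>b\<in>B. lookup (sb (U a G) p) b = 0) \<longrightarrow> p = 0)"

lemma sp_of_coeffs:
  assumes "finite A"
  shows "(\<Sum>m\<in>A. single m (z m)) \<in> sp A" "a \<in> A \<Longrightarrow> lookup (\<Sum>m\<in>A. single m (z m)) a = z a"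
proof -
  show "(\<Sum>m\<in>A. single m (z m)) \<in> sp A" by (rule sp_sum) (simp add: sp_def)
  show "a \<in> A \<Longrightarrow> lookup (\<Sum>m\<in>A. single m (z m)) a = z a"
    using assms by (simp add: lookup_sum lookup_single when_def sum.delta)
qed

lemma generic_nd:
  fixes G0 :: "nat \<times> nat \<Rightarrow> 'k::field_char_0"
  assumes "finite A" "\<And>m. m \<in> A \<Longrightarrow> keys m \<subseteq> {..<n}" "G0 \<in> Up" "nd a A B G0"
  shows "generic n (nd a A B :: (nat \<times> nat \<Rightarrow> 'k) \<Rightarrow> bool)"
proof -
  let ?M = "\<lambda>G m b. lookup (mev (U a G) m) b"
  have "\<exists>D\<in>R n. D G0 \<noteq> 0 \<and> (\<forall>G. D G \<noteq> 0 \<longrightarrow>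
    (\<forall>z. (\<forall>b\<in>B. (\<Sum>m\<in>A. z m * ?M G m b) = 0) \<longrightarrow> (\<forall>m\<in>A. z m = 0)))"
  proof (rule nonsing[OF assms(1) R_const[of 1]])
    show "(\<lambda>G. ?M G m b) \<in> R n" if "m \<in> A" for m b
      by (intro R_mev R_U) (use assms(2)[OF that] in auto)
    show "\<forall>m\<in>A. z m = 0" if z: "\<And>b. b \<in> B \<Longrightarrow> (\<Sum>m\<in>A. z m * ?M G0 m b) = 0" for z
    proof -
      let ?p = "\<Sum>m\<in>A. single m (z m)"
      note p = sp_of_coeffs[OF assms(1), where z = z]
      have "lookup (sb (U a G0) ?p) b = 0" if "b \<in> B" for b
        unfolding lookup_sb[OF assms(1) p(1)] using z[OF that] by (simp add: p(2))
      then have "?p = 0" using assms(4) p(1) unfolding nd_def by blast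
      then show ?thesis using p(2) by (metis lookup_zero)
    qed
  qed (rule R_diff R_mult; assumption)+
  then obtain D where D: "D \<in> R n" "D G0 \<noteq> 0" "\<And>G z. D G \<noteq> 0 \<Longrightarrow>
    (\<forall>b\<in>B. (\<Sum>m\<in>A. z m * ?M G m b) = 0) \<Longrightarrow> (\<forall>m\<in>A. z m = 0)" by blast
  have "nd a A B G" if "D G \<noteq> 0" for G
    unfolding nd_def
  proof (intro ballI impI)
    fix p :: "'k S" assume p: "p \<in> sp A" "\<forall>b\<in>B. lookup (sb (U a G) p) b = 0"
    then have "\<forall>m\<in>A. lookup p m = 0" by (intro D(3)[OF that]) (simp add: lookup_sb[OF assms(1) p(1)])
    then show "p = 0" using p(1) by (intro poly_mapping_eqI) (auto simp: sp_def in_keys_iff)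
  qed
  note n = this
  show ?thesis by (rule genericI[OF D(1) assms(3) D(2)]) (rule n)
qed

section \<open>Comparing an ideal with its shifted counterpart\<close>

text \<open>A unipotent change that only adds later variables. It supplies the diagonal entries in
  \<open>transfer\<close>; the next lemmas show that it disturbs neither leading monomials nor the
  coefficients on \<open>JM\<close>.\<close>

definition cc :: "nat \<Rightarrow> nat \<Rightarrow> 'k::field_char_0 S" where
  "cc n i = (if Suc i < n then var i + var (Suc i) else var i)"

lemma mev_cc:
  "(\<forall>u\<in>keys (mev (cc n :: nat \<Rightarrow> 'k::field_char_0 S) m). \<forall>k. pref u k \<le> pref m k) \<and> lookup (mev (cc n :: nat \<Rightarrow> 'k S) m) m = 1"
proof -
  have "pref v k \<le> pref (single j 1) k" if "v \<in> keys (cc n j :: 'k S)" for j v k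
  proof -
    have "keys (cc n j :: 'k S) \<subseteq> {single j 1, single (Suc j) 1}"
      using keys_add[of "var j :: 'k S" "var (Suc j)"] by (auto simp: cc_def)
    then have "v = single j 1 \<or> v = single (Suc j) 1" using that by blast
    then show ?thesis by auto
  qed
  moreover have "lookup (cc n j :: 'k S) (single j 1) = 1" for j
    by (simp add: cc_def lookup_add lookup_single)
  ultimately show ?thesis using mev_dom_down[of m "cc n :: nat \<Rightarrow> 'k S"] by simp
qed

text \<open>Only monomials dominating \<open>m\<close> contribute to its coefficient, and
  \<open>m\<close> enters its own image with coefficient 1.\<close>

lemma lookup_sb_cc:
  fixes f :: "'k::field_char_0 S"
  assumes "\<And>u. u \<in> keys f \<Longrightarrow> (\<And>k. pref m k \<le> pref u k) \<Longrightarrow> u = m"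
  shows "lookup (sb (cc n) f) m = lookup f m"
proof -
  have "lookup (sb (cc n) f) m = (\<Sum>u\<in>keys f. if u = m then lookup f u else 0)"
    unfolding lookup_sb_keys
  proof (intro sum.cong refl)
    fix u assume u: "u \<in> keys f"
    show "lookup f u * lookup (mev (cc n) u) m = (if u = m then lookup f u else 0)"
    proof (cases "m \<in> keys (mev (cc n :: nat \<Rightarrow> 'k S) u)")
      case True
      have "u = m" by (rule assms[OF u]) (rule mev_cc[THEN conjunct1, rule_format, OF True])
      then show ?thesis using mev_cc[where 'k = 'k, of n u, THEN conjunct2] by simp
    next
      case False
      then have "lookup (mev (cc n :: nat \<Rightarrow> 'k S) u) m = 0" by (simp add: in_keys_iff)
      moreover from this have "u \<noteq> m" using mev_cc[where 'k = 'k, of n u, THEN conjunct2] by auto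
      ultimately show ?thesis by simp
    qed
  qed
  then show ?thesis by (auto simp: sum.delta' in_keys_iff)
qed

lemma lead_cc:
  fixes f :: "'k::field_char_0 S"
  assumes "f \<noteq> 0" shows "sb (cc n) f \<noteq> 0 \<and> lead (sb (cc n) f) = lead f"
proof -
  have "lookup (sb (cc n) f) (lead f) = lookup f (lead f)"
  proof (rule lookup_sb_cc)
    fix u assume u: "u \<in> keys f" and "\<And>k. pref (lead f) k \<le> pref u k"
    then have "lead f \<le> u" by (intro dom_le)
    then show "u = lead f" using lead_ge[OF u] by simp
  qed
  then have k: "lead f \<in> keys (sb (cc n) f)" using lookup_lead[OF assms] by (simp add: in_keys_iff)
  moreover have "u \<le> lead f" if u: "u \<in> keys (sb (cc n) f)" for u
  proof -
    have "\<exists>m\<in>keys f. lookup f m * lookup (mev (cc n :: nat \<Rightarrow> 'k S) m) u \<noteq> 0"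
    proof (rule ccontr)
      assume "\<not> ?thesis"
      then have "lookup (sb (cc n) f) u = 0" unfolding lookup_sb_keys by (intro sum.neutral) simp
      then show False using u by (simp add: in_keys_iff)
    qed
    then obtain m where m: "m \<in> keys f" "u \<in> keys (mev (cc n :: nat \<Rightarrow> 'k S) m)" by (auto simp: in_keys_iff)
    have "u \<le> m" by (rule dom_le) (rule mev_cc[THEN conjunct1, rule_format, OF m(2)])
    then show ?thesis using lead_ge[OF m(1)] by simp
  qed
  ultimately have "lead (sb (cc n) f) = lead f" by (intro lead_eqI)
  then show ?thesis using k by auto
qed

text \<open>Look at the largest monomial of \<open>f\<close> in \<open>JM F\<close>. A contribution
  to its coefficient comes from a dominating monomial, which lies in \<open>JM F\<close> by
  \<open>JM_dom\<close> and is not smaller, hence is the monomial itself; so the coefficient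
  survives \<open>cc\<close>.\<close>

lemma cc_lower:
  fixes f :: "'k::field_char_0 S"
  assumes f: "f \<in> sp (Mon a n d)" and F: "fam a F" and z: "\<forall>b\<in>JM F a n d. lookup (sb (cc n') f) b = 0"
  shows "\<forall>b\<in>JM F a n d. lookup f b = 0"
proof (rule ccontr)
  assume "\<not> ?thesis"
  then have ne: "keys f \<inter> JM F a n d \<noteq> {}" by (auto simp: in_keys_iff)
  define m where "m = Max (keys f \<inter> JM F a n d)"
  have m: "m \<in> keys f" "m \<in> JM F a n d" using Max_in[OF _ ne] by (simp_all add: m_def)
  have mx: "u \<le> m" if "u \<in> keys f" "u \<in> JM F a n d" for u using that by (simp add: m_def)
  have "lookup (sb (cc n') f) m = lookup f m"
  proof (rule lookup_sb_cc)
    fix u assume u: "u \<in> keys f" and dom: "\<And>k. pref m k \<le> pref u k"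
    have "u \<in> Mon a n d" using f u by (auto simp: sp_def)
    then have "u \<in> JM F a n d" using JM_dom[OF F m(2) _ dom] by blast
    then show "u = m" using mx[OF u] dom_le[OF dom] by simp
  qed
  then show False using z m by (simp add: in_keys_iff)
qed

text \<open>Solved downward from the last variable, which is fixed: \<open>x_i\<close> is the image
  of \<open>x_i\<close> minus the preimage of \<open>x_(i+1)\<close>.\<close>

lemma cc_inverse: "a \<le> i \<Longrightarrow> i < n \<Longrightarrow> \<exists>y\<in>sp (Mon a n 1). sb (cc n) y = (var i :: 'k::field_char_0 S)"
proof (induction "n - i" arbitrary: i)
  case 0
  then show ?case by simp
next
  case (Suc k)
  have v: "var i \<in> (sp (Mon a n 1) :: 'k S set)" using Suc.prems by (simp add: single_Mon)
  show ?case
  proof (cases "Suc i < n")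
    case True
    then obtain y where y: "y \<in> sp (Mon a n 1)" "sb (cc n) y = (var (Suc i) :: 'k S)"
    proof -
      have "k = n - Suc i" "a \<le> Suc i" using Suc.hyps(2) Suc.prems by simp_all
      then show ?thesis using Suc.hyps(1)[of "Suc i"] True that by blast
    qed
    have "sb (cc n) (var i - y) = (cc n i :: 'k S) - var (Suc i)"
      using sb_add[of "cc n" "var i - y" y] y(2) by (simp add: algebra_simps)
    then have "sb (cc n) (var i - y) = (var i :: 'k S)" using True by (simp add: cc_def)
    then show ?thesis using sp_diff[OF v y(1)] by blast
  next
    case False
    then have "sb (cc n) (var i) = (var i :: 'k S)" by (simp add: cc_def)
    then show ?thesis using v by blast
  qed
qed

text \<open>Up to a lower triangular substitution \<^const>\<open>cc\<close>, an upper triangular substitution can lower the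
  indices of all variables except the first one.\<close>

lemma transfer:
  fixes H :: "nat \<times> nat \<Rightarrow> 'k::field_char_0"
  assumes H: "H \<in> Up" and an: "a < n"
  obtains G th where "G \<in> Up"
    "\<And>p. p \<in> polys_in {a..<n} \<Longrightarrow> sb (U a G) p = sb (cc n) (sb (U a H) (sb th p))"
    "\<And>m u. keys m \<subseteq> {a..<n} \<Longrightarrow> u \<in> keys (mev th m) \<Longrightarrow>
       u \<in> Mon a n (mdeg m) \<and> (\<forall>j. a \<le> j \<and> Suc j \<in> keys m \<longrightarrow> j \<in> keys u)"
proof -
  \<comment> \<open>\<open>y\<close> is the preimage of \<open>x_a\<close> under
    \<open>U a H\<close> followed by \<open>cc n\<close>. With \<open>th\<close> sending
    \<open>x_a\<close> to \<open>y\<close>, the whole composite fixes \<open>x_a\<close>, and column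
    \<open>a\<close> of \<open>G\<close> is a unit vector.\<close>
  obtain y1 where y1: "y1 \<in> sp (Mon a n 1)" "sb (cc n) y1 = (var a :: 'k S)" using cc_inverse[OF order_refl an] by blast
  obtain y where y: "y \<in> sp (Mon a n 1)" "sb (U a H) y = y1" using U_surj[OF H y1(1)] .
  define th where "th j = (if j = a then y else var (j - 1))" for j
  \<comment> \<open>Column \<open>j\<close> of \<open>G\<close> is column \<open>j - 1\<close> of
    \<open>H\<close> plus the same column moved down by one row, since \<open>cc\<close> turns
    \<open>x_i\<close> into \<open>x_i + x_(i+1)\<close>. The diagonal entry comes from the second
    summand alone.\<close>
  define A where "A i j = (if i < j then H (i, j - 1) else 0)" for i j
  define B where "B i j = (if a < i then H (i - 1, j - 1) else 0)" for i j
  define G where "G = (\<lambda>(i, j). if a < j \<and> j < n \<and> a \<le> i \<and> i \<le> j then A i j + B i j else if i = j then 1 else 0)"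
  have GUp: "G \<in> Up" unfolding Up_def
  proof (intro CollectI conjI allI impI)
    fix i show "G (i, i) \<noteq> 0" using UpD[OF H, of "i - 1"] by (simp add: G_def A_def B_def)
    show "G (i, j) = 0" if "j < i" for j using that by (simp add: G_def)
  qed
  moreover have "sb (U a G) p = sb (cc n) (sb (U a H) (sb th p))" if p: "p \<in> polys_in {a..<n}" for p
  proof -
    have "U a G j = sb (cc n) (sb (U a H) (th j))" if j: "j \<in> {a..<n}" for j
    proof (cases "j = a")
      case True
      then show ?thesis by (simp add: th_def y y1 U_def G_def)
    next
      case False
      then obtain k where k: "j = Suc k" "a \<le> k" "Suc k < n" using j by (cases j) auto
      have "U a G j = (\<Sum>i\<in>{a..Suc k}. const (A i j) * var i) + (\<Sum>i\<in>{a..Suc k}. const (B i j) * var i)"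
        unfolding U_def sum.distrib[symmetric] k(1)
        by (rule sum.cong) (use k in \<open>auto simp: G_def single_add distrib_right\<close>)
      also have "(\<Sum>i\<in>{a..Suc k}. const (A i j) * var i) = (\<Sum>i\<in>{a..k}. const (H (i, k)) * var i)"
      proof -
        have "{a..Suc k} = insert (Suc k) {a..k}" using k by auto
        then have "(\<Sum>i\<in>{a..Suc k}. const (A i j) * var i) = (\<Sum>i\<in>{a..k}. const (A i j) * var i)"
          by (simp add: A_def k(1))
        also have "\<dots> = (\<Sum>i\<in>{a..k}. const (H (i, k)) * var i)" by (rule sum.cong) (auto simp: A_def k(1))
        finally show ?thesis .
      qed
      also have "(\<Sum>i\<in>{a..Suc k}. const (B i j) * var i) = (\<Sum>i\<in>{a..k}. const (H (i, k)) * var (Suc i))"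
      proof -
        have "{a..Suc k} = insert a {Suc a..Suc k}" using k by auto
        then have "(\<Sum>i\<in>{a..Suc k}. const (B i j) * var i) = (\<Sum>i\<in>{Suc a..Suc k}. const (B i j) * var i)"
          by (simp add: B_def)
        also have "\<dots> = (\<Sum>i\<in>{a..k}. const (B (Suc i) j) * var (Suc i))"
          by (rule sum.shift_bounds_cl_Suc_ivl)
        also have "\<dots> = (\<Sum>i\<in>{a..k}. const (H (i, k)) * var (Suc i))"
          by (rule sum.cong) (auto simp: B_def k(1))
        finally show ?thesis .
      qed
      also have "(\<Sum>i\<in>{a..k}. const (H (i, k)) * var i) + (\<Sum>i\<in>{a..k}. const (H (i, k)) * var (Suc i)) =
          (\<Sum>i\<in>{a..k}. const (H (i, k)) * cc n i)"
        unfolding sum.distrib[symmetric]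
        by (rule sum.cong) (use k in \<open>auto simp: cc_def distrib_left\<close>)
      also have "\<dots> = sb (cc n) (U a H k)" by (simp add: U_def sb_sum sb_mult)
      also have "\<dots> = sb (cc n) (sb (U a H) (th j))" using False k by (simp add: th_def)
      finally show ?thesis .
    qed
    then have "sb (U a G) p = sb (\<lambda>j. sb (cc n) (sb (U a H) (th j))) p" by (rule subst_cong[OF p])
    then show ?thesis by (simp add: sb_sb)
  qed
  moreover have "u \<in> Mon a n (mdeg m) \<and> (\<forall>j. a \<le> j \<and> Suc j \<in> keys m \<longrightarrow> j \<in> keys u)"
    if "keys m \<subseteq> {a..<n}" "u \<in> keys (mev th m)" for m u
    using that
  proof (induction m arbitrary: u rule: mono_back)
    case zero
    then show ?case by (simp add: Mon_0)
  next
    case (add b m)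
    have b: "a \<le> b" "b < n" and km: "keys m \<subseteq> {a..<n}" using add.prems(1) by (auto simp: mono_keys_add)
    obtain x v where u: "u = x + v" "x \<in> keys (mev th m)" "v \<in> keys (th b)"
      using add.prems(2) keys_mult[of "mev th m" "th b"] by (auto simp: mev_add)
    have IH: "x \<in> Mon a n (mdeg m)" "\<forall>j. a \<le> j \<and> Suc j \<in> keys m \<longrightarrow> j \<in> keys x"
      using add.IH[OF km u(2)] by auto
    have v: "v \<in> Mon a n 1"
    proof (cases "b = a")
      case True then show ?thesis using u(3) y(1) by (auto simp: th_def sp_def)
    next
      case False
      then have "v = single (b - 1) 1" using u(3) by (simp add: th_def)
      moreover have "a \<le> b - 1" "b - 1 < n" using False b by auto
      ultimately show ?thesis by (simp add: single_Mon)
    qed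
    have "j \<in> keys v" if "a \<le> j" "Suc j = b" for j using u(3) that by (auto simp: th_def)
    then have "\<forall>j. a \<le> j \<and> Suc j \<in> keys (m + single b 1) \<longrightarrow> j \<in> keys u"
      using IH(2) by (auto simp: u(1) mono_keys_add)
    then show ?case using Mon_add[OF IH(1) v] u(1) by simp
  qed
  ultimately show thesis using that by blast
qed

text \<open>Every monomial of the image of \<open>m\<close> contains \<open>x_j\<close> whenever
  \<open>x_(j+1)\<close> divides \<open>m\<close> and \<open>j\<close> is at least \<open>a\<close>.
  Its raised support with \<open>a\<close> adjoined therefore contains that of \<open>m\<close>, and
  families are closed under supersets.\<close>

lemma th_sp:
  assumes F: "fam a F"
    and th: "\<And>m u. keys m \<subseteq> {a..<n} \<Longrightarrow> u \<in> keys (mev th m) \<Longrightarrow>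
       u \<in> Mon a n (mdeg m) \<and> (\<forall>j. a \<le> j \<and> Suc j \<in> keys m \<longrightarrow> j \<in> keys u)"
    and p: "p \<in> sp (I1 F a n d)"
  shows "sb th p \<in> sp (IM (F1 a F) a n d)"
proof (rule sb_in_sp[OF p])
  fix m assume "m \<in> I1 F a n d"
  then have m: "keys m \<subseteq> {a..<n}" "mdeg m = d" "insert a (keys m) \<in> F" by (auto simp: I1_def Mon_def)
  have "u \<in> IM (F1 a F) a n d" if u: "u \<in> keys (mev th m)" for u
  proof -
    have u1: "u \<in> Mon a n d" "\<And>j. a \<le> j \<Longrightarrow> Suc j \<in> keys m \<Longrightarrow> j \<in> keys u"
      using th[OF m(1) u] m(2) by auto
    have ku: "keys u \<subseteq> {a..}" using u1(1) by (auto simp: Mon_def)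
    have "x \<in> insert a (Suc ` keys u)" if "x \<in> insert a (keys m)" for x
    proof (cases "x = a")
      case False
      then have "x \<in> keys m" "a < x" using that m(1) by auto
      then obtain j where "x = Suc j" "a \<le> j" by (cases x) auto
      then show ?thesis using u1(2)[of j] \<open>x \<in> keys m\<close> by simp
    qed simp
    then have s: "insert a (keys m) \<subseteq> insert a (Suc ` keys u)" by blast
    have "insert a (Suc ` keys u) \<in> F"
      by (rule famD(3)[OF F m(3) s]) (use ku in \<open>auto simp: subset_iff intro: le_SucI\<close>)
    then show ?thesis using u1(1) ku by (simp add: IM_def F1_def)
  qed
  then show "mev th m \<in> sp (IM (F1 a F) a n d)" by (auto simp: sp_def)
qed

lemma IM_sub: "IM F a n d \<subseteq> Mon a n d" and I1_sub: "I1 F a n d \<subseteq> Mon a n d" and JM_sub: "JM F a n d \<subseteq> Mon a n d"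
  by (auto simp: IM_def I1_def JM_def)

lemma polys_in_ge: "p \<in> polys_in V \<Longrightarrow> V \<subseteq> W \<Longrightarrow> p \<in> polys_in W"
  using polys_in_mono[of V W] by blast

lemma sp_ge: "p \<in> sp (Mon a n d) \<Longrightarrow> p \<in> polys_in {a..}"
  by (rule polys_in_ge[OF polys_in_sp]) auto

text \<open>Follow \<open>p\<close> through the factorisation of \<open>transfer\<close>:
  \<open>th\<close> maps it into the span of \<open>IM (F1 a F)\<close>, \<open>cc_lower\<close>
  strips off \<open>cc\<close>, and \<open>H\<close> forces \<open>sb th p = 0\<close>. Injectivity
  of the whole composite \<open>U a G\<close> then gives \<open>p = 0\<close>.\<close>

lemma nd_I1:
  fixes H :: "nat \<times> nat \<Rightarrow> 'k::field_char_0"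
  assumes F: "fam a F" and H: "H \<in> Up" and an: "a < n" and nd: "nd a (IM (F1 a F) a n d) (JM (F1 a F) a n d) H"
  shows "\<exists>G\<in>Up. nd a (I1 F a n d) (JM (F1 a F) a n d) (G :: nat \<times> nat \<Rightarrow> 'k)"
proof -
  obtain G th where G: "G \<in> Up"
    "\<And>p. p \<in> polys_in {a..<n} \<Longrightarrow> sb (U a G) p = sb (cc n) (sb (U a H) (sb th p))"
    "\<And>m u. keys m \<subseteq> {a..<n} \<Longrightarrow> u \<in> keys (mev th m) \<Longrightarrow>
       u \<in> Mon a n (mdeg m) \<and> (\<forall>j. a \<le> j \<and> Suc j \<in> keys m \<longrightarrow> j \<in> keys u)"
    using transfer[OF H an] by blast
  have "p = 0" if p: "p \<in> sp (I1 F a n d)" and z: "\<forall>b\<in>JM (F1 a F) a n d. lookup (sb (U a G) p) b = 0" for p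
  proof -
    have pM: "p \<in> sp (Mon a n d)" using p sp_mono[OF I1_sub] by blast
    note eq = G(2)[OF polys_in_sp[OF pM]]
    have q: "sb th p \<in> sp (IM (F1 a F) a n d)" by (rule th_sp[OF F G(3) p])
    then have "sb th p \<in> sp (Mon a n d)" using sp_mono[OF IM_sub] by blast
    then have "sb (U a H) (sb th p) \<in> sp (Mon a n d)" by (rule sb_U_in)
    then have "\<forall>b\<in>JM (F1 a F) a n d. lookup (sb (U a H) (sb th p)) b = 0"
      by (rule cc_lower[OF _ fam_F1[OF F]]) (use z eq in auto)
    then have "sb th p = 0" using nd q unfolding nd_def by blast
    then have "sb (U a G) p = 0" using eq by simp
    moreover have "p \<in> polys_in {a..}" by (rule sp_ge[OF pM])
    ultimately show "p = 0" using U_inj[OF G(1)] by blast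
  qed
  then show ?thesis using G(1) unfolding nd_def by blast
qed

section \<open>Block structure with respect to the first variable\<close>

definition zz :: "nat \<Rightarrow> nat \<Rightarrow> 'k::field_char_0 S" where
  "zz a i = (if i = a then 0 else var i)"

lemma mev_zz: "mev (zz a) m = (if a \<in> keys m then 0 else monomial m)"
proof (cases "a \<in> keys m")
  case True
  then have "zz a a ^ lookup m a = 0" by (simp add: zz_def in_keys_iff)
  then show ?thesis using True unfolding mev_def by (auto intro!: prod_zero)
next
  case False
  then have "mev (zz a) m = mev var m" by (intro mev_cong) (auto simp: zz_def)
  then show ?thesis using False by (simp add: mev_var)
qed

lemma lookup_zz: "lookup (sb (zz a) p) m = (if a \<in> keys m then 0 else lookup p m)"
  for p :: "'k::field_char_0 S"
proof -
  have "lookup (sb (zz a) p) m = (\<Sum>u\<in>keys p. if u = m then (if a \<in> keys m then 0 else lookup p m) else 0)"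
    unfolding lookup_sb_keys by (rule sum.cong) (auto simp: mev_zz lookup_single when_def)
  then show ?thesis by (auto simp: sum.delta' in_keys_iff)
qed

text \<open>The variable \<open>x_a\<close> is sent to a multiple of itself, so setting it to 0 is
  compatible with the substitution and leaves the substitution on the variables after
  \<open>a\<close>.\<close>

lemma zz_U:
  assumes "p \<in> polys_in {a..}"
  shows "sb (zz a) (sb (U a G) p) = sb (U (Suc a) G) (sb (zz a) p)"
proof -
  have "sb (zz a) (U a G j) = sb (U (Suc a) G) (zz a j)" if j: "a \<le> j" for j
  proof -
    have "{a..j} = insert a {Suc a..j}" using j by auto
    then have "sb (zz a) (U a G j) = (\<Sum>i\<in>{Suc a..j}. const (G (i, j)) * zz a i)"
      by (simp add: U_def sb_sum sb_add sb_mult zz_def)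
    also have "\<dots> = U (Suc a) G j" unfolding U_def by (rule sum.cong) (auto simp: zz_def)
    also have "\<dots> = sb (U (Suc a) G) (zz a j)" by (auto simp: zz_def U_def)
    finally show ?thesis .
  qed
  then show ?thesis unfolding sb_sb by (intro subst_cong[OF assms]) simp
qed

lemma split_var:
  fixes p :: "'k::field_char_0 S"
  assumes "p \<in> sp A"
  obtains p0 p1 where "p = p0 + var a * p1" "p0 \<in> sp {m\<in>A. a \<notin> keys m}" "p1 \<in> sp {m. single a 1 + m \<in> A}"
proof -
  define p1 where "p1 = (\<Sum>m\<in>{m\<in>keys p. a \<in> keys m}. single (m - single a 1) (lookup p m))"
  have "p = (\<Sum>m\<in>keys p. single m (lookup p m))" by (rule poly_expand)
  also have "\<dots> = (\<Sum>m\<in>{m\<in>keys p. a \<notin> keys m} \<union> {m\<in>keys p. a \<in> keys m}. single m (lookup p m))"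
    by (rule sum.cong) auto
  also have "\<dots> = (\<Sum>m\<in>{m\<in>keys p. a \<notin> keys m}. single m (lookup p m)) +
      (\<Sum>m\<in>{m\<in>keys p. a \<in> keys m}. single m (lookup p m))"
    by (rule sum.union_disjoint) auto
  also have "(\<Sum>m\<in>{m\<in>keys p. a \<in> keys m}. single m (lookup p m)) = var a * p1"
    unfolding p1_def sum_distrib_left
    by (rule sum.cong) (auto simp: mult_single mono_split[symmetric])
  finally have "p = (\<Sum>m\<in>{m\<in>keys p. a \<notin> keys m}. single m (lookup p m)) + var a * p1" .
  moreover have "(\<Sum>m\<in>{m\<in>keys p. a \<notin> keys m}. single m (lookup p m)) \<in> sp {m\<in>A. a \<notin> keys m}"
    by (rule sp_sum) (use assms in \<open>auto simp: sp_def in_keys_iff\<close>)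
  moreover have "p1 \<in> sp {m. single a 1 + m \<in> A}"
    unfolding p1_def
  proof (rule sp_sum)
    fix m assume m: "m \<in> {m\<in>keys p. a \<in> keys m}"
    then have "single a 1 + (m - single a 1) \<in> A"
      using assms mono_split[of a m] by (auto simp: sp_def)
    then show "single (m - single a 1) (lookup p m) \<in> sp {m. single a 1 + m \<in> A}"
      using m by (simp add: in_keys_iff)
  qed
  ultimately show thesis using that by blast
qed

lemma sb_U_var: "sb (U a G) (var a * p) = const (G (a, a)) * (var a * sb (U a G) p)"
  by (simp add: sb_mult U_def mult.assoc)

lemma lookup_var_mult_0: "a \<notin> keys m \<Longrightarrow> lookup (var a * p) m = 0"
  for p :: "'k::field_char_0 S"
proof (rule ccontr)
  assume a: "a \<notin> keys m" and "lookup (var a * p) m \<noteq> 0"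
  then obtain u where "m = single a 1 + u" using lookup_single_mult_eq_0[of "single a 1" 1 p m] by blast
  then show False using a by (simp add: mono_keys_add)
qed

text \<open>The coefficient matrix is block triangular: coefficients at monomials free of
  \<open>x_a\<close> see only the part \<open>p0\<close>, and once that vanishes, division by
  \<open>x_a\<close> leaves the block of the quotient.\<close>

lemma nd_combine:
  fixes G :: "nat \<times> nat \<Rightarrow> 'k::field_char_0"
  assumes G: "G \<in> Up" and an: "a < n"
    and 0: "nd (Suc a) (IM (F0 a F) (Suc a) n (Suc d)) (JM (F0 a F) (Suc a) n (Suc d)) G"
    and 1: "nd a (I1 F a n d) (JM (F1 a F) a n d) G"
  shows "nd a (IM F a n (Suc d)) (JM F a n (Suc d)) G"
  unfolding nd_def
proof (intro ballI impI)
  fix p :: "'k S" assume p: "p \<in> sp (IM F a n (Suc d))" and z: "\<forall>b\<in>JM F a n (Suc d). lookup (sb (U a G) p) b = 0"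
  obtain p0 p1 where s: "p = p0 + var a * p1" "p0 \<in> sp {m\<in>IM F a n (Suc d). a \<notin> keys m}"
    "p1 \<in> sp {m. single a 1 + m \<in> IM F a n (Suc d)}" using split_var[OF p] .
  have p0: "p0 \<in> sp (IM (F0 a F) (Suc a) n (Suc d))" using s(2) by (simp add: IM_F0)
  have p1: "p1 \<in> sp (I1 F a n d)" using s(3) an by (simp add: I1_iff)
  have "p0 \<in> sp (Mon (Suc a) n (Suc d))" using p0 sp_mono[OF IM_sub] by blast
  then have p0M: "p0 \<in> polys_in {Suc a..}" by (rule sp_ge)
  have e: "sb (U a G) p = sb (U a G) p0 + const (G (a, a)) * (var a * sb (U a G) p1)"
    by (simp add: s(1) sb_add sb_U_var)
  have za: "sb (zz a) p0 = p0"
  proof (rule poly_mapping_eqI)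
    fix k show "lookup (sb (zz a) p0) k = lookup p0 k"
    proof (cases "a \<in> keys k")
      case True
      then have "k \<notin> keys p0" using p0M by (fastforce simp: polys_in_def)
      then show ?thesis using True by (simp add: lookup_zz in_keys_iff)
    qed (simp add: lookup_zz)
  qed
  have "p0 = 0"
  proof -
    have "lookup (sb (U (Suc a) G) p0) b = 0" if b: "b \<in> JM (F0 a F) (Suc a) n (Suc d)" for b
    proof -
      have b': "b \<in> JM F a n (Suc d)" "a \<notin> keys b" using b by (auto simp: JM_F0)
      have "p0 \<in> polys_in {a..}" by (rule polys_in_ge[OF p0M]) auto
      then have "sb (U (Suc a) G) p0 = sb (zz a) (sb (U a G) p0)" using zz_U[of p0 a G] za by simp
      then have "lookup (sb (U (Suc a) G) p0) b = lookup (sb (U a G) p0) b" using b' by (simp add: lookup_zz)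
      also have "\<dots> = lookup (sb (U a G) p) b" using b'(2) by (simp add: e lookup_add lookup_var_mult_0)
      finally show ?thesis using z b' by simp
    qed
    then show ?thesis using 0 p0 unfolding nd_def by blast
  qed
  moreover have "p1 = 0"
  proof -
    have "lookup (sb (U a G) p1) b = 0" if b: "b \<in> JM (F1 a F) a n d" for b
    proof -
      have "single a 1 + b \<in> JM F a n (Suc d)" using b an by (simp add: JM_F1)
      then have "lookup (sb (U a G) p) (single a 1 + b) = 0" using z by blast
      then show ?thesis using UpD[OF G, of a] \<open>p0 = 0\<close> by (simp add: e)
    qed
    then show ?thesis using 1 p1 unfolding nd_def by blast
  qed
  ultimately show "p = 0" by (simp add: s(1))
qed

lemma Mon_less: "m \<in> Mon a n d \<Longrightarrow> keys m \<subseteq> {..<n}"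
  by (auto simp: Mon_def)

text \<open>The induction provides a nonsingular point for each of the two blocks separately;
  genericity gives a common point, as \<open>nd_combine\<close> requires.\<close>

lemma pairing:
  assumes "fam a F" "bnd F d n"
  shows "\<exists>G\<in>Up. nd a (IM F a n d) (JM F a n d) (G :: nat \<times> nat \<Rightarrow> 'k::field_char_0)"
  using assms
proof (induction d arbitrary: a F n)
  case 0
  have "nd a (IM F a n 0) (JM F a n 0) G" for G :: "nat \<times> nat \<Rightarrow> 'k"
    unfolding nd_def
  proof (intro ballI impI)
    fix p :: "'k S" assume p: "p \<in> sp (IM F a n 0)" "\<forall>b\<in>JM F a n 0. lookup (sb (U a G) p) b = 0"
    have eq: "IM F a n 0 = JM F a n 0" "IM F a n 0 \<subseteq> {0}" by (auto simp: IM_def JM_def Mon_0)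
    have "lookup p b = 0" if b: "b \<in> IM F a n 0" for b
      using p(2) b unfolding eq(1)[symmetric] lookup_sb[OF finite_IM p(1)] using eq(2)
      by (cases "IM F a n 0 = {0}") auto
    then show "p = 0" using p(1) by (intro poly_mapping_eqI) (auto simp: sp_def in_keys_iff)
  qed
  then show ?case using id_in_Up by blast
next
  case (Suc d)
  note outer = Suc.IH
  show ?case using Suc.prems
  proof (induction "n - a" arbitrary: a F)
    case 0
    then have "IM F a n (Suc d) = {}" by (simp add: IM_def Mon_empty)
    then have "nd a (IM F a n (Suc d)) (JM F a n (Suc d)) G" for G :: "nat \<times> nat \<Rightarrow> 'k"
      by (simp add: nd_def sp_def)
    then show ?case using id_in_Up by blast
  next
    case (Suc k)
    then have an: "a < n" by simp
    have b: "bnd F (Suc d) (Suc n)" by (rule bnd_mono[OF Suc.prems]) simp_all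
    obtain G0 :: "nat \<times> nat \<Rightarrow> 'k" where G0: "G0 \<in> Up"
      "nd (Suc a) (IM (F0 a F) (Suc a) n (Suc d)) (JM (F0 a F) (Suc a) n (Suc d)) G0"
    proof -
      have "k = n - Suc a" using Suc.hyps(2) by simp
      then show ?thesis using Suc.hyps(1)[OF _ fam_F0[OF Suc.prems(1)] bnd_F0[OF Suc.prems(2)]] that by blast
    qed
    obtain H :: "nat \<times> nat \<Rightarrow> 'k" where H: "H \<in> Up" "nd a (IM (F1 a F) a n d) (JM (F1 a F) a n d) H"
      using outer[OF fam_F1[OF Suc.prems(1)] bnd_F1[OF Suc.prems(1) b]] an by auto
    obtain G1 :: "nat \<times> nat \<Rightarrow> 'k" where G1: "G1 \<in> Up" "nd a (I1 F a n d) (JM (F1 a F) a n d) G1"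
      using nd_I1[OF Suc.prems(1) H(1) an H(2)] by blast
    have "generic n (nd (Suc a) (IM (F0 a F) (Suc a) n (Suc d)) (JM (F0 a F) (Suc a) n (Suc d)) :: (nat \<times> nat \<Rightarrow> 'k) \<Rightarrow> bool)"
      by (rule generic_nd[OF finite_IM _ G0]) (use IM_sub Mon_less in blast)
    moreover have "generic n (nd a (I1 F a n d) (JM (F1 a F) a n d) :: (nat \<times> nat \<Rightarrow> 'k) \<Rightarrow> bool)"
      by (rule generic_nd[OF finite_I1 _ G1]) (use I1_sub Mon_less in blast)
    ultimately obtain G :: "nat \<times> nat \<Rightarrow> 'k" where "G \<in> Up"
      "nd (Suc a) (IM (F0 a F) (Suc a) n (Suc d)) (JM (F0 a F) (Suc a) n (Suc d)) G"
      "nd a (I1 F a n d) (JM (F1 a F) a n d) G"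
      using generic_ex[OF generic_conj] by blast
    then show ?case using nd_combine[OF _ an] by blast
  qed
qed

section \<open>Leading monomials after a change of coordinates\<close>

definition LA :: "nat \<Rightarrow> mono set \<Rightarrow> (nat \<times> nat \<Rightarrow> 'k::field_char_0) \<Rightarrow> mono set" where
  "LA a A G = leads (sb (U a G) ` sp A)"

lemma U_left_inverse:
  fixes G :: "nat \<times> nat \<Rightarrow> 'k::field_char_0"
  assumes G: "G \<in> Up"
  shows "\<exists>l. \<forall>n d p. p \<in> sp (Mon a n d) \<longrightarrow> sb l (sb (U a G) p) = p"
proof -
  obtain l where l: "\<And>j n. a \<le> j \<Longrightarrow> j < n \<Longrightarrow> l j \<in> sp (Mon a n 1)"
    "\<And>j. a \<le> j \<Longrightarrow> sb (U a G) (l j) = var j" using U_inverse[OF G] by blast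
  have 1: "sb (U a G) (sb l p) = p" if p: "p \<in> sp (Mon a n d)" for n d p
  proof -
    have "sb (U a G) (sb l p) = sb (\<lambda>j. sb (U a G) (l j)) p" by (rule sb_sb)
    also have "\<dots> = sb var p" by (rule subst_cong[OF polys_in_sp[OF p]]) (simp add: l)
    finally show ?thesis by (simp add: sb_var_id)
  qed
  have "sb l (sb (U a G) p) = p" if p: "p \<in> sp (Mon a n d)" for n d p
  proof -
    have "sb l (sb (U a G) p) \<in> sp (Mon a n d)" by (rule sb_in[OF sb_U_in[OF p] l(1)])
    then have d: "sb l (sb (U a G) p) - p \<in> sp (Mon a n d)" by (rule sp_diff[OF _ p])
    have "sb (U a G) (sb l (sb (U a G) p) - p) + sb (U a G) p = sb (U a G) (sb l (sb (U a G) p))"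
      by (simp add: sb_add[symmetric])
    then have "sb (U a G) (sb l (sb (U a G) p) - p) = 0" using 1[OF sb_U_in[OF p]] by simp
    then have "sb l (sb (U a G) p) - p = 0" by (rule U_inj[OF G sp_ge[OF d]])
    then show ?thesis by simp
  qed
  then show ?thesis by (intro exI[of _ l] allI impI)
qed

lemma lin_U: "lin (sb (U a G) ` sp A)"
  by (rule lin_image[OF lin_sp rhom_sb]) simp

lemma LA_I: "p \<in> sp A \<Longrightarrow> sb (U a G) p \<noteq> 0 \<Longrightarrow> lead (sb (U a G) p) \<in> LA a A G"
  by (auto simp: LA_def leads_def)

lemma LA_E:
  assumes "m \<in> LA a A G"
  obtains p where "p \<in> sp A" "sb (U a G) p \<noteq> 0" "lead (sb (U a G) p) = m"
  using assms by (auto simp: LA_def leads_def)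

lemma LA_sub: assumes "A \<subseteq> Mon a n d" shows "LA a A G \<subseteq> Mon a n d"
proof
  fix m assume "m \<in> LA a A G"
  then obtain p where p: "p \<in> sp A" "sb (U a G) p \<noteq> 0" "lead (sb (U a G) p) = m" by (rule LA_E)
  have "p \<in> sp (Mon a n d)" using p(1) sp_mono[OF assms] by blast
  then have "sb (U a G) p \<in> sp (Mon a n d)" by (rule sb_U_in)
  then show "m \<in> Mon a n d" using lead_in_keys[OF p(2)] p(3) by (auto simp: sp_def)
qed

lemma finite_LA: "A \<subseteq> Mon a n d \<Longrightarrow> finite (LA a A G)"
  using LA_sub finite_Mon finite_subset by metis

text \<open>A dimension count in both directions, with the substitution and its left inverse as the
  injective maps.\<close>

lemma card_LA:
  fixes G :: "nat \<times> nat \<Rightarrow> 'k::field_char_0"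
  assumes A: "A \<subseteq> Mon a n d" and G: "G \<in> Up" shows "card (LA a A G) = card A"
proof (rule antisym)
  have fA: "finite A" using A finite_Mon finite_subset by metis
  have AM: "p \<in> sp (Mon a n d)" if "p \<in> sp A" for p :: "'k S" using that sp_mono[OF A] by blast
  obtain l where l0: "\<forall>n d p. p \<in> sp (Mon a n d) \<longrightarrow> sb l (sb (U a G) p) = p" using U_left_inverse[OF G] by (rule exE)
  note l = l0[rule_format]
  show "card (LA a A G) \<le> card A"
  proof -
    have "card (leads (sb (U a G) ` sp A)) \<le> card (leads (sp A :: 'k S set))"
    proof (rule card_leads_le[OF lin_U lin_sp, where T = "sb l"])
      show "sb l ` sb (U a G) ` sp A \<subseteq> sp A"
      proof
        fix p assume "p \<in> sb l ` sb (U a G) ` sp A"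
        then obtain q where "q \<in> sp A" "p = sb l (sb (U a G) q)" by blast
        then show "p \<in> sp A" using l[OF AM] by simp
      qed
      show "p = 0" if p: "p \<in> sb (U a G) ` sp A" "sb l p = 0" for p
      proof -
        obtain q where q: "q \<in> sp A" "p = sb (U a G) q" using p(1) by blast
        then have "q = 0" using l[OF AM[OF q(1)]] p(2) by simp
        then show ?thesis using q by simp
      qed
      show "finite (leads (sb (U a G) ` sp A))" using finite_LA[OF A] by (simp add: LA_def)
    qed (simp_all add: leads_sp fA sb_add sb_mult)
    then show ?thesis by (simp add: LA_def leads_sp)
  qed
  show "card A \<le> card (LA a A G)"
  proof -
    have "card (leads (sp A :: 'k S set)) \<le> card (leads (sb (U a G) ` sp A))"
    proof (rule card_leads_le[OF lin_sp lin_U, where T = "sb (U a G)"])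
      show "p = 0" if p: "p \<in> sp A" "sb (U a G) p = 0" for p
        using U_inj[OF G sp_ge[OF AM[OF p(1)]] p(2)] .
      show "finite (leads (sb (U a G) ` sp A))" using finite_LA[OF A] by (simp add: LA_def)
    qed (simp_all add: leads_sp fA sb_add sb_mult)
    then show ?thesis by (simp add: LA_def leads_sp)
  qed
qed

lemma LA_ge:
  assumes A: "A \<subseteq> Mon a n d" and G: "G \<in> Up" and nd: "nd a A B G" and B: "finite B" "card B = card A"
  shows "mset_set B \<le> mset_set (LA a A G)"
  unfolding LA_def
proof (rule leads_ge[OF lin_U _ B(1)])
  show "finite (leads (sb (U a G) ` sp A))" using finite_LA[OF A] by (simp add: LA_def)
  show "card B = card (leads (sb (U a G) ` sp A))" using card_LA[OF A G] B(2) by (simp add: LA_def)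
  show "p = 0" if p: "p \<in> sb (U a G) ` sp A" "\<And>m. m \<in> B \<Longrightarrow> lookup p m = 0" for p
  proof -
    obtain q where q: "q \<in> sp A" "p = sb (U a G) q" using p(1) by blast
    then have "q = 0" using nd p(2) unfolding nd_def by blast
    then show ?thesis using q by simp
  qed
qed

lemma keys_monomial_mult: "keys (monomial w * p) = (+) w ` keys p"
  for p :: "'k::field_char_0 S"
proof
  show "keys (monomial w * p) \<subseteq> (+) w ` keys p"
    using lookup_single_mult_eq_0[of w 1 p] by (auto simp: in_keys_iff)
  show "(+) w ` keys p \<subseteq> keys (monomial w * p)" by (auto simp: in_keys_iff)
qed

lemma lead_monomial_mult:
  fixes p :: "'k::field_char_0 S"
  assumes "p \<noteq> 0" shows "monomial w * p \<noteq> 0 \<and> lead (monomial w * p) = w + lead p"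
proof -
  have "w + lead p \<in> keys (monomial w * p)" using lead_in_keys[OF assms] by (simp add: keys_monomial_mult)
  moreover have "u \<le> w + lead p" if "u \<in> keys (monomial w * p)" for u
    using that lead_ge[of _ p] by (auto simp: keys_monomial_mult intro: add_left_mono)
  ultimately show ?thesis using lead_eqI[of "w + lead p" "monomial w * p"] by auto
qed

text \<open>The monomial \<open>w\<close> is itself the image of some \<open>r\<close> under the
  substitution, so multiplying by \<open>r\<close> beforehand multiplies the leading monomial by
  \<open>w\<close>.\<close>

lemma LA_mult:
  fixes G :: "nat \<times> nat \<Rightarrow> 'k::field_char_0"
  assumes G: "G \<in> Up" and m: "m \<in> LA a A G" and w: "w \<in> Mon a n e"
    and mult: "\<And>u v. u \<in> A \<Longrightarrow> v \<in> Mon a n e \<Longrightarrow> u + v \<in> A'"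
  shows "w + m \<in> LA a A' G"
proof -
  obtain p where p: "p \<in> sp A" "sb (U a G) p \<noteq> 0" "lead (sb (U a G) p) = m" using m by (rule LA_E)
  have "monomial w \<in> (sp (Mon a n e) :: 'k S set)" using w by simp
  then obtain r where r: "r \<in> sp (Mon a n e)" "sb (U a G) r = monomial w" by (rule U_surj[OF G])
  have "p * r \<in> sp A'" by (rule sp_mult[OF p(1) r(1) mult])
  moreover have "sb (U a G) (p * r) = monomial w * sb (U a G) p" by (simp add: sb_mult r(2) mult.commute)
  ultimately show ?thesis
    using lead_monomial_mult[OF p(2), of w] p(3) LA_I[of "p * r" A' a G] by simp
qed

section \<open>Families fixed by the shift are lexsegments\<close>

lemma less_with_var:
  assumes "a \<in> keys u" "a \<notin> keys b" "keys u \<subseteq> {a..}" "keys b \<subseteq> {a..}"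
  shows "b < (u :: mono)"
proof -
  have "lookup b a < lookup u a" using assms by (simp add: in_keys_iff)
  moreover have "lookup b j = lookup u j" if "j < a" for j
  proof -
    have "j \<notin> keys u" "j \<notin> keys b" using that assms by auto
    then show ?thesis by (simp add: in_keys_iff)
  qed
  ultimately show ?thesis unfolding less_poly_mapping.rep_eq less_fun_def by (intro exI[of _ a] conjI allI impI)
qed

text \<open>The variable \<open>x_a\<close> is the largest one present, so a term containing it
  would exceed a leading monomial without it.\<close>

lemma lead_no_var:
  assumes f: "f \<in> sp (Mon a n d)" "f \<noteq> 0" "a \<notin> keys (lead f)" shows "f \<in> sp (Mon (Suc a) n d)"
proof -
  have "u \<in> Mon (Suc a) n d" if u: "u \<in> keys f" for u
  proof -
    have M: "u \<in> Mon a n d" "lead f \<in> Mon a n d" using f(1) u lead_in_keys[OF f(2)] by (auto simp: sp_def)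
    have "a \<notin> keys u"
    proof
      assume "a \<in> keys u"
      then have "lead f < u" using f(3) M by (intro less_with_var) (auto simp: Mon_def)
      then show False using lead_ge[OF u] by simp
    qed
    then show ?thesis using M by (simp add: Mon_Suc_iff)
  qed
  then show ?thesis by (auto simp: sp_def)
qed

text \<open>Together with \<open>pairing\<close> this makes the generic leading monomials equal to
  \<open>JM F\<close>. The bound holds for every \<open>G\<close>, because the passage to
  \<open>F0\<close> and \<open>F1\<close> starts from an arbitrary matrix, and only for large
  \<open>n\<close>, because the range of the generators depends on the degree.\<close>

definition Hyp :: "'k::field_char_0 itself \<Rightarrow> nat \<Rightarrow> nat set set \<Rightarrow> bool" where
  "Hyp _ a F \<longleftrightarrow> (\<forall>d. \<exists>n0. \<forall>n\<ge>n0. \<forall>G\<in>Up.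
     mset_set (LA a (IM F a n d) (G :: nat \<times> nat \<Rightarrow> 'k)) \<le> mset_set (JM F a n d))"

lemma generic_coord_nz:
  assumes "i \<le> j" "j < n" shows "generic n (\<lambda>G. G (i, j) \<noteq> (0 :: 'k::field_char_0))"
proof (rule genericI[OF R_coord[of i n j]])
  show "(\<lambda>(i, j). if i \<le> j then 1 else 0) \<in> (Up :: (nat \<times> nat \<Rightarrow> 'k) set)" by (simp add: Up_def)
qed (use assms in simp_all)

lemma IM_Mon_less: "m \<in> IM F a n d \<Longrightarrow> keys m \<subseteq> {..<n}"
  using IM_sub[of F a n d] Mon_less by blast

text \<open>A polynomial \<open>f = U q\<close> not involving \<open>x\<^sub>a\<close> is constant along the direction in which only \<open>x\<^sub>a\<close>
  varies; on the side of \<open>q\<close> this compares the coefficient of \<open>x\<^sub>a ^ d\<close> with a value of the part of \<open>q\<close>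
  free of \<open>x\<^sub>a\<close>.\<close>

lemma pure_power_in:
  fixes G :: "nat \<times> nat \<Rightarrow> 'k::field_char_0"
  assumes G: "G \<in> Up" and an: "a < n" and nz: "\<And>j. j \<in> {Suc a..<n} \<Longrightarrow> G (a, j) \<noteq> 0"
    and q: "q \<in> sp (Mon a n d)" and f: "sb (U a G) q \<in> sp (Mon (Suc a) n d)"
    and w: "w \<in> Mon (Suc a) n d" "c \<noteq> 0"
    and q0: "\<And>m. m \<in> keys q \<Longrightarrow> a \<notin> keys m \<Longrightarrow> m = w" "lookup q w = c"
  shows "\<exists>m\<in>keys q. keys m \<subseteq> {a}"
proof -
  obtain l where l0: "\<forall>n d p. p \<in> sp (Mon a n d) \<longrightarrow> sb l (sb (U a G) p) = p" using U_left_inverse[OF G] by (rule exE)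
  note l = l0[rule_format]
  \<comment> \<open>Evaluating a form at \<open>e\<close> reads off the coefficient of the pure
    power of \<open>x_a\<close>. The point \<open>y\<close> is the one that the substitution carries
    to \<open>e\<close>, and \<open>y'\<close> differs from it only in the coordinate of
    \<open>x_a\<close>.\<close>
  define e where "e j = (if j = a then 1 else 0 :: 'k)" for j
  define y where "y j = ev e (l j)" for j
  define y' where "y' = y(a := 0)"
  let ?f = "sb (U a G) q"
  have UU: "ev y' (U a G j) = e j - G (a, j) * y a \<and> ev y (U a G j) = e j" if j: "j \<in> {a..<n}" for j
  proof -
    have "var j \<in> (sp (Mon a n 1) :: 'k S set)" using j by (simp add: single_Mon)
    then have "sb l (U a G j) = var j" using l[of "var j" n 1] by simp
    then have "ev e (sb l (U a G j)) = e j" by simp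
    then have 1: "ev y (U a G j) = e j" by (simp add: ev_sb y_def[abs_def])
    have E: "ev v (U a G j) = G (a, j) * v a + (\<Sum>i\<in>{Suc a..j}. G (i, j) * v i)" for v
    proof -
      have "{a..j} = insert a {Suc a..j}" using j by auto
      then show ?thesis by (simp add: U_def ev_sum ev_add ev_mult)
    qed
    have "(\<Sum>i\<in>{Suc a..j}. G (i, j) * y' i) = (\<Sum>i\<in>{Suc a..j}. G (i, j) * y i)"
      by (rule sum.cong) (auto simp: y'_def)
    then have "ev y' (U a G j) = ev y (U a G j) - G (a, j) * y a" unfolding E by (simp add: y'_def)
    then show ?thesis using 1 by simp
  qed
  have Gy: "G (a, a) * y a = 1"
    using UU[of a] an by (simp add: U_def ev_mult e_def)
  then have ya: "y a \<noteq> 0" by auto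
  \<comment> \<open>\<open>v\<close> is what the substitution makes of \<open>y'\<close>. Its
    coordinate at \<open>a\<close> is 0, so only terms free of \<open>x_a\<close> count in
    \<open>ev v q\<close>; its coordinates from \<open>Suc a\<close> to \<open>n - 1\<close> are
    nonzero because row \<open>a\<close> of \<open>G\<close> is.\<close>
  define v where "v j = ev y' (U a G j)" for j
  have va: "v a = 0" using UU[of a] an Gy by (simp add: v_def e_def)
  have vj: "v j \<noteq> 0" if "j \<in> {Suc a..<n}" for j
    using UU[of j] that nz[OF that] ya by (auto simp: v_def e_def)
  have "ev e q = ev e (sb l ?f)" using l[OF q] by simp
  also have "\<dots> = ev y ?f" by (simp add: ev_sb y_def[abs_def])
  also have "\<dots> = ev y' ?f"
    by (rule subst_cong[OF polys_in_sp[OF f]]) (auto simp: y'_def)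
  also have "\<dots> = ev v q" by (simp add: ev_sb v_def[abs_def])
  also have "\<dots> = (\<Sum>m\<in>keys q. if m = w then c * mev v w else 0)"
    unfolding subst_alt
  proof (intro sum.cong refl)
    fix m assume m: "m \<in> keys q"
    show "lookup q m * mev v m = (if m = w then c * mev v w else 0)"
    proof (cases "a \<in> keys m")
      case True
      then have "v a ^ lookup m a = 0" using va by (simp add: in_keys_iff)
      then have "mev v m = 0" using True unfolding mev_def by (auto intro!: prod_zero)
      moreover have "m \<noteq> w" using True w(1) by (auto simp: Mon_def)
      ultimately show ?thesis by simp
    next
      case False
      then show ?thesis using q0(1)[OF m] q0(2) by simp
    qed
  qed
  also have "\<dots> = c * mev v w" using q0(2) w(2) by (simp add: sum.delta in_keys_iff)
  also have "\<dots> \<noteq> 0" using w vj by (auto simp: mev_def Mon_def)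
  finally have "ev e q \<noteq> 0" .
  then obtain m where m: "m \<in> keys q" "lookup q m * mev e m \<noteq> 0"
    unfolding subst_alt by (rule sum.not_neutral_contains_not_neutral)
  have "keys m \<subseteq> {a}"
  proof
    fix j assume j: "j \<in> keys m"
    show "j \<in> {a}"
    proof (rule ccontr)
      assume "j \<notin> {a}"
      then have "e j ^ lookup m j = 0" using j by (simp add: e_def in_keys_iff)
      then have "mev e m = 0" using j unfolding mev_def by (auto intro!: prod_zero)
      then show False using m(2) by simp
    qed
  qed
  then show ?thesis using m(1) by blast
qed

text \<open>Equality in the comparison permits a dimension count. The polynomials
  \<open>Q b\<close>, whose images have a leading monomial free of \<open>x_a\<close>, are as many
  as the monomials of \<open>IM F\<close> free of \<open>x_a\<close>. With the monomial of
  \<open>T0\<close> they are one too many, so a combination \<open>q\<close> of the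
  \<open>Q b\<close> has as its part free of \<open>x_a\<close> a multiple of that monomial, and
  \<open>pure_power_in\<close> applies unless the multiple is 0.\<close>

lemma Hyp_singleton:
  assumes F: "fam a F" and b: "\<And>d. \<exists>n. bnd F d n" and H: "Hyp TYPE('k::field_char_0) a F"
    and T0: "T0 \<in> F" "a \<notin> T0"
  shows "{a} \<in> F"
proof (cases "T0 = {}")
  case True
  then show ?thesis using famD(3)[OF F T0(1), of "{a}"] by simp
next
  case False
  have fT: "finite T0" "T0 \<subseteq> {a..}" using famD(1,2)[OF F T0(1)] .
  define d where "d = card T0"
  have d: "d > 0" using False fT by (simp add: d_def card_gt_0_iff)
  obtain n1 where n1: "bnd F d n1" using b by blast
  obtain n2 where n2: "\<And>n G. n2 \<le> n \<Longrightarrow> G \<in> Up \<Longrightarrow>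
    mset_set (LA a (IM F a n d) (G :: nat \<times> nat \<Rightarrow> 'k)) \<le> mset_set (JM F a n d)"
    using H unfolding Hyp_def by meson
  obtain n3 where n3: "T0 \<subseteq> {..<n3}" using fT finite_nat_iff_bounded[of T0] by auto
  define n where "n = n1 + n2 + n3 + Suc a"
  have an: "a < n" by (simp add: n_def)
  have bn: "bnd F d n" by (rule bnd_mono[OF F n1]) (simp_all add: n_def)
  have T0n: "T0 \<subseteq> {Suc a..<n}"
  proof
    fix x assume x: "x \<in> T0"
    then have "a \<le> x" "x < n3" "x \<noteq> a" using fT n3 T0(2) by auto
    then show "x \<in> {Suc a..<n}" by (simp add: n_def)
  qed
  let ?I = "IM F a n d" and ?J = "JM F a n d"
  let ?Z = "IM (F0 a F) (Suc a) n d" and ?B = "JM (F0 a F) (Suc a) n d"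
  obtain G1 :: "nat \<times> nat \<Rightarrow> 'k" where G1: "G1 \<in> Up" "nd a ?I ?J G1" 
    using pairing[OF F bn] by (rule bexE)
  have "generic n (nd a ?I ?J :: (nat \<times> nat \<Rightarrow> 'k) \<Rightarrow> bool)"
    by (rule generic_nd[OF finite_IM IM_Mon_less G1])
  moreover have "generic n (\<lambda>G. \<forall>j\<in>{Suc a..<n}. G (a, j) \<noteq> (0 :: 'k))"
    by (rule generic_all) (auto intro: generic_coord_nz)
  ultimately have "generic n (\<lambda>G. nd a ?I ?J G \<and> (\<forall>j\<in>{Suc a..<n}. G (a, j) \<noteq> (0 :: 'k)))"
    by (rule generic_conj)
  from generic_ex[OF this] obtain G :: "nat \<times> nat \<Rightarrow> 'k" where GG: "G \<in> Up"
    "nd a ?I ?J G \<and> (\<forall>j\<in>{Suc a..<n}. G (a, j) \<noteq> 0)" by (rule bexE)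
  note G = GG(1) GG(2)[THEN conjunct1] GG(2)[THEN conjunct2, rule_format]
  have LJ: "LA a ?I G = ?J"
  proof -
    have "mset_set ?J \<le> mset_set (LA a ?I G)"
      by (rule LA_ge[OF IM_sub G(1,2) finite_JM]) (simp add: card_IM_JM[OF F bn])
    moreover have "mset_set (LA a ?I G) \<le> mset_set ?J" by (rule n2[OF _ G(1)]) (simp add: n_def)
    ultimately have "mset_set (LA a ?I G) = mset_set ?J" by simp
    then show ?thesis using finite_LA[OF IM_sub] finite_JM by (metis finite_set_mset_mset_set)
  qed
  have "\<forall>b\<in>?B. \<exists>q. q \<in> sp ?I \<and> sb (U a G) q \<noteq> 0 \<and> lead (sb (U a G) q) = b"
  proof
    fix b assume "b \<in> ?B"
    then have "b \<in> LA a ?I G" unfolding LJ by (simp add: JM_F0)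
    then show "\<exists>q. q \<in> sp ?I \<and> sb (U a G) q \<noteq> 0 \<and> lead (sb (U a G) q) = b" by (metis LA_E)
  qed
  then obtain Q where Q: "\<And>b. b \<in> ?B \<Longrightarrow> Q b \<in> sp ?I"
    "\<And>b. b \<in> ?B \<Longrightarrow> sb (U a G) (Q b) \<noteq> 0 \<and> lead (sb (U a G) (Q b)) = b" by metis
  have spIM: "p \<in> sp (Mon a n d)" if "p \<in> sp ?I" for p :: "'k S" using that sp_mono[OF IM_sub] by blast
  have Q0: "sb (U a G) (Q b) \<in> sp (Mon (Suc a) n d)" if b: "b \<in> ?B" for b
    by (rule lead_no_var[OF sb_U_in[OF spIM[OF Q(1)[OF b]]]]) (use Q(2)[OF b] b in \<open>auto simp: JM_F0\<close>)
  \<comment> \<open>Any monomial outside \<open>?B\<close> would do as the index of the extra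
    vector; this one contains \<open>x_a\<close>.\<close>
  define s where "s = single a d"
  have sB: "s \<notin> ?B" using d by (auto simp: s_def JM_F0)
  define f where "f b = (if b = s then monomial (xm T0) else Q b)" for b
  have fB: "f b = Q b" if "b \<in> ?B" for b using that sB by (auto simp: f_def)
  have card: "card ?Z < card (insert s ?B)"
    using sB card_IM_JM[OF fam_F0[OF F] bnd_F0[OF bn]] by simp
  obtain c where c: "\<exists>b\<in>insert s ?B. c b \<noteq> 0" "\<forall>m\<in>?Z. (\<Sum>b\<in>insert s ?B. c b * lookup (f b) m) = 0"
    using elim[OF _ _ card, of "\<lambda>b. lookup (f b)"] by auto
  define q where "q = (\<Sum>b\<in>?B. const (c b) * Q b)"
  have qI: "q \<in> sp ?I" unfolding q_def by (rule lin_comb[OF lin_sp Q(1)])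
  have Uq: "sb (U a G) q = (\<Sum>b\<in>?B. const (c b) * sb (U a G) (Q b))"
    by (simp add: q_def sb_sum sb_mult)
  have UqM: "sb (U a G) q \<in> sp (Mon (Suc a) n d)" unfolding Uq by (rule lin_comb[OF lin_sp Q0])
  have lq: "lookup q m = - c s * lookup (monomial (xm T0) :: 'k S) m" if m: "m \<in> ?Z" for m
  proof -
    have "(\<Sum>b\<in>?B. c b * lookup (f b) m) = (\<Sum>b\<in>?B. c b * lookup (Q b) m)"
      by (rule sum.cong) (simp_all add: fB)
    then have "c s * lookup (monomial (xm T0) :: 'k S) m + (\<Sum>b\<in>?B. c b * lookup (Q b) m) = 0"
      using bspec[OF c(2) m] sB by (simp add: f_def)
    then show ?thesis by (simp add: q_def lookup_comb eq_neg_iff_add_eq_0 add.commute)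
  qed
  have keyI0: "m \<in> ?Z" if "m \<in> keys q" "a \<notin> keys m" for m using that qI by (auto simp: IM_F0 sp_def)
  have xT: "xm T0 \<in> ?Z" using T0 fT T0n by (simp add: IM_def Mon_def d_def F0_def)
  show ?thesis
  proof (cases "c s = 0")
    case True
    \<comment> \<open>Now \<open>q\<close> is divisible by \<open>x_a\<close>, and so is its image,
      which is nonzero and free of \<open>x_a\<close>: a contradiction.\<close>
    then have nz: "\<exists>b\<in>?B. c b \<noteq> 0" using c(1) by auto
    have ne: "sb (U a G) q \<noteq> 0" unfolding Uq using lead_comb[OF finite_JM Q(2) nz] by blast
    obtain p0 p1 where p: "q = p0 + var a * p1" "p0 \<in> sp {m\<in>keys q. a \<notin> keys m}"
      "p1 \<in> sp {m. single a 1 + m \<in> keys q}" using split_var[OF sp_keys[of q]] .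
    have "p0 = 0"
    proof (rule poly_mapping_eqI)
      fix m
      show "lookup p0 m = lookup 0 m"
      proof (cases "m \<in> keys p0")
        case True
        then have m: "m \<in> keys q" "a \<notin> keys m" using p(2) by (auto simp: sp_def)
        then have "lookup q m = 0" using lq[OF keyI0[OF m]] \<open>c s = 0\<close> by simp
        then show ?thesis using m(1) by (simp add: in_keys_iff)
      qed (simp add: in_keys_iff)
    qed
    then have e: "sb (U a G) q = const (G (a, a)) * (var a * sb (U a G) p1)" by (simp add: p(1) sb_U_var)
    define m where "m = lead (sb (U a G) q)"
    have m: "m \<in> keys (sb (U a G) q)" unfolding m_def by (rule lead_in_keys[OF ne])
    then have "a \<notin> keys m" using UqM by (fastforce simp: sp_def Mon_def)
    then have "lookup (sb (U a G) q) m = 0" unfolding e by (simp add: lookup_var_mult_0)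
    then show ?thesis using m by (simp add: in_keys_iff)
  next
    case False
    have "\<exists>m\<in>keys q. keys m \<subseteq> {a}"
    proof (rule pure_power_in[OF G(1) an G(3) spIM[OF qI] UqM])
      show "xm T0 \<in> Mon (Suc a) n d" using xT IM_sub by blast
      show "- c s \<noteq> 0" using False by simp
      show "lookup q (xm T0) = - c s" using lq[OF xT] by simp
      show "m = xm T0" if m: "m \<in> keys q" "a \<notin> keys m" for m
        using lq[OF keyI0[OF m]] m(1) by (auto simp: in_keys_iff lookup_single when_def split: if_splits)
    qed
    then obtain m where m: "m \<in> keys q" "keys m \<subseteq> {a}" by blast
    then have "m \<in> ?I" using qI by (auto simp: sp_def)
    then have "keys m \<in> F" "mdeg m = d" by (auto simp: IM_def Mon_def)
    moreover from this have "keys m \<noteq> {}" using d by auto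
    ultimately show ?thesis using m(2) by (metis subset_singletonD)
  qed
qed

text \<open>As \<open>{a}\<close> is in \<open>F\<close>, every monomial divisible by
  \<open>x_a\<close> occurs on both sides. Leading monomials free of \<open>x_a\<close> belong to
  polynomials free of \<open>x_a\<close>, which are unchanged when \<open>x_a\<close> is set to 0.
  Counting gives an equality of sets, and the common part cancels in the multiset order.\<close>

lemma Hyp_F0:
  assumes F: "fam a F" and aF: "{a} \<in> F" and H: "Hyp TYPE('k::field_char_0) a F"
  shows "Hyp TYPE('k) (Suc a) (F0 a F)"
  unfolding Hyp_def
proof
  fix d
  obtain n2 where n2: "\<And>n G. n2 \<le> n \<Longrightarrow> G \<in> Up \<Longrightarrow>
    mset_set (LA a (IM F a n d) (G :: nat \<times> nat \<Rightarrow> 'k)) \<le> mset_set (JM F a n d)"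
    using H unfolding Hyp_def by meson
  show "\<exists>n0. \<forall>n\<ge>n0. \<forall>G\<in>Up. mset_set (LA (Suc a) (IM (F0 a F) (Suc a) n d) (G :: nat \<times> nat \<Rightarrow> 'k))
      \<le> mset_set (JM (F0 a F) (Suc a) n d)"
  proof (intro exI allI impI ballI)
    fix n and G :: "nat \<times> nat \<Rightarrow> 'k" assume n: "n \<ge> n2" and G: "G \<in> Up"
    let ?I0 = "IM (F0 a F) (Suc a) n d" and ?J0 = "JM (F0 a F) (Suc a) n d"
    define X where "X = {m\<in>Mon a n d. a \<in> keys m}"
    have fX: "finite X" unfolding X_def by simp
    have mem: "T \<in> F" if "a \<in> T" "finite T" "T \<subseteq> {a..}" for T using famD(3)[OF F aF, of T] that by simp
    have "keys m \<in> F" if "m \<in> X" for m by (rule mem) (use that in \<open>auto simp: X_def Mon_def\<close>)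
    then have I: "IM F a n d = X \<union> ?I0" unfolding IM_F0 by (auto simp: X_def IM_def)
    have "PhiS m \<in> F" if m: "m \<in> X" for m
    proof -
      have a: "a \<in> keys m" "keys m \<subseteq> {a..}" using m by (auto simp: X_def Mon_def)
      obtain m' where m': "m = single a 1 + m'" using mono_split[OF a(1)] by blast
      then have "keys m' \<subseteq> {a..}" using a by (auto simp: mono_keys_add)
      then have "a \<in> PhiS m" using PhiS_Cons m' by simp
      then show ?thesis using PhiS_ge[OF a(2)] by (intro mem) auto
    qed
    then have J: "JM F a n d = X \<union> ?J0" unfolding JM_F0 by (auto simp: X_def JM_def)
    let ?L = "LA (Suc a) ?I0 G"
    have fL: "finite ?L" by (rule finite_LA[OF IM_sub])
    have LM: "?L \<subseteq> Mon (Suc a) n d" by (rule LA_sub[OF IM_sub])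
    have dL: "X \<inter> ?L = {}" "X \<inter> ?J0 = {}" "X \<inter> ?I0 = {}" using LM by (auto simp: X_def Mon_Suc_iff JM_F0 IM_F0)
    have sub: "LA a (IM F a n d) G \<subseteq> X \<union> ?L"
    proof
      fix m assume m: "m \<in> LA a (IM F a n d) G"
      have mM: "m \<in> Mon a n d" using LA_sub[OF IM_sub] m by blast
      show "m \<in> X \<union> ?L"
      proof (cases "a \<in> keys m")
        case True then show ?thesis using mM by (simp add: X_def)
      next
        case False
        obtain p where p: "p \<in> sp (IM F a n d)" "sb (U a G) p \<noteq> 0" "lead (sb (U a G) p) = m" using m by (rule LA_E)
        have pM: "p \<in> sp (Mon a n d)" using p(1) sp_mono[OF IM_sub] by blast
        have fM: "sb (U a G) p \<in> sp (Mon (Suc a) n d)"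
          by (rule lead_no_var[OF sb_U_in[OF pM] p(2)]) (use p(3) False in simp)
        have "sb (zz a) (sb (U a G) p) = sb (U a G) p"
        proof (rule poly_mapping_eqI)
          fix k
          have "a \<in> keys k \<Longrightarrow> k \<notin> keys (sb (U a G) p)" using fM by (fastforce simp: sp_def Mon_def)
          then show "lookup (sb (zz a) (sb (U a G) p)) k = lookup (sb (U a G) p) k"
            by (auto simp: lookup_zz in_keys_iff)
        qed
        then have eq: "sb (U a G) p = sb (U (Suc a) G) (sb (zz a) p)" using zz_U[OF sp_ge[OF pM]] by simp
        have "k \<in> ?I0" if k: "k \<in> keys (sb (zz a) p)" for k
        proof -
          have "a \<notin> keys k" "k \<in> keys p" using k by (auto simp: in_keys_iff lookup_zz split: if_splits)
          then show ?thesis using p(1) by (auto simp: IM_F0 sp_def)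
        qed
        then have "sb (zz a) p \<in> sp ?I0" by (auto simp: sp_def)
        then show ?thesis using LA_I[of "sb (zz a) p" ?I0 "Suc a" G] p(2,3) eq by simp
      qed
    qed
    have "card (X \<union> ?L) = card (LA a (IM F a n d) G)"
      unfolding card_LA[OF IM_sub G] unfolding I
      using card_Un_disjoint[OF fX fL dL(1)] card_Un_disjoint[OF fX finite_IM dL(3)] card_LA[OF IM_sub G]
      by metis
    then have "LA a (IM F a n d) G = X \<union> ?L" using sub fX fL by (intro card_subset_eq) auto
    then have "mset_set (X \<union> ?L) \<le> mset_set (X \<union> ?J0)" using n2[OF n G] J by simp
    then have "mset_set X + mset_set ?L \<le> mset_set X + mset_set ?J0"
      using mset_set_Union[OF fX fL dL(1)] mset_set_Union[OF fX finite_JM dL(2)] by simp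
    then show "mset_set ?L \<le> mset_set ?J0" by simp
  qed
qed

text \<open>All members contain \<open>a\<close>, so \<open>IM F\<close> and \<open>JM F\<close> are
  \<open>x_a\<close> times their quotients. A matrix \<open>K\<close> for \<open>F1 a F\<close> is
  turned by \<open>transfer\<close> into a matrix \<open>G\<close> for \<open>F\<close>; since
  \<open>cc\<close> keeps leading monomials, the two sets of leading monomials agree up to the
  factor \<open>x_a\<close>.\<close>

lemma Hyp_F1:
  assumes F: "fam a F" and b: "\<And>d. \<exists>n. bnd F d n" and aF: "\<And>T. T \<in> F \<Longrightarrow> a \<in> T" and H: "Hyp TYPE('k::field_char_0) a F"
  shows "Hyp TYPE('k) a (F1 a F)"
  unfolding Hyp_def
proof
  fix d
  obtain n2 where n2: "\<And>n G. n2 \<le> n \<Longrightarrow> G \<in> Up \<Longrightarrow>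
    mset_set (LA a (IM F a n (Suc d)) (G :: nat \<times> nat \<Rightarrow> 'k)) \<le> mset_set (JM F a n (Suc d))"
    using H unfolding Hyp_def by meson
  obtain n1 where n1: "bnd F (Suc d) n1" using b by blast
  show "\<exists>n0. \<forall>n\<ge>n0. \<forall>G\<in>Up. mset_set (LA a (IM (F1 a F) a n d) (G :: nat \<times> nat \<Rightarrow> 'k))
      \<le> mset_set (JM (F1 a F) a n d)"
  proof (intro exI[of _ "n1 + n2 + Suc a"] allI impI ballI)
    fix n and K :: "nat \<times> nat \<Rightarrow> 'k" assume n: "n \<ge> n1 + n2 + Suc a" and K: "K \<in> Up"
    have an: "a < n" and bn: "bnd F (Suc d) n" using bnd_mono[OF F n1, of "Suc d" n] n by auto
    obtain G th where G: "G \<in> Up"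
      "\<And>p. p \<in> polys_in {a..<n} \<Longrightarrow> sb (U a G) p = sb (cc n) (sb (U a K) (sb th p))"
      "\<And>m u. keys m \<subseteq> {a..<n} \<Longrightarrow> u \<in> keys (mev th m) \<Longrightarrow>
         u \<in> Mon a n (mdeg m) \<and> (\<forall>j. a \<le> j \<and> Suc j \<in> keys m \<longrightarrow> j \<in> keys u)"
      using transfer[OF K an] by blast
    have 1: "LA a (I1 F a n d) G = LA a (IM (F1 a F) a n d) K"
    proof (rule card_subset_eq[OF finite_LA[OF IM_sub]])
      show "card (LA a (I1 F a n d) G) = card (LA a (IM (F1 a F) a n d) K)"
        unfolding card_LA[OF IM_sub K] card_LA[OF I1_sub G(1)] by (rule card_I1[OF F bn an])
      show "LA a (I1 F a n d) G \<subseteq> LA a (IM (F1 a F) a n d) K"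
      proof
        fix m assume "m \<in> LA a (I1 F a n d) G"
        then obtain p where p: "p \<in> sp (I1 F a n d)" "sb (U a G) p \<noteq> 0" "lead (sb (U a G) p) = m" by (rule LA_E)
        have "p \<in> sp (Mon a n d)" using p(1) sp_mono[OF I1_sub] by blast
        then have e: "sb (U a G) p = sb (cc n) (sb (U a K) (sb th p))" by (intro G(2) polys_in_sp)
        have nz: "sb (U a K) (sb th p) \<noteq> 0" using e p(2) by auto
        have "sb th p \<in> sp (IM (F1 a F) a n d)" by (rule th_sp[OF F G(3) p(1)])
        from LA_I[OF this nz] show "m \<in> LA a (IM (F1 a F) a n d) K"
          using lead_cc[OF nz, of n] e p(3) by simp
      qed
    qed
    let ?x = "(+) (single a 1) :: mono \<Rightarrow> mono"
    have ix: "inj_on ?x A" for A by (simp add: inj_on_def)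
    have I: "IM F a n (Suc d) = ?x ` I1 F a n d"
    proof -
      have "m \<in> ?x ` I1 F a n d" if m: "m \<in> IM F a n (Suc d)" for m
      proof -
        have "a \<in> keys m" using m aF by (simp add: IM_def)
        then obtain m' where "m = single a 1 + m'" using mono_split by blast
        then show ?thesis using m an I1_iff by auto
      qed
      then show ?thesis using an by (auto simp: I1_iff)
    qed
    have J: "JM F a n (Suc d) = ?x ` JM (F1 a F) a n d"
    proof -
      have "m \<in> ?x ` JM (F1 a F) a n d" if m: "m \<in> JM F a n (Suc d)" for m
      proof -
        have "a \<in> PhiS m" "keys m \<subseteq> {a..}" using m aF by (auto simp: JM_def Mon_def)
        then have "a \<in> keys m" using PhiS_ge[of m "Suc a"] by (force simp: Suc_le_eq order.strict_iff_order)
        then obtain m' where "m = single a 1 + m'" using mono_split by blast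
        then show ?thesis using m an JM_F1 by auto
      qed
      then show ?thesis using an by (auto simp: JM_F1)
    qed
    have 2: "LA a (IM F a n (Suc d)) G = ?x ` LA a (I1 F a n d) G"
    proof (rule card_subset_eq[OF finite_LA[OF IM_sub], symmetric])
      show "card (?x ` LA a (I1 F a n d) G) = card (LA a (IM F a n (Suc d)) G)"
        unfolding card_image[OF ix] card_LA[OF IM_sub G(1)] card_LA[OF I1_sub G(1)] unfolding I card_image[OF ix] ..
      show "?x ` LA a (I1 F a n d) G \<subseteq> LA a (IM F a n (Suc d)) G"
      proof
        fix m assume "m \<in> ?x ` LA a (I1 F a n d) G"
        then obtain m' where m': "m = single a 1 + m'" "m' \<in> LA a (I1 F a n d) G" by blast
        then obtain p where p: "p \<in> sp (I1 F a n d)" "sb (U a G) p \<noteq> 0" "lead (sb (U a G) p) = m'" using LA_E by metis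
        define p' where "p' = const (1 / G (a, a)) * (var a * p)"
        have "var a * p \<in> sp (IM F a n (Suc d))"
          using p(1) by (auto simp: sp_def keys_monomial_mult I)
        then have p': "p' \<in> sp (IM F a n (Suc d))" unfolding p'_def by (rule sp_const)
        have e: "sb (U a G) p' = var a * sb (U a G) p"
        proof -
          have "sb (U a G) p' = const (1 / G (a, a)) * (const (G (a, a)) * (var a * sb (U a G) p))"
            unfolding p'_def sb_mult[of _ "const _"] sb_U_var sb_const ..
          then show ?thesis using UpD[OF G(1), of a] by (simp add: mult_single mult.assoc[symmetric])
        qed
        from LA_I[OF p', of a G] show "m \<in> LA a (IM F a n (Suc d)) G"
          using lead_monomial_mult[OF p(2), of "single a 1"] e p(3) m'(1) by simp
      qed
    qed
    have "mset_set (?x ` LA a (I1 F a n d) G) \<le> mset_set (?x ` JM (F1 a F) a n d)"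
      using n2[OF _ G(1), of n] n 2 J by simp
    then have le: "\<forall>y\<in>?x ` LA a (I1 F a n d) G - ?x ` JM (F1 a F) a n d.
      \<exists>z\<in>?x ` JM (F1 a F) a n d - ?x ` LA a (I1 F a n d) G. y < z"
      by (subst (asm) set_le_iff) (auto intro: finite_LA[OF I1_sub])
    show "mset_set (LA a (IM (F1 a F) a n d) K) \<le> mset_set (JM (F1 a F) a n d)"
      unfolding 1[symmetric] set_le_iff[OF finite_LA[OF I1_sub] finite_JM]
    proof
      fix y assume "y \<in> LA a (I1 F a n d) G - JM (F1 a F) a n d"
      then have "?x y \<in> ?x ` LA a (I1 F a n d) G - ?x ` JM (F1 a F) a n d" by auto
      then obtain z where "z \<in> ?x ` JM (F1 a F) a n d - ?x ` LA a (I1 F a n d) G" "?x y < z" using le by blast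
      then show "\<exists>z\<in>JM (F1 a F) a n d - LA a (I1 F a n d) G. y < z" by auto
    qed
  qed
qed

text \<open>Induction on the distance from \<open>a\<close> to the first difference
  \<open>i\<close>. If some member avoids \<open>a\<close>, then \<open>{a}\<close> is in
  \<open>F\<close>, which settles every \<open>T'\<close> containing \<open>a\<close> and otherwise
  leads to \<open>F0\<close>. If all members contain \<open>a\<close>, removing it and lowering the
  other indices leads to \<open>F1\<close>.\<close>

theorem lexsegment_of_Hyp:
  assumes "fam a F" "\<And>d. \<exists>n. bnd F d n" "Hyp TYPE('k::field_char_0) a F"
    "T \<in> F" "finite T'" "T' \<subseteq> {a..}" "card T' = card T"
    "i \<in> T'" "i \<notin> T" "\<And>j. j < i \<Longrightarrow> j \<in> T' \<longleftrightarrow> j \<in> T"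
  shows "T' \<in> F"
  using assms
proof (induction "i - a" arbitrary: a F T T' i rule: less_induct)
  case less
  note F = less.prems(1) and b = less.prems(2) and H = less.prems(3) and T = less.prems(4)
    and T' = less.prems(5,6,7) and i = less.prems(8,9) and j = less.prems(10)
  have ai: "a \<le> i" using T' i by auto
  have fT: "finite T" "T \<subseteq> {a..}" using famD(1,2)[OF F T] .
  show ?case
  proof (cases "\<exists>T0\<in>F. a \<notin> T0")
    case True
    then have aF: "{a} \<in> F" using Hyp_singleton[OF F b H] by blast
    show ?thesis
    proof (cases "a \<in> T'")
      case True
      then show ?thesis using famD(3)[OF F aF, of T'] T' by simp
    next
      case False
      then have "a < i" using ai i by (metis order.not_eq_order_implies_strict)
      then have "a \<notin> T" using j[of a] False by simp
      then have "T \<in> F0 a F" using T by (simp add: F0_def)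
      moreover have "T' \<subseteq> {Suc a..}" using T'(2) False by (auto simp: Suc_le_eq order.strict_iff_order)
      moreover have "\<exists>n. bnd (F0 a F) d n" for d using b[of d] bnd_F0 by blast
      ultimately have "T' \<in> F0 a F"
        using \<open>a < i\<close> by (intro less.hyps[OF _ fam_F0[OF F] _ Hyp_F0[OF F aF H] _ T'(1) _ T'(3) i j]) simp_all
      then show ?thesis by (simp add: F0_def)
    qed
  next
    case False
    then have aF: "\<And>S. S \<in> F \<Longrightarrow> a \<in> S" by blast
    have "i \<noteq> a" using aF[OF T] i by auto
    then have "a < i" using ai by simp
    then have aT: "a \<in> T" "a \<in> T'" using aF[OF T] j[of a] by auto
    define dn where "dn S = (\<lambda>x. x - 1) ` (S - {a})" for S :: "nat set"
    have dn: "S = insert a (Suc ` dn S) \<and> dn S \<subseteq> {a..} \<and> finite (dn S) \<and> card S = Suc (card (dn S)) \<and> (\<forall>x\<ge>a. x \<in> dn S \<longleftrightarrow> Suc x \<in> S)"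
      if S: "finite S" "S \<subseteq> {a..}" "a \<in> S" for S
    proof -
      have g: "a < x" if "x \<in> S - {a}" for x using S that by (auto simp: order.strict_iff_order)
      have "Suc ` dn S = (\<lambda>x. x) ` (S - {a})" unfolding dn_def image_image
      proof (rule image_cong[OF refl])
        show "Suc (x - 1) = x" if "x \<in> S - {a}" for x using g[OF that] by simp
      qed
      then have 1: "Suc ` dn S = S - {a}" by simp
      have "card (dn S) = card (Suc ` dn S)" by (simp add: card_image)
      then have "card S = Suc (card (dn S))" using card.remove[OF S(1,3)] 1 by simp
      moreover have "dn S \<subseteq> {a..}" using g by (force simp: dn_def)
      moreover have "finite (dn S)" using S by (simp add: dn_def)
      moreover have "x \<in> dn S \<longleftrightarrow> Suc x \<in> S" if "a \<le> x" for x
      proof -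
        have "x \<in> dn S \<longleftrightarrow> Suc x \<in> Suc ` dn S" by auto
        then show ?thesis using that unfolding 1 by auto
      qed
      ultimately show ?thesis using 1 S(3) by auto
    qed
    note dT = dn[OF fT aT(1)] and dT' = dn[OF T'(1,2) aT(2)]
    obtain k where k: "i = Suc k" "a \<le> k" using \<open>a < i\<close> by (cases i) auto
    have TF1: "dn T \<in> F1 a F" using dT T by (auto simp: F1_def)
    have bF1: "\<exists>n. bnd (F1 a F) d n" for d
    proof -
      obtain n where "bnd F (Suc d) n" using b by blast
      then have "bnd F (Suc d) (Suc (n + a))" by (rule bnd_mono[OF F]) simp_all
      then show ?thesis using bnd_F1[OF F] by (metis le_add2)
    qed
    have jk: "x \<in> dn T' \<longleftrightarrow> x \<in> dn T" if "x < k" for x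
    proof (cases "a \<le> x")
      case True
      then show ?thesis using dT dT' j[of "Suc x"] that k by auto
    next
      case False
      then show ?thesis using dT dT' by auto
    qed
    have "dn T' \<in> F1 a F"
    proof (rule less.hyps[OF _ fam_F1[OF F] bF1 Hyp_F1[OF F b aF H] TF1, of k])
      show "k - a < i - a" using k by simp
      show "finite (dn T')" "dn T' \<subseteq> {a..}" "card (dn T') = card (dn T)" "k \<in> dn T'" "k \<notin> dn T"
        using dT dT' T'(3) i k by auto
      show "\<And>j. j < k \<Longrightarrow> (j \<in> dn T') = (j \<in> dn T)" by (rule jk)
    qed
    then show ?thesis using dT' by (auto simp: F1_def)
  qed
qed

section \<open>Generic initial monomials\<close>

text \<open>The degree \<open>d\<close> part of the generic initial ideal in \<open>n\<close>
  variables, introduced as the largest of finitely many possible sets of leading monomials;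
  \<open>generic_AS\<close> shows that it is the generic value. The type argument carries the field,
  which does not appear in the type of \<open>F\<close>.\<close>

definition AS :: "'k::field_char_0 itself \<Rightarrow> nat set set \<Rightarrow> nat \<Rightarrow> nat \<Rightarrow> mono set" where
  "AS _ F n d = (SOME A. (\<exists>G\<in>Up. A = LA 0 (IM F 0 n d) (G :: nat \<times> nat \<Rightarrow> 'k)) \<and>
     (\<forall>G\<in>Up. mset_set (LA 0 (IM F 0 n d) (G :: nat \<times> nat \<Rightarrow> 'k)) \<le> mset_set A))"

lemma AS_spec:
  "(\<exists>G\<in>Up. AS TYPE('k::field_char_0) F n d = LA 0 (IM F 0 n d) (G :: nat \<times> nat \<Rightarrow> 'k)) \<and>
     (\<forall>G\<in>Up. mset_set (LA 0 (IM F 0 n d) (G :: nat \<times> nat \<Rightarrow> 'k)) \<le> mset_set (AS TYPE('k) F n d))"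
proof -
  let ?X = "(\<lambda>G :: nat \<times> nat \<Rightarrow> 'k. LA 0 (IM F 0 n d) G) ` Up"
  have "?X \<subseteq> Pow (Mon 0 n d)" using LA_sub[OF IM_sub] by blast
  then have "finite ?X" by (rule finite_subset) simp
  then have f: "finite (mset_set ` ?X)" by simp
  have ne: "mset_set ` ?X \<noteq> {}" using id_in_Up by blast
  have "Max (mset_set ` ?X) \<in> mset_set ` ?X" by (rule Max_in[OF f ne])
  then obtain G :: "nat \<times> nat \<Rightarrow> 'k" where G: "G \<in> Up" "Max (mset_set ` ?X) = mset_set (LA 0 (IM F 0 n d) G)" by auto
  have "mset_set (LA 0 (IM F 0 n d) G') \<le> mset_set (LA 0 (IM F 0 n d) G)" if "G' \<in> Up" for G' :: "nat \<times> nat \<Rightarrow> 'k"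
    unfolding G(2)[symmetric] by (rule Max_ge[OF f]) (use that in blast)
  note mx = this
  have "\<exists>A. (\<exists>G\<in>Up. A = LA 0 (IM F 0 n d) (G :: nat \<times> nat \<Rightarrow> 'k)) \<and>
     (\<forall>G\<in>Up. mset_set (LA 0 (IM F 0 n d) (G :: nat \<times> nat \<Rightarrow> 'k)) \<le> mset_set A)"
  proof (intro exI conjI ballI)
    show "\<exists>H\<in>Up. LA 0 (IM F 0 n d) G = LA 0 (IM F 0 n d) (H :: nat \<times> nat \<Rightarrow> 'k)" by (rule bexI[OF refl G(1)])
  qed (rule mx)
  then show ?thesis unfolding AS_def by (rule someI_ex)
qed

lemma AS_ge: "G \<in> Up \<Longrightarrow> mset_set (LA 0 (IM F 0 n d) G) \<le> mset_set (AS TYPE('k) F n d)"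
  for G :: "nat \<times> nat \<Rightarrow> 'k::field_char_0"
  by (rule AS_spec[where 'k = 'k, THEN conjunct2, rule_format])

lemma AS_witness:
  obtains G :: "nat \<times> nat \<Rightarrow> 'k::field_char_0" where "G \<in> Up" "AS TYPE('k) F n d = LA 0 (IM F 0 n d) G"
  using AS_spec[where 'k = 'k, THEN conjunct1] by (rule bexE)

lemma AS_sub: "AS TYPE('k::field_char_0) F n d \<subseteq> Mon 0 n d"
proof -
  obtain G :: "nat \<times> nat \<Rightarrow> 'k" where "AS TYPE('k) F n d = LA 0 (IM F 0 n d) G" by (rule AS_witness)
  then show ?thesis using LA_sub[OF IM_sub] by simp
qed

lemma finite_AS [simp]: "finite (AS TYPE('k::field_char_0) F n d)"
  by (rule finite_subset[OF AS_sub]) simp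

lemma card_AS: "card (AS TYPE('k::field_char_0) F n d) = card (IM F 0 n d)"
proof -
  obtain G :: "nat \<times> nat \<Rightarrow> 'k" where "G \<in> Up" "AS TYPE('k) F n d = LA 0 (IM F 0 n d) G" by (rule AS_witness)
  then show ?thesis using card_LA[OF IM_sub] by simp
qed

lemma mset_set_antisym:
  "finite A \<Longrightarrow> finite B \<Longrightarrow> mset_set A \<le> mset_set B \<Longrightarrow> mset_set B \<le> mset_set A \<Longrightarrow> A = B" for A :: "'a::linorder set"
  by (metis antisym finite_set_mset_mset_set)

lemma sp_IM_Mon: "p \<in> sp (IM F a n d) \<Longrightarrow> p \<in> sp (Mon a n d)"
  using sp_mono[OF IM_sub] by blast

text \<open>At the witness, \<open>AS\<close> is itself a nonsingular set of columns, by
  \<open>vanish_leads\<close>. This persists generically, so \<open>LA_ge\<close> bounds the leading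
  monomials from below by the maximum.\<close>

lemma generic_AS: "generic n (\<lambda>G :: nat \<times> nat \<Rightarrow> 'k::field_char_0. LA 0 (IM F 0 n d) G = AS TYPE('k) F n d)"
proof -
  obtain G :: "nat \<times> nat \<Rightarrow> 'k" where G: "G \<in> Up" "AS TYPE('k) F n d = LA 0 (IM F 0 n d) G" by (rule AS_witness)
  have "nd 0 (IM F 0 n d) (AS TYPE('k) F n d) G"
    unfolding nd_def
  proof (intro ballI impI)
    fix p :: "'k S" assume p: "p \<in> sp (IM F 0 n d)" "\<forall>b\<in>AS TYPE('k) F n d. lookup (sb (U 0 G) p) b = 0"
    have "sb (U 0 G) p = 0"
      by (rule vanish_leads[of _ "sb (U 0 G) ` sp (IM F 0 n d)"]) (use p G(2) in \<open>auto simp: LA_def\<close>)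
    then show "p = 0" by (rule U_inj[OF G(1) sp_ge[OF sp_IM_Mon[OF p(1)]]])
  qed
  then have "generic n (nd 0 (IM F 0 n d) (AS TYPE('k) F n d) :: (nat \<times> nat \<Rightarrow> 'k) \<Rightarrow> bool)"
    by (intro generic_nd[OF finite_IM IM_Mon_less G(1)])
  then show ?thesis
  proof (rule generic_imp)
    fix H :: "nat \<times> nat \<Rightarrow> 'k" assume H: "H \<in> Up" "nd 0 (IM F 0 n d) (AS TYPE('k) F n d) H"
    have "mset_set (AS TYPE('k) F n d) \<le> mset_set (LA 0 (IM F 0 n d) H)"
      by (rule LA_ge[OF IM_sub H finite_AS card_AS])
    then show "LA 0 (IM F 0 n d) H = AS TYPE('k) F n d"
      using AS_ge[OF H(1)] by (intro mset_set_antisym[OF finite_LA[OF IM_sub] finite_AS])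
  qed
qed

lemma IM_mult:
  assumes "fam 0 F" "u \<in> IM F 0 n d" "v \<in> Mon 0 n' e" "n \<le> n'" shows "u + v \<in> IM F 0 n' (d + e)"
proof -
  have "keys u \<in> F" "keys u \<subseteq> keys (u + v)" using assms(2) by (auto simp: IM_def mono_keys_add)
  then have "keys (u + v) \<in> F" using famD(3)[OF assms(1), of "keys u" "keys (u + v)"] by simp
  moreover have "u \<in> Mon 0 n' d" using assms(2) Mon_mono[OF order_refl assms(4)] IM_sub by blast
  ultimately show ?thesis using Mon_add[OF _ assms(3)] by (simp add: IM_def)
qed

text \<open>One generic matrix realises both sets simultaneously, so that \<open>LA_mult\<close>
  applies.\<close>

lemma AS_mult:
  assumes F: "fam 0 F" and m: "m \<in> AS TYPE('k::field_char_0) F n d" and w: "w \<in> Mon 0 n' e" and n: "n \<le> n'"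
  shows "w + m \<in> AS TYPE('k) F n' (d + e)"
proof -
  have "generic n' (\<lambda>G :: nat \<times> nat \<Rightarrow> 'k. LA 0 (IM F 0 n d) G = AS TYPE('k) F n d \<and>
      LA 0 (IM F 0 n' (d + e)) G = AS TYPE('k) F n' (d + e))"
    by (rule generic_conj[OF generic_mono[OF generic_AS n] generic_AS])
  from generic_ex[OF this] obtain G :: "nat \<times> nat \<Rightarrow> 'k" where G: "G \<in> Up"
    "LA 0 (IM F 0 n d) G = AS TYPE('k) F n d \<and> LA 0 (IM F 0 n' (d + e)) G = AS TYPE('k) F n' (d + e)" by (rule bexE)
  have "w + m \<in> LA 0 (IM F 0 n' (d + e)) G"
  proof (rule LA_mult[OF G(1) _ w])
    show "m \<in> LA 0 (IM F 0 n d) G" using m G(2) by simp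
    show "u + v \<in> IM F 0 n' (d + e)" if "u \<in> IM F 0 n d" "v \<in> Mon 0 n' e" for u v by (rule IM_mult[OF F that n])
  qed
  then show ?thesis using G(2) by simp
qed

section \<open>Adding variables to the generic initial monomials\<close>

lemma mono_cut:
  "\<exists>m w. u = w + m \<and> keys m = keys u \<inter> {..<n} \<and> keys w = keys u \<inter> {n..}" for u :: mono
proof (induction u rule: mono_back)
  case zero
  show ?case by (intro exI[of _ 0]) simp
next
  case (add a u)
  then obtain m w where m: "u = w + m" "keys m = keys u \<inter> {..<n}" "keys w = keys u \<inter> {n..}" by blast
  show ?case
  proof (cases "a < n")
    case True
    show ?thesis
    proof (intro exI conjI)
      show "u + single a 1 = w + (m + single a 1)" using m(1) by (simp add: add.assoc)
      show "keys (m + single a 1) = keys (u + single a 1) \<inter> {..<n}" using m(2) True by (simp add: mono_keys_add)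
      show "keys w = keys (u + single a 1) \<inter> {n..}" using m(3) True by (simp add: mono_keys_add)
    qed
  next
    case False
    show ?thesis
    proof (intro exI conjI)
      show "u + single a 1 = (w + single a 1) + m" using m(1) by (simp add: add_ac)
      show "keys m = keys (u + single a 1) \<inter> {..<n}" using m(2) False by (simp add: mono_keys_add)
      show "keys (w + single a 1) = keys (u + single a 1) \<inter> {n..}" using m(3) False by (simp add: mono_keys_add)
    qed
  qed
qed

lemma cut_unique:
  assumes "w + m = w' + m'" "keys m \<subseteq> {..<n}" "keys m' \<subseteq> {..<n}" "keys w \<subseteq> {n..}" "keys w' \<subseteq> {n..}"
  shows "m = m' \<and> w = (w' :: mono)"
proof -
  have l: "lookup w i + lookup m i = lookup w' i + lookup m' i" for i using assms(1) by (metis lookup_add)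
  have "lookup m i = lookup m' i" for i
  proof (cases "i < n")
    case True
    then have "i \<notin> keys w" "i \<notin> keys w'" using assms by auto
    then show ?thesis using l[of i] by (simp add: in_keys_iff)
  next
    case False
    then have "i \<notin> keys m" "i \<notin> keys m'" using assms by auto
    then show ?thesis by (simp add: in_keys_iff)
  qed
  then have "m = m'" by (rule poly_mapping_eqI)
  then show ?thesis using assms(1) by simp
qed

definition ext :: "(nat \<Rightarrow> mono set) \<Rightarrow> nat \<Rightarrow> nat \<Rightarrow> nat \<Rightarrow> mono set" where
  "ext A n n' d = (\<lambda>(e, m, w). w + m) ` (SIGMA e:{..d}. A e \<times> Mon n n' (d - e))"

lemma card_ext:
  assumes "\<And>e. A e \<subseteq> Mon 0 n e" "\<And>e. B e \<subseteq> Mon 0 n e" "\<And>e. card (A e) = card (B e)"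
  shows "card (ext A n n' d) = card (ext B n n' d)"
proof -
  have "card (ext C n n' d) = (\<Sum>e\<in>{..d}. card (C e) * card (Mon n n' (d - e)))" if C: "\<And>e. C e \<subseteq> Mon 0 n e" for C
  proof -
    have "inj_on (\<lambda>(e, m, w). w + m) (SIGMA e:{..d}. C e \<times> Mon n n' (d - e))"
    proof (rule inj_onI)
      fix x y assume xy: "x \<in> (SIGMA e:{..d}. C e \<times> Mon n n' (d - e))" "y \<in> (SIGMA e:{..d}. C e \<times> Mon n n' (d - e))"
        "(case x of (e, m, w) \<Rightarrow> w + m) = (case y of (e, m, w) \<Rightarrow> w + m)"
      obtain e m w e' m' w' where e: "x = (e, m, w)" "y = (e', m', w')" by (metis prod_cases3)
      have h: "w + m = w' + m'" "m \<in> C e" "w \<in> Mon n n' (d - e)" "m' \<in> C e'" "w' \<in> Mon n n' (d - e')"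
        using xy unfolding e by auto
      have M: "m \<in> Mon 0 n e" "m' \<in> Mon 0 n e'" using h C by blast+
      have "m = m' \<and> w = w'" by (rule cut_unique[OF h(1), of n]) (use M h in \<open>auto simp: Mon_def\<close>)
      then show "x = y" using M by (auto simp: Mon_def e)
    qed
    then have "card (ext C n n' d) = card (SIGMA e:{..d}. C e \<times> Mon n n' (d - e))"
      unfolding ext_def by (rule card_image)
    also have "\<dots> = (\<Sum>e\<in>{..d}. card (C e \<times> Mon n n' (d - e)))"
      by (rule card_SigmaI) (auto intro!: finite_cartesian_product intro: finite_subset[OF C finite_Mon])
    finally show ?thesis by (simp add: card_cartesian_product)
  qed
  then show ?thesis using assms by simp
qed

text \<open>Products with monomials in the new variables are contained in the larger set by
  \<open>AS_mult\<close>. The sizes agree because under the bound \<open>IM\<close> grows in the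
  same way.\<close>

lemma AS_ext:
  assumes F: "fam 0 F" and b: "bnd F d n" and n: "n \<le> n'"
  shows "AS TYPE('k::field_char_0) F n' d = ext (AS TYPE('k) F n) n n' d"
proof (rule card_subset_eq[symmetric])
  show "ext (AS TYPE('k) F n) n n' d \<subseteq> AS TYPE('k) F n' d"
  proof
    fix u assume "u \<in> ext (AS TYPE('k) F n) n n' d"
    then obtain e m w where u: "u = w + m" "e \<le> d" "m \<in> AS TYPE('k) F n e" "w \<in> Mon n n' (d - e)"
      by (auto simp: ext_def)
    have "w \<in> Mon 0 n' (d - e)" using u(4) Mon_mono[of 0 n n' n' "d - e"] by auto
    from AS_mult[OF F u(3) this n] show "u \<in> AS TYPE('k) F n' d" using u(1,2) by simp
  qed
  have "IM F 0 n' d = ext (IM F 0 n) n n' d"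
  proof
    show "ext (IM F 0 n) n n' d \<subseteq> IM F 0 n' d"
    proof
      fix u assume "u \<in> ext (IM F 0 n) n n' d"
      then obtain e m w where u: "u = w + m" "e \<le> d" "m \<in> IM F 0 n e" "w \<in> Mon n n' (d - e)"
        by (auto simp: ext_def)
      have "w \<in> Mon 0 n' (d - e)" using u(4) Mon_mono[of 0 n n' n' "d - e"] by auto
      from IM_mult[OF F u(3) this n] show "u \<in> IM F 0 n' d" using u(1,2) by (simp add: add.commute)
    qed
    show "IM F 0 n' d \<subseteq> ext (IM F 0 n) n n' d"
    proof
      fix u assume u: "u \<in> IM F 0 n' d"
      then have u1: "keys u \<in> F" "mdeg u = d" "keys u \<subseteq> {..<n'}" by (auto simp: IM_def Mon_def)
      obtain m w where m: "u = w + m" "keys m = keys u \<inter> {..<n}" "keys w = keys u \<inter> {n..}" using mono_cut by blast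
      have "card (keys u) \<le> d" using card_keys_le[of u] u1 by simp
      then have "keys m \<in> F" using b u1 m(2) by (simp add: bnd_def)
      moreover have "keys m \<subseteq> {..<n}" unfolding m(2) by simp
      ultimately have mI: "m \<in> IM F 0 n (mdeg m)" by (simp add: IM_def Mon_def atLeast0LessThan)
      have "mdeg w + mdeg m = d" using u1(2) unfolding m(1) by simp
      then have dw: "mdeg w = d - mdeg m" "mdeg m \<le> d" by simp_all
      have "keys w \<subseteq> {n..<n'}" unfolding m(3) using u1(3) by auto
      then have wM: "w \<in> Mon n n' (d - mdeg m)" using dw by (simp add: Mon_def)
      show "u \<in> ext (IM F 0 n) n n' d" unfolding ext_def
      proof (rule image_eqI)
        show "u = (\<lambda>(e, m, w). w + m) (mdeg m, m, w)" using m(1) by simp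
        show "(mdeg m, m, w) \<in> (SIGMA e:{..d}. IM F 0 n e \<times> Mon n n' (d - e))" using mI wM dw by simp
      qed
    qed
  qed
  then show "card (ext (AS TYPE('k) F n) n n' d) = card (AS TYPE('k) F n' d)"
    unfolding card_AS by (simp add: card_ext[OF AS_sub IM_sub card_AS])
qed simp

lemma AS_restrict:
  assumes F: "fam 0 F" and b: "bnd F d n" and n: "n \<le> n'" and u: "u \<in> Mon 0 n d"
  shows "u \<in> AS TYPE('k::field_char_0) F n' d \<longleftrightarrow> u \<in> AS TYPE('k) F n d"
proof
  assume "u \<in> AS TYPE('k) F n d"
  from AS_mult[OF F this _ n, of 0 0] show "u \<in> AS TYPE('k) F n' d" by (simp add: Mon_0)
next
  assume "u \<in> AS TYPE('k) F n' d"
  then obtain e m w where h: "u = w + m" "e \<le> d" "m \<in> AS TYPE('k) F n e" "w \<in> Mon n n' (d - e)"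
    unfolding AS_ext[OF F b n] by (auto simp: ext_def)
  have "keys w \<subseteq> {..<n} \<inter> {n..}" using u h(1,4) by (auto simp: Mon_def mono_keys_add)
  then have "keys w = {}" by fastforce
  then have "w = 0" using mdeg_eq_0_iff[of w] by (simp add: mdeg_def)
  then have "d - e = 0" using h(4) by (auto simp: Mon_def)
  then show "u \<in> AS TYPE('k) F n d" using h \<open>w = 0\<close> by simp
qed

section \<open>Generic initial ideals are strongly stable\<close>

lemma basis_span:
  fixes V :: "'k::field_char_0 S set"
  assumes V: "lin V" "finite (leads V)" and v: "\<And>b. b \<in> leads V \<Longrightarrow> v b \<in> V \<and> v b \<noteq> 0 \<and> lead (v b) = b" and w: "w \<in> V"
  shows "\<exists>z. w = (\<Sum>b\<in>leads V. const (z b) * v b)"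
proof -
  \<comment> \<open>The index \<open>None\<close> stands for \<open>w\<close>. A linear dependence
    must involve it, because the other vectors have distinct leading monomials.\<close>
  let ?B = "insert None (Some ` leads V)"
  define f where "f x = (case x of None \<Rightarrow> w | Some b \<Rightarrow> v b)" for x
  have "card (leads V) < card ?B" using V(2) by (simp add: card_image)
  then obtain c where c: "\<exists>x\<in>?B. c x \<noteq> 0" "\<forall>m\<in>leads V. (\<Sum>x\<in>?B. c x * lookup (f x) m) = 0"
    using elim[of "leads V" ?B "\<lambda>x. lookup (f x)"] V(2) by auto
  define q where "q = (\<Sum>b\<in>leads V. const (c (Some b)) * v b)"
  have q: "q \<in> V" unfolding q_def by (rule lin_comb[OF V(1)]) (use v in blast)
  have "const (c None) * w + q = 0"
  proof (rule vanish_leads)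
    show "const (c None) * w + q \<in> V" by (intro linD(2)[OF V(1)] linD(3)[OF V(1)] w q)
    show "lookup (const (c None) * w + q) m = 0" if m: "m \<in> leads V" for m
    proof -
      have "(\<Sum>x\<in>?B. c x * lookup (f x) m) = c None * lookup w m + (\<Sum>x\<in>Some ` leads V. c x * lookup (f x) m)"
        using V(2) by (subst sum.insert) (auto simp: f_def)
      also have "(\<Sum>x\<in>Some ` leads V. c x * lookup (f x) m) = (\<Sum>b\<in>leads V. c (Some b) * lookup (v b) m)"
        by (subst sum.reindex) (auto simp: f_def)
      finally show ?thesis using bspec[OF c(2) m] by (simp add: lookup_add q_def lookup_comb)
    qed
  qed
  moreover have "c None \<noteq> 0"
  proof
    assume 0: "c None = 0"
    then have "q = 0" using \<open>const (c None) * w + q = 0\<close> by simp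
    moreover have "\<exists>b\<in>leads V. c (Some b) \<noteq> 0" using c(1) 0 by auto
    then have "q \<noteq> 0" unfolding q_def using lead_comb[OF V(2), of v "\<lambda>b. c (Some b)"] v by blast
    ultimately show False by simp
  qed
  ultimately have e: "w = const (- 1 / c None) * q"
  proof -
    assume 1: "const (c None) * w + q = 0" and 2: "c None \<noteq> 0"
    from 1 have "q = - (const (c None) * w)" by (simp add: eq_neg_iff_add_eq_0 add.commute)
    then have "lookup (const (- 1 / c None) * q) k = lookup w k" for k using 2 by simp
    then show "w = const (- 1 / c None) * q" by (intro poly_mapping_eqI) simp
  qed
  have "const (- 1 / c None) * q = (\<Sum>b\<in>leads V. const (- 1 / c None * c (Some b)) * v b)"
    unfolding q_def sum_distrib_left by (rule sum.cong) (auto simp: mult_single mult.assoc[symmetric])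
  then show ?thesis using e by metis
qed

text \<open>The elementary upper triangular substitution. To first order it replaces one factor
  \<open>x_j\<close> by \<open>x_i\<close>, with the exponent of \<open>x_j\<close> as coefficient;
  in characteristic zero this is nonzero whenever \<open>x_j\<close> occurs.\<close>

definition ee :: "nat \<Rightarrow> nat \<Rightarrow> nat \<Rightarrow> 'k::field_char_0 S" where
  "ee i j k = (if k = j then var j + var i else var k)"

text \<open>Here \<open>t\<close> counts the replaced factors. Writing the relation as an equality
  of sums avoids truncated subtraction of exponents.\<close>

lemma mev_ee:
  fixes a :: mono
  assumes "i < j"
  shows "(\<forall>u\<in>keys (mev (ee i j :: nat \<Rightarrow> 'k::field_char_0 S) a). \<exists>t. u + single j t = a + single i t) \<and>
    lookup (mev (ee i j :: nat \<Rightarrow> 'k S) a) a = 1 \<and>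
    (\<forall>u. u + single j 1 = a + single i 1 \<longrightarrow> lookup (mev (ee i j :: nat \<Rightarrow> 'k S) a) u = of_nat (lookup a j))"
    (is "?K a \<and> ?C a \<and> ?L a")
proof (induction a rule: mono_back)
  case zero
  have "u \<noteq> 0" if "u + single j 1 = single i 1" for u :: mono
  proof
    assume "u = 0"
    then have "single j (1::nat) = single i 1" using that by simp
    then show False using assms by (simp del: One_nat_def)
  qed
  then show ?case by (auto simp: lookup_one when_def intro: exI[of _ 0])
next
  case (add k a)
  let ?m = "mev (ee i j :: nat \<Rightarrow> 'k S) a"
  have IH: "?K a" "?C a" "?L a" using add.IH by auto
  have e: "mev (ee i j :: nat \<Rightarrow> 'k S) (a + single k 1) = ?m * ee i j k" by (simp add: mev_add)
  show ?case
  proof (cases "k = j")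
    case False
    then have e': "mev (ee i j :: nat \<Rightarrow> 'k S) (a + single k 1) = var k * ?m" unfolding e by (simp add: ee_def mult.commute)
    have K: "?K (a + single k 1)"
    proof
      fix u assume "u \<in> keys (mev (ee i j :: nat \<Rightarrow> 'k S) (a + single k 1))"
      then obtain x where x: "u = single k 1 + x" "x \<in> keys ?m" unfolding e' keys_monomial_mult by blast
      then obtain t where t: "x + single j t = a + single i t" using IH(1) by blast
      have "u + single j t = single k 1 + (x + single j t)" unfolding x(1) by (rule add.assoc)
      also have "\<dots> = a + single k 1 + single i t" unfolding t by (simp only: add_ac)
      finally show "\<exists>t. u + single j t = a + single k 1 + single i t" by blast
    qed
    have C: "?C (a + single k 1)" unfolding e' using IH(2) lookup_single_mult[of "single k 1" 1 ?m a]
      by (simp add: add.commute)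
    have L: "?L (a + single k 1)"
    proof (intro allI impI)
      fix u assume u: "u + single j 1 = a + single k 1 + single i 1"
      have "lookup (u + single j 1) k = lookup (a + single k 1 + single i 1) k" using u by simp
      then have "lookup u k \<noteq> 0" using False by (auto simp: lookup_add lookup_single when_def)
      then obtain x where x: "u = single k 1 + x" using mono_split[of k u] by (auto simp: in_keys_iff)
      have "single k 1 + (x + single j 1) = single k 1 + (a + single i 1)"
        using u unfolding x by (simp only: add_ac)
      then have "x + single j 1 = a + single i 1" by simp
      then have "lookup ?m x = of_nat (lookup a j)" using IH(3) by blast
      then show "lookup (mev (ee i j :: nat \<Rightarrow> 'k S) (a + single k 1)) u = of_nat (lookup (a + single k 1) j)"
        unfolding e' x using False by (simp add: lookup_add lookup_single)
    qed
    show ?thesis using K C L by blast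
  next
    case True
    then have e': "mev (ee i j :: nat \<Rightarrow> 'k S) (a + single k 1) = var j * ?m + var i * ?m"
      unfolding e by (simp add: ee_def distrib_left mult.commute)
    have K: "?K (a + single k 1)"
    proof
      fix u assume "u \<in> keys (mev (ee i j :: nat \<Rightarrow> 'k S) (a + single k 1))"
      then have "u \<in> keys (var j * ?m + var i * ?m)" unfolding e' .
      then have "u \<in> keys (var j * ?m) \<union> keys (var i * ?m)" by (rule subsetD[OF keys_add])
      then consider x where "u = single j 1 + x" "x \<in> keys ?m" | x where "u = single i 1 + x" "x \<in> keys ?m"
        unfolding keys_monomial_mult by auto
      then show "\<exists>t. u + single j t = a + single k 1 + single i t"
      proof cases
        case 1
        then obtain t where t: "x + single j t = a + single i t" using IH(1) by blast
        have "u + single j t = single j 1 + (x + single j t)" unfolding 1(1) by (rule add.assoc)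
        also have "\<dots> = a + single k 1 + single i t" unfolding t True by (simp only: add_ac)
        finally show ?thesis by blast
      next
        case 2
        then obtain t where t: "x + single j t = a + single i t" using IH(1) by blast
        have "single i 1 + x + single j (t + 1) = single i 1 + (x + single j t) + single j 1"
          by (simp add: single_add add.assoc)
        also have "\<dots> = a + single j 1 + single i (t + 1)" unfolding t by (simp add: single_add add_ac)
        finally show ?thesis unfolding 2(1) True by blast
      qed
    qed
    have no: "lookup (var i * ?m) (a + single j 1) = 0"
    proof (rule ccontr)
      assume "lookup (var i * ?m) (a + single j 1) \<noteq> 0"
      then obtain x where x: "x \<in> keys ?m" "a + single j 1 = single i 1 + x"
        using lookup_single_mult_eq_0 by blast
      obtain t where t: "x + single j t = a + single i t" using IH(1) x(1) by blast
      have "lookup a i = 1 + lookup x i" using arg_cong[OF x(2), of "\<lambda>m. lookup m i"] assms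
        by (simp add: lookup_add lookup_single when_def)
      moreover have "lookup x i = lookup a i + t" using arg_cong[OF t, of "\<lambda>m. lookup m i"] assms
        by (simp add: lookup_add lookup_single when_def)
      ultimately show False by simp
    qed
    have C: "?C (a + single k 1)" unfolding e' unfolding lookup_add True no
      using IH(2) lookup_single_mult[of "single j 1" 1 ?m a] by (simp add: add.commute)
    have L: "?L (a + single k 1)"
    proof (intro allI impI)
      fix u assume "u + single j 1 = a + single k 1 + single i 1"
      then have "u + single j 1 = (a + single i 1) + single j 1" unfolding True by (simp add: add_ac)
      then have "u = a + single i 1" by (rule add_right_imp_eq)
      then have u: "u = single i 1 + a" by (simp only: add.commute)
      have 1: "lookup (var i * ?m) u = 1" unfolding u using IH(2) by simp
      have 2: "lookup (var j * ?m) u = of_nat (lookup a j)"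
      proof (cases "lookup a j = 0")
        case True
        then have "j \<notin> keys u" using assms unfolding u by (simp add: in_keys_iff lookup_add lookup_single)
        then show ?thesis using True by (simp add: lookup_var_mult_0)
      next
        case False
        then obtain x where x: "u = single j 1 + x" using mono_split[of j u]
          unfolding u by (auto simp: in_keys_iff lookup_add)
        then have "x + single j 1 = a + single i 1" using u by (simp add: add.commute)
        then have "lookup ?m x = of_nat (lookup a j)" using IH(3) by blast
        then show ?thesis unfolding x by simp
      qed
      show "lookup (mev (ee i j :: nat \<Rightarrow> 'k S) (a + single k 1)) u = of_nat (lookup (a + single k 1) j)"
        unfolding e' unfolding lookup_add 1 2 True by simp
    qed
    show ?thesis using K C L by blast
  qed
qed

text \<open>Weights representing the lexicographic order in degree \<open>d\<close>: base \<open>d + 1\<close> digits.\<close>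

definition wt :: "nat \<Rightarrow> nat \<Rightarrow> nat \<Rightarrow> nat" where
  "wt n d k = (d + 1) ^ (n - 1 - k)"

definition wts :: "nat \<Rightarrow> nat \<Rightarrow> mono \<Rightarrow> nat" where
  "wts n d m = (\<Sum>k\<in>keys m. wt n d k * lookup m k)"

text \<open>At the first difference the larger monomial gains at least one full weight. The later
  variables contribute less than that, as their weights are smaller by a factor of at least
  \<open>d + 1\<close> while their total exponent is at most \<open>d\<close>.\<close>

lemma wts_less:
  assumes "u < a" and u: "u \<in> Mon 0 n d" and a: "a \<in> Mon 0 n d"
  shows "wts n d u < wts n d a"
proof -
  obtain k where k: "lookup u k < lookup a k" "\<And>j. j < k \<Longrightarrow> lookup u j = lookup a j"
    using assms(1) unfolding less_poly_mapping.rep_eq less_fun_def by blast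
  have "k \<in> keys a" using k(1) by (simp add: in_keys_iff)
  then have kn: "k < n" using a by (auto simp: Mon_def)
  have W: "wts n d m = (\<Sum>l<k. wt n d l * lookup m l) + wt n d k * lookup m k + (\<Sum>l\<in>{k<..<n}. wt n d l * lookup m l)"
    if m: "m \<in> Mon 0 n d" for m
  proof -
    have "wts n d m = (\<Sum>l\<in>{..<n}. wt n d l * lookup m l)"
      unfolding wts_def by (rule sum.mono_neutral_left) (use m in \<open>auto simp: Mon_def in_keys_iff\<close>)
    also have "{..<n} = insert k ({..<k} \<union> {k<..<n})" using kn by auto
    also have "(\<Sum>l\<in>\<dots>. wt n d l * lookup m l) = wt n d k * lookup m k + (\<Sum>l\<in>{..<k} \<union> {k<..<n}. wt n d l * lookup m l)"
      by (rule sum.insert) auto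
    also have "(\<Sum>l\<in>{..<k} \<union> {k<..<n}. wt n d l * lookup m l) = (\<Sum>l<k. wt n d l * lookup m l) + (\<Sum>l\<in>{k<..<n}. wt n d l * lookup m l)"
      by (rule sum.union_disjoint) auto
    finally show ?thesis by simp
  qed
  let ?T = "\<Sum>l\<in>{k<..<n}. wt n d l * lookup u l"
  have "(d + 1) * ?T \<le> (\<Sum>l\<in>{k<..<n}. wt n d k * lookup u l)"
    unfolding sum_distrib_left mult.assoc[symmetric]
  proof (intro sum_mono mult_right_mono)
    fix l assume l: "l \<in> {k<..<n}"
    have "(d + 1) * wt n d l = (d + 1) ^ Suc (n - 1 - l)" by (simp add: wt_def)
    also have "\<dots> \<le> (d + 1) ^ (n - 1 - k)" by (rule power_increasing) (use l in auto)
    finally show "(d + 1) * wt n d l \<le> wt n d k" by (simp add: wt_def)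
  qed simp
  also have "\<dots> = wt n d k * (\<Sum>l\<in>{k<..<n}. lookup u l)" by (simp add: sum_distrib_left)
  also have "\<dots> \<le> wt n d k * d"
  proof (rule mult_left_mono)
    have "(\<Sum>l\<in>{k<..<n}. lookup u l) \<le> pref u n" unfolding pref_def by (rule sum_mono2) auto
    also have "\<dots> \<le> d" using pref_le_mdeg[of u n] u by (simp add: Mon_def)
    finally show "(\<Sum>l\<in>{k<..<n}. lookup u l) \<le> d" .
  qed simp
  also have "\<dots> < (d + 1) * wt n d k" by (simp add: wt_def)
  finally have T: "?T < wt n d k" by simp
  have "wt n d k * lookup u k + wt n d k \<le> wt n d k * lookup a k"
    using mult_le_mono2[of "Suc (lookup u k)" "lookup a k" "wt n d k"] k(1) by simp
  moreover have "(\<Sum>l<k. wt n d l * lookup u l) = (\<Sum>l<k. wt n d l * lookup a l)" by (rule sum.cong) (auto simp: k(2))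
  ultimately show ?thesis unfolding W[OF u] W[OF a] using T by linarith
qed

lemma mev_scale: "mev (\<lambda>k. const (t ^ W k) * var k) m = const (t ^ (\<Sum>k\<in>keys m. W k * lookup m k)) * (monomial m :: 'k::field_char_0 S)"
proof -
  have p: "const (c :: 'k) ^ l = const (c ^ l)" for c l by (induction l) (simp_all add: mult_single)
  have q: "(\<Prod>k\<in>A. const (f k :: 'k)) = const (\<Prod>k\<in>A. f k)" if "finite A" for A :: "nat set" and f
    using that by (induction A rule: finite_induct) (simp_all add: mult_single)
  have "mev (\<lambda>k. const (t ^ W k) * var k) m = (\<Prod>k\<in>keys m. const (t ^ (W k * lookup m k)) * var k ^ lookup m k)"
    unfolding mev_def by (rule prod.cong) (simp_all add: power_mult_distrib p power_mult)
  also have "\<dots> = (\<Prod>k\<in>keys m. const (t ^ (W k * lookup m k))) * mev var m"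
    unfolding prod.distrib mev_def ..
  finally show ?thesis by (simp add: q mev_var power_sum)
qed

text \<open>A one-parameter torus degenerates \<open>V\<close> to the span of its leading monomials; nonsingularity at the
  limit parameter \<open>0\<close> therefore propagates to a nearby nonzero one.\<close>

lemma AS_swap:
  assumes m: "single j 1 + u \<in> AS TYPE('k::field_char_0) F n d" and ij: "i < j"
  shows "single i 1 + u \<in> AS TYPE('k) F n d"
proof (rule ccontr)
  let ?A = "AS TYPE('k) F n d"
  let ?m = "single j 1 + u" and ?m' = "single i 1 + u"
  assume nm: "?m' \<notin> ?A"
  \<comment> \<open>Exchanging \<open>?m\<close> for the larger \<open>?m'\<close> yields a set
    above the maximum \<open>?A\<close>, so it is enough to find a matrix for which \<open>B\<close>
    is nonsingular.\<close>
  define B where "B = insert ?m' (?A - {?m})"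
  obtain G0 :: "nat \<times> nat \<Rightarrow> 'k" where G0: "G0 \<in> Up" "?A = LA 0 (IM F 0 n d) G0" by (rule AS_witness)
  define V where "V = sb (U 0 G0) ` sp (IM F 0 n d)"
  have linV: "lin V" unfolding V_def by (rule lin_U)
  have LV: "leads V = ?A" unfolding G0(2) LA_def V_def ..
  obtain v where v: "\<And>b. b \<in> leads V \<Longrightarrow> v b \<in> V \<and> v b \<noteq> 0 \<and> lead (v b) = b" using leads_basis[of V] by blast
  have VM: "p \<in> sp (Mon 0 n d)" if "p \<in> V" for p using that sb_U_in[OF sp_IM_Mon] unfolding V_def by blast
  let ?l = "wts n d" and ?E = "mev (ee i j) :: mono \<Rightarrow> 'k S"
  have AM: "a \<in> Mon 0 n d" if "a \<in> ?A" for a using that AS_sub by blast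
  have vM: "x \<in> Mon 0 n d" if "a \<in> ?A" "x \<in> keys (v a)" for a x
    using VM[of "v a"] v[of a] that unfolding LV by (auto simp: sp_def)
  have vle: "x \<le> a" if "a \<in> ?A" "x \<in> keys (v a)" for a x using lead_ge[OF that(2)] v[of a] that(1) unfolding LV by simp
  have wle: "?l x \<le> ?l a" if "a \<in> ?A" "x \<in> keys (v a)" for a x
    using vle[OF that] wts_less[OF _ vM[OF that] AM[OF that(1)]] by (cases "x = a") (auto simp: order.strict_iff_order)
  \<comment> \<open>The coefficients after the torus element with parameter \<open>1 / s\<close> and
    \<open>ee i j\<close>, with row \<open>a\<close> divided by the power belonging to its leading
    monomial. By \<open>wle\<close> no exponent is truncated, so \<open>s = 0\<close> makes sense
    and leaves only the leading term of \<open>v a\<close>.\<close>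
  define M where "M s a b = (\<Sum>x\<in>keys (v a). lookup (v a) x * s ^ (?l a - ?l x) * lookup (?E x) b)" for s :: 'k and a b
  define Rp where "Rp = {f. \<exists>p. f = (\<lambda>s :: 'k. poly p s)}"
  have Rp: "(\<lambda>s. poly p s) \<in> Rp" for p unfolding Rp_def by blast
  have M0: "M 0 a b = lookup (v a) a * lookup (?E a) b" if a: "a \<in> ?A" for a b
  proof -
    have "M 0 a b = (\<Sum>x\<in>keys (v a). if x = a then lookup (v a) a * lookup (?E a) b else 0)"
      unfolding M_def
    proof (rule sum.cong[OF refl])
      fix x assume x: "x \<in> keys (v a)"
      show "lookup (v a) x * 0 ^ (?l a - ?l x) * lookup (?E x) b = (if x = a then lookup (v a) a * lookup (?E a) b else 0)"
      proof (cases "x = a")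
        case False
        then have "?l x < ?l a" using vle[OF a x] wts_less[OF _ vM[OF a x] AM[OF a]] by simp
        then show ?thesis using False by simp
      qed simp
    qed
    also have "\<dots> = lookup (v a) a * lookup (?E a) b" by (auto simp: sum.delta in_keys_iff)
    finally show ?thesis .
  qed
  have va: "lookup (v a) a \<noteq> 0" if "a \<in> ?A" for a using lookup_lead[of "v a"] v[of a] that unfolding LV by simp
  have "\<exists>D\<in>Rp. D 0 \<noteq> 0 \<and> (\<forall>s. D s \<noteq> 0 \<longrightarrow>
    (\<forall>z. (\<forall>b\<in>B. (\<Sum>a\<in>?A. z a * M s a b) = 0) \<longrightarrow> (\<forall>a\<in>?A. z a = 0)))"
  proof (rule nonsing[OF finite_AS])
    show "(\<lambda>_. 1) \<in> Rp" using Rp[of 1] by simp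
    show "(\<lambda>s. f s - g s) \<in> Rp" if fg: "f \<in> Rp" "g \<in> Rp" for f g
    proof -
      obtain p q where "f = (\<lambda>s. poly p s)" "g = (\<lambda>s. poly q s)" using fg unfolding Rp_def by blast
      then show ?thesis using Rp[of "p - q"] by simp
    qed
    show "(\<lambda>s. f s * g s) \<in> Rp" if fg: "f \<in> Rp" "g \<in> Rp" for f g
    proof -
      obtain p q where "f = (\<lambda>s. poly p s)" "g = (\<lambda>s. poly q s)" using fg unfolding Rp_def by blast
      then show ?thesis using Rp[of "p * q"] by simp
    qed
    show "(\<lambda>s. M s a b) \<in> Rp" for a b
    proof -
      have "(\<lambda>s. M s a b) = (\<lambda>s. poly (\<Sum>x\<in>keys (v a). [:lookup (v a) x:] * [:0, 1:] ^ (?l a - ?l x) * [:lookup (?E x) b:]) s)"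
        by (rule ext) (simp add: M_def poly_sum poly_power mult_ac)
      then show ?thesis using Rp by simp
    qed
    show "\<forall>a\<in>?A. z a = 0" if z: "\<And>b. b \<in> B \<Longrightarrow> (\<Sum>a\<in>?A. z a * M 0 a b) = 0" for z
    proof (rule ccontr)
      assume "\<not> ?thesis"
      then have ne: "{a\<in>?A. z a \<noteq> 0} \<noteq> {}" by blast
      \<comment> \<open>At the limit the matrix is triangular with respect to the exponent of
        \<open>x_i\<close>: among the rows with \<open>z a\<close> nonzero take one where this
        exponent is least, and a column \<open>b\<close> that meets no other such row.\<close>
      define r where "r = Min ((\<lambda>a. lookup a i) ` {a\<in>?A. z a \<noteq> 0})"
      have "r \<in> (\<lambda>a. lookup a i) ` {a\<in>?A. z a \<noteq> 0}" unfolding r_def by (rule Min_in) (use ne in auto)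
      then obtain a where a: "a \<in> ?A" "z a \<noteq> 0" "lookup a i = r" by auto
      have mn: "lookup a i \<le> lookup a2 i" if "a2 \<in> ?A" "z a2 \<noteq> 0" for a2
        unfolding a(3) r_def by (rule Min_le) (use that in auto)
      define b where "b = (if a = ?m then ?m' else a)"
      have bB: "b \<in> B" using a(1) by (auto simp: b_def B_def)
      have E: "a2 = a" if a2: "a2 \<in> ?A" "z a2 \<noteq> 0" "lookup (?E a2) b \<noteq> 0" for a2
      proof -
        have "b \<in> keys (?E a2)" using a2(3) by (simp add: in_keys_iff)
        then obtain t where t: "b + single j t = a2 + single i t" using mev_ee[OF ij, where 'k = 'k, of a2] by blast
        have li: "lookup b i = lookup a2 i + t" using arg_cong[OF t, of "\<lambda>m. lookup m i"] ij
          by (simp add: lookup_add lookup_single when_def)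
        show ?thesis
        proof (cases "a = ?m")
          case False
          then have "t = 0" using li mn[OF a2(1,2)] by (simp add: b_def)
          then show ?thesis using t False by (simp add: b_def)
        next
          case True
          have "lookup b i = lookup a i + 1" using True ij by (simp add: b_def lookup_add lookup_single when_def)
          then have "t \<le> 1" using li mn[OF a2(1,2)] by simp
          then consider "t = 0" | "t = 1" by linarith
          then show ?thesis
          proof cases
            case 1
            then have "a2 = ?m'" using t True by (simp add: b_def)
            then show ?thesis using a2(1) nm by simp
          next
            case 2
            have "single i 1 + (u + single j 1) = single i 1 + a2" using t True 2 by (simp add: b_def add_ac)
            then have "u + single j 1 = a2" by (rule add_left_imp_eq)
            then show ?thesis using True by (metis add.commute)
          qed
        qed
      qed
      have Eb: "lookup (?E a) b \<noteq> 0"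
      proof (cases "a = ?m")
        case False
        then show ?thesis using mev_ee[OF ij, where 'k = 'k, of a] by (simp add: b_def)
      next
        case True
        have "b + single j 1 = a + single i 1" using True by (simp add: b_def add_ac)
        then have "lookup (?E a) b = of_nat (lookup a j)" using mev_ee[OF ij, where 'k = 'k, of a] by blast
        then show ?thesis using True by (simp add: lookup_add del: of_nat_add)
      qed
      have "(\<Sum>a2\<in>?A. z a2 * M 0 a2 b) = (\<Sum>a2\<in>?A. if a2 = a then z a * M 0 a b else 0)"
      proof (rule sum.cong[OF refl])
        fix a2 assume "a2 \<in> ?A"
        then show "z a2 * M 0 a2 b = (if a2 = a then z a * M 0 a b else 0)" using E[of a2] M0[of a2 b] by auto
      qed
      also have "\<dots> = z a * M 0 a b" using a(1) by (simp add: sum.delta)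
      also have "\<dots> \<noteq> 0" using a Eb M0[OF a(1)] va[OF a(1)] by simp
      finally show False using z[OF bB] by simp
    qed
  qed
  then obtain D where D: "D \<in> Rp" "D 0 \<noteq> 0" "\<forall>s. D s \<noteq> 0 \<longrightarrow>
    (\<forall>z. (\<forall>b\<in>B. (\<Sum>a\<in>?A. z a * M s a b) = 0) \<longrightarrow> (\<forall>a\<in>?A. z a = 0))" by (elim bexE conjE)
  obtain P where P: "D = (\<lambda>s. poly P s)" using D(1) unfolding Rp_def by blast
  have "P * [:0, 1:] \<noteq> 0" using D(2) unfolding P by auto
  then have "finite {s. poly (P * [:0, 1:]) s = 0}" by (rule poly_roots_finite)
  then obtain s where "poly (P * [:0, 1:]) s \<noteq> 0" using infinite_UNIV_char_0[where 'a = 'k]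
    by (metis (mono_tags, lifting) UNIV_eq_I mem_Collect_eq)
  then have s: "s \<noteq> 0" "D s \<noteq> 0" unfolding P by auto
  define t where "t = inverse s"
  have t: "t \<noteq> 0" "t ^ (x + y) * s ^ y = t ^ x" for x y
    using s(1) by (simp_all add: t_def power_add power_inverse)
  define dl where "dl k = const (t ^ wt n d k) * (var k :: 'k S)" for k
  \<comment> \<open>The composite of \<open>U 0 G0\<close>, the torus element and
    \<open>ee i j\<close> as a single matrix: row \<open>q\<close> is scaled by the weight of
    \<open>x_q\<close>, and the scaled row \<open>j\<close> is added to row \<open>i\<close>. It is
    upper triangular because \<open>i < j\<close>.\<close>
  define G where "G = (\<lambda>(q, k). G0 (q, k) * t ^ wt n d q + (if q = i \<and> j \<le> k then G0 (j, k) * t ^ wt n d j else 0))"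
  have GUp: "G \<in> Up" unfolding Up_def
  proof (intro CollectI conjI allI impI)
    fix q
    have "\<not> (q = i \<and> j \<le> q)" using ij by auto
    then show "G (q, q) \<noteq> 0" unfolding G_def prod.case if_not_P[OF \<open>\<not> (q = i \<and> j \<le> q)\<close>]
      using UpD[OF G0(1), of q] t(1) by simp
    show "G (q, k) = 0" if "k < q" for k using that G0(1) ij by (auto simp: G_def Up_def)
  qed
  have UG: "U 0 G k = sb (ee i j) (sb dl (U 0 G0 k))" for k
  proof -
    let ?e = "\<lambda>q. const (G0 (q, k) * t ^ wt n d q) * (var q :: 'k S)"
    let ?x = "const (G0 (j, k) * t ^ wt n d j) * (var i :: 'k S)"
    have "U 0 G k = (\<Sum>q\<in>{0..k}. ?e q + (if q = i then (if j \<le> k then ?x else 0) else 0))"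
      unfolding U_def by (rule sum.cong) (auto simp: G_def single_add distrib_right)
    also have "\<dots> = (\<Sum>q\<in>{0..k}. ?e q) + (if j \<le> k then ?x else 0)"
      using ij by (simp add: sum.distrib sum.delta)
    also have "\<dots> = (\<Sum>q\<in>{0..k}. ?e q + (if q = j then ?x else 0))"
      by (simp add: sum.distrib sum.delta)
    also have "\<dots> = (\<Sum>q\<in>{0..k}. const (G0 (q, k)) * (const (t ^ wt n d q) * ee i j q))"
      by (rule sum.cong) (auto simp: ee_def distrib_left mult_single mult.assoc[symmetric])
    also have "\<dots> = sb (ee i j) (sb dl (U 0 G0 k))"
      by (simp add: U_def sb_sum sb_mult dl_def)
    finally show ?thesis .
  qed
  have sbG: "sb (U 0 G) p = sb (ee i j) (sb dl (sb (U 0 G0) p))" for p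
    unfolding sb_sb UG ..
  have mdl: "mev dl x = const (t ^ ?l x) * monomial x" for x
    unfolding dl_def[abs_def] wts_def by (rule mev_scale)
  have coef: "lookup (sb (ee i j) (sb dl (v a))) b = t ^ ?l a * M s a b" if a: "a \<in> ?A" for a b
  proof -
    have "sb (ee i j) (sb dl (v a)) = (\<Sum>x\<in>keys (v a). const (lookup (v a) x) * (const (t ^ ?l x) * ?E x))"
      unfolding sb_alt[of dl] by (simp add: sb_sum sb_mult mdl sb_single)
    then have "lookup (sb (ee i j) (sb dl (v a))) b = (\<Sum>x\<in>keys (v a). lookup (v a) x * (t ^ ?l x * lookup (?E x) b))"
      by (simp add: lookup_sum)
    also have "\<dots> = (\<Sum>x\<in>keys (v a). t ^ ?l a * (lookup (v a) x * s ^ (?l a - ?l x) * lookup (?E x) b))"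
    proof (rule sum.cong[OF refl])
      fix x assume "x \<in> keys (v a)"
      then have "t ^ ?l a * s ^ (?l a - ?l x) = t ^ ?l x" using t(2)[of "?l x" "?l a - ?l x"] wle[OF a, of x] by simp
      then show "lookup (v a) x * (t ^ ?l x * lookup (?E x) b) = t ^ ?l a * (lookup (v a) x * s ^ (?l a - ?l x) * lookup (?E x) b)"
        by (simp add: mult_ac)
    qed
    finally show ?thesis by (simp add: M_def sum_distrib_left)
  qed
  have "nd 0 (IM F 0 n d) B G"
    unfolding nd_def
  proof (intro ballI impI)
    fix p :: "'k S" assume p: "p \<in> sp (IM F 0 n d)" "\<forall>b\<in>B. lookup (sb (U 0 G) p) b = 0"
    have w: "sb (U 0 G0) p \<in> V" using p(1) by (simp add: V_def)
    have fl: "finite (leads V)" unfolding LV by simp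
    obtain z where z: "sb (U 0 G0) p = (\<Sum>a\<in>leads V. const (z a) * v a)" using basis_span[OF linV fl v w] by (rule exE)
    have "sb (U 0 G) p = (\<Sum>a\<in>?A. const (z a) * sb (ee i j) (sb dl (v a)))"
      unfolding sbG z LV by (simp add: sb_sum sb_mult)
    then have "lookup (sb (U 0 G) p) b = (\<Sum>a\<in>?A. z a * t ^ ?l a * M s a b)" for b
      by (simp add: lookup_sum coef mult.assoc)
    then have "\<forall>b\<in>B. (\<Sum>a\<in>?A. (z a * t ^ ?l a) * M s a b) = 0" using p(2) by simp
    then have "\<forall>a\<in>?A. z a * t ^ ?l a = 0" using D(3)[rule_format, OF s(2), of "\<lambda>a. z a * t ^ ?l a"] by blast
    then have "\<forall>a\<in>?A. z a = 0" using t(1) by simp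
    then have "sb (U 0 G0) p = 0" unfolding z LV by simp
    then show "p = 0" by (rule U_inj[OF G0(1) sp_ge[OF sp_IM_Mon[OF p(1)]]])
  qed
  moreover have cB: "card B = card (IM F 0 n d)"
    using card.remove[OF finite_AS m] nm card_AS[where 'k = 'k, of F n d] by (simp add: B_def)
  ultimately have "mset_set B \<le> mset_set (LA 0 (IM F 0 n d) G)"
    by (intro LA_ge[OF IM_sub GUp]) (simp_all add: B_def)
  also have "\<dots> \<le> mset_set ?A" by (rule AS_ge[OF GUp])
  also have "\<dots> < mset_set B"
  proof -
    have "single j 1 < (single i 1 :: mono)" unfolding less_poly_mapping.rep_eq less_fun_def
      using ij by (intro exI[of _ i]) (auto simp: lookup_single when_def)
    then have mm: "?m < ?m'" by (rule add_strict_right_mono)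
    have fB: "finite B" by (simp add: B_def)
    have "?m' \<in> B - ?A" using nm by (simp add: B_def)
    moreover have "?A - B \<subseteq> {?m}" by (auto simp: B_def)
    ultimately show ?thesis unfolding set_less_iff[OF finite_AS fB] using mm by blast
  qed
  finally show False by simp
qed

text \<open>Raise \<open>m\<close> towards \<open>v\<close> by swaps: at the first index
  \<open>i\<close> of difference, the next variable \<open>x_j\<close> of \<open>m\<close> is
  replaced by \<open>x_i\<close>. From \<open>Suc i\<close> to \<open>j\<close> the prefix counts of
  \<open>m\<close> are constant and below those of \<open>v\<close>, so adding one keeps
  \<open>v\<close> dominant.\<close>

lemma AS_dom:
  assumes "m \<in> AS TYPE('k::field_char_0) F n d" "v \<in> Mon 0 n d" "\<forall>k. pref m k \<le> pref v k"
  shows "v \<in> AS TYPE('k) F n d"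
  using assms
proof (induction "\<Sum>k<n. pref v k - pref m k" arbitrary: m rule: less_induct)
  case less
  have mM: "m \<in> Mon 0 n d" using less.prems(1) AS_sub by blast
  show ?case
  proof (cases "m = v")
    case True
    then show ?thesis using less.prems by simp
  next
    case False
    have ex: "\<exists>i. lookup m i \<noteq> lookup v i"
    proof (rule ccontr)
      assume "\<not> ?thesis"
      then have "m = v" by (intro poly_mapping_eqI) simp
      with False show False by simp
    qed
    define i where "i = (LEAST i. lookup m i \<noteq> lookup v i)"
    have i: "lookup m i \<noteq> lookup v i" unfolding i_def using ex by (rule LeastI_ex)
    have j: "lookup m j = lookup v j" if "j < i" for j using not_less_Least[of j] that unfolding i_def by blast
    have pi: "pref m i = pref v i" unfolding pref_def by (rule sum.cong) (simp_all add: j)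
    have "pref m (Suc i) \<noteq> pref v (Suc i)" using pi i by (simp add: pref_Suc)
    then have lt: "pref m (Suc i) < pref v (Suc i)" using less.prems(3)[rule_format, of "Suc i"] by simp
    have "\<not> keys m \<subseteq> {..<Suc i}"
    proof
      assume "keys m \<subseteq> {..<Suc i}"
      then have "pref m (Suc i) = mdeg m" by (rule pref_eq_mdeg)
      then have "pref m (Suc i) = mdeg v" using mM less.prems(2) by (simp add: Mon_def)
      then show False using lt pref_le_mdeg[of v "Suc i"] by simp
    qed
    then have ne: "{j\<in>keys m. i < j} \<noteq> {}" by (auto simp: not_less less_Suc_eq_le)
    define j where "j = Min {j\<in>keys m. i < j}"
    have "j \<in> {j\<in>keys m. i < j}" unfolding j_def by (rule Min_in[OF _ ne]) simp
    then have jm: "j \<in> keys m" "i < j" by simp_all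
    have jn: "j < n" using jm(1) mM by (auto simp: Mon_def)
    have jmin: "j \<le> l" if "l \<in> keys m" "i < l" for l unfolding j_def by (rule Min_le) (use that in auto)
    obtain u where u: "m = single j 1 + u" using mono_split[OF jm(1)] by blast
    let ?m' = "single i 1 + u"
    have mem: "?m' \<in> AS TYPE('k) F n d" by (rule AS_swap[OF _ jm(2)]) (use less.prems(1) u in simp)
    have flat: "pref m k = pref m (Suc i)" if "i < k" "k \<le> j" for k
    proof -
      have "pref m k = (\<Sum>l\<in>{..<Suc i} \<union> {Suc i..<k}. lookup m l)" unfolding pref_def
        by (rule sum.cong) (use that in auto)
      also have "\<dots> = pref m (Suc i) + (\<Sum>l\<in>{Suc i..<k}. lookup m l)" unfolding pref_def
        by (rule sum.union_disjoint) auto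
      also have "(\<Sum>l\<in>{Suc i..<k}. lookup m l) = 0"
      proof (rule sum.neutral, rule ballI)
        fix l assume l: "l \<in> {Suc i..<k}"
        then have "l \<notin> keys m" using jmin[of l] that by auto
        then show "lookup m l = 0" by (simp add: in_keys_iff)
      qed
      finally show ?thesis by simp
    qed
    have p': "pref ?m' k = pref m k + (if i < k \<and> k \<le> j then 1 else 0)" for k
      unfolding u using jm(2) by auto
    have dom: "pref ?m' k \<le> pref v k" for k
    proof (cases "i < k \<and> k \<le> j")
      case True
      then have "pref m k < pref v k" using flat[of k] lt pref_mono[of "Suc i" k v] by simp
      then show ?thesis using p'[of k] True by simp
    next
      case False
      then show ?thesis unfolding p'[of k] using less.prems(3) by auto
    qed
    have "(\<Sum>k<n. pref v k - pref ?m' k) < (\<Sum>k<n. pref v k - pref m k)"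
    proof (rule sum_strict_mono_ex1)
      show "\<forall>k\<in>{..<n}. pref v k - pref ?m' k \<le> pref v k - pref m k" using p' by (simp add: diff_le_mono2)
      show "\<exists>k\<in>{..<n}. pref v k - pref ?m' k < pref v k - pref m k"
        by (rule bexI[of _ "Suc i"]) (use p'[of "Suc i"] jm jn lt in auto)
    qed simp
    then show ?thesis by (rule less.hyps[OF _ mem less.prems(2)]) (use dom in blast)
  qed
qed

section \<open>From strongly stable sets of monomials to squarefree families\<close>

text \<open>Strong stability in terms of dominance instead of single swaps, the form in which
  \<open>PhiS_dom\<close> can use it.\<close>

definition stable :: "mono set \<Rightarrow> bool" where
  "stable M \<longleftrightarrow> (\<forall>m\<in>M. \<forall>w. w + m \<in> M) \<and>
     (\<forall>m\<in>M. \<forall>v. mdeg v = mdeg m \<and> (\<forall>k. pref m k \<le> pref v k) \<longrightarrow> v \<in> M)"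

lemma stable_mult: "stable M \<Longrightarrow> m \<in> M \<Longrightarrow> w + m \<in> M"
  and stable_dom: "stable M \<Longrightarrow> m \<in> M \<Longrightarrow> mdeg v = mdeg m \<Longrightarrow> (\<And>k. pref m k \<le> pref v k) \<Longrightarrow> v \<in> M"
  unfolding stable_def by (blast, meson)

lemma stable_PhiS_dom:
  assumes M: "stable M" and m: "m \<in> M" and T: "finite T" "card T = mdeg m"
    and dom: "\<And>k. card (PhiS m \<inter> {..<k}) \<le> card (T \<inter> {..<k})"
  obtains u where "u \<in> M" "PhiS u = T" "\<forall>y. T \<subseteq> {..<y} \<longrightarrow> keys u \<subseteq> {..y - card T}"
proof -
  obtain u where u: "PhiS u = T \<and> (\<forall>y. T \<subseteq> {..<y} \<longrightarrow> keys u \<subseteq> {..y - card T})"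
    using PhiS_surj[OF T(1)] by (rule exE)
  have "mdeg u = mdeg m" using card_PhiS[of u] u T by simp
  moreover have "pref m k \<le> pref u k" for k by (rule PhiS_dom) (use dom u in simp)
  ultimately have "u \<in> M" by (rule stable_dom[OF M m])
  then show thesis using that u by blast
qed

text \<open>Without its maximum \<open>t\<close> the enlarged set still dominates the old one and
  has its size, hence is the image of a member of \<open>M\<close>. Multiplying that member by one
  last variable adds \<open>t\<close>.\<close>

lemma stable_insert:
  assumes M: "stable M" and T: "T \<in> PhiS ` M" and e: "e \<notin> T"
  shows "insert e T \<in> PhiS ` M"
proof -
  obtain m where m: "m \<in> M" "T = PhiS m" using T by blast
  have fT: "finite T" "card T = mdeg m" using m by simp_all
  define T' where "T' = insert e T"
  define t where "t = Max T'"
  define T2 where "T2 = T' - {t}"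
  have T': "finite T'" "T' \<noteq> {}" "card T' = Suc (card T)" using fT e by (simp_all add: T'_def)
  have t: "t \<in> T'" "\<And>x. x \<in> T' \<Longrightarrow> x \<le> t" using Max_in[OF T'(1,2)] T'(1) by (simp_all add: t_def)
  have T2: "finite T2" "card T2 = card T" "T' = insert t T2" "T2 \<subseteq> {..<t}"
    using T' t by (auto simp: T2_def order.strict_iff_order)
  have dom: "card (PhiS m \<inter> {..<k}) \<le> card (T2 \<inter> {..<k})" for k
  proof (cases "k \<le> t")
    case True
    have "PhiS m \<inter> {..<k} \<subseteq> T2 \<inter> {..<k}" using True m(2) by (auto simp: T2_def T'_def)
    then show ?thesis using T2(1) by (intro card_mono) auto
  next
    case False
    then have "T2 \<inter> {..<k} = T2" using T2(4) by auto
    then show ?thesis using T2(2) m(2) card_mono[OF fT(1), of "PhiS m \<inter> {..<k}"] by simp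
  qed
  have c2: "card T2 = mdeg m" using T2(2) fT(2) by simp
  obtain u where u: "u \<in> M" "PhiS u = T2" "\<forall>y. T2 \<subseteq> {..<y} \<longrightarrow> keys u \<subseteq> {..y - card T2}"
    by (rule stable_PhiS_dom[OF M m(1) T2(1) c2 dom])
  have ku: "keys u \<subseteq> {..t - card T2}" using u(3) T2(4) by blast
  have "card T2 \<le> card {..<t}" using T2(4) by (intro card_mono) auto
  then have le: "card T2 \<le> t" by simp
  have "mdeg u = card T2" using card_PhiS[of u] u(2) by simp
  then have "PhiS (u + single (t - card T2) 1) = T'" using PhiS_snoc[OF ku] u(2) T2(3) le by simp
  moreover have "u + single (t - card T2) 1 \<in> M"
    using stable_mult[OF M u(1), of "single (t - card T2) 1"] by (simp add: add.commute)
  ultimately show ?thesis unfolding T'_def[symmetric] by (metis imageI)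
qed

lemma fam_PhiS: assumes M: "stable M" shows "fam 0 (PhiS ` M)"
proof (rule famI)
  fix T assume T: "T \<in> PhiS ` M"
  show fT: "finite T" using T by auto
  show "T \<subseteq> {0..}" by simp
  show "T' \<in> PhiS ` M" if "T \<subseteq> T'" "finite T'" "T' \<subseteq> {0..}" for T'
  proof -
    have "T \<union> X \<in> PhiS ` M" if "finite X" for X
      using that
    proof (induction X rule: finite_induct)
      case empty
      then show ?case using T by simp
    next
      case (insert x X)
      then show ?case using stable_insert[OF M insert.IH, of x] T by (cases "x \<in> T \<union> X") (simp_all add: insert_absorb)
    qed
    from this[of T'] that show ?thesis by (simp add: Un_absorb1)
  qed
  show "insert i (T - {j}) \<in> PhiS ` M" if j: "j \<in> T" "0 \<le> i" "i < j" "i \<notin> T" for i j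
  proof -
    obtain m where m: "m \<in> M" "T = PhiS m" using T by blast
    let ?T = "insert i (T - {j})"
    have c: "card ?T = mdeg m" using card.remove[OF fT j(1)] j(4) fT m(2) by simp
    have "card (PhiS m \<inter> {..<k}) \<le> card (?T \<inter> {..<k})" for k
    proof (cases "j < k")
      case True
      then have "?T \<inter> {..<k} = insert i (T \<inter> {..<k} - {j})" using j(3) by auto
      moreover have "card (insert i (T \<inter> {..<k} - {j})) = card (T \<inter> {..<k})"
        using card.remove[of "T \<inter> {..<k}" j] fT j True by simp
      ultimately show ?thesis using m(2) by simp
    next
      case False
      then have "T \<inter> {..<k} \<subseteq> ?T \<inter> {..<k}" by auto
      then show ?thesis unfolding m(2)[symmetric] using fT by (intro card_mono) auto
    qed
    then obtain u where "u \<in> M" "PhiS u = ?T" using stable_PhiS_dom[OF M m(1) _ c] fT by (metis finite_Diff finite_insert)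
    then show ?thesis by (metis imageI)
  qed
qed

lemma stable_prefix:
  assumes M: "stable M" and m: "m \<in> M"
  shows "\<exists>m0 m1 a. m = m0 + m1 \<and> keys m0 \<subseteq> {..a} \<and> keys m1 \<subseteq> {a..} \<and> m0 \<in> M \<and>
    (\<forall>m' w. m' \<in> M \<and> m0 = m' + w \<longrightarrow> m' = m0)"
  using m
proof (induction m rule: mono_back)
  case zero
  have "m' = 0" if "0 = m' + w" for m' w :: mono using arg_cong[OF that, of mdeg] by simp
  then show ?case using zero by (intro exI[of _ 0]) auto
next
  case (add a u)
  show ?case
  proof (cases "\<forall>m' w. m' \<in> M \<and> u + single a 1 = m' + w \<longrightarrow> m' = u + single a 1")
    case True
    then show ?thesis using add.hyps add.prems
      by (intro exI[of _ "u + single a 1"] exI[of _ 0] exI[of _ a]) (simp add: mono_keys_add)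
  next
    case False
    then obtain m' w where w: "m' \<in> M" "u + single a 1 = m' + w" "m' \<noteq> u + single a 1" by blast
    then have "w \<noteq> 0" by auto
    then have "mdeg w \<noteq> 0" by simp
    then have "keys w \<noteq> {}" unfolding mdeg_def by auto
    then obtain x where x: "x \<in> keys w" by blast
    obtain w' where w': "w = single x 1 + w'" using mono_split[OF x] by blast
    have "x \<in> keys (u + single a 1)" using x unfolding w(2) mono_keys_add by blast
    then have xa: "x \<le> a" using add.hyps by (auto simp: mono_keys_add)
    have v: "w' + m' \<in> M" by (rule stable_mult[OF M w(1)])
    have eq: "u + single a 1 = (w' + m') + single x 1" using w(2) unfolding w' by (simp add: add_ac)
    have uM: "u \<in> M"
    proof (rule stable_dom[OF M v])
      show "mdeg u = mdeg (w' + m')" using arg_cong[OF eq, of mdeg] by simp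
      show "pref (w' + m') k \<le> pref u k" for k
        using arg_cong[OF eq, of "\<lambda>m. pref m k"] xa by (auto simp del: pref_add simp: pref_add[of _ "single _ _"] split: if_splits)
    qed
    obtain m0 m1 b where IH: "u = m0 + m1" "keys m0 \<subseteq> {..b}" "keys m1 \<subseteq> {b..}" "m0 \<in> M"
      "\<forall>m' w. m' \<in> M \<and> m0 = m' + w \<longrightarrow> m' = m0" using add.IH[OF uM] by (elim exE conjE)
    have "keys m0 \<subseteq> {..a}" using add.hyps unfolding IH(1) mono_keys_add by simp
    then have "keys m0 \<subseteq> {..min a b}" "keys (m1 + single a 1) \<subseteq> {min a b..}"
      using IH(2,3) by (auto simp: mono_keys_add)
    moreover have "u + single a 1 = m0 + (m1 + single a 1)" by (simp add: IH(1) add.assoc)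
    ultimately show ?thesis using IH(4,5) by (intro exI[of _ m0] exI[of _ "m1 + single a 1"] exI[of _ "min a b"] conjI)
  qed
qed

text \<open>The shift raises an index by less than the degree; a prefix in the first
  \<open>n\<close> variables of degree at most \<open>D\<close> therefore has its shifted set below
  \<open>n + D\<close>.\<close>

lemma bnd_PhiS:
  assumes M: "stable M"
    and g: "\<And>m. m \<in> M \<Longrightarrow> mdeg m \<le> d \<Longrightarrow> \<exists>m0 m1 a. m = m0 + m1 \<and> keys m0 \<subseteq> {..a} \<and> keys m1 \<subseteq> {a..} \<and>
      m0 \<in> M \<and> keys m0 \<subseteq> {..<n} \<and> mdeg m0 \<le> D"
  shows "bnd (PhiS ` M) d (n + D)"
  unfolding bnd_def
proof (intro ballI impI)
  fix T assume T: "T \<in> PhiS ` M" "card T \<le> d"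
  then obtain m where m: "m \<in> M" "T = PhiS m" "mdeg m \<le> d" by auto
  obtain m0 m1 a where h: "m = m0 + m1" "keys m0 \<subseteq> {..a}" "keys m1 \<subseteq> {a..}" "m0 \<in> M" "keys m0 \<subseteq> {..<n}" "mdeg m0 \<le> D"
    using g[OF m(1,3)] by (elim exE conjE)
  have "PhiS m0 \<subseteq> T" using PhiS_split[OF h(2,3)] m(2) h(1) by simp
  moreover have "PhiS m0 \<subseteq> {..<n + D}" using PhiS_less[OF h(5)] h(6) by fastforce
  ultimately have s: "PhiS m0 \<subseteq> T \<inter> {..<n + D}" by blast
  have "PhiS m0 \<in> PhiS ` M" using h(4) by blast
  from famD(3)[OF fam_PhiS[OF M] this s] show "T \<inter> {..<n + D} \<in> PhiS ` M" using m(2) by simp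
qed

section \<open>Ideals with finitely many generators and equal Hilbert functions\<close>

definition SM :: "nat set \<Rightarrow> nat \<Rightarrow> mono set" where
  "SM T d = {m. keys m = T \<and> mdeg m = d}"

lemma finite_SM: assumes "finite T" shows "finite (SM T d)"
proof -
  obtain n where "T \<subseteq> {..<n}" using finite_nat_iff_bounded[of T] assms by auto
  then have "SM T d \<subseteq> Mon 0 n d" by (auto simp: SM_def Mon_def)
  then show ?thesis by (rule finite_subset) simp
qed

lemma card_SM_le:
  assumes fin: "finite T" "finite T'" and c: "card T = card T'"
  shows "card (SM T d) \<le> card (SM T' d)"
proof -
  obtain h where h: "bij_betw h T' T" using finite_same_card_bij[OF fin(2,1)] c by auto
  define g where "g m = (\<Sum>i\<in>T'. single i (lookup m (h i)))" for m :: mono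
  have lg: "lookup (g m) i = (if i \<in> T' then lookup m (h i) else 0)" for m i
    using fin(2) by (simp add: g_def lookup_sum lookup_single when_def sum.delta)
  have hT: "h i \<in> T" if "i \<in> T'" for i using h that by (auto simp: bij_betw_def)
  show ?thesis
  proof (rule card_inj_on_le[of g])
    show "finite (SM T' d)" by (rule finite_SM[OF fin(2)])
    show "inj_on g (SM T d)"
    proof (rule inj_onI, rule poly_mapping_eqI)
      fix m m' k assume m: "m \<in> SM T d" "m' \<in> SM T d" "g m = g m'"
      show "lookup m k = lookup m' k"
      proof (cases "k \<in> T")
        case True
        then obtain i where "i \<in> T'" "h i = k" using h by (auto simp: bij_betw_def)
        then show ?thesis using lg[of m i] lg[of m' i] m(3) by simp
      next
        case False
        then have "k \<notin> keys m" "k \<notin> keys m'" using m by (auto simp: SM_def)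
        then show ?thesis by (simp add: in_keys_iff)
      qed
    qed
    show "g ` SM T d \<subseteq> SM T' d"
    proof
      fix x assume "x \<in> g ` SM T d"
      then obtain m where m: "x = g m" "keys m = T" "mdeg m = d" by (auto simp: SM_def)
      have "keys x = T'"
      proof
        show "keys x \<subseteq> T'" using lg[of m] by (auto simp: m(1) in_keys_iff split: if_splits)
        show "T' \<subseteq> keys x"
        proof
          fix i assume i: "i \<in> T'"
          then have "h i \<in> keys m" using hT m(2) by simp
          then show "i \<in> keys x" using i lg[of m i] by (simp add: m(1) in_keys_iff)
        qed
      qed
      moreover have "mdeg x = d"
      proof -
        have "mdeg x = (\<Sum>i\<in>T'. lookup m (h i))" unfolding mdeg_def \<open>keys x = T'\<close>
          by (rule sum.cong) (simp_all add: m(1) lg)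
        also have "\<dots> = (\<Sum>k\<in>T. lookup m k)" by (rule sum.reindex_bij_betw[OF h])
        finally show ?thesis using m(2,3) by (simp add: mdeg_def)
      qed
      ultimately show "x \<in> SM T' d" by (simp add: SM_def)
    qed
  qed
qed

definition nu :: "nat \<Rightarrow> nat \<Rightarrow> nat" where
  "nu k d = card (SM {..<k} d)"

lemma card_SM: "finite T \<Longrightarrow> card (SM T d) = nu (card T) d"
  unfolding nu_def by (intro antisym card_SM_le) simp_all

lemma SM_diag: assumes "finite T" shows "SM T (card T) = {xm T}"
proof -
  have "m = xm T" if m: "keys m = T" "mdeg m = card T" for m
  proof -
    have "(\<Sum>i\<in>T. lookup m i) = (\<Sum>i\<in>T. 1)" using m by (simp add: mdeg_def)
    moreover have ge: "1 \<le> lookup m i" if "i \<in> T" for i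
      using that m(1) in_keys_iff[of i m] by (simp add: Suc_le_eq One_nat_def)
    ultimately have "lookup m i = 1" if "i \<in> T" for i
      using sum_mono_inv[of "\<lambda>_. 1" T "lookup m" i] that assms by simp
    moreover have "lookup m i = 0" if "i \<notin> T" for i using that m(1) in_keys_iff[of i m] by simp
    ultimately show ?thesis by (intro poly_mapping_eqI) (simp add: lookup_xm[OF assms])
  qed
  then show ?thesis using assms by (auto simp: SM_def)
qed

lemma nu_diag: "nu k k = 1"
  using SM_diag[of "{..<k}"] by (simp add: nu_def)

definition fv :: "nat set set \<Rightarrow> nat \<Rightarrow> nat \<Rightarrow> nat \<Rightarrow> nat" where
  "fv F a n k = card {T\<in>F. T \<subseteq> {a..<n} \<and> card T = k}"

lemma card_IM_fv:
  "card (IM F 0 n d) = (\<Sum>k\<in>{..d}. fv F 0 n k * nu k d)"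
proof -
  let ?X = "\<lambda>k. {T\<in>F. T \<subseteq> {0..<n} \<and> card T = k}"
  have fX: "finite (?X k)" for k by (rule finite_subset[of _ "Pow {0..<n}"]) auto
  have fT: "finite T" if "T \<in> ?X k" for T k using that finite_subset[of T "{0..<n}"] by simp
  have fS: "finite (SM T d)" if "T \<in> ?X k" for T k by (rule finite_SM[OF fT[OF that]])
  have "IM F 0 n d = (\<Union>k\<in>{..d}. \<Union>T\<in>?X k. SM T d)"
  proof
    show "IM F 0 n d \<subseteq> (\<Union>k\<in>{..d}. \<Union>T\<in>?X k. SM T d)"
    proof
      fix m assume "m \<in> IM F 0 n d"
      then have m: "keys m \<in> F" "keys m \<subseteq> {0..<n}" "mdeg m = d" by (simp_all add: IM_def Mon_def)
      then have "m \<in> SM (keys m) d" "card (keys m) \<le> d" using card_keys_le[of m] by (simp_all add: SM_def)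
      then show "m \<in> (\<Union>k\<in>{..d}. \<Union>T\<in>?X k. SM T d)" using m by auto
    qed
    show "(\<Union>k\<in>{..d}. \<Union>T\<in>?X k. SM T d) \<subseteq> IM F 0 n d" by (auto simp: SM_def IM_def Mon_def)
  qed
  also have "card \<dots> = (\<Sum>k\<in>{..d}. card (\<Union>T\<in>?X k. SM T d))"
  proof (rule card_UN_disjoint)
    show "\<forall>k\<in>{..d}. finite (\<Union>T\<in>?X k. SM T d)" by (intro ballI finite_UN_I fX fS)
    show "\<forall>k\<in>{..d}. \<forall>k'\<in>{..d}. k \<noteq> k' \<longrightarrow> (\<Union>T\<in>?X k. SM T d) \<inter> (\<Union>T\<in>?X k'. SM T d) = {}"
      by (auto simp: SM_def)
  qed simp
  also have "\<dots> = (\<Sum>k\<in>{..d}. fv F 0 n k * nu k d)"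
  proof (rule sum.cong[OF refl])
    fix k
    have "card (\<Union>T\<in>?X k. SM T d) = (\<Sum>T\<in>?X k. card (SM T d))"
    proof (rule card_UN_disjoint[OF fX])
      show "\<forall>T\<in>?X k. finite (SM T d)" by (intro ballI fS)
      show "\<forall>T\<in>?X k. \<forall>T'\<in>?X k. T \<noteq> T' \<longrightarrow> SM T d \<inter> SM T' d = {}" by (auto simp: SM_def)
    qed
    also have "\<dots> = (\<Sum>T\<in>?X k. nu k d)"
    proof (rule sum.cong[OF refl])
      fix T assume T: "T \<in> ?X k"
      then show "card (SM T d) = nu k d" using card_SM[OF fT[OF T], of d] by simp
    qed
    finally show "card (\<Union>T\<in>?X k. SM T d) = fv F 0 n k * nu k d" by (simp add: fv_def)
  qed
  finally show ?thesis .
qed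

text \<open>Since \<open>nu k k = 1\<close>, the numbers of monomials depend on those of squarefree
  monomials by a unitriangular system, which is solved degree by degree.\<close>

lemma fv_eq:
  assumes "\<And>d. card (IM F 0 n d) = card (IM F' 0 n d)"
  shows "fv F 0 n d = fv F' 0 n d"
proof (induction d rule: less_induct)
  case (less d)
  have "{..d} = insert d {..<d}" by auto
  then have e: "card (IM G 0 n d) = fv G 0 n d + (\<Sum>k<d. fv G 0 n k * nu k d)" for G
    unfolding card_IM_fv by (simp add: nu_diag)
  have "(\<Sum>k<d. fv F 0 n k * nu k d) = (\<Sum>k<d. fv F' 0 n k * nu k d)"
    by (rule sum.cong) (simp_all add: less)
  then show ?case using e[of F] e[of F'] assms[of d] by simp
qed

section \<open>Lexsegments among strongly stable families with the same numbers\<close>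

definition lexseg :: "nat \<Rightarrow> nat set set \<Rightarrow> bool" where
  "lexseg a F \<longleftrightarrow> (\<forall>T\<in>F. \<forall>T' i. finite T' \<and> T' \<subseteq> {a..} \<and> card T' = card T \<and> i \<in> T' \<and> i \<notin> T \<and>
     (\<forall>j<i. j \<in> T' \<longleftrightarrow> j \<in> T) \<longrightarrow> T' \<in> F)"

lemma lexsegD:
  "lexseg a F \<Longrightarrow> T \<in> F \<Longrightarrow> finite T' \<Longrightarrow> T' \<subseteq> {a..} \<Longrightarrow> card T' = card T \<Longrightarrow> i \<in> T' \<Longrightarrow> i \<notin> T \<Longrightarrow>
   (\<And>j. j < i \<Longrightarrow> j \<in> T' \<longleftrightarrow> j \<in> T) \<Longrightarrow> T' \<in> F"
  unfolding lexseg_def by (drule (1) bspec, drule spec, drule spec, erule mp) (intro conjI allI impI)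

definition dn :: "nat \<Rightarrow> nat set \<Rightarrow> nat set" where
  "dn a S = (\<lambda>x. x - 1) ` (S - {a})"

lemma dn_props:
  assumes S: "finite S" "S \<subseteq> {a..}" "a \<in> S"
  shows "S = insert a (Suc ` dn a S)" "dn a S \<subseteq> {a..}" "finite (dn a S)"
proof -
  have g: "a < x" if "x \<in> S - {a}" for x using S that by (auto simp: order.strict_iff_order)
  have "Suc ` dn a S = (\<lambda>x. x) ` (S - {a})" unfolding dn_def image_image
  proof (rule image_cong[OF refl])
    show "Suc (x - 1) = x" if "x \<in> S - {a}" for x using g[OF that] by simp
  qed
  then have "Suc ` dn a S = S - {a}" by simp
  then show "S = insert a (Suc ` dn a S)" using S(3) by auto
  show "dn a S \<subseteq> {a..}" using g by (force simp: dn_def)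
  show "finite (dn a S)" using S by (simp add: dn_def)
qed

lemma card_up:
  assumes "finite S" "S \<subseteq> {a..}" shows "card (insert a (Suc ` S)) = Suc (card S)"
proof -
  have "a \<notin> Suc ` S" using assms(2) by auto
  then show ?thesis using assms(1) by (simp add: card_image)
qed

text \<open>The first variable is decided by the counts. If \<open>{a}\<close> is in
  \<open>F'\<close>, a member of \<open>F\<close> of size one moves left to \<open>{a}\<close>, and
  only \<open>F0\<close> remains to be compared. Otherwise every member of both families contains
  \<open>a\<close>, and \<open>F1\<close> remains, with one variable less.\<close>

lemma families_eq:
  assumes "fam a F" "fam a F'" "a \<le> n" "\<And>d. bnd F d n" "\<And>d. bnd F' d n" "lexseg a F'"
    "\<And>d. fv F a n d = fv F' a n d"
  shows "F = F'"
  using assms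
proof (induction "n - a" arbitrary: a n F F')
  case 0
  then have an: "a = n" by simp
  have E: "G = {T. finite T \<and> T \<subseteq> {a..} \<and> {} \<in> G}" if G: "fam a G" "\<And>d. bnd G d n" for G
  proof
    show "G \<subseteq> {T. finite T \<and> T \<subseteq> {a..} \<and> {} \<in> G}"
    proof
      fix T assume T: "T \<in> G"
      note t = famD(1,2)[OF G(1) T]
      have "T \<inter> {..<n} \<in> G" using G(2)[of "card T"] T by (simp add: bnd_def)
      moreover have "T \<inter> {..<n} = {}" using t an by auto
      ultimately show "T \<in> {T. finite T \<and> T \<subseteq> {a..} \<and> {} \<in> G}" using t by simp
    qed
    show "{T. finite T \<and> T \<subseteq> {a..} \<and> {} \<in> G} \<subseteq> G" using famD(3)[OF G(1), of "{}"] by auto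
  qed
  have N: "fv G a n 0 = (if {} \<in> G then 1 else 0)" for G
  proof -
    have "{T\<in>G. T \<subseteq> {a..<n} \<and> card T = 0} = (if {} \<in> G then {{}} else {})" using an by auto
    then show ?thesis by (simp add: fv_def)
  qed
  have "{} \<in> F \<longleftrightarrow> {} \<in> F'" using 0(8)[of 0] by (auto simp: N split: if_splits)
  then show ?case using E[OF 0(2,5)] E[OF 0(3,6)] by auto
next
  case (Suc k)
  note IH = Suc.hyps(1) and F = Suc.prems(1) and F' = Suc.prems(2) and bF = Suc.prems(4) and bF' = Suc.prems(5)
    and lex = Suc.prems(6) and cnt = Suc.prems(7)
  have an: "a < n" using Suc.hyps(2) by simp
  have fin: "finite {T\<in>G. T \<subseteq> {a..<n} \<and> card T = d}" for G d
    by (rule finite_subset[of _ "Pow {a..<n}"]) auto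
  show ?case
  proof (cases "{a} \<in> F'")
    case True
    have "fv F a n 1 \<noteq> 0"
    proof -
      have "{a} \<in> {T\<in>F'. T \<subseteq> {a..<n} \<and> card T = 1}" using True an by auto
      then have "{T\<in>F'. T \<subseteq> {a..<n} \<and> card T = 1} \<noteq> {}" by blast
      then have "fv F' a n 1 \<noteq> 0" unfolding fv_def card_0_eq[OF fin] .
      then show ?thesis using cnt[of 1] by simp
    qed
    then have "{T\<in>F. T \<subseteq> {a..<n} \<and> card T = 1} \<noteq> {}" unfolding fv_def card_0_eq[OF fin] .
    then obtain T where T: "T \<in> F" "card T = 1" by blast
    then obtain x where x: "{x} \<in> F" using card_1_singletonE[of T] by auto
    have aF: "{a} \<in> F"
    proof (cases "x = a")
      case False
      then have "a < x" using famD(2)[OF F x] by simp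
      then show ?thesis using famD(4)[OF F x, of x a] False by simp
    qed (use x in simp)
    have D: "T \<in> G \<longleftrightarrow> (finite T \<and> T \<subseteq> {a..} \<and> a \<in> T) \<or> T \<in> F0 a G" if G: "fam a G" "{a} \<in> G" for G T
      using famD(1,2)[OF G(1), of T] famD(3)[OF G, of T] by (auto simp: F0_def)
    have C: "fv G a n d = card {T. T \<subseteq> {a..<n} \<and> a \<in> T \<and> card T = d} + fv (F0 a G) (Suc a) n d"
      if G: "fam a G" "{a} \<in> G" for G d
    proof -
      have m: "T \<in> G" if "T \<subseteq> {a..<n}" "a \<in> T" for T
      proof -
        have "finite T" "T \<subseteq> {a..}" using that(1) finite_subset[of T "{a..<n}"] by auto
        then show ?thesis using D[OF G, of T] that(2) by blast
      qed
      have "{T\<in>G. T \<subseteq> {a..<n} \<and> card T = d} =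
        {T. T \<subseteq> {a..<n} \<and> a \<in> T \<and> card T = d} \<union> {T\<in>F0 a G. T \<subseteq> {Suc a..<n} \<and> card T = d}" (is "?L = ?R1 \<union> ?R2")
      proof
        have "T \<subseteq> {Suc a..<n}" if "T \<subseteq> {a..<n}" "a \<notin> T" for T
        proof
          fix x assume "x \<in> T"
          then have "a \<le> x" "x < n" "x \<noteq> a" using that by auto
          then show "x \<in> {Suc a..<n}" by simp
        qed
        then show "?L \<subseteq> ?R1 \<union> ?R2" unfolding F0_def by blast
        have "{Suc a..<n} \<subseteq> {a..<n}" by auto
        then show "?R1 \<union> ?R2 \<subseteq> ?L" using m unfolding F0_def by blast
      qed
      moreover have "card (?R1 \<union> ?R2) = card ?R1 + card ?R2"
        by (rule card_Un_disjoint) (auto simp: F0_def intro: finite_subset[of _ "Pow {a..<n}"] finite_subset[of _ "Pow {Suc a..<n}"])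
      ultimately show ?thesis unfolding fv_def by simp
    qed
    have "F0 a F = F0 a F'"
    proof (rule IH[of n "Suc a"])
      show "k = n - Suc a" using Suc.hyps(2) by simp
      show "fam (Suc a) (F0 a F)" "fam (Suc a) (F0 a F')" by (rule fam_F0[OF F], rule fam_F0[OF F'])
      show "Suc a \<le> n" using an by simp
      show "bnd (F0 a F) d n" "bnd (F0 a F') d n" for d by (rule bnd_F0[OF bF], rule bnd_F0[OF bF'])
      show "fv (F0 a F) (Suc a) n d = fv (F0 a F') (Suc a) n d" for d
        using C[OF F aF, of d] C[OF F' True, of d] cnt[of d] by simp
      show "lexseg (Suc a) (F0 a F')"
        unfolding lexseg_def
      proof (intro ballI allI impI)
        fix T T' i assume T: "T \<in> F0 a F'" and h: "finite T' \<and> T' \<subseteq> {Suc a..} \<and> card T' = card T \<and> i \<in> T' \<and> i \<notin> T \<and>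
          (\<forall>j<i. j \<in> T' \<longleftrightarrow> j \<in> T)"
        have TF: "T \<in> F'" using T by (simp add: F0_def)
        have s: "T' \<subseteq> {a..}" "a \<notin> T'" using h by (auto simp: subset_iff)
        have "T' \<in> F'" by (rule lexsegD[OF lex TF _ s(1)]) (use h in blast)+
        then show "T' \<in> F0 a F'" using s(2) by (simp add: F0_def)
      qed
    qed
    then have "T \<in> F \<longleftrightarrow> T \<in> F'" for T using D[OF F aF, of T] D[OF F' True, of T] by blast
    then show ?thesis by blast
  next
    case False
    have a1: "a \<in> T" if T: "T \<in> F'" for T
    proof (rule ccontr)
      assume aT: "a \<notin> T"
      note t = famD(1,2)[OF F' T]
      show False
      proof (cases "T = {}")
        case True
        then show False using famD(3)[OF F' T, of "{a}"] \<open>{a} \<notin> F'\<close> by simp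
      next
        case False
        \<comment> \<open>Padding with indices from \<open>n\<close> on keeps the size of
          \<open>T\<close>; the bound, uniform in the degree, then cuts the set down to
          \<open>{a}\<close>.\<close>
        let ?T = "insert a {n..<n + (card T - 1)}"
        have "card T > 0" using False t(1) by (simp add: card_gt_0_iff)
        then have c: "card ?T = card T" using an by simp
        have "?T \<in> F'"
        proof (rule lexsegD[OF lex T _ _ c, of a])
          show "?T \<subseteq> {a..}" using an by auto
          show "j \<in> ?T \<longleftrightarrow> j \<in> T" if "j < a" for j using that t(2) an by auto
        qed (use aT in simp_all)
        then have "?T \<inter> {..<n} \<in> F'" using bF'[of "card ?T"] unfolding bnd_def by blast
        moreover have "?T \<inter> {..<n} = {a}" using an by auto
        ultimately show False using \<open>{a} \<notin> F'\<close> by simp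
      qed
    qed
    have a2: "a \<in> T" if T: "T \<in> F" for T
    proof (rule ccontr)
      assume aT: "a \<notin> T"
      note t = famD(1,2)[OF F T]
      \<comment> \<open>A member of \<open>F\<close> avoiding \<open>a\<close> puts
        \<open>?W\<close> into \<open>F\<close>. Strong stability then gives all subsets of the
        range of this size, equal counts give the same for \<open>F'\<close>, and \<open>?W\<close>
        lacks \<open>a\<close>.\<close>
      let ?W = "{Suc a..<n}"
      have "T \<inter> {..<n} \<in> F" using bF[of "card T"] T unfolding bnd_def by blast
      moreover have "T \<inter> {..<n} \<subseteq> ?W"
      proof
        fix x assume "x \<in> T \<inter> {..<n}"
        then have "a \<le> x" "x < n" "x \<noteq> a" using t(2) aT by auto
        then show "x \<in> ?W" by simp
      qed
      moreover have "?W \<subseteq> {a..}" by (rule subsetI) simp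
      ultimately have W: "?W \<in> F" using famD(3)[OF F, of "T \<inter> {..<n}" ?W] by blast
      let ?S = "{T. T \<subseteq> {a..<n} \<and> card T = n - Suc a}"
      have fS: "finite ?S" by (rule finite_subset[of _ "Pow {a..<n}"]) auto
      have SF: "X \<in> F" if X: "X \<in> ?S" for X
      proof (cases "a \<in> X")
        case False
        have "X \<subseteq> ?W"
        proof
          fix x assume "x \<in> X"
          then have "a \<le> x" "x < n" "x \<noteq> a" using X False by auto
          then show "x \<in> ?W" by simp
        qed
        then have "X = ?W" using X by (intro card_subset_eq) auto
        then show ?thesis using W by simp
      next
        case True
        have "card ({a..<n} - X) = card {a..<n} - card X" by (rule card_Diff_subset) (use X finite_subset[of X "{a..<n}"] in auto)
        then have "card ({a..<n} - X) = 1" using X an by simp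
        then obtain j where j: "{a..<n} - X = {j}" by (rule card_1_singletonE)
        then have "j \<in> {a..<n}" "j \<notin> X" by auto
        then have j2: "j \<in> ?W" "a < j" using True by (auto simp: order.strict_iff_order Suc_le_eq)
        have "X = {a..<n} - {j}" using j X by auto
        also have "{a..<n} - {j} = insert a (?W - {j})" using an j2 by auto
        also have "\<dots> \<in> F" by (rule famD(4)[OF F W j2(1)]) (use j2 in auto)
        finally show ?thesis .
      qed
      then have "{T\<in>F. T \<subseteq> {a..<n} \<and> card T = n - Suc a} = ?S" by auto
      then have "fv F' a n (n - Suc a) = card ?S" using cnt[of "n - Suc a"] by (simp add: fv_def)
      then have "{T\<in>F'. T \<subseteq> {a..<n} \<and> card T = n - Suc a} = ?S"
        unfolding fv_def by (intro card_subset_eq[OF fS]) auto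
      moreover have "?W \<in> ?S" by auto
      ultimately have "?W \<in> F'" by blast
      then show False using a1 by force
    qed
    have D: "T \<in> G \<longleftrightarrow> finite T \<and> T \<subseteq> {a..} \<and> a \<in> T \<and> dn a T \<in> F1 a G"
      if G: "fam a G" "\<And>T. T \<in> G \<Longrightarrow> a \<in> T" for G T
    proof
      assume T: "T \<in> G"
      note t = famD(1,2)[OF G(1) T] G(2)[OF T]
      show "finite T \<and> T \<subseteq> {a..} \<and> a \<in> T \<and> dn a T \<in> F1 a G"
        using t dn_props[OF t] T by (simp add: F1_def)
    next
      assume h: "finite T \<and> T \<subseteq> {a..} \<and> a \<in> T \<and> dn a T \<in> F1 a G"
      then have "insert a (Suc ` dn a T) \<in> G" by (simp add: F1_def)
      then show "T \<in> G" using dn_props(1)[of T a] h by simp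
    qed
    have C: "fv (F1 a G) a (n - 1) d = fv G a n (Suc d)" if G: "fam a G" "\<And>T. T \<in> G \<Longrightarrow> a \<in> T" for G d
    proof -
      let ?g = "\<lambda>T. insert a (Suc ` T)"
      have "bij_betw ?g {T\<in>F1 a G. T \<subseteq> {a..<n - 1} \<and> card T = d} {T\<in>G. T \<subseteq> {a..<n} \<and> card T = Suc d}"
      proof (rule bij_betw_imageI)
        show "inj_on ?g {T\<in>F1 a G. T \<subseteq> {a..<n - 1} \<and> card T = d}"
        proof (rule inj_onI)
          fix T T' assume T: "T \<in> {T\<in>F1 a G. T \<subseteq> {a..<n - 1} \<and> card T = d}" "T' \<in> {T\<in>F1 a G. T \<subseteq> {a..<n - 1} \<and> card T = d}" "?g T = ?g T'"
          have "a \<notin> Suc ` T" "a \<notin> Suc ` T'" using T by auto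
          then have "Suc ` T = Suc ` T'" using T(3) by auto
          then show "T = T'" by (simp add: inj_image_eq_iff)
        qed
        show "?g ` {T\<in>F1 a G. T \<subseteq> {a..<n - 1} \<and> card T = d} = {T\<in>G. T \<subseteq> {a..<n} \<and> card T = Suc d}"
        proof
          show "?g ` {T\<in>F1 a G. T \<subseteq> {a..<n - 1} \<and> card T = d} \<subseteq> {T\<in>G. T \<subseteq> {a..<n} \<and> card T = Suc d}"
          proof
            fix S assume "S \<in> ?g ` {T\<in>F1 a G. T \<subseteq> {a..<n - 1} \<and> card T = d}"
            then obtain T where T: "S = ?g T" "T \<in> F1 a G" "T \<subseteq> {a..<n - 1}" "card T = d" by blast
            have "S \<in> G" "finite T" "T \<subseteq> {a..}" using T by (simp_all add: F1_def)
            moreover have "S \<subseteq> {a..<n}" using T(1,3) an by (force simp: subset_iff)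
            ultimately show "S \<in> {T\<in>G. T \<subseteq> {a..<n} \<and> card T = Suc d}" using card_up T by simp
          qed
          show "{T\<in>G. T \<subseteq> {a..<n} \<and> card T = Suc d} \<subseteq> ?g ` {T\<in>F1 a G. T \<subseteq> {a..<n - 1} \<and> card T = d}"
          proof
            fix S assume S: "S \<in> {T\<in>G. T \<subseteq> {a..<n} \<and> card T = Suc d}"
            then have SG: "S \<in> G" "S \<subseteq> {a..<n}" "card S = Suc d" by simp_all
            note s = famD(1,2)[OF G(1) SG(1)] G(2)[OF SG(1)]
            note p = dn_props[OF s]
            have "dn a S \<in> F1 a G" using D[OF G, of S] SG(1) by simp
            moreover have "card (dn a S) = d" using card_up[OF p(3,2)] p(1) SG(3) by simp
            moreover have "dn a S \<subseteq> {a..<n - 1}"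
            proof
              fix x assume x: "x \<in> dn a S"
              then have "Suc x \<in> S" using p(1) by blast
              then show "x \<in> {a..<n - 1}" using SG(2) p(2) x by fastforce
            qed
            ultimately show "S \<in> ?g ` {T\<in>F1 a G. T \<subseteq> {a..<n - 1} \<and> card T = d}"
              using p(1) by (intro image_eqI[of _ _ "dn a S"]) simp_all
          qed
        qed
      qed
      then show ?thesis unfolding fv_def by (rule bij_betw_same_card)
    qed
    have "F1 a F = F1 a F'"
    proof (rule IH[of "n - 1" a])
      show "k = n - 1 - a" using Suc.hyps(2) by simp
      show "fam a (F1 a F)" "fam a (F1 a F')" by (rule fam_F1[OF F], rule fam_F1[OF F'])
      show "a \<le> n - 1" using an by simp
      show "bnd (F1 a F) d (n - 1)" "bnd (F1 a F') d (n - 1)" for d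
        using bnd_F1[OF F, of d "n - 1"] bnd_F1[OF F', of d "n - 1"] bF[of "Suc d"] bF'[of "Suc d"] an by simp_all
      show "fv (F1 a F) a (n - 1) d = fv (F1 a F') a (n - 1) d" for d
        using C[OF F a2, of d] C[OF F' a1, of d] cnt[of "Suc d"] by simp
      show "lexseg a (F1 a F')"
        unfolding lexseg_def
      proof (intro ballI allI impI)
        fix T T' i assume T: "T \<in> F1 a F'" and h: "finite T' \<and> T' \<subseteq> {a..} \<and> card T' = card T \<and> i \<in> T' \<and> i \<notin> T \<and>
          (\<forall>j<i. j \<in> T' \<longleftrightarrow> j \<in> T)"
        have TF: "insert a (Suc ` T) \<in> F'" "finite T" "T \<subseteq> {a..}" using T by (simp_all add: F1_def)
        have ai: "a \<le> i" using h by auto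
        have "insert a (Suc ` T') \<in> F'"
        proof (rule lexsegD[OF lex TF(1), of _ "Suc i"])
          show "insert a (Suc ` T') \<subseteq> {a..}" using h by (auto simp: subset_iff intro: le_SucI)
          show "card (insert a (Suc ` T')) = card (insert a (Suc ` T))" using card_up[OF TF(2,3)] card_up[of T' a] h by simp
          show "j \<in> insert a (Suc ` T') \<longleftrightarrow> j \<in> insert a (Suc ` T)" if "j < Suc i" for j
            using h that by (cases j) auto
        qed (use h ai in auto)
        then show "T' \<in> F1 a F'" using h by (simp add: F1_def)
      qed
    qed
    then have "T \<in> F \<longleftrightarrow> T \<in> F'" for T using D[OF F a2, of T] D[OF F' a1, of T] by simp
    then show ?thesis by blast
  qed
qed

section \<open>Dickson's lemma\<close>

text \<open>Some subsequence is monotone; if it is decreasing, it is constant from the place of its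
  minimum on.\<close>

lemma nat_seq_mono:
  fixes g :: "nat \<Rightarrow> nat"
  shows "\<exists>r :: nat \<Rightarrow> nat. strict_mono r \<and> (\<forall>x y. x \<le> y \<longrightarrow> g (r x) \<le> g (r y))"
proof -
  obtain s where s: "strict_mono s" "monoseq (\<lambda>n. g (s n))" using seq_monosub[of g] by blast
  consider "\<forall>x y. x \<le> y \<longrightarrow> g (s x) \<le> g (s y)" | "\<forall>x y. x \<le> y \<longrightarrow> g (s y) \<le> g (s x)"
    using s(2) unfolding monoseq_def by blast
  then show ?thesis
  proof cases
    case 1
    show ?thesis by (intro exI[of _ s] conjI s(1) 1)
  next
    case 2
    obtain N where N0: "True \<and> (\<forall>x. True \<longrightarrow> g (s N) \<le> g (s x))"
      using ex_has_least_nat[of "\<lambda>_. True" 0 "\<lambda>x. g (s x)", OF TrueI] by (rule exE)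
    have N: "g (s N) \<le> g (s x)" for x using N0 by simp
    have c: "g (s (N + x)) = g (s N)" for x
    proof (rule antisym)
      show "g (s (N + x)) \<le> g (s N)" using 2 by simp
      show "g (s N) \<le> g (s (N + x))" by (rule N)
    qed
    have "strict_mono (\<lambda>x. s (N + x))" using s(1) by (simp add: strict_mono_def)
    then show ?thesis using c by (intro exI[of _ "\<lambda>x. s (N + x)"]) simp
  qed
qed

lemma mono_seq_mono:
  fixes f :: "nat \<Rightarrow> mono"
  shows "\<exists>r :: nat \<Rightarrow> nat. strict_mono r \<and> (\<forall>i<n. \<forall>x y. x \<le> y \<longrightarrow> lookup (f (r x)) i \<le> lookup (f (r y)) i)"
proof (induction n)
  case 0
  show ?case by (intro exI[of _ "\<lambda>x :: nat. x"]) (simp add: strict_mono_def)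
next
  case (Suc n)
  then obtain r :: "nat \<Rightarrow> nat" where r: "strict_mono r" "\<And>i x y. i < n \<Longrightarrow> x \<le> y \<Longrightarrow> lookup (f (r x)) i \<le> lookup (f (r y)) i" by blast
  obtain s :: "nat \<Rightarrow> nat" where s: "strict_mono s" "\<And>x y. x \<le> y \<Longrightarrow> lookup (f (r (s x))) n \<le> lookup (f (r (s y))) n"
    using nat_seq_mono[of "\<lambda>x. lookup (f (r x)) n"] by blast
  have "strict_mono (\<lambda>x. r (s x))" using r(1) s(1) by (simp add: strict_mono_def)
  moreover have "lookup (f (r (s x))) i \<le> lookup (f (r (s y))) i" if "i < Suc n" "x \<le> y" for i x y
  proof (cases "i = n")
    case True
    then show ?thesis using s(2)[OF that(2)] by simp
  next
    case False
    moreover have "s x \<le> s y" using that(2) s(1) by (simp add: strict_mono_less_eq)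
    ultimately show ?thesis using r(2)[of i "s x" "s y"] that(1) by simp
  qed
  ultimately show ?case by (intro exI[of _ "\<lambda>x. r (s x)"]) simp
qed

text \<open>Stated with a degree bound for the minimal divisors, because it serves to replace
  conditions in all degrees by finitely many. An infinite set of minimal elements would contain a
  sequence increasing in all \<open>n\<close> coordinates.\<close>

lemma dickson:
  assumes A: "\<And>m. m \<in> A \<Longrightarrow> keys m \<subseteq> {..<n}"
  shows "\<exists>D. \<forall>a\<in>A. \<exists>b\<in>A. \<exists>w. a = b + w \<and> mdeg b \<le> D \<and> (\<forall>b'\<in>A. \<forall>w'. b = b' + w' \<longrightarrow> b' = b)"
proof -
  define B where "B = {b\<in>A. \<forall>b'\<in>A. \<forall>w'. b = b' + w' \<longrightarrow> b' = b}"
  have dv: "\<exists>b\<in>B. \<exists>w. a = b + w" if "a \<in> A" for a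
    using that
  proof (induction "mdeg a" arbitrary: a rule: less_induct)
    case less
    show ?case
    proof (cases "a \<in> B")
      case True
      then show ?thesis by (intro bexI[of _ a] exI[of _ 0]) simp
    next
      case False
      then obtain b w where b: "b \<in> A" "a = b + w" "b \<noteq> a" using less.prems unfolding B_def by blast
      then have "w \<noteq> 0" by auto
      then have "0 < mdeg w" by (metis gr0I mdeg_eq_0_iff)
      then have "mdeg b < mdeg a" using b(2) by simp
      then obtain c w' where "c \<in> B" "b = c + w'" using less.hyps[OF _ b(1)] by blast
      then show ?thesis using b(2) by (intro bexI[of _ c] exI[of _ "w' + w"]) (simp_all add: add.assoc)
    qed
  qed
  have "finite B"
  proof (rule ccontr)
    assume "infinite B"
    then obtain f :: "nat \<Rightarrow> mono" where f: "inj f" "range f \<subseteq> B" using infinite_countable_subset[of B] by auto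
    obtain r :: "nat \<Rightarrow> nat" where r: "strict_mono r" "\<And>i x y. i < n \<Longrightarrow> x \<le> y \<Longrightarrow> lookup (f (r x)) i \<le> lookup (f (r y)) i"
      using mono_seq_mono[of n f] by blast
    let ?u = "f (r 0)" and ?v = "f (r 1)"
    have uv: "?u \<in> B" "?v \<in> B" using f(2) by auto
    have le: "lookup ?u i \<le> lookup ?v i" for i
    proof (cases "i < n")
      case True
      then show ?thesis using r(2)[of i 0 1] by simp
    next
      case False
      then have "i \<notin> keys ?u" using A[of ?u] uv(1) by (auto simp: B_def)
      then show ?thesis by (simp add: in_keys_iff)
    qed
    have "?v = ?u + (?v - ?u)" by (rule poly_mapping_eqI) (simp add: lookup_add lookup_minus le)
    then have "?u = ?v" using uv unfolding B_def by blast
    then have "r 0 = r 1" using f(1) by (simp add: inj_def)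
    then show False using strict_monoD[OF r(1), of 0 1] by simp
  qed
  then have mx: "mdeg b \<le> Max (mdeg ` B)" if "b \<in> B" for b using that by simp
  show ?thesis
  proof (intro exI[of _ "Max (mdeg ` B)"] ballI)
    fix a assume "a \<in> A"
    then obtain b w where b: "b \<in> B" "a = b + w" using dv by blast
    have "b \<in> A" "\<forall>b'\<in>A. \<forall>w'. b = b' + w' \<longrightarrow> b' = b" using b(1) by (simp_all add: B_def)
    then show "\<exists>b\<in>A. \<exists>w. a = b + w \<and> mdeg b \<le> Max (mdeg ` B) \<and> (\<forall>b'\<in>A. \<forall>w'. b = b' + w' \<longrightarrow> b' = b)"
      using b(2) mx[OF b(1)] by (intro bexI[of _ b] exI[of _ w] conjI)
  qed
qed

section \<open>Monomial ideals\<close>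

lemma polys_in_UNIV [simp]: "polys_in UNIV = UNIV"
  by (auto simp: polys_in_def)

text \<open>The generators are arbitrary polynomials, so only some monomial occurring in a generator
  is obtained; this is enough for \<open>bnd_of_gens\<close>.\<close>

lemma ideal_gen_key:
  assumes "p \<in> ideal_gen Rr A" "m \<in> keys p"
  shows "\<exists>a\<in>A. \<exists>u\<in>keys a. mdvd u m"
proof -
  obtain B r where B: "p = (\<Sum>a\<in>B. r a * a)" "B \<subseteq> A" using assms(1) unfolding ideal_gen_def by blast
  have "\<exists>a\<in>B. lookup (r a * a) m \<noteq> 0"
  proof (rule ccontr)
    assume "\<not> ?thesis"
    then have "lookup p m = 0" unfolding B(1) lookup_sum by (intro sum.neutral) blast
    then show False using assms(2) by (simp add: in_keys_iff)
  qed
  then obtain a where a: "a \<in> B" "m \<in> keys (r a * a)" by (auto simp: in_keys_iff)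
  then obtain x u where "m = x + u" "u \<in> keys a" using keys_mult[of "r a" a] by blast
  then have "mdvd u m" unfolding mdvd_def by (metis add.commute)
  then show ?thesis using a(1) B(2) \<open>u \<in> keys a\<close> by blast
qed

lemma ideal_gen_in: "a \<in> A \<Longrightarrow> 1 \<in> Rr \<Longrightarrow> a \<in> ideal_gen Rr A"
  unfolding ideal_gen_def by (intro CollectI exI[of _ "{a}"] exI[of _ "\<lambda>_. 1"]) simp

lemma ideal_gen_mono: "A \<subseteq> B \<Longrightarrow> ideal_gen Rr A \<subseteq> ideal_gen Rr B"
  unfolding ideal_gen_def by blast

lemma ideal_gen_monos:
  assumes A: "\<And>a. a \<in> A \<Longrightarrow> keys a \<subseteq> V"
  shows "ideal_gen (polys_in V) (monomial ` A) = {p :: 'k::field_char_0 S. p \<in> polys_in V \<and> (\<forall>m\<in>keys p. \<exists>a\<in>A. mdvd a m)}"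
    (is "?L = ?R")
proof
  show "?L \<subseteq> ?R"
  proof
    fix p assume p: "p \<in> ?L"
    have "\<exists>a\<in>A. mdvd a m" if "m \<in> keys p" for m using ideal_gen_key[OF p that] by auto
    moreover have "p \<in> polys_in V"
    proof -
      obtain B r where B: "p = (\<Sum>a\<in>B. r a * a)" "B \<subseteq> monomial ` A" "\<forall>a\<in>B. r a \<in> polys_in V"
        using p unfolding ideal_gen_def by blast
      have "a \<in> polys_in V" if "a \<in> B" for a
      proof -
        have "a \<in> monomial ` A" using \<open>a \<in> B\<close> B(2) by (rule rev_subsetD)
        then obtain c where "c \<in> A" "a = monomial c" by (rule imageE)
        then show ?thesis using A[of c] by (simp add: polys_in_def)
      qed
      then show ?thesis unfolding B(1) by (intro polys_in_sum polys_in_mult) (use B(3) in blast)+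
    qed
    ultimately show "p \<in> ?R" by blast
  qed
  show "?R \<subseteq> ?L"
  proof
    fix p :: "'k S" assume p: "p \<in> ?R"
    then have "\<forall>m\<in>keys p. \<exists>a u. a \<in> A \<and> m = a + u" unfolding mdvd_def mem_Collect_eq by blast
    then obtain a u where au: "\<And>m. m \<in> keys p \<Longrightarrow> a m \<in> A \<and> m = a m + u m" by metis
    let ?g = "\<lambda>m. monomial (a m) :: 'k S"
    \<comment> \<open>Several monomials of \<open>p\<close> may be assigned the same generator, so
      their cofactors are collected in one coefficient.\<close>
    define r where "r b = (\<Sum>m\<in>{m\<in>keys p. ?g m = b}. single (u m) (lookup p m))" for b
    have "p = (\<Sum>m\<in>keys p. single m (lookup p m))" by (rule poly_expand)
    also have "\<dots> = (\<Sum>b\<in>?g ` keys p. \<Sum>m\<in>{m\<in>keys p. ?g m = b}. single m (lookup p m))"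
      by (rule sum.group[symmetric]) auto
    also have "\<dots> = (\<Sum>b\<in>?g ` keys p. r b * b)"
    proof (rule sum.cong[OF refl])
      fix b
      show "(\<Sum>m\<in>{m\<in>keys p. ?g m = b}. single m (lookup p m)) = r b * b"
        unfolding r_def sum_distrib_right
      proof (rule sum.cong[OF refl])
        fix m assume m: "m \<in> {m\<in>keys p. ?g m = b}"
        then have "m = u m + a m" using au[of m] by (simp add: add.commute)
        moreover have "single (u m) (lookup p m) * b = single (u m + a m) (lookup p m)"
          using m by (auto simp: mult_single)
        ultimately show "single m (lookup p m) = single (u m) (lookup p m) * b" by metis
      qed
    qed
    finally have "p = (\<Sum>b\<in>?g ` keys p. r b * b)" .
    moreover have "r b \<in> polys_in V" for b
      unfolding r_def
    proof (rule polys_in_sum)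
      fix m assume m: "m \<in> {m\<in>keys p. ?g m = b}"
      then have "keys m \<subseteq> V" using p by (auto simp: polys_in_def)
      moreover have "keys (u m) \<subseteq> keys m" using au[of m] m mono_keys_add[of "a m" "u m"] by simp
      ultimately show "single (u m) (lookup p m) \<in> polys_in V" by (auto simp: polys_in_def)
    qed
    moreover have "?g ` keys p \<subseteq> monomial ` A" using au by blast
    ultimately show "p \<in> ?L" unfolding ideal_gen_def
      by (intro CollectI exI[of _ "?g ` keys p"] exI[of _ r]) simp
  qed
qed

lemma ideal_gen_monos_UNIV:
  "ideal_gen UNIV (monomial ` A) = {p. \<forall>m\<in>keys p. \<exists>a\<in>A. mdvd a m}"
  using ideal_gen_monos[of A UNIV] by simp

lemma monomial_ideal_mem:
  assumes "monomial_ideal L" shows "p \<in> L \<longleftrightarrow> (\<forall>m\<in>keys p. monomial m \<in> L)"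
proof -
  obtain A where "L = ideal_gen UNIV (monomial ` A)" using assms unfolding monomial_ideal_def by blast
  then show ?thesis by (simp add: ideal_gen_monos_UNIV)
qed

definition fam_of :: "'k::field_char_0 S set \<Rightarrow> nat set set" where
  "fam_of I = {T. finite T \<and> monomial (xm T) \<in> I}"

definition Iof :: "nat set set \<Rightarrow> 'k::field_char_0 S set" where
  "Iof F = {p. \<forall>m\<in>keys p. keys m \<in> F}"

lemma mdvd_keys: "mdvd a m \<Longrightarrow> keys a \<subseteq> keys m"
  by (auto simp: mdvd_def mono_keys_add)

lemma xm_mdvd: assumes "T \<subseteq> keys m" shows "mdvd (xm T) m"
proof -
  have fT: "finite T" by (rule finite_subset[OF assms]) simp
  have "m = xm T + (m - xm T)"
  proof (rule poly_mapping_eqI)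
    fix i
    have "lookup (xm T) i \<le> lookup m i"
      using assms by (auto simp: lookup_xm[OF fT] in_keys_iff subset_iff Suc_le_eq One_nat_def)
    then show "lookup m i = lookup (xm T + (m - xm T)) i" by (simp add: lookup_add lookup_minus)
  qed
  then show ?thesis unfolding mdvd_def by blast
qed

lemma sqf_Iof:
  assumes "squarefree_monomial_ideal I" shows "I = Iof (fam_of I)"
proof -
  obtain A where A: "\<And>m. m \<in> A \<Longrightarrow> mono_squarefree m" "I = ideal_gen UNIV (monomial ` A)"
    using assms unfolding squarefree_monomial_ideal_def by blast
  have eq: "(\<exists>a\<in>A. mdvd a m) \<longleftrightarrow> keys m \<in> fam_of I" for m
  proof
    assume "\<exists>a\<in>A. mdvd a m"
    then obtain a where a: "a \<in> A" "mdvd a m" by blast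
    have "mdvd (xm (keys a)) (xm (keys m))" by (rule xm_mdvd) (simp add: mdvd_keys[OF a(2)])
    then have "mdvd a (xm (keys m))" using squarefree_eq_xm[OF A(1)[OF a(1)]] by simp
    then show "keys m \<in> fam_of I" using a(1) by (auto simp: fam_of_def A(2) ideal_gen_monos_UNIV)
  next
    assume "keys m \<in> fam_of I"
    then obtain a where a: "a \<in> A" "mdvd a (xm (keys m))" by (auto simp: fam_of_def A(2) ideal_gen_monos_UNIV)
    have "mdvd (xm (keys m)) m" by (rule xm_mdvd) simp
    then have "mdvd a m" using a(2) unfolding mdvd_def by (metis add.assoc)
    then show "\<exists>a\<in>A. mdvd a m" using a(1) by blast
  qed
  have "p \<in> I \<longleftrightarrow> (\<forall>m\<in>keys p. \<exists>a\<in>A. mdvd a m)" for p unfolding A(2) ideal_gen_monos_UNIV by (rule mem_Collect_eq)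
  then show ?thesis unfolding Iof_def eq by (intro Set.set_eqI) (simp only: mem_Collect_eq)
qed

lemma monomial_Iof [simp]: "monomial m \<in> Iof F \<longleftrightarrow> keys m \<in> F"
  by (simp add: Iof_def)

lemma Iof_gen:
  assumes F: "fam 0 F"
  shows "Iof F = ideal_gen UNIV (monomial ` xm ` {T\<in>F. \<forall>T'\<in>F. T' \<subseteq> T \<longrightarrow> T' = T})"
proof -
  have "(\<exists>a\<in>xm ` {T\<in>F. \<forall>T'\<in>F. T' \<subseteq> T \<longrightarrow> T' = T}. mdvd a m) \<longleftrightarrow> keys m \<in> F" for m
  proof
    assume "\<exists>a\<in>xm ` {T\<in>F. \<forall>T'\<in>F. T' \<subseteq> T \<longrightarrow> T' = T}. mdvd a m"
    then obtain T where T: "T \<in> F" "mdvd (xm T) m" by blast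
    have "T \<subseteq> keys m" using mdvd_keys[OF T(2)] famD(1)[OF F T(1)] by simp
    then show "keys m \<in> F" using famD(3)[OF F T(1)] by simp
  next
    assume m: "keys m \<in> F"
    let ?X = "{T\<in>F. T \<subseteq> keys m}"
    have "finite ?X" by (rule finite_subset[of _ "Pow (keys m)"]) auto
    moreover have "?X \<noteq> {}" using m by blast
    ultimately obtain T where T: "T \<in> ?X" "\<And>T'. T' \<in> ?X \<Longrightarrow> T' \<subseteq> T \<Longrightarrow> T' = T"
      using finite_has_minimal[of ?X] by metis
    have "\<forall>T'\<in>F. T' \<subseteq> T \<longrightarrow> T' = T" using T by blast
    then show "\<exists>a\<in>xm ` {T\<in>F. \<forall>T'\<in>F. T' \<subseteq> T \<longrightarrow> T' = T}. mdvd a m"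
      using T(1) xm_mdvd[of T m] by blast
  qed
  then show ?thesis by (simp add: ideal_gen_monos_UNIV Iof_def)
qed

lemma sqf_Iof_fam: assumes F: "fam 0 F" shows "squarefree_monomial_ideal (Iof F)"
  unfolding squarefree_monomial_ideal_def Iof_gen[OF F]
  by (intro exI[of _ "xm ` {T\<in>F. \<forall>T'\<in>F. T' \<subseteq> T \<longrightarrow> T' = T}"] conjI refl) (auto intro!: squarefree_xm famD(1)[OF F])

lemma swap_xm:
  assumes "finite T" "j \<in> T" "i \<notin> T"
  shows "xm T - single j 1 + single i 1 = xm (insert i (T - {j}))"
  by (rule poly_mapping_eqI) (use assms in \<open>auto simp: lookup_add lookup_minus lookup_xm lookup_single when_def\<close>)

text \<open>The exchange condition is given for minimal generators only. For a general
  \<open>T\<close> take a minimal member \<open>X\<close> inside it: if \<open>j\<close> is not in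
  \<open>X\<close>, the exchange leaves \<open>X\<close> in place; otherwise it is performed in
  \<open>X\<close> and then enlarged.\<close>

lemma sss_fam:
  assumes "squarefree_strongly_stable I" shows "fam 0 (fam_of I)"
proof -
  have sq: "squarefree_monomial_ideal I" using assms unfolding squarefree_strongly_stable_def by blast
  define F where "F = fam_of I"
  have I: "I = Iof F" unfolding F_def by (rule sqf_Iof[OF sq])
  have mem: "monomial m \<in> I \<longleftrightarrow> keys m \<in> F" for m unfolding I by simp
  have up: "T' \<in> F" if T: "T \<in> F" "T \<subseteq> T'" "finite T'" for T T'
  proof -
    obtain A where A: "I = ideal_gen UNIV (monomial ` A)" using sq unfolding squarefree_monomial_ideal_def by blast
    have "monomial (xm T) \<in> I" using T(1) by (simp add: F_def fam_of_def)
    then obtain a where a: "a \<in> A" "mdvd a (xm T)" by (auto simp: A ideal_gen_monos_UNIV)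
    have "mdvd (xm T) (xm T')" by (rule xm_mdvd) (simp add: T)
    then have "mdvd a (xm T')" using a(2) unfolding mdvd_def by (metis add.assoc)
    then have "monomial (xm T') \<in> I" using a(1) by (auto simp: A ideal_gen_monos_UNIV)
    then show ?thesis using T(3) by (simp add: F_def fam_of_def)
  qed
  have "fam 0 F"
  proof (rule famI)
    fix T assume T: "T \<in> F"
    show fT: "finite T" using T by (simp add: F_def fam_of_def)
    show "T \<subseteq> {0..}" by simp
    show "T' \<in> F" if "T \<subseteq> T'" "finite T'" "T' \<subseteq> {0..}" for T' by (rule up[OF T that(1,2)])
    show "insert i (T - {j}) \<in> F" if ij: "j \<in> T" "0 \<le> i" "i < j" "i \<notin> T" for i j
    proof -
      let ?X = "{X\<in>F. X \<subseteq> T}"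
      have "finite ?X" by (rule finite_subset[of _ "Pow T"]) (use fT in auto)
      moreover have "?X \<noteq> {}" using T by blast
      ultimately obtain X where X: "X \<in> ?X" "\<And>X'. X' \<in> ?X \<Longrightarrow> X' \<subseteq> X \<Longrightarrow> X' = X"
        using finite_has_minimal[of ?X] by metis
      have XF: "X \<in> F" "X \<subseteq> T" using X(1) by auto
      have fX: "finite X" by (rule finite_subset[OF XF(2) fT])
      show ?thesis
      proof (cases "j \<in> X")
        case False
        then have "X \<subseteq> insert i (T - {j})" using XF by blast
        then show ?thesis by (rule up[OF XF(1)]) (use fT in simp)
      next
        case True
        have "xm X \<in> min_gens I" unfolding min_gens_def
        proof (intro CollectI conjI allI impI)
          show "monomial (xm X) \<in> I" using XF fX by (simp add: mem)
          fix m' assume m': "monomial m' \<in> I \<and> mdvd m' (xm X)"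
          then have "keys m' \<subseteq> X" using mdvd_keys[of m' "xm X"] fX by simp
          moreover have "keys m' \<in> F" using m' mem by blast
          ultimately have k: "keys m' = X" using X(2)[of "keys m'"] XF by blast
          obtain w where w: "xm X = m' + w" using m' unfolding mdvd_def by blast
          have "lookup m' l \<le> 1" for l
          proof -
            have "lookup (xm X) l \<le> 1" using fX by (simp add: lookup_xm)
            then show ?thesis unfolding w lookup_add by simp
          qed
          then have "mono_squarefree m'" by (simp add: mono_squarefree_def)
          then show "m' = xm X" using squarefree_eq_xm k by metis
        qed
        moreover have "i \<notin> X" using ij XF by blast
        ultimately have "monomial (xm X - single j 1 + single i 1) \<in> I"
          using assms ij(3) True fX unfolding squarefree_strongly_stable_def by simp
        then have "insert i (X - {j}) \<in> F" using swap_xm[OF fX True \<open>i \<notin> X\<close>] mem fX by simp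
        moreover have "insert i (X - {j}) \<subseteq> insert i (T - {j})" using XF by blast
        ultimately show ?thesis by (rule up) (use fT in simp)
      qed
    qed
  qed
  then show ?thesis unfolding F_def .
qed

text \<open>A generator lies in the ideal, so all of its monomials have their support in
  \<open>F\<close>. One of them divides \<open>xm T\<close>, has degree at most \<open>d\<close>,
  and so involves only variables below \<open>n\<close>.\<close>

lemma bnd_of_gens:
  assumes I: "I = ideal_gen UNIV A" "I = Iof F" and fF: "\<And>T. T \<in> F \<Longrightarrow> finite T" and F: "fam 0 F"
    and n: "\<And>p u. p \<in> A \<Longrightarrow> u \<in> keys p \<Longrightarrow> mdeg u \<le> d \<Longrightarrow> keys u \<subseteq> {..<n}"
  shows "bnd F d n"
  unfolding bnd_def
proof (intro ballI impI)
  fix T assume T: "T \<in> F" "card T \<le> d"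
  have fT: "finite T" by (rule fF[OF T(1)])
  then have "monomial (xm T) \<in> I" using T(1) by (simp add: I(2))
  then have "monomial (xm T) \<in> ideal_gen UNIV A" using I(1) by simp
  then obtain p u where p: "p \<in> A" "u \<in> keys p" "mdvd u (xm T)"
    using ideal_gen_key[of "monomial (xm T)" UNIV A "xm T"] by auto
  have "p \<in> Iof F" using ideal_gen_in[OF p(1), of UNIV] I by simp
  then have uF: "keys u \<in> F" using p(2) by (simp add: Iof_def)
  obtain w where w: "xm T = u + w" using p(3) unfolding mdvd_def by blast
  have "mdeg u \<le> d" using arg_cong[OF w, of mdeg] fT T(2) by simp
  then have "keys u \<subseteq> {..<n}" by (rule n[OF p(1,2)])
  moreover have "keys u \<subseteq> T" using mdvd_keys[OF p(3)] fT by simp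
  ultimately have "keys u \<subseteq> T \<inter> {..<n}" by blast
  then show "T \<inter> {..<n} \<in> F" using famD(3)[OF F uF, of "T \<inter> {..<n}"] fT by simp
qed

lemma vars_bound:
  fixes X :: "'k::field_char_0 S set"
  assumes "finite X" shows "\<exists>n. \<forall>p\<in>X. \<forall>u\<in>keys p. keys u \<subseteq> {..<n}"
proof -
  let ?V = "\<Union>p\<in>X. \<Union>u\<in>keys p. keys u"
  have "finite ?V" using assms by simp
  then obtain n where "?V \<subseteq> {..<n}" using finite_nat_iff_bounded[of ?V] by auto
  then show ?thesis by (intro exI[of _ n]) blast
qed

lemma fged_bnd:
  assumes I: "I = Iof F" and F: "fam 0 F" and g: "fin_gen_each_degree (I :: 'k::field_char_0 S set)"
  shows "\<exists>n. bnd F d n"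
proof -
  obtain A where A: "I = ideal_gen UNIV A" "\<forall>p\<in>A. \<exists>d. homogeneous d p" "\<And>d. finite {p\<in>A. homogeneous d p}"
    using g unfolding fin_gen_each_degree_def by blast
  let ?X = "\<Union>e\<in>{..d}. {p\<in>A. homogeneous e p}"
  have "finite ?X" using A(3) by simp
  then obtain n where n: "\<forall>p\<in>?X. \<forall>u\<in>keys p. keys u \<subseteq> {..<n}" using vars_bound by blast
  have "bnd F d n"
  proof (rule bnd_of_gens[OF A(1) I famD(1)[OF F] F])
    fix p u assume p: "p \<in> A" "u \<in> keys p" "mdeg u \<le> d"
    obtain e where e: "homogeneous e p" using A(2) p(1) by blast
    then have "mdeg u = e" using p(2) by (simp add: homogeneous_def)
    then have "p \<in> ?X" using e p by auto
    then show "keys u \<subseteq> {..<n}" using n p(2) by blast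
  qed simp_all
  then show ?thesis by blast
qed

lemma fg_bnd:
  assumes I: "I = Iof F" and F: "fam 0 F" and g: "finitely_generated (I :: 'k::field_char_0 S set)"
  shows "\<exists>n. \<forall>d. bnd F d n"
proof -
  obtain A where A: "finite A" "I = ideal_gen UNIV A" using g unfolding finitely_generated_def by blast
  obtain n where n: "\<forall>p\<in>A. \<forall>u\<in>keys p. keys u \<subseteq> {..<n}" using vars_bound[OF A(1)] by blast
  have "bnd F d n" for d
    by (rule bnd_of_gens[OF A(2) I famD(1)[OF F] F]) (use n in blast)+
  then show ?thesis by blast
qed

lemma fged_Iof:
  assumes F: "fam 0 F" and b: "\<And>d. \<exists>n. bnd F d n"
  shows "fin_gen_each_degree (Iof F :: 'k::field_char_0 S set)"
proof -
  let ?G = "{T\<in>F. \<forall>T'\<in>F. T' \<subseteq> T \<longrightarrow> T' = T}"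
  let ?A = "monomial ` xm ` ?G :: 'k S set"
  have "\<exists>d. homogeneous d p" if p: "p \<in> ?A" for p
  proof -
    obtain T where "p = monomial (xm T)" using p by blast
    then show ?thesis by (intro exI[of _ "mdeg (xm T)"]) (simp add: homogeneous_def)
  qed
  moreover have "finite {p\<in>?A. homogeneous d p}" for d
  proof -
    obtain n where n: "bnd F d n" using b by blast
    have "{p\<in>?A. homogeneous d p} \<subseteq> monomial ` xm ` Pow {..<n}"
    proof
      fix p assume p: "p \<in> {p\<in>?A. homogeneous d p}"
      then obtain T where T: "p = monomial (xm T)" "T \<in> ?G" by blast
      have "finite T" using famD(1)[OF F] T(2) by blast
      then have cT: "card T = d" using p unfolding T(1) by (simp add: homogeneous_def)
      have TF: "T \<in> F" "\<forall>T'\<in>F. T' \<subseteq> T \<longrightarrow> T' = T" using T(2) by simp_all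
      have "T \<inter> {..<n} \<in> F" by (rule n[unfolded bnd_def, rule_format, OF TF(1)]) (simp only: cT order_refl)
      then have "T \<inter> {..<n} = T" by (rule TF(2)[rule_format, OF _ Int_lower1])
      then have "T \<in> Pow {..<n}" by (simp only: Pow_iff Int_absorb2 inf.absorb_iff1)
      then show "p \<in> monomial ` xm ` Pow {..<n}" unfolding T(1) by (intro imageI)
    qed
    then show ?thesis by (rule finite_subset) simp
  qed
  ultimately show ?thesis unfolding fin_gen_each_degree_def
    by (intro exI[of _ ?A] conjI ballI allI Iof_gen[OF F])
qed

section \<open>Generic initial ideals of squarefree strongly stable ideals\<close>

text \<open>The matrix is continued by the identity, which makes it a member of
  \<open>Up\<close>.\<close>

definition Gof :: "nat \<Rightarrow> 'k::field_char_0 mat \<Rightarrow> nat \<times> nat \<Rightarrow> 'k" where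
  "Gof n g = (\<lambda>(i, j). if i < n \<and> j < n then g $$ (i, j) else if i = j then 1 else 0)"

lemma Gof_in: "i < n \<Longrightarrow> j < n \<Longrightarrow> Gof n g (i, j) = g $$ (i, j)"
  by (simp add: Gof_def)

lemma upper_tri_groupD:
  assumes "g \<in> upper_tri_group n"
  shows "g \<in> carrier_mat n n" "upper_triangular g" "invertible_mat g"
  using assms by (auto simp: upper_tri_group_def)

lemma det_upper_tri_nz:
  fixes g :: "'k::field_char_0 mat"
  assumes "g \<in> carrier_mat n n" "upper_triangular g"
  shows "det g \<noteq> 0 \<longleftrightarrow> (\<forall>i<n. g $$ (i, i) \<noteq> 0)"
proof -
  have "det g = prod_list (diag_mat g)" by (rule det_upper_triangular[OF assms(2,1)])
  then show ?thesis using assms(1) by (auto simp: prod_list_zero_iff diag_mat_def)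
qed

lemma Gof_Up:
  fixes g :: "'k::field_char_0 mat"
  assumes g: "g \<in> upper_tri_group n" shows "Gof n g \<in> Up"
proof -
  note c = upper_tri_groupD[OF g]
  obtain B where B: "g * B = 1\<^sub>m (dim_row g)" "B * g = 1\<^sub>m (dim_row B)"
    using c(3) unfolding invertible_mat_def inverts_mat_def by blast
  have dg: "dim_row g = n" "dim_col g = n" using c(1) by auto
  have "dim_col B = n" using arg_cong[OF B(1), of dim_col] dg by simp
  moreover have "dim_row B = n" using arg_cong[OF B(2), of dim_col] dg by simp
  ultimately have Bc: "B \<in> carrier_mat n n" by auto
  have "det g * det B = 1" using det_mult[OF c(1) Bc] B(1) dg by simp
  then have "det g \<noteq> 0" by auto
  then have "\<forall>i<n. g $$ (i, i) \<noteq> 0" using det_upper_tri_nz[OF c(1,2)] by simp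
  moreover have "g $$ (i, j) = 0" if "j < i" "i < n" for i j
    using c(2) dg that unfolding upper_triangular_def by simp
  ultimately show ?thesis unfolding Up_def Gof_def by auto
qed

lemma mat_upper:
  fixes G :: "nat \<times> nat \<Rightarrow> 'k::field_char_0"
  assumes G: "G \<in> Up" shows "mat n n G \<in> upper_tri_group n"
proof -
  let ?g = "mat n n G"
  have c: "?g \<in> carrier_mat n n" by simp
  have u: "upper_triangular ?g" using G by (auto simp: upper_triangular_def Up_def)
  have "det ?g \<noteq> 0" using det_upper_tri_nz[OF c u] UpD[OF G] by simp
  then have "?g \<in> Units (ring_mat TYPE('k) n ())" by (rule det_non_zero_imp_unit[OF c])
  then obtain B where "B \<in> carrier_mat n n" "B * ?g = 1\<^sub>m n" "?g * B = 1\<^sub>m n"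
    unfolding Units_def ring_mat_def by auto
  then have "invertible_mat ?g" unfolding invertible_mat_def inverts_mat_def by auto
  then show ?thesis using c u by (simp add: upper_tri_group_def)
qed

lemma act_eq:
  fixes g :: "'k::field_char_0 mat"
  assumes g: "g \<in> upper_tri_group n" and p: "p \<in> S_fin n"
  shows "act g p = sb (U 0 (Gof n g)) p"
  unfolding act_def
proof (rule subst_cong[OF p])
  fix j assume j: "j \<in> {..<n}"
  note c = upper_tri_groupD[OF g]
  have dg: "dim_row g = n" using c(1) by auto
  have "(\<Sum>i<n. const (g $$ (i, j)) * var i) = (\<Sum>i\<in>{0..j}. const (g $$ (i, j)) * (var i :: 'k S))"
  proof (rule sum.mono_neutral_right)
    show "{0..j} \<subseteq> {..<n}" using j by auto
    show "\<forall>i\<in>{..<n} - {0..j}. const (g $$ (i, j)) * (var i :: 'k S) = 0"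
      using c(2) dg by (auto simp: upper_triangular_def)
  qed simp
  also have "\<dots> = U 0 (Gof n g) j" unfolding U_def
    by (rule sum.cong[OF refl]) (use j in \<open>simp add: Gof_in\<close>)
  finally show "(\<Sum>i<dim_row g. const (g $$ (i, j)) * var i) = U 0 (Gof n g) j" by (simp only: dg)
qed

lemma ev_Gof:
  assumes "p \<in> polys_in ({..<n} \<times> {..<n})"
  shows "subst (\<lambda>c. c) (\<lambda>(i, j). g $$ (i, j)) p = ev (Gof n g) p"
  by (rule subst_cong[OF assms]) (auto simp: Gof_in)

lemma mono_gt_asym: "mono_gt m m' \<Longrightarrow> \<not> mono_gt m' m"
  by (auto simp: mono_gt_def)

lemma lead_monoI:
  assumes "m \<in> keys f" "\<And>m'. m' \<in> keys f \<Longrightarrow> m' \<noteq> m \<Longrightarrow> mono_gt m m'"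
  shows "lead_mono f = m"
  unfolding lead_mono_def
proof (rule the_equality)
  show "m \<in> keys f \<and> (\<forall>m'\<in>keys f. m' \<noteq> m \<longrightarrow> mono_gt m m')"
    by (intro conjI ballI impI assms)
  show "m' = m" if "m' \<in> keys f \<and> (\<forall>m''\<in>keys f. m'' \<noteq> m' \<longrightarrow> mono_gt m' m'')" for m'
  proof (rule ccontr)
    assume "m' \<noteq> m"
    then have "mono_gt m m'" "mono_gt m' m" using assms(2)[of m'] that assms(1) by simp_all
    then show False using mono_gt_asym by blast
  qed
qed

definition hcomp :: "nat \<Rightarrow> 'k::field_char_0 S \<Rightarrow> 'k S" where
  "hcomp d p = (\<Sum>m\<in>{m\<in>keys p. mdeg m = d}. single m (lookup p m))"

lemma lookup_hcomp: "lookup (hcomp d p) m = (if mdeg m = d then lookup p m else 0)"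
proof -
  have "lookup (hcomp d p) m = (\<Sum>u\<in>{u\<in>keys p. mdeg u = d}. if u = m then lookup p u else 0)"
    unfolding hcomp_def lookup_sum by (rule sum.cong[OF refl]) (simp add: lookup_single when_def)
  also have "\<dots> = (if m \<in> {u\<in>keys p. mdeg u = d} then lookup p m else 0)"
    by (rule sum.delta) simp
  also have "\<dots> = (if mdeg m = d then lookup p m else 0)" by (simp add: in_keys_iff)
  finally show ?thesis .
qed

lemma keys_hcomp: "keys (hcomp d p) = {m\<in>keys p. mdeg m = d}"
  by (auto simp: in_keys_iff lookup_hcomp split: if_splits)

lemma lookup_sb_hcomp:
  fixes p :: "'k::field_char_0 S"
  assumes p: "p \<in> S_fin n" and b: "mdeg b = d"
  shows "lookup (sb (U 0 G) p) b = lookup (sb (U 0 G) (hcomp d p)) b"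
proof -
  have z: "lookup (mev (U 0 G) m) b = 0" if m: "m \<in> keys p" "mdeg m \<noteq> d" for m
  proof -
    have "mev (U 0 G) m \<in> sp (Mon 0 n (mdeg m))"
    proof (rule mev_in)
      fix j assume "j \<in> keys m"
      then have "j < n" using p m(1) unfolding polys_in_def by blast
      then show "U 0 G j \<in> sp (Mon 0 n 1)" by (rule U_in)
    qed
    moreover have "b \<notin> Mon 0 n (mdeg m)" using m(2) b by (auto simp: Mon_def)
    ultimately have "b \<notin> keys (mev (U 0 G) m)" unfolding sp_def by blast
    then show ?thesis by (simp add: in_keys_iff)
  qed
  have "lookup (sb (U 0 G) p) b = (\<Sum>m\<in>keys p. lookup p m * lookup (mev (U 0 G) m) b)" by (rule lookup_sb_keys)
  also have "\<dots> = (\<Sum>m\<in>keys (hcomp d p). lookup p m * lookup (mev (U 0 G) m) b)"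
    unfolding keys_hcomp by (rule sum.mono_neutral_right) (auto simp: z)
  also have "\<dots> = (\<Sum>m\<in>keys (hcomp d p). lookup (hcomp d p) m * lookup (mev (U 0 G) m) b)"
    by (rule sum.cong[OF refl]) (simp add: keys_hcomp lookup_hcomp)
  also have "\<dots> = lookup (sb (U 0 G) (hcomp d p)) b" by (rule lookup_sb_keys[symmetric])
  finally show ?thesis .
qed

lemma lead_mono_hom:
  assumes "f \<in> sp (Mon 0 n d)" "f \<noteq> 0" shows "lead_mono f = lead f"
proof (rule lead_monoI)
  show "lead f \<in> keys f" by (rule lead_in_keys[OF assms(2)])
  have deg: "mdeg u = d" if "u \<in> keys f" for u using assms(1) that by (auto simp: sp_def Mon_def)
  fix m' assume m': "m' \<in> keys f" "m' \<noteq> lead f"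
  then have "m' < lead f" using lead_ge[OF m'(1)] by simp
  then show "mono_gt (lead f) m'" unfolding mono_gt_def
    using deg[OF m'(1)] deg[OF lead_in_keys[OF assms(2)]] by simp
qed

text \<open>Lower degree counts as larger, so the leading monomial of an inhomogeneous polynomial
  sits in its lowest nonzero component. That component is the image of the component of
  \<open>p\<close> of the same degree, which again lies in the ideal.\<close>

lemma initial_leads:
  fixes g :: "'k::field_char_0 mat"
  assumes g: "g \<in> upper_tri_group n"
  shows "{monomial (lead_mono f) | f. f \<in> act g ` (Iof F \<inter> S_fin n) \<and> f \<noteq> 0} =
    (monomial ` (\<Union>d. LA 0 (IM F 0 n d) (Gof n g)) :: 'k S set)" (is "?L = ?R")
proof
  let ?s = "sb (U 0 (Gof n g)) :: 'k S \<Rightarrow> 'k S"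
  show "?L \<subseteq> ?R"
  proof
    fix x assume "x \<in> ?L"
    then obtain f where f: "x = monomial (lead_mono f)" "f \<in> act g ` (Iof F \<inter> S_fin n)" "f \<noteq> 0" by blast
    obtain p where p: "f = act g p" "p \<in> Iof F" "p \<in> S_fin n" using f(2) by blast
    have fs: "f = ?s p" using act_eq[OF g p(3)] p(1) by simp
    define d where "d = Min (mdeg ` keys f)"
    have kf: "mdeg ` keys f \<noteq> {}" "finite (mdeg ` keys f)" using lead_in_keys[OF f(3)] by auto
    have "d \<in> mdeg ` keys f" unfolding d_def by (rule Min_in[OF kf(2,1)])
    then obtain b where b: "b \<in> keys f" "mdeg b = d" by blast
    have dle: "d \<le> mdeg u" if "u \<in> keys f" for u unfolding d_def by (rule Min_le[OF kf(2)]) (use that in simp)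
    let ?h = "?s (hcomp d p)"
    have cp: "hcomp d p \<in> sp (IM F 0 n d)"
    proof -
      have "u \<in> IM F 0 n d" if u: "u \<in> keys p" "mdeg u = d" for u
      proof -
        have "keys u \<subseteq> {0..<n}" using p(3) u(1) unfolding polys_in_def by fastforce
        moreover have "keys u \<in> F" using p(2) u(1) by (simp add: Iof_def)
        ultimately show ?thesis using u(2) by (simp add: IM_def Mon_def)
      qed
      then show ?thesis by (auto simp: sp_def keys_hcomp)
    qed
    then have h: "?h \<in> sp (Mon 0 n d)" by (intro sb_U_in sp_IM_Mon)
    have hk: "u \<in> keys ?h \<longleftrightarrow> u \<in> keys f" if "mdeg u = d" for u
      using lookup_sb_hcomp[OF p(3) that, of "Gof n g"] by (simp add: in_keys_iff fs)
    have h0: "?h \<noteq> 0" using hk[OF b(2)] b(1) by auto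
    have hd: "mdeg u = d" if "u \<in> keys ?h" for u using h that by (auto simp: sp_def Mon_def)
    have lk: "lead ?h \<in> keys ?h" by (rule lead_in_keys[OF h0])
    have "lead_mono f = lead ?h"
    proof (rule lead_monoI)
      show "lead ?h \<in> keys f" using lk hk[OF hd[OF lk]] by simp
      fix m' assume m': "m' \<in> keys f" "m' \<noteq> lead ?h"
      show "mono_gt (lead ?h) m'"
      proof (cases "mdeg m' = d")
        case True
        then have "m' \<in> keys ?h" using hk m'(1) by simp
        then have "m' < lead ?h" using lead_ge m'(2) by (metis order_le_imp_less_or_eq)
        then show ?thesis using True hd[OF lk] by (simp add: mono_gt_def)
      next
        case False
        then show ?thesis using dle[OF m'(1)] hd[OF lk] by (simp add: mono_gt_def)
      qed
    qed
    moreover have "lead ?h \<in> LA 0 (IM F 0 n d) (Gof n g)" by (rule LA_I[OF cp h0])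
    ultimately show "x \<in> ?R" unfolding f(1) by blast
  qed
  show "?R \<subseteq> ?L"
  proof
    fix x assume "x \<in> ?R"
    then obtain d m where x: "x = monomial m" "m \<in> LA 0 (IM F 0 n d) (Gof n g)" by blast
    obtain p where p: "p \<in> sp (IM F 0 n d)" "?s p \<noteq> 0" "lead (?s p) = m" using x(2) by (rule LA_E)
    have pS: "p \<in> S_fin n" "p \<in> Iof F"
      using p(1) by (fastforce simp: sp_def IM_def Mon_def Iof_def polys_in_def)+
    have "lead_mono (?s p) = m" using lead_mono_hom[OF sb_U_in[OF sp_IM_Mon[OF p(1)]] p(2)] p(3) by simp
    moreover have "?s p \<in> act g ` (Iof F \<inter> S_fin n)" using act_eq[OF g pS(1)] pS by (metis IntI imageI)
    ultimately show "x \<in> ?L" using x(1) p(2) by blast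
  qed
qed

text \<open>Infinitely many degrees would impose infinitely many open conditions. By
  \<open>dickson\<close> all monomials in question are multiples of those of degree at most
  \<open>D\<close>; imposing the conditions up to \<open>D\<close> gives an inclusion in every
  degree by \<open>LA_mult\<close>, and counting makes it an equality.\<close>

lemma generic_AS_all:
  assumes F: "fam 0 F"
  shows "generic n (\<lambda>G :: nat \<times> nat \<Rightarrow> 'k::field_char_0. \<forall>d. LA 0 (IM F 0 n d) G = AS TYPE('k) F n d)"
proof -
  let ?A = "\<Union>d. AS TYPE('k) F n d"
  have deg: "keys m \<subseteq> {..<n}" "mdeg m = d" if "m \<in> AS TYPE('k) F n d" for m d
  proof -
    have "m \<in> Mon 0 n d" using that AS_sub by blast
    then show "keys m \<subseteq> {..<n}" "mdeg m = d" by (fastforce simp: Mon_def)+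
  qed
  have "keys m \<subseteq> {..<n}" if "m \<in> ?A" for m using that deg(1) by blast
  from dickson[OF this] obtain D where
    D: "\<forall>a\<in>?A. \<exists>b\<in>?A. \<exists>w. a = b + w \<and> mdeg b \<le> D \<and> (\<forall>b'\<in>?A. \<forall>w'. b = b' + w' \<longrightarrow> b' = b)" by (rule exE)
  have "generic n (\<lambda>G :: nat \<times> nat \<Rightarrow> 'k. \<forall>d\<in>{..D}. LA 0 (IM F 0 n d) G = AS TYPE('k) F n d)"
    by (rule generic_all) (simp_all add: generic_AS)
  then show ?thesis
  proof (rule generic_imp)
    fix G :: "nat \<times> nat \<Rightarrow> 'k" assume G: "G \<in> Up" and C: "\<forall>d\<in>{..D}. LA 0 (IM F 0 n d) G = AS TYPE('k) F n d"
    show "\<forall>d. LA 0 (IM F 0 n d) G = AS TYPE('k) F n d"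
    proof
      fix d
      have "AS TYPE('k) F n d \<subseteq> LA 0 (IM F 0 n d) G"
      proof
        fix m assume m: "m \<in> AS TYPE('k) F n d"
        then have "m \<in> ?A" by blast
        then obtain b w where b: "b \<in> ?A" "m = b + w" "mdeg b \<le> D" using D by meson
        obtain e where e: "b \<in> AS TYPE('k) F n e" using b(1) by blast
        have "e \<in> {..D}" using deg(2)[OF e] b(3) by simp
        then have bL: "b \<in> LA 0 (IM F 0 n e) G" using C e by simp
        have w: "w \<in> Mon 0 n (mdeg w)" using deg(1)[OF m] unfolding b(2) mono_keys_add Mon_def by fastforce
        have "w + b \<in> LA 0 (IM F 0 n (e + mdeg w)) G"
          by (rule LA_mult[OF G bL w]) (rule IM_mult[OF F _ _ order_refl])
        moreover have "e + mdeg w = d" using deg(2)[OF m] deg(2)[OF e] b(2) by simp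
        ultimately show "m \<in> LA 0 (IM F 0 n d) G" unfolding b(2) by (simp add: add.commute)
      qed
      then show "LA 0 (IM F 0 n d) G = AS TYPE('k) F n d"
        using card_seteq[OF finite_LA[OF IM_sub]] card_LA[OF IM_sub G] card_AS[where 'k='k]
        by (metis order_refl)
    qed
  qed
qed

lemma Gin_fin_eq:
  assumes F: "fam 0 F"
  shows "Gin_fin n (Iof F \<inter> S_fin n :: 'k::field_char_0 S set) =
    ideal_gen (S_fin n) (monomial ` (\<Union>d. AS TYPE('k) F n d))" (is "_ = ?N")
proof -
  obtain P :: "(nat \<times> nat, 'k) mpoly" and G0 :: "nat \<times> nat \<Rightarrow> 'k" where
    P: "P \<in> polys_in ({..<n} \<times> {..<n})" and G0: "G0 \<in> Up" "ev G0 P \<noteq> 0" and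
    C: "\<And>G d. G \<in> Up \<Longrightarrow> ev G P \<noteq> 0 \<Longrightarrow> LA 0 (IM F 0 n d) G = AS TYPE('k) F n d"
    using generic_AS_all[OF F, of n, where 'k='k] unfolding generic_def R_def by auto
  have init: "initial_ideal n (act g ` (Iof F \<inter> S_fin n)) = ?N"
    if g: "g \<in> upper_tri_group n" "ev (Gof n g) P \<noteq> 0" for g
    unfolding initial_ideal_def initial_leads[OF g(1)] C[OF Gof_Up[OF g(1)] g(2)] by (rule refl)
  have ev_mat: "ev (Gof n (mat n n G)) p = ev G p" if "p \<in> polys_in ({..<n} \<times> {..<n})"
    for G :: "nat \<times> nat \<Rightarrow> 'k" and p
    by (rule subst_cong[OF that]) (auto simp: Gof_in)
  show ?thesis unfolding Gin_fin_def
  proof (rule the_equality)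
    let ?U = "{g \<in> upper_tri_group n. \<exists>p\<in>{P}. subst (\<lambda>c. c) (\<lambda>(i, j). g $$ (i, j)) p \<noteq> 0}"
    have "zariski_open n ?U" unfolding zariski_open_def by (intro exI[of _ "{P}"]) (simp add: P)
    moreover have "mat n n G0 \<in> ?U"
    proof (intro CollectI conjI bexI[of _ P])
      show "mat n n G0 \<in> upper_tri_group n" by (rule mat_upper[OF G0(1)])
      show "subst (\<lambda>c. c) (\<lambda>(i, j). mat n n G0 $$ (i, j)) P \<noteq> 0"
        unfolding ev_Gof[OF P] ev_mat[OF P] by (rule G0(2))
    qed simp
    moreover have "initial_ideal n (act g ` (Iof F \<inter> S_fin n)) = ?N" if "g \<in> ?U" for g
    proof (rule init)
      show "g \<in> upper_tri_group n" using that by blast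
      have "subst (\<lambda>c. c) (\<lambda>(i, j). g $$ (i, j)) P \<noteq> 0" using that by blast
      then show "ev (Gof n g) P \<noteq> 0" unfolding ev_Gof[OF P] .
    qed
    ultimately show "\<exists>U. zariski_open n U \<and> U \<noteq> {} \<and> (\<forall>g\<in>U. initial_ideal n (act g ` (Iof F \<inter> S_fin n)) = ?N)"
      by (intro exI[of _ ?U] conjI ballI) blast+
  next
    \<comment> \<open>Uniqueness: another nonempty open set contains a matrix outside the
      hypersurface of \<open>P\<close>, where both values are attained.\<close>
    fix M :: "'k S set" assume "\<exists>U. zariski_open n U \<and> U \<noteq> {} \<and> (\<forall>g\<in>U. initial_ideal n (act g ` (Iof F \<inter> S_fin n)) = M)"
    then obtain U where U: "zariski_open n U" "U \<noteq> {}" "\<forall>g\<in>U. initial_ideal n (act g ` (Iof F \<inter> S_fin n)) = M" by blast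
    obtain Q where Q: "Q \<subseteq> polys_in ({..<n} \<times> {..<n})"
      "U = {g \<in> upper_tri_group n. \<exists>p\<in>Q. subst (\<lambda>c. c) (\<lambda>(i, j). g $$ (i, j)) p \<noteq> 0}"
      using U(1) unfolding zariski_open_def by (elim exE conjE)
    obtain g q where q: "g \<in> upper_tri_group n" "q \<in> Q" "subst (\<lambda>c. c) (\<lambda>(i, j). g $$ (i, j)) q \<noteq> 0"
      using U(2) unfolding Q(2) by blast
    have qp: "q \<in> polys_in ({..<n} \<times> {..<n})" using q(2) Q(1) by blast
    have "ev (Gof n g) q \<noteq> 0" using q(3) unfolding ev_Gof[OF qp] .
    moreover have "(\<lambda>G. ev G q) \<in> R n" "(\<lambda>G. ev G P) \<in> R n" using qp P unfolding R_def by blast+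
    ultimately obtain G where G: "G \<in> Up" "ev G P \<noteq> 0" "ev G q \<noteq> 0"
      using generic_meet[of "\<lambda>G. ev G P" n G0 "\<lambda>G. ev G q" "Gof n g"] G0 Gof_Up[OF q(1)] by blast
    let ?g = "mat n n G"
    have "?g \<in> upper_tri_group n" by (rule mat_upper[OF G(1)])
    moreover have "subst (\<lambda>c. c) (\<lambda>(i, j). ?g $$ (i, j)) q \<noteq> 0" 
      unfolding ev_Gof[OF qp] ev_mat[OF qp] by (rule G(3))
    ultimately have "?g \<in> U" unfolding Q(2) using q(2) by blast
    then have "M = initial_ideal n (act ?g ` (Iof F \<inter> S_fin n))" using U(3) by blast
    also have "\<dots> = ?N" by (rule init[OF mat_upper[OF G(1)]]) (unfold ev_mat[OF P], rule G(2))
    finally show "M = ?N" .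
  qed
qed

section \<open>Passage to infinitely many variables\<close>

definition GM :: "'k::field_char_0 itself \<Rightarrow> nat set set \<Rightarrow> mono set" where
  "GM T F = {m. \<exists>n0. \<forall>n\<ge>n0. m \<in> AS T F n (mdeg m)}"

text \<open>Once the bound holds and the variables of \<open>m\<close> are available,
  \<open>AS_restrict\<close> makes membership independent of \<open>n\<close>.\<close>

lemma GM_iff:
  assumes F: "fam 0 F" and b: "bnd F d n" and m: "m \<in> Mon 0 n d"
  shows "m \<in> GM TYPE('k::field_char_0) F \<longleftrightarrow> m \<in> AS TYPE('k) F n d"
proof
  have d: "mdeg m = d" using m by (simp add: Mon_def)
  have r: "m \<in> AS TYPE('k) F n' d \<longleftrightarrow> m \<in> AS TYPE('k) F n d" if "n \<le> n'" for n'
    by (rule AS_restrict[OF F b that m])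
  show "m \<in> AS TYPE('k) F n d" if "m \<in> GM TYPE('k) F"
  proof -
    have "\<exists>n0. \<forall>n\<ge>n0. m \<in> AS TYPE('k) F n (mdeg m)" using that unfolding GM_def by (rule CollectD)
    then obtain n0 where "\<forall>n\<ge>n0. m \<in> AS TYPE('k) F n d" unfolding d by (rule exE)
    then have "m \<in> AS TYPE('k) F (max n n0) d" by (rule allE[of _ "max n n0"]) simp
    then show ?thesis by (rule iffD1[OF r, rotated]) simp
  qed
  show "m \<in> GM TYPE('k) F" if "m \<in> AS TYPE('k) F n d"
    unfolding GM_def by (intro CollectI exI[of _ n] allI impI) (unfold d, rule iffD2[OF r that])
qed

lemma bnd_large:
  assumes F: "fam 0 F" and b: "\<And>d. \<exists>n. bnd F d n" and V: "finite V"
  shows "\<exists>n. bnd F d n \<and> V \<subseteq> {..<n::nat}"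
proof -
  obtain n where n: "bnd F d n" using b by blast
  obtain n' where n': "V \<subseteq> {..<n'}" using V finite_nat_iff_bounded by blast
  have "bnd F d (max n n')" by (rule bnd_mono[OF F n]) simp_all
  moreover have "V \<subseteq> {..<max n n'}" using n' by fastforce
  ultimately show ?thesis by blast
qed

lemma stable_GM:
  assumes F: "fam 0 F" and b: "\<And>d. \<exists>n. bnd F d n"
  shows "stable (GM TYPE('k::field_char_0) F)"
  unfolding stable_def
proof (intro conjI ballI allI impI)
  fix m w assume m: "m \<in> GM TYPE('k) F"
  obtain n where n: "bnd F (mdeg m + mdeg w) n" "keys (w + m) \<subseteq> {..<n}"
    using bnd_large[OF F b, of "keys (w + m)" "mdeg m + mdeg w"] by auto
  have bm: "bnd F (mdeg m) n" by (rule bnd_mono[OF F n(1)]) simp_all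
  have mem: "m \<in> Mon 0 n (mdeg m)" "w \<in> Mon 0 n (mdeg w)" "w + m \<in> Mon 0 n (mdeg m + mdeg w)"
    using n(2) by (auto simp: Mon_def mono_keys_add)
  have "m \<in> AS TYPE('k) F n (mdeg m)" using GM_iff[OF F bm mem(1)] m by blast
  then have "w + m \<in> AS TYPE('k) F n (mdeg m + mdeg w)" by (rule AS_mult[OF F _ mem(2) order_refl])
  then show "w + m \<in> GM TYPE('k) F" using GM_iff[OF F n(1) mem(3)] by blast
next
  fix m v assume m: "m \<in> GM TYPE('k) F" and v: "mdeg v = mdeg m \<and> (\<forall>k. pref m k \<le> pref v k)"
  obtain n where n: "bnd F (mdeg m) n" "keys m \<union> keys v \<subseteq> {..<n}"
    using bnd_large[OF F b, of "keys m \<union> keys v" "mdeg m"] by auto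
  have mem: "m \<in> Mon 0 n (mdeg m)" "v \<in> Mon 0 n (mdeg m)" using n(2) v by (auto simp: Mon_def)
  have "m \<in> AS TYPE('k) F n (mdeg m)" using GM_iff[OF F n(1) mem(1)] m by blast
  then have "v \<in> AS TYPE('k) F n (mdeg m)" by (rule AS_dom[OF _ mem(2)]) (use v in blast)
  then show "v \<in> GM TYPE('k) F" using GM_iff[OF F n(1) mem(2)] by blast
qed

lemma GM_prefix:
  assumes F: "fam 0 F" and b: "bnd F (mdeg m) n" and m: "m \<in> GM TYPE('k::field_char_0) F"
  shows "\<exists>w m0. m = w + m0 \<and> m0 \<in> GM TYPE('k) F \<and> keys m0 \<subseteq> {..<n} \<and> keys w \<subseteq> {n..}"
proof -
  let ?d = "mdeg m"
  obtain k where k: "keys m \<subseteq> {..<k}" using finite_nat_iff_bounded[of "keys m"] by auto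
  let ?n = "max n k"
  have "m \<in> Mon 0 ?n ?d" using k by (fastforce simp: Mon_def)
  moreover have "bnd F ?d ?n" by (rule bnd_mono[OF F b]) simp_all
  ultimately have "m \<in> AS TYPE('k) F ?n ?d" using GM_iff[OF F] m by blast
  then have "m \<in> ext (AS TYPE('k) F n) n ?n ?d" using AS_ext[OF F b, of ?n, where 'k='k] by simp
  then obtain e m0 w where e: "e \<le> ?d" "m0 \<in> AS TYPE('k) F n e" "w \<in> Mon n ?n (?d - e)" "m = w + m0"
    unfolding ext_def by auto
  have m0: "m0 \<in> Mon 0 n e" using e(2) AS_sub by blast
  have "bnd F e n" by (rule bnd_mono[OF F b e(1) order_refl])
  then have "m0 \<in> GM TYPE('k) F" using GM_iff[OF F _ m0] e(2) by blast
  moreover have "keys m0 \<subseteq> {..<n}" using m0 by (auto simp: Mon_def)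
  moreover have "keys w \<subseteq> {n..}" using e(3) by (auto simp: Mon_def)
  ultimately show ?thesis using e(4) by blast
qed

lemma mdvd_trans: "mdvd a b \<Longrightarrow> mdvd b c \<Longrightarrow> mdvd a c"
  unfolding mdvd_def by (metis add.assoc)

lemma one_S_fin: "1 \<in> S_fin n"
  by (simp add: polys_in_def)

lemma ideal_gen_ideal_gen:
  "ideal_gen UNIV (ideal_gen (S_fin n) (monomial ` A)) = (ideal_gen UNIV (monomial ` A) :: 'k::field_char_0 S set)"
proof
  show "ideal_gen UNIV (monomial ` A) \<subseteq> (ideal_gen UNIV (ideal_gen (S_fin n) (monomial ` A)) :: 'k S set)"
    by (rule ideal_gen_mono) (auto intro: ideal_gen_in one_S_fin)
  show "ideal_gen UNIV (ideal_gen (S_fin n) (monomial ` A)) \<subseteq> (ideal_gen UNIV (monomial ` A) :: 'k S set)"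
  proof
    fix p :: "'k S" assume p: "p \<in> ideal_gen UNIV (ideal_gen (S_fin n) (monomial ` A))"
    have "\<exists>a\<in>A. mdvd a m" if m: "m \<in> keys p" for m
    proof -
      obtain q :: "'k S" and u where q: "q \<in> ideal_gen (S_fin n) (monomial ` A)" "u \<in> keys q" "mdvd u m"
        using ideal_gen_key[OF p m] by blast
      obtain b :: "'k S" and c where b: "b \<in> monomial ` A" "c \<in> keys b" "mdvd c u" using ideal_gen_key[OF q(1,2)] by blast
      have "c \<in> A" using b(1,2) by auto
      then show ?thesis using mdvd_trans[OF b(3) q(3)] by blast
    qed
    then show "p \<in> ideal_gen UNIV (monomial ` A)" by (simp add: ideal_gen_monos_UNIV)
  qed
qed

lemma mdvd_GM:
  assumes F: "fam 0 F" and b: "\<And>d. \<exists>n. bnd F d n"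
  shows "(\<exists>a\<in>GM TYPE('k::field_char_0) F. mdvd a m) \<longleftrightarrow> m \<in> GM TYPE('k) F"
proof
  assume "\<exists>a\<in>GM TYPE('k) F. mdvd a m"
  then obtain a u where a: "a \<in> GM TYPE('k) F" "m = a + u" unfolding mdvd_def by blast
  have "u + a \<in> GM TYPE('k) F" by (rule stable_mult[OF stable_GM[OF F b] a(1)])
  then show "m \<in> GM TYPE('k) F" unfolding a(2) by (simp add: add.commute)
next
  assume "m \<in> GM TYPE('k) F"
  moreover have "mdvd m m" unfolding mdvd_def by (intro exI[of _ 0]) simp
  ultimately show "\<exists>a\<in>GM TYPE('k) F. mdvd a m" by blast
qed

text \<open>In degree \<open>d\<close> the extended ideal has reached its final value as soon as
  \<open>bnd F d n\<close> holds, since by \<open>GM_prefix\<close> every limit monomial is then a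
  multiple of one in the first \<open>n\<close> variables.\<close>

lemma Gin_eq:
  assumes F: "fam 0 F" and b: "\<And>d. \<exists>n. bnd F d n"
  shows "Gin (Iof F :: 'k::field_char_0 S set) = ideal_gen UNIV (monomial ` GM TYPE('k) F)" (is "_ = ?L")
proof -
  have ev: "{p \<in> ideal_gen UNIV (Gin_fin n (Iof F \<inter> S_fin n)). homogeneous d p} = {p \<in> ?L. homogeneous d p}"
    if n: "bnd F d n" for d n
  proof -
    have eq: "(\<exists>a\<in>\<Union>e. AS TYPE('k) F n e. mdvd a m) \<longleftrightarrow> m \<in> GM TYPE('k) F" if m: "mdeg m = d" for m
    proof
      assume "\<exists>a\<in>\<Union>e. AS TYPE('k) F n e. mdvd a m"
      then obtain a e u where a: "a \<in> AS TYPE('k) F n e" "m = a + u" unfolding mdvd_def by blast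
      have aM: "a \<in> Mon 0 n e" using a(1) AS_sub by blast
      have "e \<le> d" using m a(2) aM by (auto simp: Mon_def)
      then have "bnd F e n" by (rule bnd_mono[OF F n _ order_refl])
      then have aG: "a \<in> GM TYPE('k) F" using GM_iff[OF F _ aM] a(1) by blast
      show "m \<in> GM TYPE('k) F" unfolding mdvd_GM[OF F b, symmetric]
        by (rule bexI[OF _ aG]) (unfold mdvd_def a(2), rule exI, rule refl)
    next
      assume mG: "m \<in> GM TYPE('k) F"
      have bm: "bnd F (mdeg m) n" using n m by simp
      obtain w m0 where m0: "m = w + m0" "m0 \<in> GM TYPE('k) F" "keys m0 \<subseteq> {..<n}"
        using GM_prefix[OF F bm mG] by blast
      have mM: "m0 \<in> Mon 0 n (mdeg m0)" using m0(3) by (auto simp: Mon_def)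
      have "mdeg m0 \<le> d" using m m0(1) by simp
      then have "bnd F (mdeg m0) n" by (rule bnd_mono[OF F n _ order_refl])
      then have "m0 \<in> AS TYPE('k) F n (mdeg m0)" using GM_iff[OF F _ mM] m0(2) by blast
      moreover have "mdvd m0 m" unfolding mdvd_def m0(1) by (intro exI[of _ w]) (rule add.commute)
      ultimately show "\<exists>a\<in>\<Union>e. AS TYPE('k) F n e. mdvd a m" by blast
    qed
    have "((\<forall>m\<in>keys p. \<exists>a\<in>\<Union>e. AS TYPE('k) F n e. mdvd a m) \<and> homogeneous d p) \<longleftrightarrow>
      ((\<forall>m\<in>keys p. m \<in> GM TYPE('k) F) \<and> homogeneous d p)" for p :: "'k S"
    proof (cases "homogeneous d p")
      case True
      have "(\<forall>m\<in>keys p. \<exists>a\<in>\<Union>e. AS TYPE('k) F n e. mdvd a m) \<longleftrightarrow> (\<forall>m\<in>keys p. m \<in> GM TYPE('k) F)"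
      proof (rule ball_cong[OF refl eq])
        show "mdeg m = d" if "m \<in> keys p" for m using True that unfolding homogeneous_def by blast
      qed
      then show ?thesis by (simp only:)
    qed (simp only: simp_thms)
    then show ?thesis
      unfolding Gin_fin_eq[OF F] ideal_gen_ideal_gen ideal_gen_monos_UNIV mem_Collect_eq mdvd_GM[OF F b]
      by (rule Collect_cong)
  qed
  have evt: "\<forall>\<^sub>F n in sequentially. {p \<in> ideal_gen UNIV (Gin_fin n (Iof F \<inter> S_fin n)). homogeneous d p} = {p \<in> ?L. homogeneous d p}" for d
  proof -
    obtain n where n: "bnd F d n" using b by blast
    show ?thesis by (rule eventually_sequentiallyI[of n]) (rule ev[OF bnd_mono[OF F n order_refl]])
  qed
  show ?thesis unfolding Gin_def
  proof (rule the_equality)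
    show "monomial_ideal ?L \<and> (\<forall>d. \<forall>\<^sub>F n in sequentially.
        {p \<in> ideal_gen UNIV (Gin_fin n (Iof F \<inter> S_fin n)). homogeneous d p} = {p \<in> ?L. homogeneous d p})"
      using evt unfolding monomial_ideal_def by blast
  next
    \<comment> \<open>Uniqueness: a monomial ideal is determined by its monomials, and each of them
      is tested in a single degree.\<close>
    fix L' :: "'k S set" assume L': "monomial_ideal L' \<and> (\<forall>d. \<forall>\<^sub>F n in sequentially.
        {p \<in> ideal_gen UNIV (Gin_fin n (Iof F \<inter> S_fin n)). homogeneous d p} = {p \<in> L'. homogeneous d p})"
    have mL: "monomial m \<in> L' \<longleftrightarrow> monomial m \<in> ?L" for m
    proof -
      have "\<forall>\<^sub>F n in sequentially.
        {p \<in> ideal_gen UNIV (Gin_fin n (Iof F \<inter> S_fin n)). homogeneous (mdeg m) p} = {p \<in> L'. homogeneous (mdeg m) p}"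
        using L' by blast
      then have "\<forall>\<^sub>F n in sequentially. {p \<in> L'. homogeneous (mdeg m) p} = {p \<in> ?L. homogeneous (mdeg m) p}"
        using evt[of "mdeg m"] by eventually_elim simp
      then have "{p \<in> L'. homogeneous (mdeg m) p} = {p \<in> ?L. homogeneous (mdeg m) p}"
        by (simp only: eventually_const sequentially_bot not_False_eq_True)
      moreover have "homogeneous (mdeg m) (monomial m :: 'k S)" by (simp add: homogeneous_def)
      ultimately show ?thesis by blast
    qed
    have "monomial_ideal ?L" unfolding monomial_ideal_def by blast
    then show "L' = ?L" using L' monomial_ideal_mem[of L'] monomial_ideal_mem[of ?L] mL by blast
  qed
qed

text \<open>The ideal is generated by the shifts of minimal generators only. By
  \<open>stable_prefix\<close> every member of \<open>GM\<close> begins with a minimal generator,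
  and by \<open>PhiS_split\<close> its shifted set contains the shifted generator.\<close>

lemma Delta_eq:
  assumes F: "fam 0 F" and b: "\<And>d. \<exists>n. bnd F d n"
  shows "Delta_lex (Iof F :: 'k::field_char_0 S set) = Iof (PhiS ` GM TYPE('k) F)"
proof -
  let ?M = "GM TYPE('k) F"
  let ?L = "ideal_gen UNIV (monomial ` ?M) :: 'k S set"
  have st: "stable ?M" by (rule stable_GM[OF F b])
  have mem: "monomial m \<in> ?L \<longleftrightarrow> m \<in> ?M" for m unfolding ideal_gen_monos_UNIV mdvd_GM[OF F b] by simp
  have eq: "(\<exists>a\<in>Phi_mono ` min_gens ?L. mdvd a m) \<longleftrightarrow> keys m \<in> PhiS ` ?M" for m
  proof
    assume "\<exists>a\<in>Phi_mono ` min_gens ?L. mdvd a m"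
    then obtain g where g: "g \<in> min_gens ?L" "mdvd (xm (PhiS g)) m" unfolding Phi_mono_eq by blast
    have "g \<in> ?M" using g(1) mem unfolding min_gens_def by blast
    then have "PhiS g \<in> PhiS ` ?M" by blast
    moreover have "PhiS g \<subseteq> keys m" using mdvd_keys[OF g(2)] by simp
    ultimately show "keys m \<in> PhiS ` ?M" by (rule famD(3)[OF fam_PhiS[OF st]]) simp_all
  next
    assume "keys m \<in> PhiS ` ?M"
    then obtain u where u: "keys m = PhiS u" "u \<in> ?M" by blast
    obtain m0 m1 a where m0: "u = m0 + m1" "keys m0 \<subseteq> {..a}" "keys m1 \<subseteq> {a..}" "m0 \<in> ?M"
      "\<forall>m' w. m' \<in> ?M \<and> m0 = m' + w \<longrightarrow> m' = m0"
      using stable_prefix[OF st u(2)] by (elim exE conjE)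
    have "m0 \<in> min_gens ?L" unfolding min_gens_def using m0(4,5) mem unfolding mdvd_def by blast
    moreover have "mdvd (xm (PhiS m0)) m" by (rule xm_mdvd) (use PhiS_split[OF m0(2,3)] u(1) m0(1) in simp)
    ultimately show "\<exists>a\<in>Phi_mono ` min_gens ?L. mdvd a m" unfolding Phi_mono_eq by blast
  qed
  have "Delta_lex (Iof F :: 'k S set) = ideal_gen UNIV (monomial ` Phi_mono ` min_gens ?L)"
    unfolding Delta_lex_def Phi_def Gin_eq[OF F b] by (rule refl)
  also have "\<dots> = {p. \<forall>m\<in>keys p. \<exists>a\<in>Phi_mono ` min_gens ?L. mdvd a m}" by (rule ideal_gen_monos_UNIV)
  also have "\<dots> = Iof (PhiS ` ?M)" unfolding Iof_def eq by (rule refl)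
  finally show ?thesis .
qed

section \<open>Comparison with the shifted ideal\<close>

definition shift :: "'k::field_char_0 itself \<Rightarrow> nat set set \<Rightarrow> nat set set" where
  "shift T F = PhiS ` GM T F"

lemma fam_shift:
  assumes F: "fam 0 F" and b: "\<And>d. \<exists>n. bnd F d n" shows "fam 0 (shift TYPE('k::field_char_0) F)"
  unfolding shift_def by (rule fam_PhiS[OF stable_GM[OF F b]])

lemma bnd_shift:
  assumes F: "fam 0 F" and b: "\<And>d. \<exists>n. bnd F d n" and n: "bnd F d n"
  shows "bnd (shift TYPE('k::field_char_0) F) d (n + d)"
  unfolding shift_def
proof (rule bnd_PhiS[OF stable_GM[OF F b]])
  fix m assume m: "m \<in> GM TYPE('k) F" "mdeg m \<le> d"
  have bm: "bnd F (mdeg m) n" by (rule bnd_mono[OF F n m(2) order_refl])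
  obtain w m0 where h: "m = w + m0" "m0 \<in> GM TYPE('k) F" "keys m0 \<subseteq> {..<n}" "keys w \<subseteq> {n..}"
    using GM_prefix[OF F bm m(1)] by (elim exE conjE)
  show "\<exists>m0 m1 a. m = m0 + m1 \<and> keys m0 \<subseteq> {..a} \<and> keys m1 \<subseteq> {a..} \<and> m0 \<in> GM TYPE('k) F \<and>
    keys m0 \<subseteq> {..<n} \<and> mdeg m0 \<le> d"
  proof (intro exI conjI)
    show "m = m0 + w" unfolding h(1) by (rule add.commute)
    show "keys m0 \<subseteq> {..n}" using h(3) by fastforce
    show "mdeg m0 \<le> d" using m(2) unfolding h(1) by simp
  qed (rule h)+
qed

text \<open>For a bound in all degrees at once, \<open>dickson\<close> limits to \<open>D\<close>
  the degrees of minimal members in the first \<open>n\<close> variables. The prefix given by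
  \<open>stable_prefix\<close> is such a member, so \<open>n + D\<close> works.\<close>

lemma bnd_shift_uniform:
  assumes F: "fam 0 F" and n: "\<And>d. bnd F d n"
  shows "\<exists>n'. \<forall>d. bnd (shift TYPE('k::field_char_0) F) d n'"
proof -
  let ?M = "GM TYPE('k) F"
  have b: "\<And>d. \<exists>n. bnd F d n" using n by (rule exI)
  have st: "stable ?M" by (rule stable_GM[OF F b])
  define A where "A = {m\<in>?M. keys m \<subseteq> {..<n}}"
  have kA: "keys m \<subseteq> {..<n}" if "m \<in> A" for m using that unfolding A_def by simp
  obtain D where D: "\<forall>a\<in>A. \<exists>b\<in>A. \<exists>w. a = b + w \<and> mdeg b \<le> D \<and> (\<forall>b'\<in>A. \<forall>w'. b = b' + w' \<longrightarrow> b' = b)"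
    using dickson[OF kA] by (rule exE)
  have "bnd (PhiS ` ?M) d (n + D)" for d
  proof (rule bnd_PhiS[OF st])
    fix m assume m: "m \<in> ?M" "mdeg m \<le> d"
    obtain w q where q: "m = w + q" "q \<in> ?M" "keys q \<subseteq> {..<n}" "keys w \<subseteq> {n..}"
      using GM_prefix[OF F n m(1)] by (elim exE conjE)
    obtain p0 p1 a where p: "q = p0 + p1" "keys p0 \<subseteq> {..a}" "keys p1 \<subseteq> {a..}" "p0 \<in> ?M"
      "\<forall>m' w. m' \<in> ?M \<and> p0 = m' + w \<longrightarrow> m' = p0"
      using stable_prefix[OF st q(2)] by (elim exE conjE)
    have pn: "keys p0 \<subseteq> {..<n}" using q(3) unfolding p(1) mono_keys_add by (rule order_trans[OF Un_upper1])
    then have pA: "p0 \<in> A" using p(4) unfolding A_def by simp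
    obtain b where b: "b \<in> A" "\<exists>w. p0 = b + w \<and> mdeg b \<le> D \<and> (\<forall>b'\<in>A. \<forall>w'. b = b' + w' \<longrightarrow> b' = b)"
      using bspec[OF D pA] by (rule bexE)
    obtain v where v: "p0 = b + v" "mdeg b \<le> D" using b(2) by (elim exE conjE)
    have "b \<in> ?M" using b(1) unfolding A_def by simp
    then have "b = p0" using p(5)[rule_format, of b v] v(1) by simp
    then have pD: "mdeg p0 \<le> D" using v(2) by simp
    show "\<exists>m0 m1 a. m = m0 + m1 \<and> keys m0 \<subseteq> {..a} \<and> keys m1 \<subseteq> {a..} \<and> m0 \<in> ?M \<and>
      keys m0 \<subseteq> {..<n} \<and> mdeg m0 \<le> D"
    proof (intro exI conjI)
      show "m = p0 + (p1 + w)" unfolding q(1) p(1) by (simp add: add.commute add.left_commute)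
      show "keys p0 \<subseteq> {..min a n}" using p(2) pn by fastforce
      have "keys p1 \<subseteq> {min a n..}" by (rule order_trans[OF p(3)]) simp
      moreover have "keys w \<subseteq> {min a n..}" by (rule order_trans[OF q(4)]) simp
      ultimately show "keys (p1 + w) \<subseteq> {min a n..}" unfolding mono_keys_add by (rule Un_least)
    qed (rule p pn pD)+
  qed
  then show ?thesis unfolding shift_def by blast
qed

text \<open>Injectivity of \<open>PhiS\<close> undoes the shift. This identity turns statements
  about generic initial monomials into statements about the shifted family.\<close>

lemma JM_shift:
  assumes F: "fam 0 F" and n: "bnd F d n"
  shows "JM (shift TYPE('k::field_char_0) F) 0 n d = AS TYPE('k) F n d"
proof -
  have "PhiS m \<in> PhiS ` GM TYPE('k) F \<longleftrightarrow> m \<in> GM TYPE('k) F" for m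
    by (auto dest: inj_PhiS)
  then have "JM (shift TYPE('k) F) 0 n d = {m\<in>Mon 0 n d. m \<in> GM TYPE('k) F}" unfolding JM_def shift_def by simp
  also have "\<dots> = {m\<in>Mon 0 n d. m \<in> AS TYPE('k) F n d}" using GM_iff[OF F n, where 'k='k] by (intro Collect_cong conj_cong refl)
  also have "\<dots> = AS TYPE('k) F n d" using AS_sub[where 'k='k, of F n d] by blast
  finally show ?thesis .
qed

lemma card_shift:
  assumes F: "fam 0 F" and b: "\<And>d. \<exists>n. bnd F d n" and n: "bnd F d n" and n': "bnd (shift TYPE('k::field_char_0) F) d n"
  shows "card (IM F 0 n d) = card (IM (shift TYPE('k) F) 0 n d)"
  using card_IM_JM[OF fam_shift[OF F b] n'] unfolding JM_shift[OF F n] card_AS by (rule sym)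

lemma JM_le_shift:
  assumes F: "fam 0 F" and n: "bnd F d n"
  shows "mset_set (JM F 0 n d) \<le> mset_set (JM (shift TYPE('k::field_char_0) F) 0 n d)"
proof -
  obtain G :: "nat \<times> nat \<Rightarrow> 'k" where G: "G \<in> Up" "nd 0 (IM F 0 n d) (JM F 0 n d) G"
    using pairing[OF F n, where 'k='k] by (rule bexE)
  have "mset_set (JM F 0 n d) \<le> mset_set (LA 0 (IM F 0 n d) G)"
    by (rule LA_ge[OF IM_sub G finite_JM card_IM_JM[OF F n, symmetric]])
  also have "\<dots> \<le> mset_set (AS TYPE('k) F n d)" by (rule AS_ge[OF G(1)])
  finally show ?thesis unfolding JM_shift[OF F n] .
qed

text \<open>Take the least size at which the families differ. A differing set of this size lies
  below \<open>n\<close>, since otherwise its restriction would be smaller, where the families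
  agree. So \<open>JM\<close> sees all differences, and the comparison of multisets assigns the
  largest to \<open>F'\<close>.\<close>

lemma first_diff:
  assumes F: "fam 0 F" and F': "fam 0 F'" and b: "\<And>d. \<exists>n. bnd F d n \<and> bnd F' d n"
    and le: "\<forall>d n. bnd F d n \<and> bnd F' d n \<longrightarrow> mset_set (JM F 0 n d) \<le> mset_set (JM F' 0 n d)" and ne: "F \<noteq> F'"
  shows "\<exists>T n. T \<in> F' \<and> T \<notin> F \<and> bnd F (card T) n \<and> bnd F' (card T) n \<and> T \<subseteq> {..<n} \<and>
    (\<forall>X. finite X \<and> card X < card T \<longrightarrow> (X \<in> F \<longleftrightarrow> X \<in> F')) \<and>
    (\<forall>X. finite X \<and> card X = card T \<and> (X \<in> F) \<noteq> (X \<in> F') \<and> X \<noteq> T \<longrightarrow>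
      (\<exists>i. i \<in> T \<and> i \<notin> X \<and> (\<forall>j<i. j \<in> T \<longleftrightarrow> j \<in> X)))"
proof -
  define P where "P d \<longleftrightarrow> (\<exists>X. finite X \<and> card X = d \<and> (X \<in> F) \<noteq> (X \<in> F'))" for d
  obtain X where X: "(X \<in> F) \<noteq> (X \<in> F')" using ne by blast
  have "finite X" using X famD(1)[OF F, of X] famD(1)[OF F', of X] by argo
  then have "P (card X)" unfolding P_def using X by blast
  then have exP: "\<exists>d. P d" by (rule exI)
  define d where "d = (LEAST d. P d)"
  have Pd: "P d" unfolding d_def by (rule LeastI_ex[OF exP])
  have low: "X \<in> F \<longleftrightarrow> X \<in> F'" if "finite X" "card X < d" for X
  proof -
    have "\<not> P (card X)" using that(2) unfolding d_def by (rule not_less_Least)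
    then show ?thesis unfolding P_def using that(1) by blast
  qed
  obtain n where n: "bnd F d n" "bnd F' d n" using b by blast
  have aux: "X \<in> H'" if H: "X \<in> H" "bnd H d n" "fam 0 H'" "card X = d" "finite X" "X \<inter> {..<n} \<in> H \<Longrightarrow> X \<inter> {..<n} \<in> H'"
    for X H H'
  proof -
    have "X \<inter> {..<n} \<in> H" by (rule H(2)[unfolded bnd_def, rule_format, OF H(1)]) (simp only: H(4) order_refl)
    then have "X \<inter> {..<n} \<in> H'" by (rule H(6))
    then show ?thesis by (rule famD(3)[OF H(3) _ Int_lower1 H(5)]) simp
  qed
  have sub: "X \<subseteq> {..<n}" if X: "finite X" "card X = d" "(X \<in> F) \<noteq> (X \<in> F')" for X
  proof (rule ccontr)
    assume "\<not> X \<subseteq> {..<n}"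
    then have "X \<inter> {..<n} \<subset> X" by blast
    then have "card (X \<inter> {..<n}) < d" using psubset_card_mono[OF X(1)] X(2) by simp
    then have eq: "X \<inter> {..<n} \<in> F \<longleftrightarrow> X \<inter> {..<n} \<in> F'" by (rule low[rotated]) (simp add: X(1))
    have "X \<in> F'" if "X \<in> F" by (rule aux[OF that n(1) F' X(2,1) iffD1[OF eq]])
    moreover have "X \<in> F" if "X \<in> F'" by (rule aux[OF that n(2) F X(2,1) iffD2[OF eq]])
    ultimately show False using X(3) by argo
  qed
  have toU: "\<exists>u. PhiS u = X \<and> u \<in> Mon 0 n d" if X: "finite X" "card X = d" "X \<subseteq> {..<n}" for X
  proof -
    obtain m where m: "PhiS m = X" "\<forall>y. X \<subseteq> {..<y} \<longrightarrow> keys m \<subseteq> {..y - card X}"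
      using PhiS_surj[OF X(1)] by (elim exE conjE)
    have md: "mdeg m = d" using X(2) card_PhiS[of m] m(1) by simp
    have "keys m \<subseteq> {0..<n}"
    proof (cases "d = 0")
      case True
      then have "m = 0" using md by simp
      then show ?thesis by simp
    next
      case False
      then have "X \<noteq> {}" using X(2) by auto
      then have "0 < n" using X(3) by auto
      then have "{..n - d} \<subseteq> {0..<n}" using False by auto
      moreover have "keys m \<subseteq> {..n - d}" using m(2)[rule_format, OF X(3)] X(2) by simp
      ultimately show ?thesis by (rule order_trans[rotated])
    qed
    then show ?thesis using m(1) md by (auto simp: Mon_def)
  qed
  let ?A = "JM F 0 n d" and ?B = "JM F' 0 n d"
  define E where "E = (?A - ?B) \<union> (?B - ?A)"
  have finE: "finite E" unfolding E_def by simp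
  have inE: "u \<in> E \<longleftrightarrow> (PhiS u \<in> F) \<noteq> (PhiS u \<in> F')" if "u \<in> Mon 0 n d" for u
    using that unfolding E_def JM_def by blast
  obtain X0 where X0: "finite X0" "card X0 = d" "(X0 \<in> F) \<noteq> (X0 \<in> F')" using Pd unfolding P_def by blast
  obtain u0 where u0: "PhiS u0 = X0" "u0 \<in> Mon 0 n d" using toU[OF X0(1,2) sub[OF X0]] by blast
  have "u0 \<in> E" using inE[OF u0(2)] X0(3) u0(1) by blast
  define m where "m = Max E"
  have mE: "m \<in> E" unfolding m_def by (rule Max_in[OF finE]) (use \<open>u0 \<in> E\<close> in blast)
  have mx: "u \<le> m" if "u \<in> E" for u unfolding m_def by (rule Max_ge[OF finE that])
  have mB: "m \<in> ?B - ?A"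
  proof (rule ccontr)
    assume "m \<notin> ?B - ?A"
    then have "m \<in> ?A - ?B" using mE unfolding E_def by blast
    then obtain x where "x \<in> ?B - ?A" "m < x" using le n set_le_iff[OF finite_JM finite_JM] by meson
    then show False using mx[of x] unfolding E_def by (meson UnI2 leD)
  qed
  then have mM: "m \<in> Mon 0 n d" and T: "PhiS m \<in> F'" "PhiS m \<notin> F" unfolding JM_def by blast+
  have md: "mdeg m = d" using mM by (simp add: Mon_def)
  have cT: "card (PhiS m) = d" using md by simp
  have top: "\<exists>i. i \<in> PhiS m \<and> i \<notin> X \<and> (\<forall>j<i. j \<in> PhiS m \<longleftrightarrow> j \<in> X)"
    if X: "finite X" "card X = d" "(X \<in> F) \<noteq> (X \<in> F')" "X \<noteq> PhiS m" for X
  proof -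
    obtain u where u: "PhiS u = X" "u \<in> Mon 0 n d" using toU[OF X(1,2) sub[OF X(1-3)]] by blast
    have "u \<in> E" using inE[OF u(2)] X(3) u(1) by blast
    then have "u \<le> m" by (rule mx)
    moreover have "u \<noteq> m" using X(4) u(1) by blast
    ultimately have "u < m" by (rule order.not_eq_order_implies_strict[rotated])
    moreover have "mdeg u = mdeg m" using u(2) md by (simp add: Mon_def)
    ultimately show ?thesis unfolding u(1)[symmetric] by (rule mono_less_PhiS)
  qed
  show ?thesis
  proof (rule exI[of _ "PhiS m"], rule exI[of _ n], intro conjI allI impI)
    show "PhiS m \<in> F'" "PhiS m \<notin> F" by (rule T)+
    show "bnd F (card (PhiS m)) n" "bnd F' (card (PhiS m)) n" unfolding cT by (rule n)+
    show "PhiS m \<subseteq> {..<n}" by (rule sub[OF finite_PhiS cT]) (use T in simp)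
    show "X \<in> F \<longleftrightarrow> X \<in> F'" if "finite X \<and> card X < card (PhiS m)" for X
      using low[of X] that unfolding cT by blast
    show "\<exists>i. i \<in> PhiS m \<and> i \<notin> X \<and> (\<forall>j<i. j \<in> PhiS m \<longleftrightarrow> j \<in> X)"
      if "finite X \<and> card X = card (PhiS m) \<and> (X \<in> F) \<noteq> (X \<in> F') \<and> X \<noteq> PhiS m" for X
      using top[of X] that unfolding cT by blast
  qed
qed

text \<open>Monomials of the degree of \<open>xm T\<close> that are not squarefree have a smaller
  support, where the families agree; hence only squarefree ones compete with
  \<open>xm T\<close>.\<close>

lemma ideal_gt_first_diff:
  assumes F: "fam 0 F" and F': "fam 0 F'" and b: "\<And>d. \<exists>n. bnd F d n \<and> bnd F' d n"
    and le: "\<forall>d n. bnd F d n \<and> bnd F' d n \<longrightarrow> mset_set (JM F 0 n d) \<le> mset_set (JM F' 0 n d)" and ne: "F \<noteq> F'"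
  shows "ideal_gt (Iof F' :: 'k::field_char_0 S set) (Iof F)"
proof -
  obtain T n where T: "T \<in> F'" "T \<notin> F" and low: "\<forall>X. finite X \<and> card X < card T \<longrightarrow> (X \<in> F \<longleftrightarrow> X \<in> F')"
    and top: "\<forall>X. finite X \<and> card X = card T \<and> (X \<in> F) \<noteq> (X \<in> F') \<and> X \<noteq> T \<longrightarrow>
      (\<exists>i. i \<in> T \<and> i \<notin> X \<and> (\<forall>j<i. j \<in> T \<longleftrightarrow> j \<in> X))"
    using first_diff[OF F F' b le ne] by (elim exE conjE)
  have fT: "finite T" by (rule famD(1)[OF F' T(1)])
  show ?thesis unfolding ideal_gt_def monomial_Iof
  proof (intro exI[of _ "xm T"] conjI allI impI)
    show "keys (xm T) \<in> F'" "keys (xm T) \<notin> F" using T fT by simp_all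
    fix m' assume m': "(keys m' \<in> F') \<noteq> (keys m' \<in> F) \<and> m' \<noteq> xm T"
    define X where "X = keys m'"
    have fX: "finite X" unfolding X_def by simp
    have XF: "(X \<in> F) \<noteq> (X \<in> F')" using m' unfolding X_def by blast
    have cX: "card T \<le> card X" using low XF fX by (meson not_le)
    have cm: "card X \<le> mdeg m'" unfolding X_def by (rule card_keys_le)
    show "mono_gt (xm T) m'"
    proof (cases "mdeg m' = card T")
      case True
      then have c: "card X = card T" using cX cm by simp
      have "m' \<in> SM X (card X)" unfolding SM_def using True c by (simp add: X_def)
      then have mx: "m' = xm X" unfolding SM_diag[OF fX] by simp
      have "X \<noteq> T" using m' mx by blast
      then obtain i where i: "i \<in> T" "i \<notin> X" "\<forall>j<i. j \<in> T \<longleftrightarrow> j \<in> X" using top fX c XF by blast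
      show ?thesis unfolding mono_gt_iff mx
        using i c by (intro disjI2 conjI exI[of _ i]) (simp_all add: lookup_xm fX fT)
    next
      case False
      then have "mdeg (xm T) < mdeg m'" using cX cm fT by simp
      then show ?thesis unfolding mono_gt_def by (rule disjI1)
    qed
  qed
qed

text \<open>At the first difference \<open>T\<close> every other differing set is lexicographically
  smaller. A lexsegment containing one of them would contain \<open>T\<close>, so
  \<open>IM F\<close> would be strictly smaller than \<open>IM F'\<close> in that degree.\<close>

lemma lexseg_maximal:
  assumes F: "fam 0 F" and F': "fam 0 F'" and b: "\<And>d. \<exists>n. bnd F d n \<and> bnd F' d n"
    and le: "\<forall>d n. bnd F d n \<and> bnd F' d n \<longrightarrow> mset_set (JM F 0 n d) \<le> mset_set (JM F' 0 n d)"
    and card: "\<forall>d n. bnd F d n \<and> bnd F' d n \<longrightarrow> card (IM F 0 n d) = card (IM F' 0 n d)"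
    and lex: "lexseg 0 F"
  shows "F = F'"
proof (rule ccontr)
  assume ne: "F \<noteq> F'"
  obtain T n where T: "T \<in> F'" "T \<notin> F" and n: "bnd F (card T) n" "bnd F' (card T) n" "T \<subseteq> {..<n}"
    and low: "\<forall>X. finite X \<and> card X < card T \<longrightarrow> (X \<in> F \<longleftrightarrow> X \<in> F')"
    and top: "\<forall>X. finite X \<and> card X = card T \<and> (X \<in> F) \<noteq> (X \<in> F') \<and> X \<noteq> T \<longrightarrow>
      (\<exists>i. i \<in> T \<and> i \<notin> X \<and> (\<forall>j<i. j \<in> T \<longleftrightarrow> j \<in> X))"
    using first_diff[OF F F' b le ne] by (elim exE conjE)
  have fT: "finite T" by (rule famD(1)[OF F' T(1)])
  let ?d = "card T"
  have up: "X \<in> F'" if X: "X \<in> F" "card X \<le> ?d" for X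
  proof (rule ccontr)
    assume nX: "X \<notin> F'"
    have fX: "finite X" by (rule famD(1)[OF F X(1)])
    have "\<not> card X < ?d" using low fX X(1) nX by blast
    then have c: "card X = ?d" using X(2) by simp
    have "X \<noteq> T" using X(1) T(2) by blast
    then obtain i where i: "i \<in> T" "i \<notin> X" "\<forall>j<i. j \<in> T \<longleftrightarrow> j \<in> X" using top fX c X(1) nX by blast
    have "T \<in> F" by (rule lexsegD[OF lex X(1) fT _ c[symmetric] i(1,2)]) (use i(3) in simp_all)
    then show False using T(2) by blast
  qed
  have "m \<in> IM F' 0 n ?d" if m: "m \<in> IM F 0 n ?d" for m
  proof -
    have "keys m \<in> F" "mdeg m = ?d" using m by (simp_all add: IM_def Mon_def)
    then have "keys m \<in> F'" using up[of "keys m"] card_keys_le[of m] by simp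
    then show ?thesis using m by (simp add: IM_def)
  qed
  moreover have "xm T \<in> IM F' 0 n ?d" using T(1) fT n(3) by (auto simp: IM_def Mon_def)
  moreover have "xm T \<notin> IM F 0 n ?d" using T(2) fT by (simp add: IM_def)
  ultimately have "IM F 0 n ?d \<subset> IM F' 0 n ?d" by blast
  then have "card (IM F 0 n ?d) < card (IM F' 0 n ?d)" by (rule psubset_card_mono[OF finite_IM])
  then show False using card n(1,2) by (metis less_irrefl)
qed

lemma USLI_iff:
  assumes F: "fam 0 F" and b: "\<And>d. \<exists>n. bnd F d n"
  shows "USLI (Iof F :: 'k::field_char_0 S set) \<longleftrightarrow> lexseg 0 F"
proof
  assume "USLI (Iof F :: 'k S set)"
  then have L: "keys m' \<in> F" if "keys m \<in> F" "mono_squarefree m'" "mdeg m' = mdeg m" "mono_gt m' m" for m m'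
    using that unfolding USLI_def squarefree_lexsegment_def monomial_Iof by blast
  show "lexseg 0 F" unfolding lexseg_def
  proof (intro ballI allI impI, elim conjE)
    fix T T' i assume T: "T \<in> F" and T': "finite T'" "card T' = card T" "i \<in> T'" "i \<notin> T" "\<forall>j<i. j \<in> T' \<longleftrightarrow> j \<in> T"
    have fT: "finite T" by (rule famD(1)[OF F T])
    have "keys (xm T') \<in> F"
    proof (rule L)
      show "keys (xm T) \<in> F" using T fT by simp
      show "mono_squarefree (xm T')" by (rule squarefree_xm[OF T'(1)])
      show "mdeg (xm T') = mdeg (xm T)" using T' fT by simp
      show "mono_gt (xm T') (xm T)" unfolding mono_gt_iff
        using T' fT by (intro disjI2 conjI exI[of _ i]) (simp_all add: lookup_xm)
    qed
    then show "T' \<in> F" using T'(1) by simp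
  qed
next
  assume lex: "lexseg 0 F"
  have "monomial m' \<in> (Iof F :: 'k S set)"
    if h: "monomial m \<in> (Iof F :: 'k S set)" "mono_squarefree m'" "mdeg m' = mdeg m" "mono_gt m' m" for m m'
  proof -
    define T T' where "T = keys m" and "T' = keys m'"
    have T: "T \<in> F" "finite T" "finite T'" using h(1) by (simp_all add: T_def T'_def)
    have mx: "m' = xm T'" unfolding T'_def by (rule squarefree_eq_xm[OF h(2), symmetric])
    have c: "card T' = mdeg m" using h(3) T(3) unfolding mx by simp
    obtain i where i: "lookup m i < lookup m' i" "\<forall>j<i. lookup m' j = lookup m j"
      using h(3,4) unfolding mono_gt_iff by auto
    have l: "lookup m' j = (if j \<in> T' then 1 else 0)" for j unfolding mx by (rule lookup_xm[OF T(3)])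
    have iT': "i \<in> T'" using i(1) l[of i] by (auto split: if_splits)
    have iT: "i \<notin> T" using i(1) l[of i] iT' unfolding T_def in_keys_iff by simp
    have jT: "j \<in> T' \<longleftrightarrow> j \<in> T" if "j < i" for j
      using i(2)[rule_format, OF that] l[of j] unfolding T_def in_keys_iff by (auto split: if_splits)
    \<comment> \<open>The given \<open>m\<close> need not be squarefree, so its support may have
      fewer elements than \<open>T'\<close>. It is padded with indices beyond \<open>T\<close> and
      \<open>i\<close>, which does not affect the comparison at \<open>i\<close>.\<close>
    define N where "N = Suc (Max (insert i T))"
    have N: "j < N" if "j \<in> insert i T" for j 
    proof -
      have "j \<le> Max (insert i T)" by (rule Max_ge[OF _ that]) (simp add: T(2))
      then show ?thesis unfolding N_def by (simp only: less_Suc_eq_le)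
    qed
    define T2 where "T2 = T \<union> {N..<N + (card T' - card T)}"
    have "card T \<le> card T'" unfolding c T_def by (rule card_keys_le)
    moreover have "T \<inter> {N..<N + (card T' - card T)} = {}" using N by fastforce
    ultimately have c2: "card T' = card T2" unfolding T2_def using T(2) by (simp add: card_Un_disjoint)
    have T2: "T2 \<in> F" by (rule famD(3)[OF F T(1)]) (simp_all add: T2_def T(2))
    have iN: "i < N" by (rule N) simp
    have "T' \<in> F"
    proof (rule lexsegD[OF lex T2 T(3) _ c2 iT'])
      show "i \<notin> T2" using iT iN by (simp add: T2_def)
      show "j \<in> T' \<longleftrightarrow> j \<in> T2" if "j < i" for j using jT[OF that] that iN by (simp add: T2_def)
    qed simp
    then show ?thesis by (simp add: T'_def)
  qed
  then show "USLI (Iof F :: 'k S set)"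
    unfolding USLI_def squarefree_lexsegment_def using fged_Iof[OF F b] sqf_Iof_fam[OF F] by blast
qed

text \<open>If the shift fixes \<open>F\<close>, then by \<open>JM_shift\<close> the maximum
  \<open>AS\<close> is \<open>JM F\<close>, which is the hypothesis \<open>Hyp\<close>, and
  \<open>F\<close> is a lexsegment. In the other direction \<open>lexseg_maximal\<close> applies to
  \<open>F\<close> and its shift.\<close>

lemma shift_props:
  assumes F: "fam 0 F" and b: "\<And>d. \<exists>n. bnd F d n"
  defines "F' \<equiv> shift TYPE('k::field_char_0) F"
  shows "lexseg 0 F \<Longrightarrow> F = F'" "\<not> lexseg 0 F \<Longrightarrow> ideal_gt (Iof F' :: 'k S set) (Iof F)"
proof -
  have F': "fam 0 F'" unfolding F'_def by (rule fam_shift[OF F b])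
  have bb: "\<exists>n. bnd F d n \<and> bnd F' d n" for d
  proof -
    obtain n where n: "bnd F d n" using b by blast
    have "bnd F d (n + d)" by (rule bnd_mono[OF F n]) simp_all
    then show ?thesis using bnd_shift[OF F b n, where 'k='k] unfolding F'_def by blast
  qed
  have le: "\<forall>d n. bnd F d n \<and> bnd F' d n \<longrightarrow> mset_set (JM F 0 n d) \<le> mset_set (JM F' 0 n d)"
    unfolding F'_def by (intro allI impI, elim conjE, rule JM_le_shift[OF F])
  have card: "\<forall>d n. bnd F d n \<and> bnd F' d n \<longrightarrow> card (IM F 0 n d) = card (IM F' 0 n d)"
    unfolding F'_def by (intro allI impI, elim conjE, rule card_shift[OF F b])
  show "F = F'" if "lexseg 0 F" by (rule lexseg_maximal[OF F F' bb le card that])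
  show "ideal_gt (Iof F' :: 'k S set) (Iof F)" if nl: "\<not> lexseg 0 F"
  proof (rule ideal_gt_first_diff[OF F F' bb le])
    show "F \<noteq> F'"
    proof
      assume eq: "F = F'"
      have "Hyp TYPE('k) 0 F" unfolding Hyp_def
      proof
        fix d
        obtain n0 where n0: "bnd F d n0" using b by blast
        have "mset_set (LA 0 (IM F 0 n d) G) \<le> mset_set (JM F 0 n d)"
          if n: "n \<ge> n0" and G: "G \<in> Up" for n and G :: "nat \<times> nat \<Rightarrow> 'k"
        proof -
          have "bnd F d n" by (rule bnd_mono[OF F n0 order_refl n])
          from JM_shift[OF F this, where 'k='k] have J: "JM F 0 n d = AS TYPE('k) F n d"
            unfolding F'_def[symmetric] eq[symmetric] .
          show ?thesis unfolding J by (rule AS_ge[OF G])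
        qed
        then show "\<exists>n0. \<forall>n\<ge>n0. \<forall>G\<in>Up. mset_set (LA 0 (IM F 0 n d) (G :: nat \<times> nat \<Rightarrow> 'k)) \<le> mset_set (JM F 0 n d)"
          by (intro exI[of _ n0] allI impI ballI)
      qed
      note L = lexsegment_of_Hyp[OF F b this]
      have "lexseg 0 F" unfolding lexseg_def
      proof (intro ballI allI impI, elim conjE)
        fix T T' i assume h: "T \<in> F" "finite T'" "T' \<subseteq> {0..}" "card T' = card T" "i \<in> T'" "i \<notin> T" "\<forall>j<i. j \<in> T' \<longleftrightarrow> j \<in> T"
        show "T' \<in> F" by (rule L[OF h(1-6)]) (use h(7) in blast)
      qed
      then show False using nl by blast
    qed
  qed
qed

section \<open>The order on monomial ideals and the iteration\<close>

lemma mono_gt_trans: "mono_gt a b \<Longrightarrow> mono_gt b c \<Longrightarrow> mono_gt a c"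
  by (auto simp: mono_gt_def)

lemma mono_gt_total: "a \<noteq> b \<Longrightarrow> mono_gt a b \<or> mono_gt b a"
  unfolding mono_gt_def by (metis nat_neq_iff neq_iff)

lemma ideal_gt_irrefl: "\<not> ideal_gt I I"
  unfolding ideal_gt_def by blast

lemma ideal_gt_trans:
  assumes "ideal_gt I J" "ideal_gt J K" shows "ideal_gt I K"
proof -
  let ?d = "\<lambda>I J m. (monomial m \<in> I) \<noteq> (monomial m \<in> J)"
  obtain a where a: "monomial a \<in> I" "monomial a \<notin> J" "\<forall>m. ?d I J m \<and> m \<noteq> a \<longrightarrow> mono_gt a m"
    using assms(1) unfolding ideal_gt_def by blast
  obtain c where c: "monomial c \<in> J" "monomial c \<notin> K" "\<forall>m. ?d J K m \<and> m \<noteq> c \<longrightarrow> mono_gt c m"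
    using assms(2) unfolding ideal_gt_def by blast
  have "a \<noteq> c" using a(2) c(1) by blast
  then consider "mono_gt a c" | "mono_gt c a" using mono_gt_total by blast
  then show ?thesis
  proof cases
    case 1
    have "monomial a \<notin> K"
    proof
      assume "monomial a \<in> K"
      then have "mono_gt c a" using c(3) a(2) \<open>a \<noteq> c\<close> by blast
      then show False using 1 mono_gt_asym by blast
    qed
    moreover have "mono_gt a m" if "?d I K m" "m \<noteq> a" for m
    proof (cases "?d I J m")
      case True
      then show ?thesis using a(3) that(2) by blast
    next
      case False
      then have "?d J K m" using that(1) by argo
      then have "m = c \<or> mono_gt c m" using c(3) by blast
      then show ?thesis using 1 mono_gt_trans[OF 1] by auto
    qed
    ultimately show ?thesis unfolding ideal_gt_def using a(1) by blast
  next
    case 2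
    have "monomial c \<in> I"
    proof (rule ccontr)
      assume "monomial c \<notin> I"
      then have "mono_gt a c" using a(3) c(1) \<open>a \<noteq> c\<close> by blast
      then show False using 2 mono_gt_asym by blast
    qed
    moreover have "mono_gt c m" if "?d I K m" "m \<noteq> c" for m
    proof (cases "?d J K m")
      case True
      then show ?thesis using c(3) that(2) by blast
    next
      case False
      then have "?d I J m" using that(1) by argo
      then have "m = a \<or> mono_gt a m" using a(3) by blast
      then show ?thesis using 2 mono_gt_trans[OF 2] by auto
    qed
    ultimately show ?thesis unfolding ideal_gt_def using c(2) by blast
  qed
qed

text \<open>The shift preserves the counts, and both families have a common bound in all degrees, so
  a lexsegment as the shift would equal \<open>F\<close> by \<open>families_eq\<close>.\<close>

lemma not_lexseg_shift:
  assumes F: "fam 0 F" and n: "\<And>d. bnd F d n" and nl: "\<not> lexseg 0 F"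
  shows "\<not> lexseg 0 (shift TYPE('k::field_char_0) F)"
proof
  let ?F' = "shift TYPE('k) F"
  assume lex: "lexseg 0 ?F'"
  have b: "\<And>d. \<exists>n. bnd F d n" using n by (rule exI)
  have F': "fam 0 ?F'" by (rule fam_shift[OF F b])
  obtain n' where n': "\<forall>d. bnd ?F' d n'" using bnd_shift_uniform[OF F n, where 'k='k] by (rule exE)
  let ?N = "max n n'"
  have N: "bnd F d ?N" "bnd ?F' d ?N" for d
    by (rule bnd_mono[OF F n order_refl max.cobounded1], rule bnd_mono[OF F' n'[rule_format] order_refl max.cobounded2])
  have N': "bnd F d k" "bnd ?F' d k" if "?N \<le> k" for d k
    by (rule bnd_mono[OF F N(1) order_refl that], rule bnd_mono[OF F' N(2) order_refl that])
  have "fv F 0 ?N d = fv ?F' 0 ?N d" for d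
    by (rule fv_eq) (rule card_shift[OF F b N])
  then have "F = ?F'" by (rule families_eq[OF F F' _ N lex, rotated]) simp
  then show False using lex nl by simp
qed

theorem theorem5p9:
  fixes I :: "'k::field_char_0 S set"
  assumes "squarefree_strongly_stable I"
    and "fin_gen_each_degree I"
  shows "(\<not> USLI I \<longrightarrow> ideal_gt (Delta_lex I) I) \<and>
         (USLI I \<longrightarrow> Delta_lex I = I) \<and>
         (finitely_generated I \<and> \<not> USLI I \<longrightarrow> inj (\<lambda>i::nat. (Delta_lex ^^ i) I))"
proof -
  define F where "F = fam_of I"
  have sq: "squarefree_monomial_ideal I" using assms(1) unfolding squarefree_strongly_stable_def by blast
  have I: "I = Iof F" unfolding F_def by (rule sqf_Iof[OF sq])
  have F: "fam 0 F" unfolding F_def by (rule sss_fam[OF assms(1)])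
  have b: "\<exists>n. bnd F d n" for d by (rule fged_bnd[OF I F assms(2)])
  have D: "Delta_lex (Iof H :: 'k S set) = Iof (shift TYPE('k) H)" if "fam 0 H" "\<And>d. \<exists>n. bnd H d n" for H
    unfolding shift_def by (rule Delta_eq[OF that])
  have U: "USLI I \<longleftrightarrow> lexseg 0 F" unfolding I by (rule USLI_iff[OF F b])
  have DI: "Delta_lex I = Iof (shift TYPE('k) F)" unfolding I by (rule D[OF F b])
  show ?thesis
  proof (intro conjI impI)
    assume "\<not> USLI I"
    then have "\<not> lexseg 0 F" unfolding U .
    then have "ideal_gt (Iof (shift TYPE('k) F) :: 'k S set) (Iof F)" by (rule shift_props(2)[OF F b])
    then show "ideal_gt (Delta_lex I) I" unfolding DI I[symmetric] .
  next
    assume "USLI I"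
    then have "lexseg 0 F" unfolding U .
    then have eq: "shift TYPE('k) F = F" by (rule shift_props(1)[OF F b, symmetric])
    show "Delta_lex I = I" unfolding DI eq by (rule I[symmetric])
  next
    assume h: "finitely_generated I \<and> \<not> USLI I"
    obtain n where n: "\<forall>d. bnd F d n" using fg_bnd[OF I F conjunct1[OF h]] by (rule exE)
    define H where "H i = (shift TYPE('k) ^^ i) F" for i
    \<comment> \<open>The invariant of the iteration. It includes a bound uniform in the degree,
      which \<open>not_lexseg_shift\<close> requires at every step; the iterates then increase
      strictly and are distinct.\<close>
    define C where "C G \<longleftrightarrow> fam 0 G \<and> (\<exists>n. \<forall>d. bnd G d n) \<and> \<not> lexseg 0 G" for G
    have CS: "C (shift TYPE('k) G) \<and> Delta_lex (Iof G :: 'k S set) = Iof (shift TYPE('k) G) \<and>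
        ideal_gt (Iof (shift TYPE('k) G) :: 'k S set) (Iof G)" if "C G" for G
    proof -
      have G: "fam 0 G" "\<not> lexseg 0 G" using that unfolding C_def by blast+
      obtain n where n: "\<forall>d. bnd G d n" using \<open>C G\<close> unfolding C_def by blast
      have bG: "\<exists>n. bnd G d n" for d using n by blast
      have "C (shift TYPE('k) G)" unfolding C_def
        by (intro conjI fam_shift[OF G(1) bG] bnd_shift_uniform[OF G(1) n[rule_format]]
          not_lexseg_shift[OF G(1) n[rule_format] G(2)])
      then show ?thesis using D[OF G(1) bG] shift_props(2)[OF G(1) bG G(2)] by blast
    qed
    have HC: "C (H i)" for i
    proof (induction i)
      case 0
      show ?case unfolding H_def C_def using F n h U by auto
    next
      case (Suc i)
      then show ?case using CS[of "H i"] unfolding H_def by simp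
    qed
    have DH: "(Delta_lex ^^ i) I = Iof (H i)" for i
    proof (induction i)
      case 0
      show ?case using I by (simp add: H_def)
    next
      case (Suc i)
      then show ?case using CS[OF HC[of i]] unfolding H_def by simp
    qed
    have gt: "ideal_gt (Iof (H (i + Suc k)) :: 'k S set) (Iof (H i))" for i k
    proof (induction k)
      case 0
      show ?case using CS[OF HC[of i]] unfolding H_def by simp
    next
      case (Suc k)
      have "ideal_gt (Iof (H (i + Suc (Suc k))) :: 'k S set) (Iof (H (i + Suc k)))"
        using CS[OF HC[of "i + Suc k"]] unfolding H_def by simp
      then show ?case using Suc by (rule ideal_gt_trans)
    qed
    have ne: "(Delta_lex ^^ i) I \<noteq> (Delta_lex ^^ j) I" if "i < j" for i j
    proof
      assume eq: "(Delta_lex ^^ i) I = (Delta_lex ^^ j) I"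
      obtain k where "j = i + Suc k" using less_imp_Suc_add[OF \<open>i < j\<close>] by auto
      then show False using gt[of i k] eq ideal_gt_irrefl unfolding DH by metis
    qed
    show "inj (\<lambda>i::nat. (Delta_lex ^^ i) I)"
      by (rule injI) (metis ne nat_neq_iff)
  qed
qed

end
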